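(* Assume that $(\hat u,\hat x)$ is a weak minimum of problem (P) (satisfying the standing assumptions (a)-(d) of the context). Then $$\max_{\lambda\in\Lambda}Q(v,z,\lambda)\ \ge\ 0\qquad\text{for all }(v,z)\in\mathcal C .$$
   Context: Setting. $T>0$; $f_0,f_1:\mathbb R^n\to\mathbb R^n$ are $C^2$ and Lipschitz continuous; $\phi:\mathbb R^n\times\mathbb R^n\to\mathbb R$, $g:\mathbb R^n\to\mathbb R$ and $\Phi:\mathbb R^n\times\mathbb R^n\to\mathbb R^{n_1+n_2}$ are $C^2$; $u_{\min}\in\mathbb R\cup\{-\infty\}$, $u_{\max}\in\mathbb R\cup\{+\infty\}$. Set $f(u,x):=f_0(x)+uf_1(x)$ and $K_\Phi:=\{0\}_{\mathbb R^{n_1}}\times\mathbb R^{n_2}_-$. Problem (P): minimize $\phi(x_0,x_T)$ over $(u,x)\in L^\infty(0,T)\times W^{1,\infty}(0,T)^n$ subject to $\dot x_t=f_0(x_t)+u_tf_1(x_t)$ for a.a. $t$; $\Phi(x_0,x_T)\in K_\Phi$; $u_{\min}\le u_t\le u_{\max}$ for a.a. $t$; $g(x_t)\le 0$ for all $t\in[0,T]$. A pair satisfying all constraints is a feasible trajectory; $(\hat u,\hat x)$ is a fixed feasible trajectory. It is a weak minimum if $\phi(\hat x_0,\hat x_T)\le\phi(\tilde x_0,\tilde x_T)$ for any feasible $(\tilde u,\tilde x)$ with $\|(\tilde u,\tilde x)-(\hat u,\hat x)\|_\infty$ small enough. Functions whose argument is omitted are evaluated at $(\hat u,\hat x)$ (and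 at the multiplier). Multipliers. $\mathcal M$ is the space of finite Radon measures on $[0,T]$; every $\mathrm d\mu\in\mathcal M$ is identified with the derivative of a function $\mu$ of bounded variation with $\mu_T=0$. Let $H(u,x,p):=pf(u,x)$ and $\ell^{\beta,\Psi}:=\beta\phi+\Psi\Phi$. $\Lambda=\Lambda(\hat u,\hat x)$ is the set of $\lambda=(\beta,\Psi,p,\mathrm d\mu)\in\mathbb R_+\times\mathbb R^{(n_1+n_2)*}\times BV(0,T)^{n*}\times\mathcal M$ with $(\beta,\Psi,\mathrm d\mu)\ne0$ such that: $\Psi_i\ge0$ and $\Psi_i\Phi_i(\hat x_0,\hat x_T)=0$ for $i=n_1+1,\dots,n_1+n_2$; $\mathrm d\mu\ge0$ and $\int_0^Tg(\hat x_t)\,\mathrm d\mu_t=0$; $-\mathrm dp_t=p_tf_x(\hat u_t,\hat x_t)\,\mathrm dt+g'(\hat x_t)\,\mathrm d\mu_t$ on $[0,T]$ with $(-p_0,p_T)=D\ell^{\beta,\Psi}(\hat x_0,\hat x_T)$; and for a.a. $t$: $\hat u_t=u_{\min}$ if $u_{\min}>-\infty$ and $p_tf_1(\hat x_t)>0$, $\hat u_t=u_{\max}$ if $u_{\max}<+\infty$ and $p_tf_1(\hat x_t)<0$, $p_tf_1(\hat x_t)=0$ if $u_{\min}<\hat u_t<u_{\max}$. (For BV functions, $h(0-):=h_0$, $h(T+):=h_T$.) Since $\Lambda$ is a cone, "$\max_{\lambda\in\Lambda}(\cdot)\ge0$" means that there exists $\lambda\in\Lambda$ with value $\ge0$. Arcs.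 $C:=\{t\in[0,T]:g(\hat x_t)=0\}$; $B_-:=\{t:\hat u_t=u_{\min}\}$, $B_+:=\{t:\hat u_t=u_{\max}\}$ (up to null sets; empty if the corresponding bound is infinite), $B:=B_-\cup B_+$; $S:=\{t:u_{\min}<\hat u_t<u_{\max},\ g(\hat x_t)<0\}$. A $C$ arc is a maximal open interval $(a,b)\subset C$; a $B_\pm$ arc (or $B$ arc) is a maximal open interval contained, up to a null set, in $B_+$ or in $B_-$; $S$ arcs are defined similarly. Junction times are points of $(0,T)$ at which the trajectory switches from one type of arc ($B_-,B_+,C,S$) to another; a "$CS$ junction" is one from a $C$ arc to an $S$ arc, etc. Standing assumptions: (a) $[0,T]$ is, up to a null set, the disjoint union of finitely many arcs of type $B$, $C$ and $S$ (understood so that $g(\hat x_t)<0$ on $B$ and $S$ arcs and $C$ is the union of the closures of the $C$ arcs); (b) $\hat u$ is at uniformly positive distance from the bounds $u_{\min},u_{\max}$ over $C$ and $S$ arcs; (c) $\hat u$ is discontinuous (has a nonzero jump) at $CS$ and $SC$ junctions; (d) the state constraint is of first order: $g'(\hat x_t)f_1(\hat x_t)\ne0$ on $C$. Critical cone. Let $A_t:=D_xf(\hat u_t,\hat x_t)$ and $T_\Phi:=\{0\}_{\mathbb R^{n_1}}\times\{\eta\in\mathbb R^{n_2}:\eta_i\le0\text{ if }\Phi_{n_1+i}(\hat x_0,\hat x_T)=0\}$. $\mathcal C$ is the set of $(v,z)\in L^\infty(0,T)\times W^{1,\infty}(0,T)^n$ with $\dot z_t=A_tz_t+v_tf_1(\hat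 x_t)$ a.e., $\phi'(\hat x_0,\hat x_T)(z_0,z_T)\le0$, $\Phi'(\hat x_0,\hat x_T)(z_0,z_T)\in T_\Phi$, $v_t\ge0$ a.e. on $B_-$, $v_t\le0$ a.e. on $B_+$, and $g'(\hat x_t)z_t\le0$ on $C$. Quadratic form. $$Q(v,z,\lambda):=\int_0^T\big(z_t^\top H_{xx}z_t+2v_tH_{ux}z_t\big)\mathrm dt+D^2\ell^{\beta,\Psi}(\hat x_0,\hat x_T)(z_0,z_T)^2+\int_0^Tz_t^\top g''(\hat x_t)z_t\,\mathrm d\mu_t .$$ *)

theory Defs
  imports "HOL-Analysis.Analysis"
begin

section \<open>Function classes\<close>

definition C2 :: "('a::real_normed_vector \<Rightarrow> 'b::real_normed_vector) \<Rightarrow> bool" where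
  "C2 h \<longleftrightarrow> (\<exists>(h' :: 'a \<Rightarrow> 'a \<Rightarrow>\<^sub>L 'b) (h'' :: 'a \<Rightarrow> 'a \<Rightarrow>\<^sub>L 'a \<Rightarrow>\<^sub>L 'b).
     (\<forall>x. (h has_derivative blinfun_apply (h' x)) (at x)) \<and>
     (\<forall>x. (h' has_derivative blinfun_apply (h'' x)) (at x)) \<and>
     continuous_on UNIV h'')"

definition second_derivative ::
    "('a::real_normed_vector \<Rightarrow> 'b::real_normed_vector) \<Rightarrow> 'a \<Rightarrow> 'a \<Rightarrow> 'a \<Rightarrow> 'b" where
  "second_derivative h x k l =
     frechet_derivative (\<lambda>y. frechet_derivative h (at y) k) (at x) l"

text \<open>Elements of \<open>L\<^sup>\<infinity>(0,T)\<close> are represented by functions; the values on null sets and outside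
  \<open>[0,T]\<close> are irrelevant.\<close>

definition L_infty :: "real \<Rightarrow> (real \<Rightarrow> 'a::euclidean_space) \<Rightarrow> bool" where
  "L_infty T w \<longleftrightarrow> w \<in> borel_measurable (lebesgue_on {0..T}) \<and>
     (\<exists>K. AE t in lebesgue_on {0..T}. norm (w t) \<le> K)"

text \<open>\<open>W1_infty_deriv T x w\<close>: \<open>x\<close> is the continuous representative on \<open>[0,T]\<close> of an element of
  \<open>W\<^sup>1\<^sup>,\<^sup>\<infinity>(0,T)\<close>, and \<open>w\<close> represents its derivative (which is unique up to null sets).\<close>

definition W1_infty_deriv ::
    "real \<Rightarrow> (real \<Rightarrow> 'a::euclidean_space) \<Rightarrow> (real \<Rightarrow> 'a) \<Rightarrow> bool" where
  "W1_infty_deriv T x w \<longleftrightarrow> L_infty T w \<and>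
     (\<forall>t\<in>{0..T}. x t = x 0 + integral\<^sup>L (lebesgue_on {0..t}) w)"

definition bounded_variation_on ::
    "real \<Rightarrow> real \<Rightarrow> (real \<Rightarrow> 'a::real_normed_vector) \<Rightarrow> bool" where
  "bounded_variation_on a b h \<longleftrightarrow> (\<exists>V. \<forall>N (s :: nat \<Rightarrow> real).
     (\<forall>i\<le>N. s i \<in> {a..b}) \<and> (\<forall>i<N. s i \<le> s (Suc i)) \<longrightarrow>
     (\<Sum>i<N. norm (h (s (Suc i)) - h (s i))) \<le> V)"

text \<open>One-sided values of a function of bounded variation on \<open>[0,T]\<close>, with the conventions
  \<open>h(0-) = h(0)\<close> and \<open>h(T+) = h(T)\<close>. The derivative \<open>dh\<close> is the measure on \<open>[0,T]\<close> that assigns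
  \<open>h(t+) - h(s-)\<close> to \<open>[s,t]\<close>; it may have atoms at the end points.\<close>

definition left_value :: "(real \<Rightarrow> 'a::t2_space) \<Rightarrow> real \<Rightarrow> 'a" where
  "left_value h t = (if 0 < t then Lim (at_left t) h else h 0)"

definition right_value :: "real \<Rightarrow> (real \<Rightarrow> 'a::t2_space) \<Rightarrow> real \<Rightarrow> 'a" where
  "right_value T h t = (if t < T then Lim (at_right t) h else h T)"


section \<open>The optimal control problem\<close>

text \<open>Minimise \<open>\<phi>(x\<^sub>0,x\<^sub>T)\<close> subject to \<open>x' = f\<^sub>0(x) + u f\<^sub>1(x)\<close>, \<open>\<Phi>(x\<^sub>0,x\<^sub>T) \<in> {0} \<times> \<real>\<^sub>-\<^sup>n\<^sup>2\<close>,
  \<open>u\<^sub>m\<^sub>i\<^sub>n \<le> u \<le> u\<^sub>m\<^sub>a\<^sub>x\<close> and \<open>g(x) \<le> 0\<close>; here \<open>\<phi>\<close>, \<open>\<Phi>\<close>, \<open>g\<close> are \<open>cost\<close>, \<open>endpoint_con\<close>, \<open>state_con\<close>.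
  The map \<open>\<Phi>\<close> has the components \<open>endpoint_con P i\<close>, \<open>1 \<le> i \<le> n\<^sub>1 + n\<^sub>2\<close>, so that
  \<open>n\<^sub>1 = 0\<close> and \<open>n\<^sub>2 = 0\<close> are allowed. The other components are irrelevant.\<close>

record ('n::finite) ocp =
  horizon :: real
  f0 :: "real ^ 'n \<Rightarrow> real ^ 'n"
  f1 :: "real ^ 'n \<Rightarrow> real ^ 'n"
  cost :: "(real ^ 'n) \<times> (real ^ 'n) \<Rightarrow> real"
  state_con :: "real ^ 'n \<Rightarrow> real"
  n1 :: nat
  n2 :: nat
  endpoint_con :: "nat \<Rightarrow> (real ^ 'n) \<times> (real ^ 'n) \<Rightarrow> real"
  u_min :: ereal
  u_max :: ereal

definition ocp_data :: "('n::finite) ocp \<Rightarrow> bool" where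
  "ocp_data P \<longleftrightarrow>
     horizon P > 0 \<and>
     C2 (f0 P) \<and> (\<exists>L. L-lipschitz_on UNIV (f0 P)) \<and>
     C2 (f1 P) \<and> (\<exists>L. L-lipschitz_on UNIV (f1 P)) \<and>
     C2 (cost P) \<and> C2 (state_con P) \<and> (\<forall>i\<in>{1..n1 P + n2 P}. C2 (endpoint_con P i)) \<and>
     u_min P \<noteq> \<infinity> \<and> u_max P \<noteq> - \<infinity>"

definition dynamics :: "('n::finite) ocp \<Rightarrow> real \<Rightarrow> real ^ 'n \<Rightarrow> real ^ 'n" where
  "dynamics P u x = f0 P x + u *\<^sub>R f1 P x"

definition feasible ::
    "('n::finite) ocp \<Rightarrow> (real \<Rightarrow> real) \<Rightarrow> (real \<Rightarrow> real ^ 'n) \<Rightarrow> bool" where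
  "feasible P u x \<longleftrightarrow>
     L_infty (horizon P) u \<and>
     (\<exists>x'. W1_infty_deriv (horizon P) x x' \<and>
        (AE t in lebesgue_on {0..horizon P}. x' t = dynamics P (u t) (x t))) \<and>
     (\<forall>i\<in>{1..n1 P}. endpoint_con P i (x 0, x (horizon P)) = 0) \<and>
     (\<forall>i\<in>{n1 P + 1..n1 P + n2 P}. endpoint_con P i (x 0, x (horizon P)) \<le> 0) \<and>
     (AE t in lebesgue_on {0..horizon P}. u_min P \<le> ereal (u t) \<and> ereal (u t) \<le> u_max P) \<and>
     (\<forall>t\<in>{0..horizon P}. state_con P (x t) \<le> 0)"

definition weak_minimum ::
    "('n::finite) ocp \<Rightarrow> (real \<Rightarrow> real) \<Rightarrow> (real \<Rightarrow> real ^ 'n) \<Rightarrow> bool" where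
  "weak_minimum P u x \<longleftrightarrow> feasible P u x \<and>
     (\<exists>\<epsilon>>0. \<forall>v y. feasible P v y \<and>
        (AE t in lebesgue_on {0..horizon P}. \<bar>v t - u t\<bar> \<le> \<epsilon>) \<and>
        (\<forall>t\<in>{0..horizon P}. norm (y t - x t) \<le> \<epsilon>) \<longrightarrow>
        cost P (x 0, x (horizon P)) \<le> cost P (y 0, y (horizon P)))"


section \<open>Arcs and junctions\<close>

definition contact_set :: "('n::finite) ocp \<Rightarrow> (real \<Rightarrow> real ^ 'n) \<Rightarrow> real set" where
  "contact_set P x = {t\<in>{0..horizon P}. state_con P (x t) = 0}"

definition B_minus :: "('n::finite) ocp \<Rightarrow> (real \<Rightarrow> real) \<Rightarrow> real set" where
  "B_minus P u = {t\<in>{0..horizon P}. ereal (u t) = u_min P}"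

definition B_plus :: "('n::finite) ocp \<Rightarrow> (real \<Rightarrow> real) \<Rightarrow> real set" where
  "B_plus P u = {t\<in>{0..horizon P}. ereal (u t) = u_max P}"

definition singular_set ::
    "('n::finite) ocp \<Rightarrow> (real \<Rightarrow> real) \<Rightarrow> (real \<Rightarrow> real ^ 'n) \<Rightarrow> real set" where
  "singular_set P u x =
     {t\<in>{0..horizon P}. u_min P < ereal (u t) \<and> ereal (u t) < u_max P \<and> state_con P (x t) < 0}"

text \<open>\<open>(a,b)\<close> is a nonempty open interval in \<open>[0,T]\<close> with the property \<open>R\<close>, maximal for inclusion.\<close>

definition maximal_interval :: "real \<Rightarrow> (real set \<Rightarrow> bool) \<Rightarrow> real \<Rightarrow> real \<Rightarrow> bool" where
  "maximal_interval T R a b \<longleftrightarrow>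
     0 \<le> a \<and> a < b \<and> b \<le> T \<and> R {a<..<b} \<and>
     (\<forall>c d. 0 \<le> c \<and> c \<le> a \<and> b \<le> d \<and> d \<le> T \<and> R {c<..<d} \<longrightarrow> c = a \<and> d = b)"

definition C_arc ::
    "('n::finite) ocp \<Rightarrow> (real \<Rightarrow> real ^ 'n) \<Rightarrow> real \<Rightarrow> real \<Rightarrow> bool" where
  "C_arc P x = maximal_interval (horizon P) (\<lambda>I. I \<subseteq> contact_set P x)"

definition B_arc ::
    "('n::finite) ocp \<Rightarrow> (real \<Rightarrow> real) \<Rightarrow> real \<Rightarrow> real \<Rightarrow> bool" where
  "B_arc P u a b \<longleftrightarrow>
     maximal_interval (horizon P) (\<lambda>I. negligible (I - B_minus P u)) a b \<or>
     maximal_interval (horizon P) (\<lambda>I. negligible (I - B_plus P u)) a b"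

definition S_arc ::
    "('n::finite) ocp \<Rightarrow> (real \<Rightarrow> real) \<Rightarrow> (real \<Rightarrow> real ^ 'n) \<Rightarrow> real \<Rightarrow> real \<Rightarrow> bool" where
  "S_arc P u x = maximal_interval (horizon P) (\<lambda>I. negligible (I - singular_set P u x))"

definition finite_arc_structure ::
    "('n::finite) ocp \<Rightarrow> (real \<Rightarrow> real) \<Rightarrow> (real \<Rightarrow> real ^ 'n) \<Rightarrow> bool" where
  "finite_arc_structure P u x \<longleftrightarrow>
     (\<exists>\<A>. finite \<A> \<and> disjoint \<A> \<and>
        (\<forall>I\<in>\<A>. \<exists>a b. I = {a<..<b} \<and> (B_arc P u a b \<or> C_arc P x a b \<or> S_arc P u x a b)) \<and>
        negligible ({0..horizon P} - \<Union>\<A>)) \<and>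
     (\<forall>a b. B_arc P u a b \<or> S_arc P u x a b \<longrightarrow> (\<forall>t\<in>{a<..<b}. state_con P (x t) < 0)) \<and>
     contact_set P x = \<Union>{{a..b} | a b. C_arc P x a b}"

definition control_away_from_bounds ::
    "('n::finite) ocp \<Rightarrow> (real \<Rightarrow> real) \<Rightarrow> (real \<Rightarrow> real ^ 'n) \<Rightarrow> bool" where
  "control_away_from_bounds P u x \<longleftrightarrow>
     (\<exists>\<rho>>0. \<forall>a b. C_arc P x a b \<or> S_arc P u x a b \<longrightarrow>
        (AE t in lebesgue_on {a<..<b}.
           u_min P + ereal \<rho> \<le> ereal (u t) \<and> ereal (u t) \<le> u_max P - ereal \<rho>))"

definition CS_junction ::
    "('n::finite) ocp \<Rightarrow> (real \<Rightarrow> real) \<Rightarrow> (real \<Rightarrow> real ^ 'n) \<Rightarrow> real \<Rightarrow> bool" where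
  "CS_junction P u x \<tau> \<longleftrightarrow> (\<exists>a b. C_arc P x a \<tau> \<and> S_arc P u x \<tau> b)"

definition SC_junction ::
    "('n::finite) ocp \<Rightarrow> (real \<Rightarrow> real) \<Rightarrow> (real \<Rightarrow> real ^ 'n) \<Rightarrow> real \<Rightarrow> bool" where
  "SC_junction P u x \<tau> \<longleftrightarrow> (\<exists>a b. S_arc P u x a \<tau> \<and> C_arc P x \<tau> b)"

text \<open>As \<open>u\<close> is only defined up to null sets, its one-sided limits are essential limits.\<close>

definition has_nonzero_jump :: "(real \<Rightarrow> real) \<Rightarrow> real \<Rightarrow> bool" where
  "has_nonzero_jump u \<tau> \<longleftrightarrow> (\<exists>l r. l \<noteq> r \<and>
     (u \<longlongrightarrow> l) (inf (ae_filter lebesgue) (at_left \<tau>)) \<and>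
     (u \<longlongrightarrow> r) (inf (ae_filter lebesgue) (at_right \<tau>)))"

definition discontinuous_at_CS_SC_junctions ::
    "('n::finite) ocp \<Rightarrow> (real \<Rightarrow> real) \<Rightarrow> (real \<Rightarrow> real ^ 'n) \<Rightarrow> bool" where
  "discontinuous_at_CS_SC_junctions P u x \<longleftrightarrow>
     (\<forall>\<tau>. CS_junction P u x \<tau> \<or> SC_junction P u x \<tau> \<longrightarrow> has_nonzero_jump u \<tau>)"

definition first_order_state_constraint ::
    "('n::finite) ocp \<Rightarrow> (real \<Rightarrow> real ^ 'n) \<Rightarrow> bool" where
  "first_order_state_constraint P x \<longleftrightarrow>
     (\<forall>t\<in>contact_set P x. frechet_derivative (state_con P) (at (x t)) (f1 P (x t)) \<noteq> 0)"


section \<open>Multipliers\<close>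

text \<open>Row vectors \<open>p\<close> are identified with elements of \<open>\<real>\<^sup>n\<close>, acting by the inner product.\<close>

definition hamiltonian :: "('n::finite) ocp \<Rightarrow> real \<Rightarrow> real ^ 'n \<Rightarrow> real ^ 'n \<Rightarrow> real" where
  "hamiltonian P u x p = p \<bullet> dynamics P u x"

definition ell ::
    "('n::finite) ocp \<Rightarrow> real \<Rightarrow> (nat \<Rightarrow> real) \<Rightarrow> (real ^ 'n) \<times> (real ^ 'n) \<Rightarrow> real" where
  "ell P \<beta> \<Psi> y = \<beta> * cost P y + (\<Sum>i=1..n1 P + n2 P. \<Psi> i * endpoint_con P i y)"

definition lin_dynamics :: "('n::finite) ocp \<Rightarrow> (real \<Rightarrow> real) \<Rightarrow> (real \<Rightarrow> real ^ 'n) \<Rightarrow>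
    real \<Rightarrow> real ^ 'n \<Rightarrow> real ^ 'n" where
  "lin_dynamics P u x t = frechet_derivative (\<lambda>y. dynamics P (u t) y) (at (x t))"

text \<open>The equation \<open>-dp = p f\<^sub>x dt + g' d\<mu>\<close> of row vector valued measures on \<open>[0,T]\<close>, stated on all
  closed subintervals and applied to an arbitrary vector \<open>h\<close>.\<close>

definition costate_equation ::
    "('n::finite) ocp \<Rightarrow> (real \<Rightarrow> real) \<Rightarrow> (real \<Rightarrow> real ^ 'n) \<Rightarrow>
     (real \<Rightarrow> real ^ 'n) \<Rightarrow> real measure \<Rightarrow> bool" where
  "costate_equation P u x p \<mu> \<longleftrightarrow>
     (\<forall>s t h. 0 \<le> s \<and> s \<le> t \<and> t \<le> horizon P \<longrightarrow>
        - ((right_value (horizon P) p t - left_value p s) \<bullet> h) =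
          (LINT \<tau>:{s..t}|lebesgue. p \<tau> \<bullet> lin_dynamics P u x \<tau> h) +
          (LINT \<tau>:{s..t}|\<mu>. frechet_derivative (state_con P) (at (x \<tau>)) h))"

type_synonym 'n multiplier = "real \<times> (nat \<Rightarrow> real) \<times> (real \<Rightarrow> real ^ 'n) \<times> real measure"

text \<open>Since only multipliers with \<open>d\<mu> \<ge> 0\<close> are admitted, \<open>d\<mu>\<close> is taken directly to be a finite
  (nonnegative) Borel measure on \<open>[0,T]\<close>; such measures are Radon.\<close>

definition multipliers ::
    "('n::finite) ocp \<Rightarrow> (real \<Rightarrow> real) \<Rightarrow> (real \<Rightarrow> real ^ 'n) \<Rightarrow> 'n multiplier set" where
  "multipliers P u x = {(\<beta>, \<Psi>, p, \<mu>).
     \<beta> \<ge> 0 \<and>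
     bounded_variation_on 0 (horizon P) p \<and>
     sets \<mu> = sets (restrict_space borel {0..horizon P}) \<and> finite_measure \<mu> \<and>
     (\<beta> \<noteq> 0 \<or> (\<exists>i\<in>{1..n1 P + n2 P}. \<Psi> i \<noteq> 0) \<or> emeasure \<mu> (space \<mu>) \<noteq> 0) \<and>
     (\<forall>i\<in>{n1 P + 1..n1 P + n2 P}. \<Psi> i \<ge> 0 \<and> \<Psi> i * endpoint_con P i (x 0, x (horizon P)) = 0) \<and>
     (LINT t|\<mu>. state_con P (x t)) = 0 \<and>
     costate_equation P u x p \<mu> \<and>
     (\<forall>h k. frechet_derivative (ell P \<beta> \<Psi>) (at (x 0, x (horizon P))) (h, k) =
        (- p 0) \<bullet> h + p (horizon P) \<bullet> k) \<and>
     (AE t in lebesgue_on {0..horizon P}.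
        (u_min P > - \<infinity> \<and> p t \<bullet> f1 P (x t) > 0 \<longrightarrow> ereal (u t) = u_min P) \<and>
        (u_max P < \<infinity> \<and> p t \<bullet> f1 P (x t) < 0 \<longrightarrow> ereal (u t) = u_max P) \<and>
        (u_min P < ereal (u t) \<and> ereal (u t) < u_max P \<longrightarrow> p t \<bullet> f1 P (x t) = 0))}"


section \<open>Critical cone and quadratic form\<close>

definition critical_cone ::
    "('n::finite) ocp \<Rightarrow> (real \<Rightarrow> real) \<Rightarrow> (real \<Rightarrow> real ^ 'n) \<Rightarrow>
     ((real \<Rightarrow> real) \<times> (real \<Rightarrow> real ^ 'n)) set" where
  "critical_cone P u x = {(v, z).
     L_infty (horizon P) v \<and>
     (\<exists>z'. W1_infty_deriv (horizon P) z z' \<and>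
        (AE t in lebesgue_on {0..horizon P}. z' t = lin_dynamics P u x t (z t) + v t *\<^sub>R f1 P (x t))) \<and>
     frechet_derivative (cost P) (at (x 0, x (horizon P))) (z 0, z (horizon P)) \<le> 0 \<and>
     (\<forall>i\<in>{1..n1 P}.
        frechet_derivative (endpoint_con P i) (at (x 0, x (horizon P))) (z 0, z (horizon P)) = 0) \<and>
     (\<forall>i\<in>{n1 P + 1..n1 P + n2 P}. endpoint_con P i (x 0, x (horizon P)) = 0 \<longrightarrow>
        frechet_derivative (endpoint_con P i) (at (x 0, x (horizon P))) (z 0, z (horizon P)) \<le> 0) \<and>
     (AE t in lebesgue_on {0..horizon P}. t \<in> B_minus P u \<longrightarrow> v t \<ge> 0) \<and>
     (AE t in lebesgue_on {0..horizon P}. t \<in> B_plus P u \<longrightarrow> v t \<le> 0) \<and>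
     (\<forall>t\<in>contact_set P x. frechet_derivative (state_con P) (at (x t)) (z t) \<le> 0)}"

definition H_xx :: "('n::finite) ocp \<Rightarrow> real \<Rightarrow> real ^ 'n \<Rightarrow> real ^ 'n \<Rightarrow>
    real ^ 'n \<Rightarrow> real ^ 'n \<Rightarrow> real" where
  "H_xx P u x p = second_derivative (\<lambda>y. hamiltonian P u y p) x"

definition H_ux :: "('n::finite) ocp \<Rightarrow> real \<Rightarrow> real ^ 'n \<Rightarrow> real ^ 'n \<Rightarrow>
    real ^ 'n \<Rightarrow> real" where
  "H_ux P u x p k = deriv (\<lambda>w. frechet_derivative (\<lambda>y. hamiltonian P w y p) (at x) k) u"

definition quad_form :: "('n::finite) ocp \<Rightarrow> (real \<Rightarrow> real) \<Rightarrow> (real \<Rightarrow> real ^ 'n) \<Rightarrow>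
    (real \<Rightarrow> real) \<Rightarrow> (real \<Rightarrow> real ^ 'n) \<Rightarrow> 'n multiplier \<Rightarrow> real" where
  "quad_form P u x v z = (\<lambda>(\<beta>, \<Psi>, p, \<mu>).
     (LINT t|lebesgue_on {0..horizon P}.
        H_xx P (u t) (x t) (p t) (z t) (z t) + 2 * v t * H_ux P (u t) (x t) (p t) (z t)) +
     second_derivative (ell P \<beta> \<Psi>) (x 0, x (horizon P))
        (z 0, z (horizon P)) (z 0, z (horizon P)) +
     (LINT t|\<mu>. second_derivative (state_con P) (x t) (z t) (z t)))"

end

(* The arc structure forces g(x_t) <= -c dist(t, C) away from the contact set C, and jumps at the CS and
   SC junctions make this linear. Hence every critical direction (v, z) is radial for the state constraint,
   and second order perturbations x + e z + e^2 zeta + o(e^2) involve no curvature term. Here zeta solves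
   the linearised equation with a second order source term and a control w that is only restricted
   on B. If some such zeta decreased the cost and all active constraints strictly at second order,
   uniformly with respect to prescribed small values of the equality constraints, then Brouwer's
   theorem would produce feasible trajectories with smaller cost near the weak minimum. Hence an
   approximate minimax inequality holds on the convex set of all zeta of bounded size. A penalty
   argument on finite sets of constraints and weak compactness of probability measures (Helly) turn it into
   multipliers that do not depend on zeta; duality with the costate removes zeta and leaves Q >= 0. *)

theory Submission
  imports Defs "HOL-Probability.Probability"
begin

section \<open>Minimax over convex sets of functions\<close>

text \<open>Radiality comes from comparing two linear rates: g'(x)z is nonpositive on C and
  Lipschitz in time, so e g'(x)z is at most e K dist(t, C), and for small e the margin of g absorbs
  it. Only the e^2 term on C remains to be made negative. The obstacle is the equality constraints.
  Failure of the strict system is only known near one small target value y per stage, so each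
  equation becomes two inequalities of opposite sign with shifts that tend to zero. A limit of
  weights could then put equal masses on both signs, which cancel to a zero multiplier. This is why
  the minimax lemmas also record an element of the convex set that is positive wherever the weight
  is positive: the two signs of one equation are never both positive for it. The bound on the data
  of zeta grows with the stage, so the limit inequality holds for all initial values and all
  admissible w; scaling them gives the transversality condition at 0 and the signs of p f_1. The
  direction (v, z) is fixed before the multiplier is found, so the multiplier may depend on
  it.\<close>

lemma finite_coordinates_convergent_subseq:
  fixes X :: "nat \<Rightarrow> nat \<Rightarrow> real"
  assumes "\<And>n i. i < K \<Longrightarrow> \<bar>X n i\<bar> \<le> B"
  shows "\<exists>r l. strict_mono (r::nat\<Rightarrow>nat) \<and> (\<forall>i<K. (\<lambda>n. X (r n) i) \<longlonglongrightarrow> l i)"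
  using assms
proof (induction K)
  case 0
  then show ?case by (intro exI[of _ id]) (auto simp: strict_mono_def)
next
  case (Suc K)
  then obtain r l where r: "strict_mono (r::nat\<Rightarrow>nat)" "\<And>i. i<K \<Longrightarrow> (\<lambda>n. X (r n) i) \<longlonglongrightarrow> l i"
    by (metis less_SucI)
  have "bounded (range (\<lambda>n. X (r n) K))"
    unfolding bounded_iff using Suc.prems[of K] by auto
  from bounded_imp_convergent_subsequence[OF this]
  obtain q m where q: "strict_mono q" "((\<lambda>n. X (r n) K) \<circ> q) \<longlonglongrightarrow> m" by auto
  have "(\<lambda>n. X ((r \<circ> q) n) i) \<longlonglongrightarrow> (l(K:=m)) i" if "i < Suc K" for i
  proof (cases "i = K")
    case True
    then show ?thesis using q(2) by (simp add: o_def)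
  next
    case False
    then have "(\<lambda>n. X (r n) i) \<longlonglongrightarrow> l i" using that r(2) by auto
    from LIMSEQ_subseq_LIMSEQ[OF this q(1)] show ?thesis using False by (simp add: o_def)
  qed
  moreover have "strict_mono (r \<circ> q)" using r q by (simp add: strict_mono_o)
  ultimately show ?case by blast
qed

text \<open>Kuhn's combinatorial lemma on the grid of mesh 1/p, with labels recording the signs of
  the components of \<open>f\<close>, yields a cell in which every label takes both values. As p
  grows these cells shrink to a point where each component is both nonnegative and nonpositive.
  Continuity is stated sequentially and in the coordinates below \<open>K\<close> only, so
  \<open>K = 0\<close> is included.\<close>

lemma Poincare_Miranda_nat:
  fixes f :: "(nat \<Rightarrow> real) \<Rightarrow> nat \<Rightarrow> real"
  assumes cont: "\<And>X l. (\<And>n i. i < K \<Longrightarrow> X n i \<in> {0..1}) \<Longrightarrow> (\<And>i. i < K \<Longrightarrow> (\<lambda>n. X n i) \<longlonglongrightarrow> l i)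
        \<Longrightarrow> (\<And>i. i < K \<Longrightarrow> (\<lambda>n. f (X n) i) \<longlonglongrightarrow> f l i)"
    and lo: "\<And>\<theta> i. (\<And>j. j < K \<Longrightarrow> \<theta> j \<in> {0..1}) \<Longrightarrow> i < K \<Longrightarrow> \<theta> i = 0 \<Longrightarrow> f \<theta> i \<le> 0"
    and hi: "\<And>\<theta> i. (\<And>j. j < K \<Longrightarrow> \<theta> j \<in> {0..1}) \<Longrightarrow> i < K \<Longrightarrow> \<theta> i = 1 \<Longrightarrow> f \<theta> i \<ge> 0"
  shows "\<exists>\<theta>. (\<forall>j<K. \<theta> j \<in> {0..1}) \<and> (\<forall>i<K. f \<theta> i = 0)"
proof -
  define pt where "pt p q = (\<lambda>j. real (q j) / real p)" for p :: nat and q :: "nat \<Rightarrow> nat"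
  \<comment> \<open>On the two opposite faces the label is prescribed, as Kuhn's lemma demands;
    elsewhere it records the sign of the component.\<close>
  define lab where "lab p q i = (if q i = 0 then 0 else if q i = p then 1 else if f (pt p q) i \<le> 0 then 0 else (1::nat))"
    for p :: nat and q i
  have "\<exists>q rs. (\<forall>i<K. q i < p) \<and> (\<forall>i<K. (\<forall>j<K. q j \<le> rs True i j \<and> rs True i j \<le> q j + 1) \<and>
     (\<forall>j<K. q j \<le> rs False i j \<and> rs False i j \<le> q j + 1) \<and> lab p (rs True i) i = 1 \<and> lab p (rs False i) i = 0)"
    if p0: "p > 0" for p
  proof -
    have l01: "lab p x i = 0 \<or> lab p x i = 1" for x i by (auto simp: lab_def)
    have lb: "lab p x i = 0" if "x i = 0" for x i using that by (simp add: lab_def)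
    have ub: "lab p x i = 1" if "x i = p" for x i using that \<open>p > 0\<close> by (simp add: lab_def)
    obtain q where q: "\<forall>i<K. q i < p" "\<forall>i<K. \<exists>r s. (\<forall>j<K. q j \<le> r j \<and> r j \<le> q j + 1) \<and> (\<forall>j<K. q j \<le> s j \<and> s j \<le> q j + 1) \<and> lab p r i \<noteq> lab p s i"
    proof (rule kuhn_lemma[of p K "lab p"])
      show "0 < p" by (rule p0)
    qed (use l01 lb ub in blast)+
    have "\<exists>r s. (\<forall>j<K. q j \<le> r j \<and> r j \<le> q j + 1) \<and> (\<forall>j<K. q j \<le> s j \<and> s j \<le> q j + 1) \<and> lab p r i = 1 \<and> lab p s i = 0" if i: "i < K" for i
      using q(2) i l01 by metis
    then obtain r s where "\<forall>i<K. (\<forall>j<K. q j \<le> r i j \<and> r i j \<le> q j + 1) \<and> (\<forall>j<K. q j \<le> s i j \<and> s i j \<le> q j + 1) \<and> lab p (r i) i = 1 \<and> lab p (s i) i = 0"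
      by metis
    then show ?thesis using q(1) by (intro exI[of _ q] exI[of _ "\<lambda>b. if b then r else s"]) auto
  qed
  then have "\<forall>p. \<exists>q rs. (\<forall>i<K. q i < Suc p) \<and> (\<forall>i<K. (\<forall>j<K. q j \<le> rs True i j \<and> rs True i j \<le> q j + 1) \<and>
     (\<forall>j<K. q j \<le> rs False i j \<and> rs False i j \<le> q j + 1) \<and> lab (Suc p) (rs True i) i = 1 \<and> lab (Suc p) (rs False i) i = 0)"
    by blast
  then obtain q rs where q: "\<And>p i. i < K \<Longrightarrow> q p i < Suc p"
    and rs: "\<And>p i j b. i < K \<Longrightarrow> j < K \<Longrightarrow> q p j \<le> rs p b i j \<and> rs p b i j \<le> q p j + 1"
    and lab: "\<And>p i. i < K \<Longrightarrow> lab (Suc p) (rs p True i) i = 1 \<and> lab (Suc p) (rs p False i) i = 0"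
    by (metis (full_types))
  have "\<bar>pt (Suc n) (q n) i\<bar> \<le> 1" if "i < K" for n i
    using q[OF that, of n] by (simp add: pt_def divide_simps)
  from finite_coordinates_convergent_subseq[of K "\<lambda>n. pt (Suc n) (q n)", OF this]
  obtain r l where r: "strict_mono (r::nat\<Rightarrow>nat)" and l: "\<And>i. i<K \<Longrightarrow> (\<lambda>n. pt (Suc (r n)) (q (r n)) i) \<longlonglongrightarrow> l i"
    by blast
  have in01: "pt (Suc n) (rs n b i) j \<in> {0..1}" if "i < K" "j < K" for n b i j
    using rs[OF that, of n b] q[OF that(2), of n] by (simp add: pt_def divide_simps)
  have lim: "(\<lambda>n. pt (Suc (r n)) (rs (r n) b i) j) \<longlonglongrightarrow> l j" if ij: "i < K" "j < K" for b i j
  proof -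
    have b1: "\<bar>pt (Suc n) (rs n b i) j - pt (Suc n) (q n) j\<bar> \<le> 1 / real (Suc n)" for n
      using rs[OF ij, of n b] by (simp add: pt_def diff_divide_distrib[symmetric] divide_right_mono)
    have "(\<lambda>n. pt (Suc (r n)) (rs (r n) b i) j - pt (Suc (r n)) (q (r n)) j) \<longlonglongrightarrow> 0"
    proof (rule Lim_null_comparison)
      show "\<forall>\<^sub>F n in sequentially. norm (pt (Suc (r n)) (rs (r n) b i) j - pt (Suc (r n)) (q (r n)) j) \<le> 1 / real (Suc (r n))"
        using b1 by simp
      have "(\<lambda>n. 1 / real (Suc n)) \<longlonglongrightarrow> 0" using LIMSEQ_inverse_real_of_nat by (simp add: inverse_eq_divide)
      from LIMSEQ_subseq_LIMSEQ[OF this r] show "(\<lambda>n. 1 / real (Suc (r n))) \<longlonglongrightarrow> 0" by (simp add: o_def)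
    qed
    from tendsto_add[OF this l[OF ij(2)]] show ?thesis by simp
  qed
  have "f l i = 0" if i: "i < K" for i
  proof -
    have c: "(\<lambda>n. f (pt (Suc (r n)) (rs (r n) b i)) i) \<longlonglongrightarrow> f l i" for b
      by (rule cont) (use lim in01 i in auto)
    \<comment> \<open>On a face the prescribed label says nothing about \<open>f\<close>; there
      \<open>lo\<close> and \<open>hi\<close> supply the sign.\<close>
    have s: "f (pt (Suc n) (rs n True i)) i \<ge> 0" "f (pt (Suc n) (rs n False i)) i \<le> 0" for n
    proof -
      have L: "lab (Suc n) (rs n True i) i = 1" "lab (Suc n) (rs n False i) i = 0" using lab i by auto
      show "f (pt (Suc n) (rs n True i)) i \<ge> 0"
      proof (cases "rs n True i i = Suc n")
        case True
        then show ?thesis using i in01 by (intro hi) (auto simp: pt_def)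
      next
        case False
        then show ?thesis using L(1) by (auto simp: lab_def split: if_splits)
      qed
      show "f (pt (Suc n) (rs n False i)) i \<le> 0"
      proof (cases "rs n False i i = 0")
        case True
        then show ?thesis using i in01 by (intro lo) (auto simp: pt_def)
      next
        case False
        then show ?thesis using L(2) by (auto simp: lab_def split: if_splits)
      qed
    qed
    have "f l i \<ge> 0" using c[of True] by (rule tendsto_lowerbound) (use s in auto)
    moreover have "f l i \<le> 0" using c[of False] by (rule tendsto_upperbound) (use s in auto)
    ultimately show ?thesis by simp
  qed
  moreover have "l j \<in> {0..1}" if "j < K" for j
  proof -
    have "l j \<ge> 0" using lim[OF that that, of True] by (rule tendsto_lowerbound) (use in01[OF that that] in auto)
    moreover have "l j \<le> 1" using lim[OF that that, of True] by (rule tendsto_upperbound) (use in01[OF that that] in auto)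
    ultimately show ?thesis by simp
  qed
  ultimately show ?thesis by blast
qed

text \<open>If \<open>f\<close> differs from the identity by at most 1, component i is nonpositive
  where \<open>\<theta> i = -1\<close> and nonnegative where \<open>\<theta> i = 1\<close>. These
  are the face conditions above after rescaling the cube.\<close>

lemma near_identity_zero:
  fixes f :: "(nat \<Rightarrow> real) \<Rightarrow> nat \<Rightarrow> real"
  assumes cont: "\<And>X l. (\<And>n i. i < K \<Longrightarrow> X n i \<in> {-1..1}) \<Longrightarrow> (\<And>i. i < K \<Longrightarrow> (\<lambda>n. X n i) \<longlonglongrightarrow> l i)
        \<Longrightarrow> (\<And>i. i < K \<Longrightarrow> (\<lambda>n. f (X n) i) \<longlonglongrightarrow> f l i)"
    and near: "\<And>\<theta> i. (\<And>j. j < K \<Longrightarrow> \<theta> j \<in> {-1..1}) \<Longrightarrow> i < K \<Longrightarrow> \<bar>f \<theta> i - \<theta> i\<bar> \<le> 1"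
  shows "\<exists>\<theta>. (\<forall>j<K. \<theta> j \<in> {-1..1}) \<and> (\<forall>i<K. f \<theta> i = 0)"
proof -
  define g where "g \<theta> = f (\<lambda>j. 2 * \<theta> j - 1)" for \<theta> :: "nat \<Rightarrow> real"
  have "\<exists>\<theta>. (\<forall>j<K. \<theta> j \<in> {0..1}) \<and> (\<forall>i<K. g \<theta> i = 0)"
  proof (rule Poincare_Miranda_nat)
    fix X :: "nat \<Rightarrow> nat \<Rightarrow> real" and l i
    assume *: "\<And>n i. i < K \<Longrightarrow> X n i \<in> {0..1}" "\<And>i. i < K \<Longrightarrow> (\<lambda>n. X n i) \<longlonglongrightarrow> l i" "i < K"
    show "(\<lambda>n. g (X n) i) \<longlonglongrightarrow> g l i"
      unfolding g_def
    proof (rule cont)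
      fix n j assume "j < K" then show "2 * X n j - 1 \<in> {-1..1}" using *(1)[of j n] by auto
    next
      fix j assume "j < K" then show "(\<lambda>n. 2 * X n j - 1) \<longlonglongrightarrow> 2 * l j - 1"
        by (intro tendsto_intros *(2))
    qed (rule *)
  next
    fix \<theta> :: "nat \<Rightarrow> real" and i assume "\<And>j. j < K \<Longrightarrow> \<theta> j \<in> {0..1}" "i < K" "\<theta> i = 0"
    then show "g \<theta> i \<le> 0" using near[of "\<lambda>j. 2 * \<theta> j - 1" i] by (auto simp: g_def)
  next
    fix \<theta> :: "nat \<Rightarrow> real" and i assume "\<And>j. j < K \<Longrightarrow> \<theta> j \<in> {0..1}" "i < K" "\<theta> i = 1"
    then show "g \<theta> i \<ge> 0" using near[of "\<lambda>j. 2 * \<theta> j - 1" i] by (auto simp: g_def)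
  qed
  then obtain \<theta> where t: "\<And>j. j<K \<Longrightarrow> \<theta> j \<in> {0..1}" "\<And>i. i<K \<Longrightarrow> g \<theta> i = 0" by blast
  show ?thesis
  proof (rule exI[of _ "\<lambda>j. 2 * \<theta> j - 1"], intro conjI allI impI)
    fix j assume "j < K" then show "2 * \<theta> j - 1 \<in> {-1..1}" using t(1)[of j] by auto
  next
    fix i assume "i < K" then show "f (\<lambda>j. 2 * \<theta> j - 1) i = 0" using t(2) by (simp add: g_def)
  qed
qed

section \<open>Minimax inequalities and weak limits of their weights\<close>

text \<open>The square of the positive part has derivative \<open>2 * max 0 a\<close>, and this is
  its quadratic upper bound. It replaces differentiation in the descent argument below.\<close>

lemma pos_part_square_add: "(max 0 (a + b))\<^sup>2 \<le> (max 0 a)\<^sup>2 + 2 * max 0 a * b + b\<^sup>2" for a b :: real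
proof (cases "a \<ge> 0")
  case True
  have "(a + b)\<^sup>2 = a\<^sup>2 + 2 * a * b + b\<^sup>2" by (simp add: power2_eq_square algebra_simps)
  then show ?thesis using True zero_le_power2[of "a + b"] by (cases "a + b \<ge> 0") auto
next
  case False
  have "(max 0 (a + b))\<^sup>2 \<le> \<bar>b\<bar>\<^sup>2" using False by (intro power_mono) auto
  then show ?thesis using False by simp
qed

text \<open>Minimising the penalty \<open>\<Sum>\<^sub>d (h d)\<^sub>+\<^sup>2\<close> approximately over \<open>X\<close> yields the weights
  \<open>(h* d)\<^sub>+\<close>; no separation theorem in a space of unknown dimension is needed.\<close>

lemma finite_minimax:
  fixes X :: "('a \<Rightarrow> real) set"
  assumes fin: "finite N" and ne: "X \<noteq> {}"
    and cvx: "\<And>h k s. h \<in> X \<Longrightarrow> k \<in> X \<Longrightarrow> 0 \<le> s \<Longrightarrow> s \<le> 1 \<Longrightarrow> (\<lambda>d. (1 - s) * h d + s * k d) \<in> X"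
    and bdd: "\<And>h d. h \<in> X \<Longrightarrow> d \<in> N \<Longrightarrow> \<bar>h d\<bar> \<le> M"
    and c: "c > 0" and pos: "\<And>h. h \<in> X \<Longrightarrow> \<exists>d\<in>N. h d \<ge> c"
  shows "\<exists>m. (\<forall>d. m d \<ge> 0) \<and> (\<Sum>d\<in>N. m d) = 1 \<and> (\<forall>h\<in>X. (\<Sum>d\<in>N. m d * h d) \<ge> 0) \<and>
      (\<exists>h\<in>X. \<forall>d\<in>N. m d > 0 \<longrightarrow> h d > 0)"
proof -
  define J where "J h = (\<Sum>d\<in>N. (max 0 (h d))\<^sup>2)" for h :: "'a \<Rightarrow> real"
  have Jc: "J h \<ge> c\<^sup>2" if hX: "h \<in> X" for h
  proof -
    obtain d where d: "d \<in> N" "h d \<ge> c" using pos[OF hX] by blast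
    have "c\<^sup>2 \<le> (max 0 (h d))\<^sup>2" using d c by (intro power_mono) auto
    also have "\<dots> \<le> J h" unfolding J_def using fin d by (intro member_le_sum) auto
    finally show ?thesis .
  qed
  have M0: "M \<ge> 0" using ne bdd pos by (meson abs_ge_zero equals0I order_trans)
  define Q where "Q = 1 + real (card N) * (2 * M)\<^sup>2"
  have Q: "Q \<ge> 1" by (simp add: Q_def)
  \<comment> \<open>Step length from the near minimiser towards another point of \<open>X\<close>;
    \<open>s * Q \<le> c\<^sup>2\<close> keeps the quadratic remainder below
    \<open>s * c\<^sup>2\<close>.\<close>
  define s where "s = min 1 (c\<^sup>2 / Q)"
  have s: "0 < s" "s \<le> 1" "s * Q \<le> c\<^sup>2" using c Q by (auto simp: s_def min_def field_simps)
  define J0 where "J0 = Inf (J ` X)"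
  have bb: "bdd_below (J ` X)" using Jc by (auto simp: bdd_below_def)
  have J0: "J0 \<le> J h" if "h \<in> X" for h unfolding J0_def using that bb by (simp add: cInf_lower)
  \<comment> \<open>The infimum need not be attained. The tolerance \<open>s * c\<^sup>2\<close> and
    the quadratic remainder together amount to at most \<open>2 * s * c\<^sup>2\<close>, which
    \<open>2 * s * J h\<close> covers because \<open>J h \<ge> c\<^sup>2\<close>.\<close>
  obtain h where h: "h \<in> X" "J h < J0 + s * c\<^sup>2"
    using cInf_lessD[of "J ` X" "J0 + s * c\<^sup>2"] ne s c by (auto simp: J0_def)
  have key: "(\<Sum>d\<in>N. max 0 (h d) * k d) \<ge> 0" if k: "k \<in> X" for k
  proof -
    have "J0 \<le> J (\<lambda>d. (1 - s) * h d + s * k d)" using J0 cvx h k s by simp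
    also have "\<dots> = (\<Sum>d\<in>N. (max 0 (h d + s * (k d - h d)))\<^sup>2)"
      unfolding J_def by (intro sum.cong refl arg_cong[where f="\<lambda>z. (max 0 z)\<^sup>2"]) (simp add: algebra_simps)
    also have "\<dots> \<le> (\<Sum>d\<in>N. (max 0 (h d))\<^sup>2 + 2 * max 0 (h d) * (s * (k d - h d)) + s\<^sup>2 * (2*M)\<^sup>2)"
    proof (rule sum_mono)
      fix d assume d: "d \<in> N"
      have "\<bar>k d - h d\<bar> \<le> 2 * M" using bdd[OF h(1) d] bdd[OF k d] by linarith
      then have "(k d - h d)\<^sup>2 \<le> (2*M)\<^sup>2" by (metis power2_abs power_mono abs_ge_zero)
      then have "(s * (k d - h d))\<^sup>2 \<le> s\<^sup>2 * (2*M)\<^sup>2" by (simp add: power_mult_distrib mult_left_mono)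
      then show "(max 0 (h d + s * (k d - h d)))\<^sup>2 \<le> (max 0 (h d))\<^sup>2 + 2 * max 0 (h d) * (s * (k d - h d)) + s\<^sup>2 * (2*M)\<^sup>2"
        using pos_part_square_add[of "h d" "s * (k d - h d)"] by linarith
    qed
    also have "\<dots> = J h + 2 * s * ((\<Sum>d\<in>N. max 0 (h d) * k d) - (\<Sum>d\<in>N. max 0 (h d) * h d)) + s\<^sup>2 * (Q - 1)"
      by (simp add: sum.distrib J_def sum_subtractf sum_distrib_left Q_def algebra_simps)
    also have "(\<Sum>d\<in>N. max 0 (h d) * h d) = J h"
      unfolding J_def by (intro sum.cong) (auto simp: max_def power2_eq_square)
    finally have "0 < s * c\<^sup>2 + 2 * s * ((\<Sum>d\<in>N. max 0 (h d) * k d) - J h) + s\<^sup>2 * (Q - 1)" using h by linarith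
    also have "s\<^sup>2 * (Q - 1) \<le> s * c\<^sup>2"
    proof -
      have "s * (Q - 1) \<le> s * Q" using s(1) by simp
      then have "s * (s * (Q - 1)) \<le> s * c\<^sup>2" using s(1,3) by (intro mult_left_mono) linarith+
      then show ?thesis by (simp add: power2_eq_square mult.assoc)
    qed
    finally have "0 < s * (2 * c\<^sup>2 + 2 * ((\<Sum>d\<in>N. max 0 (h d) * k d) - J h))" by (simp add: algebra_simps)
    then show ?thesis using s Jc[OF h(1)] by (simp add: zero_less_mult_iff)
  qed
  define Z where "Z = (\<Sum>d\<in>N. max 0 (h d))"
  obtain d where d: "d \<in> N" "h d \<ge> c" using pos h by blast
  have "max 0 (h d) \<le> Z" unfolding Z_def using d fin by (intro member_le_sum) auto
  then have Z: "Z > 0" using d c by linarith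
  show ?thesis
  proof (intro exI[of _ "\<lambda>d. max 0 (h d) / Z"] conjI allI ballI)
    show "(\<Sum>d\<in>N. max 0 (h d) / Z) = 1" using Z by (simp add: sum_divide_distrib[symmetric] Z_def)
  next
    fix k assume "k \<in> X"
    then have "0 \<le> (\<Sum>d\<in>N. max 0 (h d) * k d) / Z" using key Z by simp
    then show "0 \<le> (\<Sum>d\<in>N. max 0 (h d) / Z * k d)" by (simp add: sum_divide_distrib)
  next
    \<comment> \<open>The weights are the normalised positive parts of \<open>h\<close>, so they are
      positive only where \<open>h\<close> is. This clause is what later prevents the two signs of
      an equality constraint from cancelling.\<close>
    show "\<exists>h'\<in>X. \<forall>d\<in>N. max 0 (h d) / Z > 0 \<longrightarrow> h' d > 0"
      using h Z by (intro bexI[of _ h]) (auto simp: zero_less_divide_iff less_max_iff_disj)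
  qed (use Z in auto)
qed

text \<open>By equicontinuity a finite net of \<open>D\<close> loses at most \<open>c/2\<close>, so
  the finite case applies and its weights form a discrete distribution. The integrand
  \<open>k\<close> only has to agree with \<open>h\<close> on \<open>D\<close>, since
  \<open>h\<close> is arbitrary elsewhere. The last clause places all atoms where one and the same
  member of \<open>X\<close> is positive.\<close>

lemma compact_minimax:
  fixes X :: "(real \<Rightarrow> real) set"
  assumes D: "compact D" and ne: "X \<noteq> {}"
    and cvx: "\<And>h k s. h \<in> X \<Longrightarrow> k \<in> X \<Longrightarrow> 0 \<le> s \<Longrightarrow> s \<le> 1 \<Longrightarrow> (\<lambda>d. (1 - s) * h d + s * k d) \<in> X"
    and bdd: "\<And>h d. h \<in> X \<Longrightarrow> d \<in> D \<Longrightarrow> \<bar>h d\<bar> \<le> M"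
    and equi: "\<And>e. e > 0 \<Longrightarrow> \<exists>\<delta>>0. \<forall>h\<in>X. \<forall>d\<in>D. \<forall>d'\<in>D. \<bar>d - d'\<bar> < \<delta> \<longrightarrow> \<bar>h d - h d'\<bar> < e"
    and c: "c > 0" and pos: "\<And>h. h \<in> X \<Longrightarrow> \<exists>d\<in>D. h d \<ge> c"
  shows "\<exists>\<nu>. real_distribution \<nu> \<and> measure \<nu> D = 1 \<and> 
     (\<forall>h\<in>X. \<forall>k\<in>borel_measurable borel. (\<forall>d\<in>D. k d = h d) \<longrightarrow> integral\<^sup>L \<nu> k \<ge> 0) \<and>
     (\<exists>h\<in>X. \<forall>d\<in>D. measure \<nu> {d} > 0 \<longrightarrow> h d > 0)"
proof -
  obtain \<delta> where \<delta>: "\<delta> > 0" "\<And>h d d'. h \<in> X \<Longrightarrow> d \<in> D \<Longrightarrow> d' \<in> D \<Longrightarrow> \<bar>d - d'\<bar> < \<delta> \<Longrightarrow> \<bar>h d - h d'\<bar> < c / 2"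
    using equi[of "c/2"] c by auto
  obtain N where N: "finite N" "N \<subseteq> D" "D \<subseteq> (\<Union>d\<in>N. ball d \<delta>)"
    using compactE_image[OF D, of D "\<lambda>d. ball d \<delta>"] \<delta>(1) by (metis UN_I centre_in_ball open_ball subsetI)
  have "\<exists>d\<in>N. h d \<ge> c/2" if h: "h \<in> X" for h
  proof -
    obtain d where d: "d \<in> D" "h d \<ge> c" using pos h by blast
    obtain d' where d': "d' \<in> N" "d \<in> ball d' \<delta>" using d N by blast
    then have "\<bar>h d - h d'\<bar> < c / 2" using \<delta>(2)[OF h d(1), of d'] N(2) by (auto simp: dist_real_def)
    then have "h d' \<ge> c / 2" using d(2) by (simp add: abs_if split: if_splits)
    then show ?thesis using d' by blast
  qed
  with finite_minimax[of N X M "c/2"] N cvx bdd c ne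
  obtain m where m: "\<And>d. m d \<ge> 0" "(\<Sum>d\<in>N. m d) = 1" "\<And>h. h\<in>X \<Longrightarrow> (\<Sum>d\<in>N. m d * h d) \<ge> 0"
    and mh: "\<exists>h\<in>X. \<forall>d\<in>N. m d > 0 \<longrightarrow> h d > 0" by (smt (verit, best) half_gt_zero subsetD)
  \<comment> \<open>The point measure lives on the subsets of \<open>N\<close>; its image under the
    inclusion is a Borel distribution on the line, the form in which Helly's theorem is
    used.\<close>
  define PM where "PM = point_measure N (\<lambda>d. ennreal (m d))"
  define \<nu> where "\<nu> = distr PM borel (\<lambda>x. x)"
  have spm: "space PM = N" "sets PM = Pow N" by (auto simp: PM_def space_point_measure sets_point_measure)
  have idm: "(\<lambda>x. x) \<in> measurable PM (borel :: real measure)" by (simp add: PM_def)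
  have em: "emeasure \<nu> A = ennreal (\<Sum>d\<in>N \<inter> A. m d)" if A: "A \<in> sets borel" for A
  proof -
    have "emeasure \<nu> A = emeasure PM (N \<inter> A)"
      unfolding \<nu>_def using A idm by (simp add: emeasure_distr spm Int_commute)
    also have "\<dots> = (\<Sum>d\<in>N \<inter> A. ennreal (m d))"
      unfolding PM_def using N by (intro emeasure_point_measure_finite) auto
    finally show ?thesis using m by (simp add: sum_ennreal)
  qed
  interpret pr: prob_space \<nu>
    by standard (use em[of UNIV] m in \<open>simp add: \<nu>_def\<close>)
  have rd: "real_distribution \<nu>" by (standard) (auto simp: \<nu>_def)
  have int: "integral\<^sup>L \<nu> h = (\<Sum>d\<in>N. m d * h d)" if "h \<in> borel_measurable borel" for h
  proof -
    have "integral\<^sup>L \<nu> h = integral\<^sup>L PM h" unfolding \<nu>_def using that idm by (simp add: integral_distr)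
    also have "\<dots> = (\<Sum>d\<in>N. m d * h d)" unfolding PM_def using N m by (simp add: lebesgue_integral_point_measure_finite)
    finally show ?thesis .
  qed
  have mD: "measure \<nu> D = 1"
    using em[of D] D N m by (simp add: measure_def compact_imp_closed Int_absorb2)
  have I: "integral\<^sup>L \<nu> k \<ge> 0" if "h \<in> X" "k \<in> borel_measurable borel" "\<forall>d\<in>D. k d = h d" for h k
  proof -
    have "(\<Sum>d\<in>N. m d * k d) = (\<Sum>d\<in>N. m d * h d)" using that(3) N by (intro sum.cong) auto
    then show ?thesis using int[OF that(2)] m(3)[OF that(1)] by simp
  qed
  obtain h where h: "h \<in> X" "\<forall>d\<in>N. m d > 0 \<longrightarrow> h d > 0" using mh by blast
  have S: "h d > 0" if d: "d \<in> D" "measure \<nu> {d} > 0" for d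
  proof -
    have "(\<Sum>e\<in>N \<inter> {d}. m e) > 0" using that em[of "{d}"] m(1) by (simp add: measure_def sum_nonneg)
    then have "d \<in> N \<and> m d > 0" by (cases "d \<in> N") auto
    then show ?thesis using h by blast
  qed
  show ?thesis
    by (intro exI[of _ \<nu>] conjI rd mD bexI[of _ h] h) (use I S in auto)
qed


text \<open>A common bounded support gives tightness, hence Helly selection. That the limit is still
  carried by \<open>D\<close> is seen by testing with the truncated distance to \<open>D\<close>,
  whose integral is zero along the sequence.\<close>

lemma weak_limit_on_compact:
  fixes \<nu> :: "nat \<Rightarrow> real measure"
  assumes D: "compact D" and \<nu>: "\<And>n. real_distribution (\<nu> n)" "\<And>n. measure (\<nu> n) D = 1"
  shows "\<exists>r M. strict_mono (r::nat\<Rightarrow>nat) \<and> real_distribution M \<and> measure M D = 1 \<and>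
    (\<forall>h. continuous_on UNIV h \<and> (\<exists>B. \<forall>t. \<bar>h t\<bar> \<le> B) \<longrightarrow> (\<lambda>n. integral\<^sup>L (\<nu> (r n)) h) \<longlonglongrightarrow> integral\<^sup>L M (h :: real \<Rightarrow> real))"
proof -
  interpret \<nu>: real_distribution "\<nu> n" for n by (rule \<nu>)
  obtain B where B: "B > 0" "\<And>d. d \<in> D \<Longrightarrow> \<bar>d\<bar> \<le> B"
    using compact_imp_bounded[OF D] bounded_pos[of D] by auto
  have Db: "D \<in> sets borel" using D by (simp add: compact_imp_closed)
  have "tight \<nu>"
    unfolding tight_def
  proof (intro conjI allI impI)
    fix e :: real assume "e > 0"
    have "measure (\<nu> n) {-B-1<..B} \<ge> 1" for n
    proof -
      have "D \<subseteq> {-B-1<..B}" using B by (fastforce simp: abs_le_iff)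
      then have "measure (\<nu> n) D \<le> measure (\<nu> n) {-B-1<..B}"
        by (intro \<nu>.finite_measure_mono) auto
      then show ?thesis using \<nu> by simp
    qed
    then have "measure (\<nu> n) {-B-1<..B} > 1 - e" for n using \<open>e > 0\<close> by (meson diff_less_eq less_add_same_cancel1 less_le_trans)
    then show "\<exists>a b. a < b \<and> (\<forall>n. measure (\<nu> n) {a<..b} > 1 - e)"
      using B(1) by (intro exI[of _ "-B-1"] exI[of _ B]) auto
  qed (rule \<nu>)
  from tight_imp_convergent_subsubsequence[OF this, of id]
  obtain r M where r: "strict_mono (r::nat\<Rightarrow>nat)" "real_distribution M" "weak_conv_m (\<nu> \<circ> r) M"
    by (auto simp: strict_mono_def)
  interpret M: real_distribution M by (rule r)
  have conv: "(\<lambda>n. integral\<^sup>L (\<nu> (r n)) h) \<longlonglongrightarrow> integral\<^sup>L M h"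
    if "continuous_on UNIV h" "\<forall>t. \<bar>h t\<bar> \<le> C" for h :: "real \<Rightarrow> real" and C
  proof -
    have "(\<lambda>n. integral\<^sup>L ((\<nu> \<circ> r) n) h) \<longlonglongrightarrow> integral\<^sup>L M h"
    proof (rule weak_conv_imp_integral_bdd_continuous_conv[where B=C])
      show "\<And>n. real_distribution ((\<nu> \<circ> r) n)" using \<nu> by simp
      show "\<And>x. isCont h x" using that(1) by (simp add: continuous_on_eq_continuous_at)
    qed (rule r that(2)[rule_format, unfolded real_norm_def[symmetric]])+
    then show ?thesis by simp
  qed
  have De: "D \<noteq> {}" using \<nu>(2) by fastforce
  define q where "q t = min 1 (infdist t D)" for t
  have q: "continuous_on UNIV q" "\<And>t. 0 \<le> q t" "\<And>t. q t \<le> 1" "\<And>t. q t = 0 \<longleftrightarrow> t \<in> D"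
  proof -
    show "continuous_on UNIV q" unfolding q_def
      by (intro continuous_on_min continuous_on_const continuous_on_infdist continuous_on_id)
    show "q t = 0 \<longleftrightarrow> t \<in> D" for t
      using in_closed_iff_infdist_zero[OF compact_imp_closed[OF D] De, of t] by (auto simp: q_def min_def)
  qed (auto simp: q_def infdist_nonneg)
  have AEn: "AE t in \<nu> n. t \<in> D" for n
    using \<nu>.prob_eq_1[of D n] \<nu>(2) Db by simp
  have "integral\<^sup>L (\<nu> n) q = 0" for n
  proof (rule integral_eq_zero_AE)
    show "AE t in \<nu> n. q t = 0" using AEn by eventually_elim (simp add: q)
  qed
  moreover have "(\<lambda>n. integral\<^sup>L (\<nu> (r n)) q) \<longlonglongrightarrow> integral\<^sup>L M q"
    by (rule conv[OF q(1)]) (use q in auto)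
  ultimately have q0: "integral\<^sup>L M q = 0" by (simp add: LIMSEQ_const_iff)
  have "AE t in M. q t = 0"
  proof (subst integral_nonneg_eq_0_iff_AE[symmetric])
    have "q \<in> borel_measurable borel" using q(1) by (rule borel_measurable_continuous_onI)
    then show "integrable M q" using q by (intro M.integrable_const_bound[where B=1]) auto
  qed (use q q0 in auto)
  then have "AE t in M. t \<in> D" by (simp add: q)
  then have "measure M D = 1" using M.prob_eq_1[of D] Db by simp
  then show ?thesis using r conv by blast
qed

text \<open>The shifts \<open>b n\<close> vanish uniformly in the limit, and the slack
  \<open>c n\<close> turns mere positivity into the uniform positivity of the compact case. Since
  the sets \<open>X n\<close> increase, an element of \<open>X m\<close> is tested at all later
  stages and its inequality survives. In the final clause the points are isolated in
  \<open>D\<close>, because only then does the mass of a single point pass to the weak limit; if at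
  no stage both points can be positive, they cannot both carry mass.\<close>

lemma minimax_limit:
  fixes X :: "nat \<Rightarrow> (real \<Rightarrow> real) set" and b :: "nat \<Rightarrow> real \<Rightarrow> real" and c \<beta> :: "nat \<Rightarrow> real"
  assumes D: "compact D" and ne: "\<And>n. X n \<noteq> {}" and inc: "\<And>m n. m \<le> n \<Longrightarrow> X m \<subseteq> X n"
    and cvx: "\<And>n h k s. h \<in> X n \<Longrightarrow> k \<in> X n \<Longrightarrow> 0 \<le> s \<Longrightarrow> s \<le> 1 \<Longrightarrow> (\<lambda>d. (1 - s) * h d + s * k d) \<in> X n"
    and bdd: "\<And>n. \<exists>M. \<forall>h\<in>X n. \<forall>d\<in>D. \<bar>h d\<bar> \<le> M"
    and equi: "\<And>n e. e > 0 \<Longrightarrow> \<exists>\<delta>>0. \<forall>h\<in>X n. \<forall>d\<in>D. \<forall>d'\<in>D. \<bar>d - d'\<bar> < \<delta> \<longrightarrow> \<bar>h d - h d'\<bar> < e"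
    and bc: "\<And>n. continuous_on D (b n)" and b0: "\<And>n d. d \<in> D \<Longrightarrow> \<bar>b n d\<bar> \<le> \<beta> n" "\<beta> \<longlonglongrightarrow> 0"
    and c: "\<And>n. c n > 0" "c \<longlonglongrightarrow> 0"
    and pos: "\<And>n h. h \<in> X n \<Longrightarrow> \<exists>d\<in>D. h d + b n d > 0"
  shows "\<exists>\<nu>. real_distribution \<nu> \<and> measure \<nu> D = 1 \<and>
     (\<forall>n. \<forall>h\<in>X n. \<forall>k\<in>borel_measurable borel. (\<forall>d\<in>D. k d = h d) \<longrightarrow> integral\<^sup>L \<nu> k \<ge> 0) \<and>
     (\<forall>d1\<in>D. \<forall>d2\<in>D. \<forall>\<delta>>0. (\<forall>d\<in>D. \<bar>d - d1\<bar> < \<delta> \<longrightarrow> d = d1) \<and> (\<forall>d\<in>D. \<bar>d - d2\<bar> < \<delta> \<longrightarrow> d = d2) \<and>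
        (\<forall>n. \<forall>h\<in>X n. h d1 + b n d1 + c n \<le> 0 \<or> h d2 + b n d2 + c n \<le> 0) \<longrightarrow>
        measure \<nu> {d1} = 0 \<or> measure \<nu> {d2} = 0)"
proof -
  define Y where "Y n = (\<lambda>h d. h d + b n d + c n) ` X n" for n
  have "\<exists>\<nu>. real_distribution \<nu> \<and> measure \<nu> D = 1 \<and>
     (\<forall>h\<in>Y n. \<forall>k\<in>borel_measurable borel. (\<forall>d\<in>D. k d = h d) \<longrightarrow> integral\<^sup>L \<nu> k \<ge> 0) \<and>
     (\<exists>h\<in>Y n. \<forall>d\<in>D. measure \<nu> {d} > 0 \<longrightarrow> h d > 0)" for n
  proof -
    obtain M where M: "\<And>h d. h \<in> X n \<Longrightarrow> d \<in> D \<Longrightarrow> \<bar>h d\<bar> \<le> M" using bdd by blast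
    show ?thesis
    proof (rule compact_minimax[where c="c n" and M="M + \<beta> n + c n"])
      show "Y n \<noteq> {}" using ne by (simp add: Y_def)
    next
      fix h k and s :: real assume "h \<in> Y n" "k \<in> Y n" and s: "0 \<le> s" "s \<le> 1"
      then obtain h' k' where hk: "h' \<in> X n" "k' \<in> X n" "h = (\<lambda>d. h' d + b n d + c n)" "k = (\<lambda>d. k' d + b n d + c n)"
        by (auto simp: Y_def)
      have "(\<lambda>d. (1 - s) * h d + s * k d) = (\<lambda>d. ((1 - s) * h' d + s * k' d) + b n d + c n)"
        by (auto simp: hk algebra_simps)
      then show "(\<lambda>d. (1 - s) * h d + s * k d) \<in> Y n"
        unfolding Y_def by (intro image_eqI[OF _ cvx[OF hk(1,2) s]])
    next
      fix h d assume "h \<in> Y n" and d: "d \<in> D"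
      then obtain h' where h: "h' \<in> X n" "h = (\<lambda>d. h' d + b n d + c n)" by (auto simp: Y_def)
      show "\<bar>h d\<bar> \<le> M + \<beta> n + c n" using M[OF h(1) d] b0(1)[OF d, of n] c(1)[of n] by (simp add: h(2))
    next
      fix e :: real assume e: "e > 0"
      obtain \<delta> where \<delta>: "\<delta> > 0" "\<And>h d d'. h\<in>X n \<Longrightarrow> d\<in>D \<Longrightarrow> d'\<in>D \<Longrightarrow> \<bar>d - d'\<bar> < \<delta> \<Longrightarrow> \<bar>h d - h d'\<bar> < e/2"
        using equi[of "e/2" n] e by auto
      have "uniformly_continuous_on D (b n)" by (rule compact_uniformly_continuous[OF bc D])
      then obtain \<delta>' where \<delta>': "\<delta>' > 0" "\<And>d d'. d\<in>D \<Longrightarrow> d'\<in>D \<Longrightarrow> \<bar>d - d'\<bar> < \<delta>' \<Longrightarrow> \<bar>b n d - b n d'\<bar> < e/2"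
        unfolding uniformly_continuous_on_def dist_real_def using e by (metis half_gt_zero)
      have "\<bar>h d - h d'\<bar> < e" if h: "h \<in> Y n" and d: "d \<in> D" "d' \<in> D" "\<bar>d - d'\<bar> < min \<delta> \<delta>'" for h d d'
      proof -
        obtain h' where h': "h' \<in> X n" "h = (\<lambda>d. h' d + b n d + c n)" using h by (auto simp: Y_def)
        show ?thesis using \<delta>(2)[OF h'(1) d(1,2)] \<delta>'(2)[OF d(1,2)] d(3) unfolding h'(2) by linarith
      qed
      then show "\<exists>\<delta>>0. \<forall>h\<in>Y n. \<forall>d\<in>D. \<forall>d'\<in>D. \<bar>d - d'\<bar> < \<delta> \<longrightarrow> \<bar>h d - h d'\<bar> < e"
        using \<delta>(1) \<delta>'(1) by (intro exI[of _ "min \<delta> \<delta>'"]) auto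
    next
      fix h assume "h \<in> Y n"
      then obtain h' where h: "h' \<in> X n" "h = (\<lambda>d. h' d + b n d + c n)" by (auto simp: Y_def)
      from pos[OF h(1)] obtain d where "d \<in> D" "h' d + b n d > 0" by blast
      then show "\<exists>d\<in>D. c n \<le> h d" unfolding h(2) by (intro bexI[of _ d]) auto
    qed (use D c in auto)
  qed
  then obtain \<nu> where \<nu>: "\<And>n. real_distribution (\<nu> n)" "\<And>n. measure (\<nu> n) D = 1"
     and \<nu>I: "\<And>n h k. h\<in>Y n \<Longrightarrow> k\<in>borel_measurable borel \<Longrightarrow> (\<forall>d\<in>D. k d = h d) \<Longrightarrow> integral\<^sup>L (\<nu> n) k \<ge> 0"
     and \<nu>P: "\<And>n. \<exists>h\<in>Y n. \<forall>d\<in>D. measure (\<nu> n) {d} > 0 \<longrightarrow> h d > 0"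
    by metis
  obtain r M where r: "strict_mono (r::nat\<Rightarrow>nat)" and M: "real_distribution M" "measure M D = 1" and
    lim: "\<And>h :: real \<Rightarrow> real. continuous_on UNIV h \<Longrightarrow> \<exists>B. \<forall>t. \<bar>h t\<bar> \<le> B \<Longrightarrow> (\<lambda>n. integral\<^sup>L (\<nu> (r n)) h) \<longlonglongrightarrow> integral\<^sup>L M h"
    using weak_limit_on_compact[of D \<nu>, OF D \<nu>] by blast
  interpret \<nu>: real_distribution "\<nu> n" for n by (rule \<nu>)
  interpret M: real_distribution M by (rule M)
  have Db: "D \<in> sets borel" using D by (simp add: compact_imp_closed)
  have AEn: "AE t in \<nu> n. t \<in> D" for n
    using \<nu>.prob_eq_1[of D n] \<nu>(2) Db by simp
  have AEM: "AE t in M. t \<in> D" using M.prob_eq_1[of D] M(2) Db by simp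
  \<comment> \<open>Weak convergence tests bounded continuous functions on the whole line, so
    functions on \<open>D\<close> are extended by Tietze's theorem.\<close>
  have ext: "\<exists>g. continuous_on UNIV g \<and> (\<exists>B. \<forall>t. \<bar>g t\<bar> \<le> B) \<and> (\<forall>d\<in>D. g d = f d)"
    if f: "continuous_on D f" for f :: "real \<Rightarrow> real"
  proof -
    obtain B where B: "B > 0" "\<And>d. d \<in> D \<Longrightarrow> norm (f d) \<le> B"
      using compact_imp_bounded[OF compact_continuous_image[OF f D]] bounded_pos[of "f ` D"] by auto
    obtain g where "continuous_on UNIV g" "\<And>d. d \<in> D \<Longrightarrow> g d = f d" "\<And>t. t \<in> UNIV \<Longrightarrow> norm (g t) \<le> B"
    proof (rule Tietze[OF f, of UNIV B])
      show "closedin (top_of_set UNIV) D" using D by (simp add: compact_imp_closed)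
    qed (use B in auto)
    then show ?thesis by (intro exI[of _ g]) auto
  qed
  have int: "integrable (\<nu> n) g" if "continuous_on UNIV g" "\<forall>t. \<bar>g t\<bar> \<le> B" for g :: "real \<Rightarrow> real" and n B
    using that borel_measurable_continuous_onI[of g] by (intro \<nu>.integrable_const_bound[where B=B]) auto
  have I: "integral\<^sup>L M k \<ge> 0" if h: "h \<in> X m" and k: "k \<in> borel_measurable borel" and kh: "\<forall>d\<in>D. k d = h d" for m h k
  proof -
    have hc: "continuous_on D h"
      unfolding continuous_on_iff dist_real_def using equi[of _ m] h by (metis abs_minus_commute)
    obtain g where g: "continuous_on UNIV g" "\<exists>B. \<forall>t. \<bar>g t\<bar> \<le> B" "\<And>d. d\<in>D \<Longrightarrow> g d = h d" using ext[OF hc] by blast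
    then obtain B where B: "\<forall>t. \<bar>g t\<bar> \<le> B" by blast
    have low: "integral\<^sup>L (\<nu> n) g \<ge> - \<beta> n - c n" if "m \<le> n" for n
    proof -
      obtain a where a: "continuous_on UNIV a" "\<exists>B. \<forall>t. \<bar>a t\<bar> \<le> B" "\<And>d. d\<in>D \<Longrightarrow> a d = b n d" using ext[OF bc] by blast
      then obtain B' where B': "\<forall>t. \<bar>a t\<bar> \<le> B'" by blast
      have "(\<lambda>d. h d + b n d + c n) \<in> Y n" unfolding Y_def using h inc[OF that] by blast
      then have "0 \<le> (\<integral>t. g t + a t + c n \<partial>\<nu> n)"
      proof (rule \<nu>I)
        show "(\<lambda>t. g t + a t + c n) \<in> borel_measurable borel"
          by (intro borel_measurable_continuous_onI continuous_intros g(1) a(1))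
      qed (use g a in auto)
      also have "\<dots> = integral\<^sup>L (\<nu> n) g + integral\<^sup>L (\<nu> n) a + c n"
        using int[OF g(1) B] int[OF a(1) B'] \<nu>.prob_space by simp
      also have "integral\<^sup>L (\<nu> n) a \<le> (\<integral>t. \<beta> n \<partial>\<nu> n)"
      proof (rule integral_mono_AE)
        show "AE t in \<nu> n. a t \<le> \<beta> n" using AEn[of n]
        proof eventually_elim
          case (elim t) then show ?case using a(3)[of t] b0(1)[of t n] by auto
        qed
      qed (use int[OF a(1) B'] in auto)
      finally show ?thesis using \<nu>.prob_space by simp
    qed
    have "integral\<^sup>L M g \<ge> 0"
    proof (rule LIMSEQ_le[OF _ lim[OF g(1,2)]])
      have "(\<lambda>n. - \<beta> n - c n) \<longlonglongrightarrow> - 0 - 0" by (intro tendsto_intros b0 c)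
      from LIMSEQ_subseq_LIMSEQ[OF this r] show "(\<lambda>n. - \<beta> (r n) - c (r n)) \<longlonglongrightarrow> 0" by (simp add: o_def)
      show "\<exists>N. \<forall>n\<ge>N. - \<beta> (r n) - c (r n) \<le> integral\<^sup>L (\<nu> (r n)) g"
        using low seq_suble[OF r] by (meson le_trans)
    qed
    also have "integral\<^sup>L M g = integral\<^sup>L M k"
    proof (rule integral_cong_AE)
      show "AE t in M. g t = k t" using AEM by eventually_elim (use g kh in auto)
    qed (use k borel_measurable_continuous_onI[OF g(1)] in auto)
    finally show ?thesis .
  qed
  have P: "measure M {d1} = 0 \<or> measure M {d2} = 0"
    if d: "d1 \<in> D" "d2 \<in> D" and \<delta>: "\<delta> > 0" "\<forall>d\<in>D. \<bar>d - d1\<bar> < \<delta> \<longrightarrow> d = d1" "\<forall>d\<in>D. \<bar>d - d2\<bar> < \<delta> \<longrightarrow> d = d2"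
      and ex: "\<forall>n. \<forall>h\<in>X n. h d1 + b n d1 + c n \<le> 0 \<or> h d2 + b n d2 + c n \<le> 0" for d1 d2 \<delta>
  proof -
    have conv: "(\<lambda>n. measure (\<nu> (r n)) {e}) \<longlonglongrightarrow> measure M {e}" if e: "\<forall>d\<in>D. \<bar>d - e\<bar> < \<delta> \<longrightarrow> d = e" for e
    proof -
      \<comment> \<open>A tent of width \<open>\<delta>\<close>: on \<open>D\<close> it coincides
        with the indicator of the isolated point \<open>e\<close>, and it is continuous.\<close>
      define w where "w t = max 0 (1 - \<bar>t - e\<bar> / \<delta>)" for t
      have w: "continuous_on UNIV w" unfolding w_def using \<delta>(1) by (intro continuous_intros) auto
      have wb: "\<forall>t. \<bar>w t\<bar> \<le> 1" unfolding w_def using \<delta>(1) by auto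
      have wi: "w t = indicat_real {e} t" if "t \<in> D" for t
        using e that \<delta>(1) by (cases "t = e") (auto simp: w_def max_def field_simps)
      have wm: "w \<in> borel_measurable borel" using w by (rule borel_measurable_continuous_onI)
      have "measure (\<nu> n) {e} = integral\<^sup>L (\<nu> n) w" for n
      proof -
        have "integral\<^sup>L (\<nu> n) w = integral\<^sup>L (\<nu> n) (indicat_real {e})"
        proof (rule integral_cong_AE)
          show "AE t in \<nu> n. w t = indicat_real {e} t" using AEn[of n] by eventually_elim (rule wi)
        qed (use wm in auto)
        then show ?thesis by simp
      qed
      moreover have "measure M {e} = integral\<^sup>L M w"
      proof -
        have "integral\<^sup>L M w = integral\<^sup>L M (indicat_real {e})"
        proof (rule integral_cong_AE)
          show "AE t in M. w t = indicat_real {e} t" using AEM by eventually_elim (rule wi)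
        qed (use wm in auto)
        then show ?thesis by simp
      qed
      ultimately show ?thesis using lim[OF w] wb by auto
    qed
    have "measure (\<nu> n) {d1} * measure (\<nu> n) {d2} = 0" for n
    proof -
      obtain h where h: "h \<in> X n" "\<forall>d\<in>D. measure (\<nu> n) {d} > 0 \<longrightarrow> h d + b n d + c n > 0"
        using \<nu>P[of n] by (auto simp: Y_def)
      then have "\<not> measure (\<nu> n) {d1} > 0 \<or> \<not> measure (\<nu> n) {d2} > 0" using ex d by (meson not_less)
      then show ?thesis by (metis measure_nonneg less_eq_real_def mult_zero_left mult_zero_right)
    qed
    moreover have "(\<lambda>n. measure (\<nu> (r n)) {d1} * measure (\<nu> (r n)) {d2}) \<longlonglongrightarrow> measure M {d1} * measure M {d2}"
      by (intro tendsto_mult conv \<delta>)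
    ultimately have "(\<lambda>n. 0) \<longlonglongrightarrow> measure M {d1} * measure M {d2}" by (simp only:)
    then have "measure M {d1} * measure M {d2} = 0" by (simp add: LIMSEQ_const_iff)
    then show ?thesis by simp
  qed
  show ?thesis
    by (rule exI[of _ M]) (use M I P in blast)
qed

section \<open>Integral equations\<close>

text \<open>Boundedness is required at every point of the line and not just almost everywhere on
  [0,T]. Integrals over all bounded intervals then exist without side conditions, and composition
  with continuous maps preserves the class.\<close>

definition bdd_meas :: "(real \<Rightarrow> 'a::euclidean_space) \<Rightarrow> bool" where
  "bdd_meas f \<longleftrightarrow> f \<in> borel_measurable lebesgue \<and> (\<exists>K. \<forall>t. norm (f t) \<le> K)"

abbreviation IL :: "real \<Rightarrow> real \<Rightarrow> (real \<Rightarrow> 'a::euclidean_space) \<Rightarrow> 'a" where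
  "IL a b f \<equiv> integral\<^sup>L (lebesgue_on {a..b}) f"

lemma bdd_measD: "bdd_meas f \<Longrightarrow> f \<in> borel_measurable lebesgue"
  by (simp add: bdd_meas_def)

lemma bdd_meas_on: "bdd_meas f \<Longrightarrow> f \<in> borel_measurable (lebesgue_on S)"
  by (simp add: bdd_meas_def measurable_restrict_space1)

lemma bdd_meas_integrable_on:
  assumes "bdd_meas f" "S \<in> lmeasurable"
  shows "integrable (lebesgue_on S) f"
proof -
  obtain K where K: "\<And>t. norm (f t) \<le> K" using assms(1) by (auto simp: bdd_meas_def)
  interpret finite_measure "lebesgue_on S"
    using assms(2) by (rule finite_measure_lebesgue_on)
  show ?thesis by (rule integrable_const_bound[where B=K]) (use K bdd_meas_on[OF assms(1)] in auto)
qed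

lemma bdd_meas_integrable: "bdd_meas f \<Longrightarrow> integrable (lebesgue_on {a..b}) f"
  by (rule bdd_meas_integrable_on) auto

lemma IL_eq_integral: "bdd_meas f \<Longrightarrow> IL a b f = integral {a..b} f"
  by (intro lebesgue_integral_eq_integral bdd_meas_integrable) auto

lemma bdd_meas_integrable_HK: "bdd_meas f \<Longrightarrow> f integrable_on {a..b}"
  by (intro integrable_on_lebesgue_on bdd_meas_integrable) auto

lemma bdd_meas_compose:
  fixes f :: "real \<Rightarrow> 'a::euclidean_space" and h :: "'a \<Rightarrow> 'b::euclidean_space"
  assumes f: "bdd_meas f" and h: "continuous_on UNIV h"
  shows "bdd_meas (\<lambda>t. h (f t))"
proof -
  obtain K where K: "\<And>t. norm (f t) \<le> K" using f by (auto simp: bdd_meas_def)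
  have "compact (h ` cball 0 K)" by (intro compact_continuous_image continuous_on_subset[OF h]) auto
  then obtain M where M: "\<And>y. y \<in> h ` cball 0 K \<Longrightarrow> norm y \<le> M"
    using compact_imp_bounded bounded_iff by metis
  have "norm (h (f t)) \<le> M" for t by (rule M) (use K[of t] in auto)
  moreover have "(\<lambda>t. h (f t)) \<in> borel_measurable lebesgue"
    using measurable_compose[OF bdd_measD[OF f] borel_measurable_continuous_onI[OF h]] .
  ultimately show ?thesis by (auto simp: bdd_meas_def)
qed

lemma bdd_meas_Pair: "bdd_meas f \<Longrightarrow> bdd_meas g \<Longrightarrow> bdd_meas (\<lambda>t. (f t, g t))"
  unfolding bdd_meas_def
proof (elim conjE exE, intro conjI)
  fix K K' assume "\<forall>t. norm (f t) \<le> K" "\<forall>t. norm (g t) \<le> K'"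
  then show "\<exists>K. \<forall>t. norm (f t, g t) \<le> K"
    by (intro exI[of _ "K + K'"]) (meson add_mono norm_Pair_le order_trans)
qed (rule borel_measurable_Pair)

lemma bdd_meas_compose2:
  fixes f :: "real \<Rightarrow> 'a::euclidean_space" and g :: "real \<Rightarrow> 'b::euclidean_space" and h :: "'a \<Rightarrow> 'b \<Rightarrow> 'c::euclidean_space"
  assumes "bdd_meas f" "bdd_meas g" "continuous_on UNIV (\<lambda>p. h (fst p) (snd p))"
  shows "bdd_meas (\<lambda>t. h (f t) (g t))"
  using bdd_meas_compose[OF bdd_meas_Pair[OF assms(1,2)] assms(3)] by simp

lemma bdd_meas_cont: "continuous_on UNIV f \<Longrightarrow> bounded (range f) \<Longrightarrow> bdd_meas f"
proof -
  assume f: "continuous_on UNIV f" "bounded (range f)"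
  have "f \<in> borel_measurable lborel" using borel_measurable_continuous_onI[OF f(1)] by simp
  then have "f \<in> borel_measurable lebesgue" by (rule measurable_completion)
  then show "bdd_meas f" using f(2) by (auto simp: bdd_meas_def bounded_iff)
qed

lemma bdd_meas_add: "bdd_meas f \<Longrightarrow> bdd_meas g \<Longrightarrow> bdd_meas (\<lambda>t. f t + g t)"
  by (rule bdd_meas_compose2) (auto intro!: continuous_intros)

lemma bdd_meas_diff: "bdd_meas f \<Longrightarrow> bdd_meas g \<Longrightarrow> bdd_meas (\<lambda>t. f t - g t)"
  by (rule bdd_meas_compose2) (auto intro!: continuous_intros)

lemma bdd_meas_scaleR: "bdd_meas f \<Longrightarrow> bdd_meas g \<Longrightarrow> bdd_meas (\<lambda>t. f t *\<^sub>R g t)"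
  by (rule bdd_meas_compose2) (auto intro!: continuous_intros)

lemma bdd_meas_mult: "bdd_meas f \<Longrightarrow> bdd_meas g \<Longrightarrow> bdd_meas (\<lambda>t. f t * g t :: real)"
  by (rule bdd_meas_compose2) (auto intro!: continuous_intros)

lemma bdd_meas_inner: "bdd_meas f \<Longrightarrow> bdd_meas g \<Longrightarrow> bdd_meas (\<lambda>t. f t \<bullet> g t)"
  by (rule bdd_meas_compose2) (auto intro!: continuous_intros)

lemma bdd_meas_norm: "bdd_meas f \<Longrightarrow> bdd_meas (\<lambda>t. norm (f t))"
  by (rule bdd_meas_compose) (auto intro!: continuous_intros)

lemma bdd_meas_const: "bdd_meas (\<lambda>t. c)"
  by (auto simp: bdd_meas_def)

lemma bdd_meas_sum: "(\<And>i. i \<in> I \<Longrightarrow> bdd_meas (f i)) \<Longrightarrow> bdd_meas (\<lambda>t. \<Sum>i\<in>I. f i t)"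
  by (induction I rule: infinite_finite_induct) (auto intro: bdd_meas_add bdd_meas_const)

lemma IL_cong: "(\<And>t. t \<in> {a..b} \<Longrightarrow> f t = g t) \<Longrightarrow> IL a b f = IL a b g"
  by (intro Bochner_Integration.integral_cong) auto

lemma IL_cong_AE:
  assumes "AE t in lebesgue_on {0..T}. f t = g t" "f \<in> borel_measurable (lebesgue_on {a..b})"
     "g \<in> borel_measurable (lebesgue_on {a..b})" "{a..b} \<subseteq> {0..T}"
  shows "IL a b f = IL a b g"
proof (rule integral_cong_AE)
  have "AE t in lebesgue. t \<in> {0..T} \<longrightarrow> f t = g t" using assms(1) by (simp add: AE_restrict_space_iff)
  then show "AE t in lebesgue_on {a..b}. f t = g t"
    using assms(4) by (auto simp: AE_restrict_space_iff elim!: eventually_mono)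
qed (use assms in auto)

lemma IL_add: "bdd_meas f \<Longrightarrow> bdd_meas g \<Longrightarrow> IL a b (\<lambda>t. f t + g t) = IL a b f + IL a b g"
  by (intro Bochner_Integration.integral_add bdd_meas_integrable)

lemma IL_diff: "bdd_meas f \<Longrightarrow> bdd_meas g \<Longrightarrow> IL a b (\<lambda>t. f t - g t) = IL a b f - IL a b g"
  by (intro Bochner_Integration.integral_diff bdd_meas_integrable)

lemma IL_inner: "bdd_meas f \<Longrightarrow> IL a b (\<lambda>t. c \<bullet> f t) = c \<bullet> IL a b f"
  by (intro integral_inner_right bdd_meas_integrable)

lemma IL_combine: "bdd_meas f \<Longrightarrow> a \<le> b \<Longrightarrow> b \<le> c \<Longrightarrow> IL a c f = IL a b f + IL b c f"
  by (simp add: IL_eq_integral Henstock_Kurzweil_Integration.integral_combine bdd_meas_integrable_HK)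

lemma IL_const: "a \<le> b \<Longrightarrow> IL a b (\<lambda>t. c) = (b - a) *\<^sub>R c"
  by (subst IL_eq_integral) (auto simp: bdd_meas_const)

lemma IL_mono:
  assumes "bdd_meas f" "bdd_meas (g :: real \<Rightarrow> real)" "AE t in lebesgue_on {a..b}. f t \<le> g t"
  shows "IL a b f \<le> IL a b g"
  using assms by (intro integral_mono_AE bdd_meas_integrable)

lemma IL_norm_le:
  assumes f: "bdd_meas f" and g: "bdd_meas g" "AE t in lebesgue_on {a..b}. norm (f t) \<le> g t"
  shows "norm (IL a b f) \<le> IL a b g"
proof -
  have "norm (IL a b f) \<le> IL a b (\<lambda>t. norm (f t))" by (rule integral_norm_bound)
  also have "\<dots> \<le> IL a b g" by (intro IL_mono bdd_meas_norm assms)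
  finally show ?thesis .
qed

lemma IL_norm_bound:
  assumes f: "bdd_meas f" and g: "AE t in lebesgue_on {a..b}. norm (f t) \<le> K" and ab: "a \<le> b"
  shows "norm (IL a b f) \<le> K * (b - a)"
  using IL_norm_le[OF f bdd_meas_const g] ab unfolding IL_const[OF ab] by (simp add: mult.commute)

lemma IL_increment:
  assumes f: "bdd_meas f" and st: "0 \<le> s" "s \<le> t"
  shows "IL 0 t f - IL 0 s f = IL s t f"
  using IL_combine[OF f st] by simp

lemma IL_Lipschitz:
  assumes f: "bdd_meas f" and K: "\<And>t. norm (f t) \<le> K" and st: "0 \<le> s" "0 \<le> t"
  shows "norm (IL 0 t f - IL 0 s f) \<le> K * \<bar>t - s\<bar>"
proof -
  have *: "norm (IL 0 t f - IL 0 s f) \<le> K * \<bar>t - s\<bar>" if "0 \<le> s" "s \<le> t" for s t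
    unfolding IL_increment[OF f that] using IL_norm_bound[OF f _ that(2), of K] K that by simp
  show ?thesis using *[of s t] *[of t s] st by (cases "s \<le> t") (auto simp: norm_minus_commute abs_minus_commute)
qed

lemma IL_continuous: "bdd_meas f \<Longrightarrow> continuous_on {0..T} (\<lambda>t. IL 0 t f)"
proof -
  assume f: "bdd_meas f"
  have "continuous_on {0..T} (\<lambda>t. integral {0..t} f)"
    by (intro indefinite_integral_continuous_1 bdd_meas_integrable_HK f)
  then show ?thesis by (simp add: IL_eq_integral[OF f])
qed

lemma IL_continuous_backward: "bdd_meas f \<Longrightarrow> continuous_on {0..T} (\<lambda>t. IL t T f)"
proof -
  assume f: "bdd_meas f"
  have "continuous_on {0..T} (\<lambda>t. IL 0 T f - IL 0 t f)"
    by (intro continuous_intros IL_continuous f)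
  then show ?thesis
  proof (rule continuous_on_eq)
    fix t assume "t \<in> {0..T}"
    then show "IL 0 T f - IL 0 t f = IL t T f" using IL_combine[OF f, of 0 t T] by simp
  qed
qed

section \<open>Volterra equations: existence and stability\<close>

text \<open>Precomposition with this projection onto the interval extends a function continuous on
  [0,T] to a bounded continuous function on the line, without changing it on [0,T].\<close>

definition clamp_to :: "real \<Rightarrow> real \<Rightarrow> real" where
  "clamp_to T t = max 0 (min T t)"

lemma clamp_to_simps [simp]: "0 \<le> t \<Longrightarrow> t \<le> T \<Longrightarrow> clamp_to T t = t"
  by (simp add: clamp_to_def)

lemma clamp_to_in: "0 \<le> T \<Longrightarrow> clamp_to T t \<in> {0..T}"
  by (simp add: clamp_to_def)

lemma clamp_compose:
  fixes f :: "real \<Rightarrow> 'a::euclidean_space"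
  assumes "continuous_on {0..T} f" "0 \<le> T"
  shows "continuous_on UNIV (\<lambda>t. f (clamp_to T t))" "bounded (range (\<lambda>t. f (clamp_to T t)))"
proof -
  show "continuous_on UNIV (\<lambda>t. f (clamp_to T t))"
    by (rule continuous_on_compose2[OF assms(1)]) (use assms(2) in \<open>auto simp: clamp_to_def intro!: continuous_intros\<close>)
  have "bounded (f ` {0..T})" using assms(1) by (intro compact_imp_bounded compact_continuous_image) auto
  then show "bounded (range (\<lambda>t. f (clamp_to T t)))"
    by (rule bounded_subset) (use clamp_to_in[OF assms(2)] in auto)
qed

lemma bdd_meas_clamp: "continuous_on {0..T} f \<Longrightarrow> 0 \<le> T \<Longrightarrow> bdd_meas (\<lambda>t. f (clamp_to T t))"
  using clamp_compose by (intro bdd_meas_cont) auto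

text \<open>Banach's fixed point theorem in the norm weighted by \<open>\<omega>\<close>. The set \<open>J t\<close> is \<open>[0,t]\<close> for
  initial value problems and \<open>[t,T]\<close> for the costate, whose equation runs backwards.\<close>

lemma Picard:
  fixes F :: "real \<Rightarrow> 'a::euclidean_space \<Rightarrow> 'a" and J :: "real \<Rightarrow> real set" and \<omega> :: "real \<Rightarrow> real"
  assumes T: "0 \<le> T" and J: "\<And>t. t \<in> {0..T} \<Longrightarrow> J t \<subseteq> {0..T} \<and> J t \<in> sets lebesgue"
    and Jc: "\<And>f :: real \<Rightarrow> 'a. bdd_meas f \<Longrightarrow> continuous_on {0..T} (\<lambda>t. integral\<^sup>L (lebesgue_on (J t)) f)"
    and \<omega>: "continuous_on {0..T} \<omega>" "\<And>t. t \<in> {0..T} \<Longrightarrow> \<omega> t > 0"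
      "\<And>t. t \<in> {0..T} \<Longrightarrow> L * integral\<^sup>L (lebesgue_on (J t)) \<omega> \<le> \<omega> t / 2"
    and Fm: "\<And>y. bdd_meas y \<Longrightarrow> bdd_meas (\<lambda>s. F s (y s))"
    and FL: "\<And>s y y'. s \<in> {0..T} \<Longrightarrow> norm (F s y - F s y') \<le> L * norm (y - y')"
    and L: "L \<ge> 0"
    and c: "continuous_on {0..T} c"
  shows "\<exists>y. continuous_on UNIV y \<and> bounded (range y) \<and> (\<forall>t\<in>{0..T}. y t = c t + integral\<^sup>L (lebesgue_on (J t)) (\<lambda>s. F s (y s)))"
proof -
  define cl where "cl = clamp_to T"
  have cl: "cl t \<in> {0..T}" for t using clamp_to_in[OF T] by (simp add: cl_def)
  have cli: "cl t = t" if "t \<in> {0..T}" for t using that by (simp add: cl_def)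
  have \<omega>c: "continuous_on UNIV (\<lambda>t. \<omega> (cl t))" "bounded (range (\<lambda>t. \<omega> (cl t)))"
    using clamp_compose[OF \<omega>(1) T] by (auto simp: cl_def)
  have \<omega>p: "\<omega> (cl t) > 0" for t using \<omega>(2) cl by blast
  \<comment> \<open>The fixed point is sought for the quotient of the unknown by
    \<open>\<omega>\<close>; \<open>Y\<close> multiplies the weight back. The supremum norm of the
    quotient is the weighted norm.\<close>
  define Y where "Y b = (\<lambda>s. \<omega> (cl s) *\<^sub>R apply_bcontfun b s)" for b :: "real \<Rightarrow>\<^sub>C 'a"
  have Yc: "continuous_on UNIV (Y b)" "bounded (range (Y b))" for b
  proof -
    show "continuous_on UNIV (Y b)" unfolding Y_def by (intro continuous_intros \<omega>c) auto
    obtain K where K: "\<And>t. norm (\<omega> (cl t)) \<le> K" using \<omega>c(2) by (auto simp: bounded_iff)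
    have "norm (Y b t) \<le> K * norm b" for t
      unfolding Y_def using K[of t] norm_bounded[of b t] by (simp add: mult_mono order_trans[OF abs_ge_zero])
    then show "bounded (range (Y b))" by (auto simp: bounded_iff)
  qed
  have Ym: "bdd_meas (Y b)" for b using Yc by (rule bdd_meas_cont)
  define G where "G b t = (1 / \<omega> t) *\<^sub>R (c t + integral\<^sup>L (lebesgue_on (J t)) (\<lambda>s. F s (Y b s)))" for b t
  have Gc: "continuous_on {0..T} (G b)" for b
    unfolding G_def using \<omega>(2) by (intro continuous_intros \<omega> c Jc Fm Ym ballI) (metis less_irrefl)
  define Op where "Op b = Bcontfun (\<lambda>t. G b (cl t))" for b
  have Opa: "apply_bcontfun (Op b) = (\<lambda>t. G b (cl t))" for b
    unfolding Op_def using clamp_compose[OF Gc T, of b]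
    by (intro Bcontfun_inverse) (auto simp: bcontfun_def cl_def)
  have contr: "dist (Op b) (Op b') \<le> 1/2 * dist b b'" for b b'
  proof (rule dist_bound)
    fix t
    define s where "s = cl t"
    have s: "s \<in> {0..T}" unfolding s_def by (rule cl)
    have Jm: "J s \<in> lmeasurable"
      by (rule fmeasurableI2[OF _ conjunct1[OF J[OF s]] conjunct2[OF J[OF s]]]) simp
    have int: "integrable (lebesgue_on (J s)) (\<lambda>s. F s (Y b s))" for b
      by (intro bdd_meas_integrable_on Fm Ym Jm)
    have \<omega>i: "integrable (lebesgue_on (J s)) \<omega>"
    proof -
      have "integrable (lebesgue_on (J s)) (\<lambda>s. \<omega> (cl s))" by (intro bdd_meas_integrable_on bdd_meas_cont \<omega>c Jm)
      moreover have "integrable (lebesgue_on (J s)) \<omega> \<longleftrightarrow> integrable (lebesgue_on (J s)) (\<lambda>s. \<omega> (cl s))"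
      proof (rule Bochner_Integration.integrable_cong[OF refl])
        fix r assume "r \<in> space (lebesgue_on (J s))"
        then have "r \<in> {0..T}" using J[OF s] by auto
        then show "\<omega> r = \<omega> (cl r)" using cli by simp
      qed
      ultimately show ?thesis by simp
    qed
    have "norm (integral\<^sup>L (lebesgue_on (J s)) (\<lambda>s. F s (Y b s)) - integral\<^sup>L (lebesgue_on (J s)) (\<lambda>s. F s (Y b' s)))
       = norm (integral\<^sup>L (lebesgue_on (J s)) (\<lambda>s. F s (Y b s) - F s (Y b' s)))"
      by (simp add: int)
    also have "\<dots> \<le> integral\<^sup>L (lebesgue_on (J s)) (\<lambda>s. norm (F s (Y b s) - F s (Y b' s)))"
      by (rule integral_norm_bound)
    also have "\<dots> \<le> integral\<^sup>L (lebesgue_on (J s)) (\<lambda>s. L * (\<omega> s * dist b b'))"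
    proof (rule integral_mono)
      fix r assume "r \<in> space (lebesgue_on (J s))"
      then have r: "r \<in> {0..T}" using J[OF s] by auto
      have "norm (F r (Y b r) - F r (Y b' r)) \<le> L * norm (Y b r - Y b' r)" by (rule FL[OF r])
      also have "norm (Y b r - Y b' r) = \<omega> r * dist (apply_bcontfun b r) (apply_bcontfun b' r)"
        using \<omega>(2)[OF r] by (simp add: Y_def cli[OF r] dist_norm flip: scaleR_diff_right)
      also have "\<dots> \<le> \<omega> r * dist b b'" using \<omega>(2)[OF r] by (intro mult_left_mono dist_bounded) auto
      finally show "norm (F r (Y b r) - F r (Y b' r)) \<le> L * (\<omega> r * dist b b')" using L by (simp add: mult_left_mono)
    qed (use int \<omega>i in auto)
    also have "\<dots> = L * integral\<^sup>L (lebesgue_on (J s)) \<omega> * dist b b'" by simp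
    also have "\<dots> \<le> \<omega> s / 2 * dist b b'" by (intro mult_right_mono \<omega> s) auto
    finally have *: "norm (integral\<^sup>L (lebesgue_on (J s)) (\<lambda>s. F s (Y b s)) - integral\<^sup>L (lebesgue_on (J s)) (\<lambda>s. F s (Y b' s)))
       \<le> \<omega> s / 2 * dist b b'" .
    have "dist (G b s) (G b' s) = (1 / \<omega> s) * norm (integral\<^sup>L (lebesgue_on (J s)) (\<lambda>s. F s (Y b s)) - integral\<^sup>L (lebesgue_on (J s)) (\<lambda>s. F s (Y b' s)))"
      using \<omega>(2)[OF s] by (simp add: G_def dist_norm flip: scaleR_diff_right)
    also have "\<dots> \<le> (1 / \<omega> s) * (\<omega> s / 2 * dist b b')" using * \<omega>(2)[OF s] by (intro mult_left_mono) auto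
    finally show "dist (apply_bcontfun (Op b) t) (apply_bcontfun (Op b') t) \<le> 1/2 * dist b b'"
      using \<omega>(2)[OF s] by (simp add: Opa s_def)
  qed
  obtain b where b: "Op b = b" using banach_fix_type[of "1/2" Op] contr by auto
  have "Y b t = c t + integral\<^sup>L (lebesgue_on (J t)) (\<lambda>s. F s (Y b s))" if t: "t \<in> {0..T}" for t
  proof -
    have "apply_bcontfun b t = G b t" using Opa[of b] b cli[OF t] by metis
    then show ?thesis using \<omega>(2)[OF t] by (simp add: Y_def cli[OF t] G_def)
  qed
  then show ?thesis using Yc[of b] by blast
qed

text \<open>With the weight exp(2Ls) integration followed by the factor L has norm at most 1/2,
  however long the interval is. Existence on all of [0,T] follows in one application of the
  contraction principle.\<close>

lemma IL_exp_forward: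
  assumes "L > 0" "0 \<le> t"
  shows "L * IL 0 t (\<lambda>s. exp (2 * L * s)) \<le> exp (2 * L * t) / 2"
proof -
  have "((\<lambda>s. exp (2 * L * s)) has_integral (exp (2 * L * t) / (2*L) - exp (2 * L * 0) / (2*L))) {0..t}"
    using assms by (intro fundamental_theorem_of_calculus)
      (auto intro!: derivative_eq_intros simp: has_real_derivative_iff_has_vector_derivative[symmetric])
  then have "integral {0..t} (\<lambda>s. exp (2 * L * s)) = exp (2 * L * t) / (2*L) - 1 / (2*L)" by (simp add: integral_unique)
  moreover have "integrable (lebesgue_on {0..t}) (\<lambda>s. exp (2 * L * s))"
    by (intro continuous_imp_integrable_real continuous_intros)
  ultimately have "IL 0 t (\<lambda>s. exp (2 * L * s)) = exp (2 * L * t) / (2*L) - 1 / (2*L)"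
    by (simp add: lebesgue_integral_eq_integral)
  then show ?thesis using assms by (simp add: field_simps)
qed

lemma IL_exp_backward:
  assumes "L > 0" "t \<le> T"
  shows "L * IL t T (\<lambda>s. exp (- 2 * L * s)) \<le> exp (- 2 * L * t) / 2"
proof -
  have "((\<lambda>s. exp (- 2 * L * s)) has_integral (- exp (- 2 * L * T) / (2*L) - (- exp (- 2 * L * t) / (2*L)))) {t..T}"
    using assms by (intro fundamental_theorem_of_calculus)
      (auto intro!: derivative_eq_intros simp: has_real_derivative_iff_has_vector_derivative[symmetric])
  then have "integral {t..T} (\<lambda>s. exp (- 2 * L * s)) = - exp (- 2 * L * T) / (2*L) + exp (- 2 * L * t) / (2*L)" by (simp add: integral_unique)
  moreover have "integrable (lebesgue_on {t..T}) (\<lambda>s. exp (- 2 * L * s))"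
    by (intro continuous_imp_integrable_real continuous_intros)
  ultimately have *: "IL t T (\<lambda>s. exp (- 2 * L * s)) = - exp (- 2 * L * T) / (2*L) + exp (- 2 * L * t) / (2*L)"
    by (simp add: lebesgue_integral_eq_integral)
  have "L * IL t T (\<lambda>s. exp (- 2 * L * s)) = - exp (- 2 * L * T) / 2 + exp (- 2 * L * t) / 2"
  proof -
    have "L * (- a / (2 * L) + b / (2 * L)) = - a / 2 + b / 2" for a b using assms by (simp add: field_simps)
    then show ?thesis using * by (simp only:)
  qed
  then show ?thesis by simp
qed

lemma ode_exists:
  fixes F :: "real \<Rightarrow> 'a::euclidean_space \<Rightarrow> 'a"
  assumes T: "0 \<le> T"
    and Fm: "\<And>y. bdd_meas y \<Longrightarrow> bdd_meas (\<lambda>s. F s (y s))"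
    and FL: "\<And>s y y'. s \<in> {0..T} \<Longrightarrow> norm (F s y - F s y') \<le> L * norm (y - y')"
  shows "\<exists>y. continuous_on UNIV y \<and> bounded (range y) \<and> (\<forall>t\<in>{0..T}. y t = a + IL 0 t (\<lambda>s. F s (y s)))"
proof (rule Picard[where \<omega>="\<lambda>s. exp (2 * (\<bar>L\<bar> + 1) * s)" and L="\<bar>L\<bar> + 1" and c="\<lambda>_. a" and J="\<lambda>t. {0..t}", OF T])
  fix s and y y' :: 'a assume s: "s \<in> {0..T}"
  have "L * norm (y - y') \<le> (\<bar>L\<bar> + 1) * norm (y - y')" by (intro mult_right_mono) auto
  then show "norm (F s y - F s y') \<le> (\<bar>L\<bar> + 1) * norm (y - y')" using FL[OF s, of y y'] by linarith
next
  fix t assume "t \<in> {0..T}"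
  then show "(\<bar>L\<bar> + 1) * IL 0 t (\<lambda>s. exp (2 * (\<bar>L\<bar> + 1) * s)) \<le> exp (2 * (\<bar>L\<bar> + 1) * t) / 2"
    by (intro IL_exp_forward) auto
qed (use Fm IL_continuous in \<open>auto intro!: continuous_intros\<close>)

lemma ode_exists_backward:
  fixes F :: "real \<Rightarrow> 'a::euclidean_space \<Rightarrow> 'a"
  assumes T: "0 \<le> T"
    and Fm: "\<And>y. bdd_meas y \<Longrightarrow> bdd_meas (\<lambda>s. F s (y s))"
    and FL: "\<And>s y y'. s \<in> {0..T} \<Longrightarrow> norm (F s y - F s y') \<le> L * norm (y - y')"
  shows "\<exists>y. continuous_on UNIV y \<and> bounded (range y) \<and> (\<forall>t\<in>{0..T}. y t = a + IL t T (\<lambda>s. F s (y s)))"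
proof (rule Picard[where \<omega>="\<lambda>s. exp (- 2 * (\<bar>L\<bar> + 1) * s)" and L="\<bar>L\<bar> + 1" and c="\<lambda>_. a" and J="\<lambda>t. {t..T}", OF T])
  fix s and y y' :: 'a assume s: "s \<in> {0..T}"
  have "L * norm (y - y') \<le> (\<bar>L\<bar> + 1) * norm (y - y')" by (intro mult_right_mono) auto
  then show "norm (F s y - F s y') \<le> (\<bar>L\<bar> + 1) * norm (y - y')" using FL[OF s, of y y'] by linarith
next
  fix t assume "t \<in> {0..T}"
  then show "(\<bar>L\<bar> + 1) * IL t T (\<lambda>s. exp (- 2 * (\<bar>L\<bar> + 1) * s)) \<le> exp (- 2 * (\<bar>L\<bar> + 1) * t) / 2"
    by (intro IL_exp_backward) auto
qed (use Fm IL_continuous_backward in \<open>auto intro!: continuous_intros\<close>)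

text \<open>Nothing is differentiated. At a maximum point of exp(-2Lt) y(t), with maximum M, the
  bound y(r) <= M exp(2Lr) is inserted into the integral inequality and gives M <= a + M/2. This
  explains the factor 2 and the rate 2L, which are not sharp.\<close>

lemma Gronwall:
  fixes y :: "real \<Rightarrow> real"
  assumes y: "continuous_on {0..T} y" and L: "L > 0" and a: "a \<ge> 0"
    and le: "\<And>t. t \<in> {0..T} \<Longrightarrow> y t \<le> a + L * IL 0 t y" and t: "t \<in> {0..T}"
  shows "y t \<le> 2 * a * exp (2 * L * T)"
proof -
  have "continuous_on {0..T} (\<lambda>t. exp (- 2 * L * t) * y t)" by (intro continuous_intros y)
  from continuous_attains_sup[OF _ _ this] t
  obtain s where s: "s \<in> {0..T}" "\<And>r. r \<in> {0..T} \<Longrightarrow> exp (- 2 * L * r) * y r \<le> exp (- 2 * L * s) * y s" by force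
  define M where "M = exp (- 2 * L * s) * y s"
  have yM: "y r \<le> M * exp (2 * L * r)" if "r \<in> {0..T}" for r
  proof -
    have "exp (2 * L * r) * (exp (- 2 * L * r) * y r) \<le> exp (2 * L * r) * M"
      unfolding M_def using s(2)[OF that] by (intro mult_left_mono) auto
    moreover have "exp (2 * L * r) * exp (- 2 * L * r) = 1" by (simp flip: exp_add)
    ultimately show ?thesis by (metis mult.assoc mult.commute mult_1)
  qed
  have "M \<le> 2 * a"
  proof (cases "M \<le> 0")
    case True
    then show ?thesis using a by simp
  next
    case False
    have iy: "integrable (lebesgue_on {0..s}) y"
      using s(1) by (intro continuous_imp_integrable_real continuous_on_subset[OF y]) auto
    have ie: "integrable (lebesgue_on {0..s}) (\<lambda>s. exp (2 * L * s))"
      by (intro continuous_imp_integrable_real continuous_intros)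
    have "y s \<le> a + L * IL 0 s y" by (rule le[OF s(1)])
    also have "IL 0 s y \<le> IL 0 s (\<lambda>r. M * exp (2 * L * r))"
      by (rule integral_mono) (use iy ie yM s(1) in auto)
    also have "\<dots> = M * IL 0 s (\<lambda>r. exp (2 * L * r))" by simp
    finally have "y s \<le> a + M * (L * IL 0 s (\<lambda>r. exp (2 * L * r)))" using L by (simp add: algebra_simps)
    also have "\<dots> \<le> a + M * (exp (2 * L * s) / 2)"
      using IL_exp_forward[OF L, of s] s(1) False by (intro add_left_mono mult_left_mono) auto
    finally have "exp (- 2 * L * s) * y s \<le> exp (- 2 * L * s) * (a + M * (exp (2 * L * s) / 2))" by (intro mult_left_mono) auto
    moreover have "exp (- 2 * L * s) * (a + M * (exp (2 * L * s) / 2)) = exp (- 2 * L * s) * a + M / 2 * (exp (- 2 * L * s) * exp (2 * L * s))"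
      by (simp only: algebra_simps) simp
    moreover have "exp (- 2 * L * s) * exp (2 * L * s) = 1" by (simp flip: exp_add)
    ultimately have "M \<le> exp (- 2 * L * s) * a + M / 2" by (metis M_def mult.right_neutral)
    moreover have "exp (- 2 * L * s) * a \<le> 1 * a" using a L s(1) by (intro mult_right_mono) auto
    ultimately show ?thesis by simp
  qed
  have "y t \<le> M * exp (2 * L * t)" by (rule yM[OF t])
  also have "\<dots> \<le> 2 * a * exp (2 * L * t)" using \<open>M \<le> 2 * a\<close> by (intro mult_right_mono) auto
  also have "\<dots> \<le> 2 * a * exp (2 * L * T)" using a t L by (intro mult_left_mono) auto
  finally show ?thesis .
qed

section \<open>Second order Taylor expansions\<close>

text \<open>By uniqueness the witnesses in \<open>C2\<close> are the Frechet derivatives. The outer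
  argument of \<open>h''\<close> is the direction in which \<open>h'\<close> is differentiated,
  which is why \<open>k\<close> and \<open>l\<close> change places.\<close>

lemma C2E:
  assumes "C2 h"
  obtains h' h'' where "\<And>x. (h has_derivative blinfun_apply (h' x)) (at x)"
    "\<And>x. (h' has_derivative blinfun_apply (h'' x)) (at x)" "continuous_on UNIV h''"
    "\<And>x k. frechet_derivative h (at x) k = blinfun_apply (h' x) k"
    "\<And>x k l. second_derivative h x k l = blinfun_apply (blinfun_apply (h'' x) l) k"
proof -
  obtain h' :: "'a \<Rightarrow> 'a \<Rightarrow>\<^sub>L 'b" and h'' :: "'a \<Rightarrow> 'a \<Rightarrow>\<^sub>L 'a \<Rightarrow>\<^sub>L 'b"
    where h: "\<And>x. (h has_derivative blinfun_apply (h' x)) (at x)"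
    "\<And>x. (h' has_derivative blinfun_apply (h'' x)) (at x)" "continuous_on UNIV h''"
    using assms unfolding C2_def by blast
  have 1: "frechet_derivative h (at x) k = h' x k" for x k
    using frechet_derivative_at[OF h(1)] by metis
  have "((\<lambda>y. blinfun_apply (h' y) k) has_derivative (\<lambda>l. blinfun_apply (h'' x l) k)) (at x)" for x k
    by (auto intro!: derivative_eq_intros h(2))
  then have 2: "second_derivative h x k l = h'' x l k" for x k l
    unfolding second_derivative_def 1 using frechet_derivative_at by metis
  show ?thesis by (rule that[OF h 1 2])
qed

lemma C2_has_derivative: "C2 h \<Longrightarrow> (h has_derivative frechet_derivative h (at x)) (at x)"
  by (metis C2E frechet_derivative_works differentiable_def)

lemma C2_continuous: "C2 h \<Longrightarrow> continuous_on S h"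
  by (meson C2_has_derivative has_derivative_continuous continuous_at_imp_continuous_on)

lemma C2_D_linear: "C2 h \<Longrightarrow> bounded_linear (frechet_derivative h (at x))"
  using C2_has_derivative has_derivative_bounded_linear by blast

lemma C2_D_continuous:
  assumes "C2 h" shows "continuous_on S (\<lambda>p. frechet_derivative h (at (fst p)) (snd p))"
proof -
  obtain h' where h': "\<And>x. (\<exists>D. (h' has_derivative D) (at x))" "\<And>x k. frechet_derivative h (at x) k = blinfun_apply (h' x) k"
    using C2E[OF assms] by metis
  have "continuous_on UNIV h'"
    using h'(1) by (meson has_derivative_continuous continuous_at_imp_continuous_on)
  then have "continuous_on S (\<lambda>p. blinfun_apply (h' (fst p)) (snd p))"
    by (intro continuous_intros) (auto intro!: continuous_on_compose2[of UNIV h'] continuous_intros)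
  then show ?thesis by (simp add: h')
qed

lemma C2_D2_continuous:
  assumes "C2 h" shows "continuous_on S (\<lambda>p. second_derivative h (fst p) (snd p) (snd p))"
proof -
  obtain h'' where h'': "continuous_on UNIV h''" "\<And>x k l. second_derivative h x k l = blinfun_apply (blinfun_apply (h'' x) l) k"
    using C2E[OF assms] by metis
  have "continuous_on S (\<lambda>p. blinfun_apply (blinfun_apply (h'' (fst p)) (snd p)) (snd p))"
    by (intro continuous_intros) (auto intro!: continuous_on_compose2[of UNIV h''] continuous_intros h'')
  then show ?thesis by (simp add: h'')
qed

lemma C2_D_has_derivative:
  assumes "C2 h" shows "((\<lambda>y. frechet_derivative h (at y) k) has_derivative second_derivative h x k) (at x)"
proof -
  obtain h' h'' where h: "\<And>x. (h' has_derivative blinfun_apply (h'' x)) (at x)"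
    "\<And>x k. frechet_derivative h (at x) k = blinfun_apply (h' x) k"
    "\<And>x k l. second_derivative h x k l = blinfun_apply (blinfun_apply (h'' x) l) k"
    using C2E[OF assms] by metis
  have "((\<lambda>y. blinfun_apply (h' y) k) has_derivative (\<lambda>l. blinfun_apply (h'' x l) k)) (at x)" for x k
    by (auto intro!: derivative_eq_intros h(1))
  moreover have "second_derivative h x k = (\<lambda>l. h'' x l k)" using h(3) by auto
  ultimately show ?thesis by (simp add: h)
qed

text \<open>The mean value inequality is used twice, for \<open>h'\<close> and then along the
  segment for \<open>h\<close>. The remainder is uniform in x because \<open>h''\<close> is
  uniformly continuous on the compact set of points within distance 1 of \<open>K\<close>.\<close>

lemma C2_Taylor:
  fixes h :: "'a::euclidean_space \<Rightarrow> 'b::euclidean_space"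
  assumes "C2 h" "compact K" "\<eta> > 0"
  shows "\<exists>d>0. \<forall>x\<in>K. \<forall>k. norm k \<le> d \<longrightarrow>
    norm (h (x + k) - h x - frechet_derivative h (at x) k - (1/2) *\<^sub>R second_derivative h x k k) \<le> \<eta> * (norm k)\<^sup>2"
proof -
  obtain h' h'' where h: "\<And>x. (h has_derivative blinfun_apply (h' x)) (at x)"
    "\<And>x. (h' has_derivative blinfun_apply (h'' x)) (at x)" "continuous_on UNIV h''"
    "\<And>x k. frechet_derivative h (at x) k = blinfun_apply (h' x) k"
    "\<And>x k l. second_derivative h x k l = blinfun_apply (blinfun_apply (h'' x) l) k"
    using C2E[OF assms(1)] by metis
  define K' where "K' = {x + y | x y. x \<in> K \<and> y \<in> cball 0 1}"
  have "compact K'" unfolding K'_def using assms(2) by (intro compact_sums) auto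
  then have "uniformly_continuous_on K' h''"
    by (intro compact_uniformly_continuous continuous_on_subset[OF h(3)]) auto
  then obtain d where d: "d > 0" "\<And>x y. x \<in> K' \<Longrightarrow> y \<in> K' \<Longrightarrow> dist y x < d \<Longrightarrow> dist (h'' y) (h'' x) < \<eta>"
    using assms(3) unfolding uniformly_continuous_on_def by metis
  have A: "norm (h' (x + k) - h' x - h'' x k) \<le> \<eta> * norm k" if x: "x \<in> K" and k: "norm k < min 1 d" for x k
  proof -
    have "norm (h' (x + k) - h' x - blinfun_apply (h'' x) (x + k - x)) \<le> norm (x + k - x) * \<eta>"
    proof (rule differentiable_bound_linearization[where S="ball x (min 1 d)"])
      fix t :: real assume t: "t \<in> {0..1}"
      have "norm (t *\<^sub>R k) \<le> norm k" using t by (simp add: mult_left_le_one_le)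
      then show "x + t *\<^sub>R (x + k - x) \<in> ball x (min 1 d)" using k by (simp add: dist_norm)
    next
      fix y assume y: "y \<in> ball x (min 1 d)"
      have "y = x + (y - x)" by simp
      moreover have "y - x \<in> cball 0 1" using y by (simp add: dist_norm norm_minus_commute)
      ultimately have "y \<in> K'" unfolding K'_def using x by blast
      moreover have "x \<in> K'" unfolding K'_def using x by (intro CollectI exI[of _ x] exI[of _ 0]) auto
      ultimately have "dist (h'' y) (h'' x) < \<eta>" using d(2) y by (simp add: dist_commute)
      then have "norm (h'' y - h'' x) \<le> \<eta>" by (simp add: dist_norm)
      then show "onorm (blinfun_apply (h'' y) - blinfun_apply (h'' x)) \<le> \<eta>"
        by (simp add: norm_blinfun.rep_eq minus_blinfun.rep_eq fun_diff_def)
    next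
      show "x \<in> ball x (min 1 d)" using d(1) by simp
    qed (auto intro: has_derivative_at_withinI h(2))
    then show ?thesis by (simp add: mult.commute)
  qed
  have B: "norm (h (x + k) - h x - h' x k - (1/2) *\<^sub>R h'' x k k) \<le> \<eta> * (norm k)\<^sup>2" if x: "x \<in> K" and k: "norm k < min 1 d" for x k
  proof -
    \<comment> \<open>\<open>h\<close> along the segment minus its second order Taylor polynomial;
      the derivative of \<open>g\<close> is the linearisation error of \<open>h'\<close> applied to
      \<open>k\<close>.\<close>
    define g where "g t = h (x + t *\<^sub>R k) - h x - t *\<^sub>R h' x k - (t\<^sup>2 / 2) *\<^sub>R h'' x k k" for t :: real
    have gd: "(g has_derivative (\<lambda>s. s *\<^sub>R (h' (x + t *\<^sub>R k) k - h' x k - t *\<^sub>R h'' x k k))) (at t within {0..1})" for t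
      unfolding g_def
      by (rule derivative_eq_intros has_derivative_compose[OF _ h(1)] refl)+
         (auto simp: algebra_simps blinfun.scaleR_right scaleR_add_left)
    have "norm (g 1 - g 0) \<le> (\<eta> * (norm k)\<^sup>2) * norm (1 - 0 :: real)"
    proof (rule differentiable_bound[OF _ gd])
      fix t :: real assume t: "t \<in> {0..1}"
      have tk: "norm (t *\<^sub>R k) \<le> norm k" using t by (simp add: mult_left_le_one_le)
      have "norm (h' (x + t *\<^sub>R k) k - h' x k - t *\<^sub>R h'' x k k) = norm ((h' (x + t *\<^sub>R k) - h' x - h'' x (t *\<^sub>R k)) k)"
        by (simp add: blinfun.diff_left blinfun.scaleR_right blinfun.scaleR_left)
      also have "\<dots> \<le> norm (h' (x + t *\<^sub>R k) - h' x - h'' x (t *\<^sub>R k)) * norm k" by (rule norm_blinfun)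
      also have "\<dots> \<le> (\<eta> * norm (t *\<^sub>R k)) * norm k" using A[OF x, of "t *\<^sub>R k"] tk k by (intro mult_right_mono) auto
      also have "\<dots> \<le> (\<eta> * norm k) * norm k" using tk assms(3) by (intro mult_right_mono mult_left_mono) auto
      finally have *: "norm (h' (x + t *\<^sub>R k) k - h' x k - t *\<^sub>R h'' x k k) \<le> \<eta> * (norm k)\<^sup>2"
        by (simp add: power2_eq_square mult.assoc)
      show "onorm (\<lambda>s. s *\<^sub>R (h' (x + t *\<^sub>R k) k - h' x k - t *\<^sub>R h'' x k k)) \<le> \<eta> * (norm k)\<^sup>2"
      proof (rule onorm_le)
        fix s :: real
        show "norm (s *\<^sub>R (h' (x + t *\<^sub>R k) k - h' x k - t *\<^sub>R h'' x k k)) \<le> \<eta> * (norm k)\<^sup>2 * norm s"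
          using mult_left_mono[OF *, of "\<bar>s\<bar>"] by (simp add: mult.commute)
      qed
    qed auto
    then show ?thesis by (simp add: g_def)
  qed
  show ?thesis
    by (rule exI[of _ "min 1 d / 2"]) (use B d(1) in \<open>auto simp: h(4,5)\<close>)
qed

text \<open>Inserting k = e z + e^2 \<zeta> into Taylor's formula, the second derivative at (k, k)
  differs from e^2 times its value at (z, z) by terms of order e^3. Half of \<open>\<eta>\<close>
  pays for the Taylor remainder and half for these terms.\<close>

lemma C2_expansion:
  fixes h :: "'a::euclidean_space \<Rightarrow> 'b::euclidean_space"
  assumes C: "C2 h" and K: "compact K" and \<eta>: "\<eta> > 0" and R: "R > 0"
  shows "\<exists>e0>0. \<forall>e x z \<zeta>. 0 < e \<longrightarrow> e < e0 \<longrightarrow> x \<in> K \<longrightarrow> norm z \<le> R \<longrightarrow> norm \<zeta> \<le> R \<longrightarrow>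
    norm (h (x + e *\<^sub>R z + e\<^sup>2 *\<^sub>R \<zeta>) - h x - e *\<^sub>R frechet_derivative h (at x) z
      - e\<^sup>2 *\<^sub>R (frechet_derivative h (at x) \<zeta> + (1/2) *\<^sub>R second_derivative h x z z)) \<le> \<eta> * e\<^sup>2"
proof -
  obtain h' h'' where h: "continuous_on UNIV h''"
    "\<And>x k. frechet_derivative h (at x) k = blinfun_apply (h' x) k"
    "\<And>x k l. second_derivative h x k l = blinfun_apply (blinfun_apply (h'' x) l) k"
    using C2E[OF C] by metis
  have "compact (h'' ` K)" by (intro compact_continuous_image K continuous_on_subset[OF h(1)]) auto
  then obtain M where M: "M > 0" "\<And>x. x \<in> K \<Longrightarrow> norm (h'' x) \<le> M"
    using compact_imp_bounded bounded_pos by (metis image_eqI)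
  \<comment> \<open>Since norm k <= 2 e R, this choice turns the Taylor remainder into exactly
    \<open>\<eta> / 2 * e\<^sup>2\<close>.\<close>
  define \<eta>' where "\<eta>' = \<eta> / (8 * R\<^sup>2)"
  have \<eta>': "\<eta>' > 0" using \<eta> R by (simp add: \<eta>'_def)
  obtain d where d: "d > 0" "\<And>x k. x\<in>K \<Longrightarrow> norm k \<le> d \<Longrightarrow>
    norm (h (x + k) - h x - h' x k - (1/2) *\<^sub>R h'' x k k) \<le> \<eta>' * (norm k)\<^sup>2"
    using C2_Taylor[OF C K \<eta>'] unfolding h by blast
  define e0 where "e0 = Min {1, d / (2 * R), \<eta> / (4 * M * R\<^sup>2)}"
  have e0: "e0 > 0" using d M R \<eta> by (simp add: e0_def)
  have "norm (h (x + e *\<^sub>R z + e\<^sup>2 *\<^sub>R \<zeta>) - h x - e *\<^sub>R h' x z - e\<^sup>2 *\<^sub>R (h' x \<zeta> + (1/2) *\<^sub>R h'' x z z)) \<le> \<eta> * e\<^sup>2"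
    if e: "0 < e" "e < e0" and x: "x \<in> K" and z: "norm z \<le> R" "norm \<zeta> \<le> R" for e x z \<zeta>
  proof -
    have e1: "e < 1" "e * (2 * R) \<le> d" "e * (4 * M * R\<^sup>2) \<le> \<eta>"
      using e d M R by (auto simp: e0_def pos_less_divide_eq)
    define k where "k = e *\<^sub>R z + e\<^sup>2 *\<^sub>R \<zeta>"
    have "norm k \<le> e * R + e\<^sup>2 * R" unfolding k_def using e z
      by (intro norm_triangle_le add_mono) (auto intro!: mult_left_mono)
    also have "e\<^sup>2 \<le> e" using e e1 by (simp add: power2_eq_square mult_left_le_one_le)
    finally have "norm k \<le> e * R + e * R" using R by (simp add: mult_right_mono)
    then have kn: "norm k \<le> e * (2 * R)" by (simp only: mult_2 distrib_left)
    have T: "norm (h (x + k) - h x - h' x k - (1/2) *\<^sub>R h'' x k k) \<le> \<eta>' * (norm k)\<^sup>2"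
      using d(2)[OF x] kn e1 by simp
    have "\<eta>' * (norm k)\<^sup>2 \<le> \<eta>' * (e * (2 * R))\<^sup>2" using kn \<eta>' by (intro mult_left_mono power_mono) auto
    also have "\<dots> = \<eta> / 2 * e\<^sup>2" using R by (simp add: \<eta>'_def power_mult_distrib)
    finally have T: "norm (h (x + k) - h x - h' x k - (1/2) *\<^sub>R h'' x k k) \<le> \<eta> / 2 * e\<^sup>2" using T by linarith
    define r where "r = e ^ 3 *\<^sub>R (h'' x z \<zeta> + h'' x \<zeta> z + e *\<^sub>R h'' x \<zeta> \<zeta>)"
    have q: "h'' x k k = e\<^sup>2 *\<^sub>R h'' x z z + r"
      by (simp add: k_def r_def blinfun.add_left blinfun.add_right blinfun.scaleR_left blinfun.scaleR_right
          scaleR_add_right power2_eq_square power3_eq_cube mult.assoc)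
    have b: "norm (h'' x a b) \<le> M * R\<^sup>2" if "norm a \<le> R" "norm b \<le> R" for a b
    proof -
      have "norm (h'' x a b) \<le> norm (h'' x a) * norm b" by (rule norm_blinfun)
      also have "\<dots> \<le> (norm (h'' x) * norm a) * norm b" by (intro mult_right_mono norm_blinfun) auto
      also have "\<dots> \<le> (M * R) * R" using M x that R by (intro mult_mono) auto
      finally show ?thesis by (simp add: power2_eq_square mult.assoc)
    qed
    have "norm r = e ^ 3 * norm (h'' x z \<zeta> + h'' x \<zeta> z + e *\<^sub>R h'' x \<zeta> \<zeta>)" using e by (simp add: r_def)
    also have "\<dots> \<le> e ^ 3 * (M * R\<^sup>2 + M * R\<^sup>2 + 1 * (M * R\<^sup>2))"
    proof (rule mult_left_mono)
      have "norm (e *\<^sub>R h'' x \<zeta> \<zeta>) \<le> 1 * (M * R\<^sup>2)" unfolding norm_scaleR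
        using e e1 b[OF z(2) z(2)] by (intro mult_mono) auto
      then show "norm (h'' x z \<zeta> + h'' x \<zeta> z + e *\<^sub>R h'' x \<zeta> \<zeta>) \<le> M * R\<^sup>2 + M * R\<^sup>2 + 1 * (M * R\<^sup>2)"
        using b[OF z(1) z(2)] b[OF z(2) z(1)] by (intro norm_triangle_le add_mono) auto
    qed (use e in auto)
    also have "\<dots> \<le> e\<^sup>2 * (e * (4 * M * R\<^sup>2))" using e M R by (simp add: power2_eq_square power3_eq_cube)
    also have "\<dots> \<le> e\<^sup>2 * \<eta>" using e1 by (intro mult_left_mono) auto
    finally have r: "norm ((1/2) *\<^sub>R r) \<le> \<eta> / 2 * e\<^sup>2" by (simp add: mult.commute)
    have lin: "h' x k = e *\<^sub>R h' x z + e\<^sup>2 *\<^sub>R h' x \<zeta>"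
      by (simp add: k_def blinfun.add_right blinfun.scaleR_right)
    have eq: "h (x + e *\<^sub>R z + e\<^sup>2 *\<^sub>R \<zeta>) - h x - e *\<^sub>R h' x z - e\<^sup>2 *\<^sub>R (h' x \<zeta> + (1/2) *\<^sub>R h'' x z z)
       = (h (x + k) - h x - h' x k - (1/2) *\<^sub>R h'' x k k) + (1/2) *\<^sub>R r"
      unfolding lin q by (simp add: k_def scaleR_add_right add.assoc algebra_simps)
    show ?thesis unfolding eq
    proof (rule norm_triangle_le)
      show "norm (h (x + k) - h x - h' x k - (1/2) *\<^sub>R h'' x k k) + norm ((1/2) *\<^sub>R r) \<le> \<eta> * e\<^sup>2"
        using add_mono[OF T r] by simp
    qed
  qed
  then show ?thesis using e0 unfolding h by blast
qed

section \<open>Linear systems driven by a measure\<close>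

lemma IL_restrict: "{c..d} \<subseteq> {a..b} \<Longrightarrow> IL a b (\<lambda>s. if s \<in> {c..d} then f s else 0) = IL c d f"
  by (rule integral_restrict) auto

text \<open>Exchange of the integrals over the triangle s <= \<tau>. The measure is general because
  the lemma serves both the constraint measure and, for the absolutely continuous part of the
  costate, Lebesgue measure. The closed half-line counts an atom at s, which leads to the left
  continuous version of the costate.\<close>

lemma Fubini_Volterra:
  fixes w y :: "real \<Rightarrow> 'a::euclidean_space"
  assumes M: "finite_measure M" "(\<lambda>t. t) \<in> borel_measurable M" "space M = {0..T}"
    and w: "w \<in> borel_measurable M" "\<And>t. norm (w t) \<le> K" and y: "bdd_meas y"
  shows "(\<integral>\<tau>. w \<tau> \<bullet> IL 0 \<tau> y \<partial>M) = IL 0 T (\<lambda>s. (\<integral>\<tau>. indicat_real {s..} \<tau> *\<^sub>R w \<tau> \<partial>M) \<bullet> y s)"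
proof -
  interpret M: finite_measure M by (rule M)
  interpret N: finite_measure "lebesgue_on {0..T}" by (rule finite_measure_lebesgue_on) auto
  interpret P: pair_sigma_finite M "lebesgue_on {0..T}" ..
  interpret Q: finite_measure "M \<Otimes>\<^sub>M lebesgue_on {0..T}"
    by (rule finite_measure_pair_measure) unfold_locales
  obtain K' where K': "\<And>t. norm (y t) \<le> K'" using y by (auto simp: bdd_meas_def)
  have [measurable]: "(\<lambda>t. t) \<in> borel_measurable M" "w \<in> borel_measurable M" by fact+
  have [measurable]: "y \<in> borel_measurable (lebesgue_on {0..T})" using y by (rule bdd_meas_on)
  have [measurable]: "(\<lambda>t. t) \<in> borel_measurable (lebesgue_on {0..T})"
    by (intro measurable_restrict_space1 measurable_completion) simp
  define f where "f = (\<lambda>(\<tau>, s). indicat_real {s..} \<tau> * (w \<tau> \<bullet> y s))"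
  have f_meas: "f \<in> borel_measurable (M \<Otimes>\<^sub>M lebesgue_on {0..T})"
  proof -
    have "f = (\<lambda>p. if snd p \<le> fst p then w (fst p) \<bullet> y (snd p) else 0)"
      by (auto simp: f_def fun_eq_iff indicator_def)
    also have "\<dots> \<in> borel_measurable (M \<Otimes>\<^sub>M lebesgue_on {0..T})"
      by measurable
    finally show ?thesis .
  qed
  have "integrable (M \<Otimes>\<^sub>M lebesgue_on {0..T}) f"
  proof (rule Q.integrable_const_bound[where B="\<bar>K\<bar> * \<bar>K'\<bar>"])
    have "norm (f p) \<le> \<bar>K\<bar> * \<bar>K'\<bar>" for p
    proof (cases p)
      case (Pair \<tau> s)
      have "\<bar>w \<tau> \<bullet> y s\<bar> \<le> norm (w \<tau>) * norm (y s)" by (rule Cauchy_Schwarz_ineq2)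
      also have "\<dots> \<le> \<bar>K\<bar> * \<bar>K'\<bar>" using w(2)[of \<tau>] K'[of s] by (intro mult_mono) auto
      finally show ?thesis by (auto simp: f_def Pair indicator_def)
    qed
    then show "AE p in M \<Otimes>\<^sub>M lebesgue_on {0..T}. norm (f p) \<le> \<bar>K\<bar> * \<bar>K'\<bar>" by simp
  qed (rule f_meas)
  then have *: "(\<integral>s. (\<integral>\<tau>. f (\<tau>, s) \<partial>M) \<partial>lebesgue_on {0..T}) = (\<integral>\<tau>. (\<integral>s. f (\<tau>, s) \<partial>lebesgue_on {0..T}) \<partial>M)"
    by (rule P.Fubini_integral[of "\<lambda>\<tau> s. f (\<tau>, s)", simplified])
  have "(\<integral>s. f (\<tau>, s) \<partial>lebesgue_on {0..T}) = w \<tau> \<bullet> IL 0 \<tau> y" if \<tau>: "\<tau> \<in> {0..T}" for \<tau>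
  proof -
    have "(\<integral>s. f (\<tau>, s) \<partial>lebesgue_on {0..T}) = IL 0 T (\<lambda>s. if s \<in> {0..\<tau>} then w \<tau> \<bullet> y s else 0)"
      by (intro Bochner_Integration.integral_cong) (auto simp: f_def indicator_def)
    also have "\<dots> = IL 0 \<tau> (\<lambda>s. w \<tau> \<bullet> y s)" using \<tau> by (intro IL_restrict) auto
    finally show ?thesis by (simp add: IL_inner[OF y])
  qed
  then have 1: "(\<integral>\<tau>. (\<integral>s. f (\<tau>, s) \<partial>lebesgue_on {0..T}) \<partial>M) = (\<integral>\<tau>. w \<tau> \<bullet> IL 0 \<tau> y \<partial>M)"
    by (intro Bochner_Integration.integral_cong) (auto simp: M(3))
  have "(\<integral>\<tau>. f (\<tau>, s) \<partial>M) = (\<integral>\<tau>. indicat_real {s..} \<tau> *\<^sub>R w \<tau> \<partial>M) \<bullet> y s" for s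
  proof -
    have "integrable M (\<lambda>\<tau>. indicat_real {s..} \<tau> *\<^sub>R w \<tau>)"
    proof (rule M.integrable_const_bound[where B="\<bar>K\<bar>"])
      have "norm (indicat_real {s..} \<tau> *\<^sub>R w \<tau>) \<le> \<bar>K\<bar>" for \<tau>
        using w(2)[of \<tau>] by (auto simp: indicator_def)
      then show "AE \<tau> in M. norm (indicat_real {s..} \<tau> *\<^sub>R w \<tau>) \<le> \<bar>K\<bar>" by simp
      have "(\<lambda>\<tau>. indicat_real {s..} \<tau> *\<^sub>R w \<tau>) = (\<lambda>\<tau>. if s \<le> \<tau> then w \<tau> else 0)" by (auto simp: indicator_def)
      also have "\<dots> \<in> borel_measurable M" by measurable
      finally show "(\<lambda>\<tau>. indicat_real {s..} \<tau> *\<^sub>R w \<tau>) \<in> borel_measurable M" .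
    qed
    then show ?thesis by (subst integral_inner_left[symmetric]) (auto simp: f_def)
  qed
  then show ?thesis using * 1 by simp
qed

text \<open>The adjoint problem in abstract form: \<open>A\<close> stands for the linearised
  dynamics, \<open>\<gamma>\<close> for the gradient of the state constraint along the trajectory,
  and \<open>l1\<close> for the terminal value of the costate.\<close>

locale linear_system =
  fixes T :: real and A :: "real \<Rightarrow> 'a::euclidean_space \<Rightarrow> 'a" and \<gamma> :: "real \<Rightarrow> 'a" and \<mu> :: "real measure" and l1 :: 'a
  assumes T: "0 < T"
    and A_lin: "\<And>s. linear (A s)"
    and A_meas: "\<And>y. bdd_meas y \<Longrightarrow> bdd_meas (\<lambda>s. A s (y s))"
    and A_bdd: "\<exists>K. \<forall>s h. norm (A s h) \<le> K * norm h"
    and \<gamma>_meas: "\<gamma> \<in> borel_measurable borel" and \<gamma>_bdd: "\<exists>K. \<forall>t. norm (\<gamma> t) \<le> K"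
    and \<mu>_fin: "finite_measure \<mu>" and \<mu>_sets: "sets \<mu> = sets (restrict_space borel {0..T})"
begin

sublocale \<mu>: finite_measure \<mu> by (rule \<mu>_fin)

definition "Kg = (SOME K. K \<ge> 0 \<and> (\<forall>t. norm (\<gamma> t) \<le> K))"
lemma Kg: "Kg \<ge> 0" "norm (\<gamma> t) \<le> Kg"
proof -
  obtain K where "\<forall>t. norm (\<gamma> t) \<le> K" using \<gamma>_bdd by blast
  then have "\<bar>K\<bar> \<ge> 0 \<and> (\<forall>t. norm (\<gamma> t) \<le> \<bar>K\<bar>)" by (meson abs_ge_self abs_ge_zero order_trans)
  then have "Kg \<ge> 0 \<and> (\<forall>t. norm (\<gamma> t) \<le> Kg)" unfolding Kg_def by (rule someI)
  then show "Kg \<ge> 0" "norm (\<gamma> t) \<le> Kg" by auto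
qed

lemma \<mu>_space: "space \<mu> = {0..T}"
  using sets_eq_imp_space_eq[OF \<mu>_sets] by (simp add: space_restrict_space)

lemma \<mu>_borel: "f \<in> borel_measurable borel \<Longrightarrow> f \<in> borel_measurable \<mu>"
  using measurable_cong_sets[OF \<mu>_sets refl] measurable_restrict_space1 by blast

lemma ind_meas: "S \<in> sets borel \<Longrightarrow> (\<lambda>\<tau>. indicat_real S \<tau> *\<^sub>R \<gamma> \<tau>) \<in> borel_measurable \<mu>"
proof (rule \<mu>_borel)
  assume S[measurable]: "S \<in> sets borel"
  note \<gamma>_meas[measurable]
  show "(\<lambda>\<tau>. indicat_real S \<tau> *\<^sub>R \<gamma> \<tau>) \<in> borel_measurable borel" by measurable
qed

lemma ind_int: "S \<in> sets borel \<Longrightarrow> integrable \<mu> (\<lambda>\<tau>. indicat_real S \<tau> *\<^sub>R \<gamma> \<tau>)"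
proof (rule \<mu>.integrable_const_bound[where B=Kg])
  have "norm (indicat_real S \<tau> *\<^sub>R \<gamma> \<tau>) \<le> Kg" for \<tau>
    using Kg(1) Kg(2)[of \<tau>] by (auto simp: indicator_def)
  then show "AE \<tau> in \<mu>. norm (indicat_real S \<tau> *\<^sub>R \<gamma> \<tau>) \<le> Kg" by simp
qed (rule ind_meas)

definition "gint S = (\<integral>\<tau>. indicat_real S \<tau> *\<^sub>R \<gamma> \<tau> \<partial>\<mu>)"

lemma gint_Un: "S \<in> sets borel \<Longrightarrow> R \<in> sets borel \<Longrightarrow> S \<inter> R = {} \<Longrightarrow> gint (S \<union> R) = gint S + gint R"
proof -
  assume *: "S \<in> sets borel" "R \<in> sets borel" "S \<inter> R = {}"
  have "gint (S \<union> R) = (\<integral>\<tau>. indicat_real S \<tau> *\<^sub>R \<gamma> \<tau> + indicat_real R \<tau> *\<^sub>R \<gamma> \<tau> \<partial>\<mu>)"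
    unfolding gint_def using *(3) by (intro Bochner_Integration.integral_cong) (auto simp: indicator_def)
  then show ?thesis unfolding gint_def using ind_int * by simp
qed

lemma gint_norm: "S \<in> sets borel \<Longrightarrow> norm (gint S) \<le> Kg * measure \<mu> (S \<inter> {0..T})"
proof -
  assume S: "S \<in> sets borel"
  have Sm: "S \<inter> {0..T} \<in> sets \<mu>" using S by (auto simp: \<mu>_sets sets_restrict_space)
  have "norm (gint S) \<le> (\<integral>\<tau>. norm (indicat_real S \<tau> *\<^sub>R \<gamma> \<tau>) \<partial>\<mu>)" unfolding gint_def by (rule integral_norm_bound)
  also have "\<dots> \<le> (\<integral>\<tau>. Kg * indicat_real (S \<inter> {0..T}) \<tau> \<partial>\<mu>)"
  proof (rule integral_mono)
    show "integrable \<mu> (\<lambda>\<tau>. norm (indicat_real S \<tau> *\<^sub>R \<gamma> \<tau>))" using ind_int[OF S] by (rule integrable_norm)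
    show "integrable \<mu> (\<lambda>\<tau>. Kg * indicat_real (S \<inter> {0..T}) \<tau>)" using Sm by (intro integrable_mult_right integrable_real_indicator) (auto simp: \<mu>.emeasure_finite less_top[symmetric])
    fix \<tau> assume "\<tau> \<in> space \<mu>"
    then show "norm (indicat_real S \<tau> *\<^sub>R \<gamma> \<tau>) \<le> Kg * indicat_real (S \<inter> {0..T}) \<tau>"
      using Kg(2)[of \<tau>] by (auto simp: \<mu>_space indicator_def)
  qed
  also have "\<dots> = Kg * measure \<mu> (S \<inter> {0..T})" using Sm by (simp add: \<mu>_space)
  finally show ?thesis .
qed

text \<open>As s increases to t the half-lines shrink to the closed one, so an atom of
  \<open>\<mu>\<close> at t is kept; the limit from the right in \<open>gint_right\<close> loses it.
  The difference is the jump of the costate at t.\<close>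

lemma gint_left:
  "((\<lambda>s. gint {s..}) \<longlongrightarrow> gint {t..}) (at_left t)"
proof (rule tendsto_at_left_sequentially[of "t - 1"])
  fix S :: "nat \<Rightarrow> real" assume S: "\<And>n. S n < t" "S \<longlonglongrightarrow> t"
  show "(\<lambda>n. gint {S n..}) \<longlonglongrightarrow> gint {t..}"
    unfolding gint_def
  proof (rule integral_dominated_convergence[where w="\<lambda>_. Kg"])
    show "AE \<tau> in \<mu>. (\<lambda>n. indicat_real {S n..} \<tau> *\<^sub>R \<gamma> \<tau>) \<longlonglongrightarrow> indicat_real {t..} \<tau> *\<^sub>R \<gamma> \<tau>"
    proof (rule AE_I2)
      fix \<tau>
      have "\<forall>\<^sub>F n in sequentially. indicat_real {S n..} \<tau> = indicat_real {t..} \<tau>"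
      proof (cases "t \<le> \<tau>")
        case True
        then have "S n \<le> \<tau>" for n using S(1)[of n] by simp
        then show ?thesis using True by simp
      next
        case False
        then have "\<forall>\<^sub>F n in sequentially. S n > \<tau>" using S(2) by (intro order_tendstoD) auto
        then show ?thesis by eventually_elim (use False in auto)
      qed
      then show "(\<lambda>n. indicat_real {S n..} \<tau> *\<^sub>R \<gamma> \<tau>) \<longlonglongrightarrow> indicat_real {t..} \<tau> *\<^sub>R \<gamma> \<tau>"
        by (intro tendsto_scaleR tendsto_eventually) auto
    qed
    fix n show "AE \<tau> in \<mu>. norm (indicat_real {S n..} \<tau> *\<^sub>R \<gamma> \<tau>) \<le> Kg"
      using Kg by (intro AE_I2) (auto simp: indicator_def)
  qed (use ind_meas in auto)
qed simp

lemma gint_right: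
  "((\<lambda>s. gint {s..}) \<longlongrightarrow> gint {t<..}) (at_right t)"
proof (rule tendsto_at_right_sequentially[of _ "t + 1"])
  fix S :: "nat \<Rightarrow> real" assume S: "\<And>n. t < S n" "S \<longlonglongrightarrow> t"
  show "(\<lambda>n. gint {S n..}) \<longlonglongrightarrow> gint {t<..}"
    unfolding gint_def
  proof (rule integral_dominated_convergence[where w="\<lambda>_. Kg"])
    show "AE \<tau> in \<mu>. (\<lambda>n. indicat_real {S n..} \<tau> *\<^sub>R \<gamma> \<tau>) \<longlonglongrightarrow> indicat_real {t<..} \<tau> *\<^sub>R \<gamma> \<tau>"
    proof (rule AE_I2)
      fix \<tau>
      have "\<forall>\<^sub>F n in sequentially. indicat_real {S n..} \<tau> = indicat_real {t<..} \<tau>"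
      proof (cases "\<tau> \<le> t")
        case True
        then have "\<not> S n \<le> \<tau>" for n using S(1)[of n] by simp
        then show ?thesis using True by simp
      next
        case False
        then have "\<forall>\<^sub>F n in sequentially. S n < \<tau>" using S(2) by (intro order_tendstoD) auto
        then show ?thesis by eventually_elim (use False in auto)
      qed
      then show "(\<lambda>n. indicat_real {S n..} \<tau> *\<^sub>R \<gamma> \<tau>) \<longlonglongrightarrow> indicat_real {t<..} \<tau> *\<^sub>R \<gamma> \<tau>"
        by (intro tendsto_scaleR tendsto_eventually) auto
    qed
    fix n show "AE \<tau> in \<mu>. norm (indicat_real {S n..} \<tau> *\<^sub>R \<gamma> \<tau>) \<le> Kg"
      using Kg by (intro AE_I2) (auto simp: indicator_def)
  qed (use ind_meas in auto)
qed simp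

text \<open>The part of the costate that comes from the terminal value and from
  \<open>\<mu>\<close>. What remains after subtracting it is continuous and solves a backward
  integral equation with respect to Lebesgue measure, so an equation driven by a measure is reduced
  to the fixed point theorem.\<close>

definition "mm t = l1 + gint {t..}"

lemma mm_bdd_meas: "bdd_meas mm"
  unfolding bdd_meas_def
proof
  have "(\<lambda>t. \<integral>\<tau>. indicat_real {t..} \<tau> *\<^sub>R \<gamma> \<tau> \<partial>\<mu>) \<in> borel_measurable borel"
  proof (rule \<mu>.borel_measurable_lebesgue_integral)
    have [measurable]: "(\<lambda>t. t) \<in> borel_measurable \<mu>" "\<gamma> \<in> borel_measurable \<mu>" by (rule \<mu>_borel, simp add: \<gamma>_meas)+
    have "(\<lambda>(t, \<tau>). indicat_real {t..} \<tau> *\<^sub>R \<gamma> \<tau>) = (\<lambda>p. if fst p \<le> snd p then \<gamma> (snd p) else 0)"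
      by (auto simp: fun_eq_iff indicator_def)
    also have "\<dots> \<in> borel_measurable (borel \<Otimes>\<^sub>M \<mu>)" by measurable
    finally show "(\<lambda>(t, \<tau>). indicat_real {t..} \<tau> *\<^sub>R \<gamma> \<tau>) \<in> borel_measurable (borel \<Otimes>\<^sub>M \<mu>)" .
  qed
  then have "mm \<in> borel_measurable borel" unfolding mm_def gint_def by measurable
  then have "mm \<in> borel_measurable lborel" by simp
  then show "mm \<in> borel_measurable lebesgue" by (rule measurable_completion)
  show "\<exists>K. \<forall>t. norm (mm t) \<le> K"
  proof (intro exI allI)
    fix t
    have "measure \<mu> ({t..} \<inter> {0..T}) \<le> measure \<mu> (space \<mu>)" by (rule \<mu>.bounded_measure)
    then have "Kg * measure \<mu> ({t..} \<inter> {0..T}) \<le> Kg * measure \<mu> (space \<mu>)" using Kg by (intro mult_left_mono) auto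
    then have "norm (gint {t..}) \<le> Kg * measure \<mu> (space \<mu>)" using gint_norm[of "{t..}"] by auto
    then show "norm (mm t) \<le> norm l1 + Kg * measure \<mu> (space \<mu>)" unfolding mm_def by (intro norm_triangle_mono) auto
  qed
qed

section \<open>The transposed equation, the costate and duality\<close>

text \<open>The transpose of \<open>A s\<close> in coordinates; \<open>AT_inner\<close> is its
  defining property.\<close>

definition "AT s p = (\<Sum>b\<in>Basis. (p \<bullet> A s b) *\<^sub>R b)"

lemma AT_inner: "AT s p \<bullet> h = p \<bullet> A s h"
proof -
  have "A s h = A s (\<Sum>b\<in>Basis. (h \<bullet> b) *\<^sub>R b)" by (simp add: euclidean_representation)
  also have "\<dots> = (\<Sum>b\<in>Basis. (h \<bullet> b) *\<^sub>R A s b)" using A_lin[of s] by (simp add: linear_sum linear_cmul)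
  finally show ?thesis
    by (simp add: AT_def inner_sum_left inner_sum_right mult.commute inner_commute[of _ h])
qed

lemma AT_bdd_meas: "bdd_meas y \<Longrightarrow> bdd_meas (\<lambda>s. AT s (y s))"
  unfolding AT_def by (intro bdd_meas_sum bdd_meas_scaleR bdd_meas_inner A_meas bdd_meas_const)

lemma AT_diff: "AT s p - AT s q = AT s (p - q)"
  by (simp add: AT_def inner_diff_left scaleR_diff_left sum_subtractf)

lemma AT_bound: "\<exists>K. \<forall>s p. norm (AT s p) \<le> K * norm p"
proof -
  obtain K where K: "\<And>s h. norm (A s h) \<le> K * norm h" using A_bdd by blast
  have "norm (AT s p) \<le> (\<Sum>b\<in>(Basis::'a set). norm p * K)" for s p
    unfolding AT_def
  proof (rule order_trans[OF norm_sum], rule sum_mono)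
    fix b :: 'a assume b: "b \<in> Basis"
    have "\<bar>p \<bullet> A s b\<bar> \<le> norm p * norm (A s b)" by (rule Cauchy_Schwarz_ineq2)
    also have "\<dots> \<le> norm p * K" using K[of s b] b by (intro mult_left_mono) auto
    finally show "norm ((p \<bullet> A s b) *\<^sub>R b) \<le> norm p * K" using b by simp
  qed
  then show ?thesis by (intro exI[of _ "real (card (Basis::'a set)) * K"]) (simp add: mult.commute mult.left_commute)
qed

lemma costate_exists: "\<exists>q. continuous_on UNIV q \<and> bounded (range q) \<and> (\<forall>t\<in>{0..T}. q t = IL t T (\<lambda>s. AT s (mm s + q s)))"
proof -
  obtain K where K: "\<And>s p. norm (AT s p) \<le> K * norm p" using AT_bound by blast
  have "\<exists>q. continuous_on UNIV q \<and> bounded (range q) \<and> (\<forall>t\<in>{0..T}. q t = 0 + IL t T (\<lambda>s. AT s (mm s + q s)))"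
    by (rule ode_exists_backward[where L=K])
      (use T K in \<open>auto simp: AT_diff intro!: AT_bdd_meas bdd_meas_add mm_bdd_meas\<close>)
  then show ?thesis by simp
qed

definition "qq = (SOME q. continuous_on UNIV q \<and> bounded (range q) \<and> (\<forall>t\<in>{0..T}. q t = IL t T (\<lambda>s. AT s (mm s + q s))))"

lemma qq: "continuous_on UNIV qq" "bounded (range qq)" "t \<in> {0..T} \<Longrightarrow> qq t = IL t T (\<lambda>s. AT s (mm s + qq s))"
  using someI_ex[OF costate_exists] unfolding qq_def[symmetric] by auto

definition "ph t = mm t + qq t"

text \<open>\<open>ph\<close> is the left continuous version of the costate on \<open>[0,T]\<close>; the convention
  \<open>p(T+) = p(T)\<close> requires the value at \<open>T\<close> to be changed by the atom of \<open>\<mu>\<close> there.\<close>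

definition "costate t = (if t = T then l1 else ph t)"

lemma qq_bdd_meas: "bdd_meas qq" using qq by (intro bdd_meas_cont)
lemma ph_bdd_meas: "bdd_meas ph" unfolding ph_def by (intro bdd_meas_add mm_bdd_meas qq_bdd_meas)
lemma ATph: "bdd_meas (\<lambda>s. AT s (ph s))" by (intro AT_bdd_meas ph_bdd_meas)
lemma qq_ph: "t \<in> {0..T} \<Longrightarrow> qq t = IL t T (\<lambda>s. AT s (ph s))" using qq(3) by (simp add: ph_def)

text \<open>Integration by parts against the costate: the pairing of \<zeta> with the terminal value
  and with \<gamma> d\<mu> is expressed by the initial value and the source alone. Writing \<zeta>
  as the integral of its density and exchanging integrals replaces a product rule for functions of
  bounded variation.\<close>

lemma duality:
  assumes \<zeta>: "bdd_meas \<zeta>" "\<And>t. t \<in> {0..T} \<Longrightarrow> \<zeta> t = a + IL 0 t (\<lambda>s. A s (\<zeta> s) + \<sigma> s)" and \<sigma>: "bdd_meas \<sigma>"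
  shows "l1 \<bullet> \<zeta> T + (\<integral>\<tau>. \<gamma> \<tau> \<bullet> \<zeta> \<tau> \<partial>\<mu>) = ph 0 \<bullet> a + IL 0 T (\<lambda>s. ph s \<bullet> \<sigma> s)"
proof -
  define d where "d s = A s (\<zeta> s) + \<sigma> s" for s
  have d: "bdd_meas d" unfolding d_def by (intro bdd_meas_add A_meas \<zeta> \<sigma>)
  have T0: "T \<in> {0..T}" "0 \<in> {0..T}" using T by auto
  have \<gamma>\<mu>: "\<gamma> \<in> borel_measurable \<mu>" by (rule \<mu>_borel[OF \<gamma>_meas])
  have idm: "(\<lambda>t. t) \<in> borel_measurable \<mu>" by (rule \<mu>_borel) simp
  have g0: "gint {0..} = (\<integral>\<tau>. \<gamma> \<tau> \<partial>\<mu>)"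
    unfolding gint_def by (intro Bochner_Integration.integral_cong) (auto simp: \<mu>_space)
  have \<gamma>int: "integrable \<mu> \<gamma>" using \<gamma>\<mu> Kg by (intro \<mu>.integrable_const_bound[where B=Kg]) auto
  obtain Kd where Kd: "\<And>t. norm (d t) \<le> Kd" using d by (auto simp: bdd_meas_def)
  have Dc: "continuous_on {0..T} (\<lambda>t. IL 0 t d)" by (rule IL_continuous[OF d])
  have Dint: "integrable \<mu> (\<lambda>\<tau>. \<gamma> \<tau> \<bullet> IL 0 \<tau> d)"
  proof (rule \<mu>.integrable_const_bound[where B="Kg * (Kd * T)"])
    show "AE \<tau> in \<mu>. norm (\<gamma> \<tau> \<bullet> IL 0 \<tau> d) \<le> Kg * (Kd * T)"
    proof (rule AE_I2)
      fix \<tau> assume "\<tau> \<in> space \<mu>"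
      then have \<tau>: "0 \<le> \<tau>" "\<tau> \<le> T" by (auto simp: \<mu>_space)
      have Kd0: "0 \<le> Kd" using norm_ge_zero Kd order_trans by blast
      have "norm (IL 0 \<tau> d) \<le> Kd * (\<tau> - 0)" by (rule IL_norm_bound[OF d]) (use Kd \<tau> in auto)
      also have "\<dots> \<le> Kd * T" using \<tau> Kd0 by (intro mult_left_mono) auto
      finally have *: "norm (IL 0 \<tau> d) \<le> Kd * T" .
      have "norm (\<gamma> \<tau> \<bullet> IL 0 \<tau> d) \<le> norm (\<gamma> \<tau>) * norm (IL 0 \<tau> d)" by (simp add: Cauchy_Schwarz_ineq2)
      also have "\<dots> \<le> Kg * (Kd * T)" using * Kg by (intro mult_mono) auto
      finally show "norm (\<gamma> \<tau> \<bullet> IL 0 \<tau> d) \<le> Kg * (Kd * T)" .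
    qed
    have "(\<lambda>t. IL 0 (clamp_to T t) d) \<in> borel_measurable borel"
      using clamp_compose(1)[OF Dc] T by (intro borel_measurable_continuous_onI) auto
    then have "(\<lambda>t. \<gamma> t \<bullet> IL 0 (clamp_to T t) d) \<in> borel_measurable \<mu>"
      using \<gamma>_meas by (intro \<mu>_borel) measurable
    then show "(\<lambda>\<tau>. \<gamma> \<tau> \<bullet> IL 0 \<tau> d) \<in> borel_measurable \<mu>"
      by (rule measurable_cong[THEN iffD1, rotated]) (simp add: \<mu>_space)
  qed
  have "(\<integral>\<tau>. \<gamma> \<tau> \<bullet> \<zeta> \<tau> \<partial>\<mu>) = (\<integral>\<tau>. \<gamma> \<tau> \<bullet> a + \<gamma> \<tau> \<bullet> IL 0 \<tau> d \<partial>\<mu>)"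
    using \<zeta>(2) by (intro Bochner_Integration.integral_cong) (auto simp: \<mu>_space d_def[abs_def] inner_add_right)
  also have "\<dots> = (\<integral>\<tau>. \<gamma> \<tau> \<partial>\<mu>) \<bullet> a + (\<integral>\<tau>. \<gamma> \<tau> \<bullet> IL 0 \<tau> d \<partial>\<mu>)"
    using \<gamma>int Dint by simp
  also have "(\<integral>\<tau>. \<gamma> \<tau> \<bullet> IL 0 \<tau> d \<partial>\<mu>) = IL 0 T (\<lambda>s. gint {s..} \<bullet> d s)"
    unfolding gint_def by (rule Fubini_Volterra[OF \<mu>_fin idm \<mu>_space \<gamma>\<mu> Kg(2) d])
  finally have 1: "(\<integral>\<tau>. \<gamma> \<tau> \<bullet> \<zeta> \<tau> \<partial>\<mu>) = gint {0..} \<bullet> a + IL 0 T (\<lambda>s. gint {s..} \<bullet> d s)" using g0 by simp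
  have 2: "l1 \<bullet> \<zeta> T = l1 \<bullet> a + IL 0 T (\<lambda>s. l1 \<bullet> d s)"
    using \<zeta>(2)[OF T0(1)] by (simp add: d_def[symmetric] IL_inner[OF d] inner_add_right)
  have gm: "bdd_meas (\<lambda>s. gint {s..})"
    using bdd_meas_diff[OF mm_bdd_meas bdd_meas_const[of l1]] by (simp add: mm_def)
  have 3: "l1 \<bullet> \<zeta> T + (\<integral>\<tau>. \<gamma> \<tau> \<bullet> \<zeta> \<tau> \<partial>\<mu>) = mm 0 \<bullet> a + IL 0 T (\<lambda>s. mm s \<bullet> d s)"
    unfolding 1 2 mm_def
    by (simp add: inner_add_left IL_add bdd_meas_inner gm d bdd_meas_const)
  define r where "r s = AT s (ph s)" for s
  have r: "bdd_meas r" unfolding r_def by (rule ATph)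
  obtain Kr where Kr: "\<And>t. norm (r t) \<le> Kr" using r by (auto simp: bdd_meas_def)
  \<comment> \<open>\<open>qq s\<close> is a tail integral with respect to Lebesgue measure, so the
    exchange of integrals applies once more, now with the density \<open>r\<close> as
    weight.\<close>
  have "IL 0 T (\<lambda>s. qq s \<bullet> d s) = IL 0 T (\<lambda>s. (IL 0 T (\<lambda>\<tau>. indicat_real {s..} \<tau> *\<^sub>R r \<tau>)) \<bullet> d s)"
  proof (rule IL_cong)
    fix s assume s: "s \<in> {0..T}"
    have "IL 0 T (\<lambda>\<tau>. indicat_real {s..} \<tau> *\<^sub>R r \<tau>) = IL 0 T (\<lambda>\<tau>. if \<tau> \<in> {s..T} then r \<tau> else 0)"
      by (intro IL_cong) (auto simp: indicator_def)
    also have "\<dots> = IL s T r"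
      using s by (intro IL_restrict) auto
    finally show "qq s \<bullet> d s = IL 0 T (\<lambda>\<tau>. indicat_real {s..} \<tau> *\<^sub>R r \<tau>) \<bullet> d s"
      using qq_ph[OF s] by (simp add: r_def[abs_def])
  qed
  also have "\<dots> = IL 0 T (\<lambda>\<tau>. r \<tau> \<bullet> IL 0 \<tau> d)"
  proof (rule Fubini_Volterra[symmetric, OF _ _ _ _ Kr d])
    show "finite_measure (lebesgue_on {0..T})" by (rule finite_measure_lebesgue_on) auto
    show "(\<lambda>t. t) \<in> borel_measurable (lebesgue_on {0..T})"
      by (intro measurable_restrict_space1 measurable_completion) simp
  qed (auto intro: bdd_meas_on r)
  also have "\<dots> = IL 0 T (\<lambda>\<tau>. r \<tau> \<bullet> \<zeta> \<tau> - r \<tau> \<bullet> a)"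
    using \<zeta>(2) by (intro IL_cong) (auto simp: d_def[abs_def] inner_diff_right inner_add_right)
  also have "\<dots> = IL 0 T (\<lambda>\<tau>. r \<tau> \<bullet> \<zeta> \<tau>) - IL 0 T (\<lambda>\<tau>. a \<bullet> r \<tau>)"
    by (subst IL_diff) (auto intro!: bdd_meas_inner r \<zeta> bdd_meas_const simp: inner_commute)
  also have "IL 0 T (\<lambda>\<tau>. a \<bullet> r \<tau>) = qq 0 \<bullet> a"
    unfolding r_def using qq_ph[OF T0(2)] IL_inner[OF ATph] by (simp add: inner_commute)
  finally have 4: "IL 0 T (\<lambda>s. qq s \<bullet> d s) = IL 0 T (\<lambda>\<tau>. ph \<tau> \<bullet> A \<tau> (\<zeta> \<tau>)) - qq 0 \<bullet> a"
    by (simp add: r_def AT_inner)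
  have "IL 0 T (\<lambda>s. mm s \<bullet> d s) + IL 0 T (\<lambda>s. qq s \<bullet> d s) = IL 0 T (\<lambda>s. ph s \<bullet> d s)"
    by (subst IL_add[symmetric]) (auto intro!: bdd_meas_inner mm_bdd_meas qq_bdd_meas d simp: ph_def inner_add_left)
  also have "\<dots> = IL 0 T (\<lambda>\<tau>. ph \<tau> \<bullet> A \<tau> (\<zeta> \<tau>)) + IL 0 T (\<lambda>s. ph s \<bullet> \<sigma> s)"
    by (subst IL_add[symmetric]) (auto intro!: bdd_meas_inner ph_bdd_meas A_meas \<zeta> \<sigma> simp: d_def inner_add_right)
  finally show ?thesis using 3 4 by (simp add: ph_def inner_add_left)
qed

end

section \<open>One-sided values, jumps and variation of the costate\<close>

context linear_system
begin

lemma costate_end: "costate T = l1" by (simp add: costate_def)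
lemma costate_0: "costate 0 = ph 0" using T by (simp add: costate_def)
lemma costate_ph: "t \<noteq> T \<Longrightarrow> costate t = ph t" by (simp add: costate_def)

lemma qq_T: "qq T = 0"
proof -
  have "T \<in> {0..T}" using T by simp
  moreover have "IL T T (\<lambda>s. AT s (ph s)) = 0" using IL_combine[OF ATph, of T T T] by simp
  ultimately show ?thesis using qq_ph by metis
qed

lemma left_value_costate:
  assumes s: "0 \<le> s" "s \<le> T" shows "left_value costate s = ph s"
proof (cases "0 < s")
  case True
  have "(qq \<longlongrightarrow> qq s) (at_left s)"
    using qq(1) by (metis UNIV_I continuous_on_def filterlim_at_split)
  then have "((\<lambda>t. mm t + qq t) \<longlongrightarrow> mm s + qq s) (at_left s)"
    unfolding mm_def by (intro tendsto_intros gint_left)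
  moreover have "\<forall>\<^sub>F t in at_left s. mm t + qq t = costate t"
    unfolding eventually_at_left[OF True] using s by (intro exI[of _ 0]) (auto simp: True costate_def ph_def)
  ultimately have "(costate \<longlongrightarrow> ph s) (at_left s)" unfolding ph_def by (rule Lim_transform_eventually)
  then show ?thesis using True by (simp add: left_value_def tendsto_Lim)
next
  case False
  then show ?thesis using s by (simp add: left_value_def costate_0)
qed

lemma right_value_costate:
  assumes s: "0 \<le> s" "s \<le> T" shows "right_value T costate s = l1 + gint {s<..} + qq s"
proof (cases "s < T")
  case True
  have "(qq \<longlongrightarrow> qq s) (at_right s)"
    using qq(1) by (metis UNIV_I continuous_on_def filterlim_at_split)
  then have "((\<lambda>t. mm t + qq t) \<longlongrightarrow> (l1 + gint {s<..}) + qq s) (at_right s)"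
    unfolding mm_def by (intro tendsto_intros gint_right)
  moreover have "\<forall>\<^sub>F t in at_right s. mm t + qq t = costate t"
    by (auto simp: eventually_at_right[OF True] costate_def ph_def intro!: exI[of _ T] True)
  ultimately have "(costate \<longlongrightarrow> l1 + gint {s<..} + qq s) (at_right s)" by (rule Lim_transform_eventually)
  then show ?thesis using True by (simp add: right_value_def tendsto_Lim)
next
  case False
  then have "s = T" using s by simp
  \<comment> \<open>At T the convention for the right value agrees with the general formula, because
    \<open>\<mu>\<close> lives on [0,T] and \<open>qq\<close> vanishes at T.\<close>
  moreover have "gint {T<..} = 0"
    using gint_norm[of "{T<..}"] by (simp add: greaterThan_Int_greaterThan[symmetric] disjoint_iff Int_def cong: conj_cong)
  ultimately show ?thesis by (simp add: right_value_def costate_end qq_T)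
qed

lemma costate_jump:
  assumes st: "0 \<le> s" "s \<le> t" "t \<le> T"
  shows "- (right_value T costate t - left_value costate s) = gint {s..t} + IL s t (\<lambda>s. AT s (ph s))"
proof -
  have "{s..} = {s..t} \<union> {t<..}" using st by auto
  then have "gint {s..} = gint {s..t} + gint {t<..}" by (simp add: gint_Un Int_def)
  moreover have "qq s = qq t + IL s t (\<lambda>s. AT s (ph s))"
    using qq_ph[of s] qq_ph[of t] IL_combine[OF ATph, of s t T] st by simp
  ultimately show ?thesis
    using st by (simp add: left_value_costate right_value_costate ph_def mm_def)
qed

lemma costate_equation_A:
  assumes st: "0 \<le> s" "s \<le> t" "t \<le> T"
  shows "- ((right_value T costate t - left_value costate s) \<bullet> h) =
    IL s t (\<lambda>\<tau>. costate \<tau> \<bullet> A \<tau> h) + (LINT \<tau>:{s..t}|\<mu>. \<gamma> \<tau> \<bullet> h)"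
proof -
  have "- ((right_value T costate t - left_value costate s) \<bullet> h) = (gint {s..t} + IL s t (\<lambda>s. AT s (ph s))) \<bullet> h"
    using costate_jump[OF st] by (metis inner_minus_left)
  also have "\<dots> = gint {s..t} \<bullet> h + IL s t (\<lambda>s. h \<bullet> AT s (ph s))"
    by (simp add: inner_add_left inner_add_right IL_inner[OF ATph] inner_commute)
  also have "IL s t (\<lambda>\<tau>. h \<bullet> AT \<tau> (ph \<tau>)) = IL s t (\<lambda>\<tau>. costate \<tau> \<bullet> A \<tau> h)"
  proof -
    have 1: "IL s t (\<lambda>\<tau>. h \<bullet> AT \<tau> (ph \<tau>)) = integral {s..t} (\<lambda>\<tau>. ph \<tau> \<bullet> A \<tau> h)"
      by (subst IL_eq_integral) (auto intro!: bdd_meas_inner bdd_meas_const ATph ph_bdd_meas A_meas simp: AT_inner inner_commute[of h])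
    have "bdd_meas (\<lambda>\<tau>. ph \<tau> \<bullet> A \<tau> h)" by (intro bdd_meas_inner ph_bdd_meas A_meas bdd_meas_const)
    then have 2: "integral {s..t} (\<lambda>\<tau>. ph \<tau> \<bullet> A \<tau> h) = IL s t (\<lambda>\<tau>. ph \<tau> \<bullet> A \<tau> h)" by (simp add: IL_eq_integral)
    \<comment> \<open>Changing the value at T does not affect Lebesgue integrals; the change matters
      only for one-sided values and for the condition at T.\<close>
    have 3: "IL s t (\<lambda>\<tau>. ph \<tau> \<bullet> A \<tau> h) = IL s t (\<lambda>\<tau>. costate \<tau> \<bullet> A \<tau> h)"
    proof (rule integral_cong_AE)
      have "AE \<tau> in lebesgue. \<tau> \<noteq> T" by (rule AE_I'[of "{T}"]) auto
      then have "AE \<tau> in lebesgue_on {s..t}. \<tau> \<noteq> T" by (auto simp: AE_restrict_space_iff)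
      then show "AE \<tau> in lebesgue_on {s..t}. ph \<tau> \<bullet> A \<tau> h = costate \<tau> \<bullet> A \<tau> h"
        by eventually_elim (simp add: costate_ph)
      show "(\<lambda>\<tau>. ph \<tau> \<bullet> A \<tau> h) \<in> borel_measurable (lebesgue_on {s..t})"
        by (intro bdd_meas_on bdd_meas_inner ph_bdd_meas A_meas bdd_meas_const)
      have [measurable]: "ph \<in> borel_measurable lebesgue" by (rule bdd_measD[OF ph_bdd_meas])
      have [measurable]: "(\<lambda>t::real. t) \<in> borel_measurable lebesgue" by (rule measurable_completion) simp
      have "costate \<in> borel_measurable lebesgue" unfolding costate_def[abs_def] by measurable
      then have "costate \<in> borel_measurable (lebesgue_on {s..t})" by (rule measurable_restrict_space1)
      moreover have "(\<lambda>\<tau>. A \<tau> h) \<in> borel_measurable (lebesgue_on {s..t})" by (intro bdd_meas_on A_meas bdd_meas_const)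
      ultimately show "(\<lambda>\<tau>. costate \<tau> \<bullet> A \<tau> h) \<in> borel_measurable (lebesgue_on {s..t})" by (rule borel_measurable_inner)
    qed
    show ?thesis using 1 2 3 by simp
  qed
  also have "gint {s..t} \<bullet> h = (LINT \<tau>:{s..t}|\<mu>. \<gamma> \<tau> \<bullet> h)"
    unfolding gint_def set_lebesgue_integral_def by (subst integral_inner_left[symmetric]) (auto intro: ind_int)
  finally show ?thesis by simp
qed

text \<open>Each increment is dominated by the increment of \<open>W\<close>, so the sums telescope.
  \<open>W\<close> collects the mass of \<open>\<mu>\<close> on [0,t), a linear part for the
  absolutely continuous term, and the jump \<open>J\<close> that appears at T, where the left
  continuous version is replaced by \<open>l1\<close>.\<close>

lemma costate_bounded_variation: "bounded_variation_on 0 T costate"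
proof -
  obtain Kr where Kr: "\<And>t. norm (AT t (ph t)) \<le> Kr" using ATph by (auto simp: bdd_meas_def)
  define J where "J = norm (gint {T..})"
  define W where "W t = Kg * measure \<mu> {0..<t} + Kr * t + (if t = T then J else 0)" for t
  have sm: "{a..<b} \<inter> {0..T} \<in> sets \<mu>" for a b by (simp add: \<mu>_sets sets_restrict_space_iff)
  have step: "norm (costate t - costate s) \<le> W t - W s" if st: "0 \<le> s" "s \<le> t" "t \<le> T" for s t
  proof -
    have ph: "norm (ph t - ph s) \<le> Kg * measure \<mu> {s..<t} + Kr * (t - s)"
    proof -
      have "{s..} = {s..<t} \<union> {t..}" using st by auto
      then have "gint {s..} = gint {s..<t} + gint {t..}" by (simp add: gint_Un Int_def)
      moreover have "qq s = qq t + IL s t (\<lambda>s. AT s (ph s))"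
        using qq_ph[of s] qq_ph[of t] IL_combine[OF ATph, of s t T] st by simp
      ultimately have eq: "ph t - ph s = - (gint {s..<t} + IL s t (\<lambda>s. AT s (ph s)))" by (simp add: ph_def mm_def)
      have "norm (ph t - ph s) \<le> norm (gint {s..<t}) + norm (IL s t (\<lambda>s. AT s (ph s)))"
        unfolding eq norm_minus_cancel by (rule norm_triangle_ineq)
      moreover have "norm (IL s t (\<lambda>s. AT s (ph s))) \<le> Kr * (t - s)"
        by (rule IL_norm_bound[OF ATph]) (use Kr st in auto)
      moreover have "{s..<t} \<inter> {0..T} = {s..<t}" using st by auto
      then have "norm (gint {s..<t}) \<le> Kg * measure \<mu> {s..<t}" using gint_norm[of "{s..<t}"] by simp
      ultimately show ?thesis by linarith
    qed
    have m: "measure \<mu> {0..<t} = measure \<mu> {0..<s} + measure \<mu> {s..<t}"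
    proof -
      have e: "{0..<s} \<inter> {0..T} = {0..<s}" "{s..<t} \<inter> {0..T} = {s..<t}" "{0..<t} = {0..<s} \<union> {s..<t}" using st by auto
      show ?thesis unfolding e(3)
        using sm[of 0 s] sm[of s t] unfolding e(1,2) by (intro \<mu>.finite_measure_Union) auto
    qed
    have W: "W t - W s = Kg * measure \<mu> {s..<t} + Kr * (t - s) + ((if t = T then J else 0) - (if s = T then J else 0))"
      by (simp add: W_def m algebra_simps)
    show ?thesis
    proof (cases "s = t")
      case False
      then have sT: "s \<noteq> T" using st by simp
      show ?thesis
      proof (cases "t = T")
        case True
        have "costate t - costate s = (ph t - ph s) - gint {T..}"
          using True sT by (simp add: costate_def ph_def mm_def qq_T)
        then have "norm (costate t - costate s) \<le> norm (ph t - ph s) + J" unfolding J_def by (metis norm_triangle_ineq4)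
        then show ?thesis using ph W True sT by simp
      next
        case False
        then show ?thesis using ph W sT by (simp add: costate_def)
      qed
    qed simp
  qed
  show ?thesis
    unfolding bounded_variation_on_def
  proof (intro exI allI impI)
    fix N and s :: "nat \<Rightarrow> real"
    assume s: "(\<forall>i\<le>N. s i \<in> {0..T}) \<and> (\<forall>i<N. s i \<le> s (Suc i))"
    have Wle: "W 0 \<le> W a \<and> W a \<le> W T" if "a \<in> {0..T}" for a
      using step[of 0 a] step[of a T] that norm_ge_zero[of "costate a - costate 0"] norm_ge_zero[of "costate T - costate a"]
      by (smt (verit) atLeastAtMost_iff)
    have "(\<Sum>i<N. norm (costate (s (Suc i)) - costate (s i))) \<le> (\<Sum>i<N. W (s (Suc i)) - W (s i))"
      using s by (intro sum_mono step) auto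
    also have "\<dots> = W (s N) - W (s 0)" by (rule sum_lessThan_telescope)
    also have "\<dots> \<le> W T - W 0" using Wle[of "s N"] Wle[of "s 0"] s by auto
    finally show "(\<Sum>i<N. norm (costate (s (Suc i)) - costate (s i))) \<le> W T - W 0" .
  qed
qed

end

section \<open>Second order expansion of trajectories\<close>

text \<open>An argument error of size \<open>\<delta> * e\<^sup>2\<close> is written as
  \<open>e\<^sup>2 *\<^sub>R \<delta> *\<^sub>R k\<close> with \<open>norm k \<le> 1\<close> and
  absorbed into \<zeta>. Only the linear term in \<zeta> changes, by at most \<open>\<delta>\<close>
  times a bound on the first derivative.\<close>

lemma C2_expansion_perturbed:
  fixes h :: "'a::euclidean_space \<Rightarrow> 'b::euclidean_space"
  assumes C: "C2 h" and K: "compact K" and \<eta>: "\<eta> > 0" and R: "R > 0"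
  shows "\<exists>e0>0. \<exists>\<delta>>0. \<forall>e x z \<zeta> y. 0 < e \<longrightarrow> e < e0 \<longrightarrow> x \<in> K \<longrightarrow> norm z \<le> R \<longrightarrow> norm \<zeta> \<le> R \<longrightarrow>
    norm (y - x - e *\<^sub>R z - e\<^sup>2 *\<^sub>R \<zeta>) \<le> \<delta> * e\<^sup>2 \<longrightarrow>
    norm (h y - h x - e *\<^sub>R frechet_derivative h (at x) z
      - e\<^sup>2 *\<^sub>R (frechet_derivative h (at x) \<zeta> + (1/2) *\<^sub>R second_derivative h x z z)) \<le> \<eta> * e\<^sup>2"
proof -
  obtain e0 where e0: "e0 > 0" "\<And>e x z \<zeta>. 0 < e \<Longrightarrow> e < e0 \<Longrightarrow> x \<in> K \<Longrightarrow> norm z \<le> R + 1 \<Longrightarrow> norm \<zeta> \<le> R + 1 \<Longrightarrow>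
    norm (h (x + e *\<^sub>R z + e\<^sup>2 *\<^sub>R \<zeta>) - h x - e *\<^sub>R frechet_derivative h (at x) z
      - e\<^sup>2 *\<^sub>R (frechet_derivative h (at x) \<zeta> + (1/2) *\<^sub>R second_derivative h x z z)) \<le> \<eta> / 2 * e\<^sup>2"
    using C2_expansion[OF C K, of "\<eta>/2" "R+1"] \<eta> R by auto
  have "bounded ((\<lambda>p. frechet_derivative h (at (fst p)) (snd p)) ` (K \<times> cball 0 1))"
    by (intro compact_imp_bounded compact_continuous_image C2_D_continuous C compact_Times K compact_cball)
  then obtain M where M0: "M > 0" "\<And>y. y \<in> (\<lambda>p. frechet_derivative h (at (fst p)) (snd p)) ` (K \<times> cball 0 1) \<Longrightarrow> norm y \<le> M"
    unfolding bounded_pos by blast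
  have M: "norm (frechet_derivative h (at x) k) \<le> M" if "x \<in> K" "norm k \<le> 1" for x k
    using that by (auto intro!: M0 image_eqI[of _ _ "(x, k)"])
  define \<delta> where "\<delta> = min 1 (\<eta> / (2 * M))"
  have \<delta>: "\<delta> > 0" "\<delta> \<le> 1" "\<delta> * M \<le> \<eta> / 2" using \<eta> M0(1) by (auto simp: \<delta>_def min_def field_simps)
  have "norm (h y - h x - e *\<^sub>R frechet_derivative h (at x) z
      - e\<^sup>2 *\<^sub>R (frechet_derivative h (at x) \<zeta> + (1/2) *\<^sub>R second_derivative h x z z)) \<le> \<eta> * e\<^sup>2"
    if e: "0 < e" "e < e0" and x: "x \<in> K" "norm z \<le> R" "norm \<zeta> \<le> R" "norm (y - x - e *\<^sub>R z - e\<^sup>2 *\<^sub>R \<zeta>) \<le> \<delta> * e\<^sup>2" for e x z \<zeta> y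
  proof -
    define D where "D = frechet_derivative h (at x)"
    have D: "bounded_linear D" unfolding D_def by (rule C2_D_linear[OF C])
    define k where "k = (1 / (\<delta> * e\<^sup>2)) *\<^sub>R (y - x - e *\<^sub>R z - e\<^sup>2 *\<^sub>R \<zeta>)"
    have k: "norm k \<le> 1" using x(4) e \<delta> by (simp add: k_def divide_simps)
    have ky: "y = x + e *\<^sub>R z + e\<^sup>2 *\<^sub>R (\<zeta> + \<delta> *\<^sub>R k)" using e \<delta> by (simp add: k_def scaleR_add_right mult.commute)
    have "norm (\<delta> *\<^sub>R k) \<le> 1" using k \<delta> by (simp add: mult_le_one)
    then have n: "norm (\<zeta> + \<delta> *\<^sub>R k) \<le> R + 1" using x(3) by (intro norm_triangle_le) auto
    have 1: "norm (h y - h x - e *\<^sub>R D z - e\<^sup>2 *\<^sub>R (D (\<zeta> + \<delta> *\<^sub>R k) + (1/2) *\<^sub>R second_derivative h x z z)) \<le> \<eta> / 2 * e\<^sup>2"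
      unfolding ky D_def by (rule e0) (use e x n in auto)
    have "norm (D k) \<le> M" unfolding D_def by (rule M) (use x k in auto)
    then have "\<delta> * norm (D k) \<le> \<delta> * M" using \<delta> by (intro mult_left_mono) auto
    then have "\<delta> * norm (D k) \<le> \<eta> / 2" using \<delta>(3) by simp
    then have 2: "norm (e\<^sup>2 *\<^sub>R \<delta> *\<^sub>R D k) \<le> \<eta> / 2 * e\<^sup>2" using \<delta>(1) mult_left_mono[of "\<delta> * norm (D k)" "\<eta>/2" "e\<^sup>2"] by (simp add: mult.commute mult.left_commute)
    have "D (\<zeta> + \<delta> *\<^sub>R k) = D \<zeta> + \<delta> *\<^sub>R D k" using D by (simp add: bounded_linear.linear linear_add linear_cmul)
    then have eq: "h y - h x - e *\<^sub>R D z - e\<^sup>2 *\<^sub>R (D \<zeta> + (1/2) *\<^sub>R second_derivative h x z z)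
      = (h y - h x - e *\<^sub>R D z - e\<^sup>2 *\<^sub>R (D (\<zeta> + \<delta> *\<^sub>R k) + (1/2) *\<^sub>R second_derivative h x z z)) + e\<^sup>2 *\<^sub>R \<delta> *\<^sub>R D k"
      by (simp add: scaleR_add_right)
    have "norm (h y - h x - e *\<^sub>R D z - e\<^sup>2 *\<^sub>R (D \<zeta> + (1/2) *\<^sub>R second_derivative h x z z)) \<le> \<eta> / 2 * e\<^sup>2 + \<eta> / 2 * e\<^sup>2"
      unfolding eq by (rule order_trans[OF norm_triangle_ineq add_mono[OF 1 2]])
    then show ?thesis by (simp add: D_def)
  qed
  then show ?thesis using e0(1) \<delta>(1) by blast
qed

text \<open>The stability estimate behind the comparisons of trajectories: \<open>\<rho>0\<close> is
  the error in the initial value and \<open>\<rho>\<close> the defect in the right-hand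
  side.\<close>

lemma integral_equation_compare:
  fixes y1 y2 :: "real \<Rightarrow> 'a::euclidean_space"
  assumes L: "L > 0" and c: "continuous_on {0..T} y1" "continuous_on {0..T} y2" and d: "bdd_meas d1" "bdd_meas d2"
    and y1: "\<And>t. t \<in> {0..T} \<Longrightarrow> y1 t = a1 + IL 0 t d1" and y2: "\<And>t. t \<in> {0..T} \<Longrightarrow> y2 t = a2 + IL 0 t d2"
    and le: "\<And>s. s \<in> {0..T} \<Longrightarrow> norm (d1 s - d2 s) \<le> L * norm (y1 s - y2 s) + \<rho>" and a: "norm (a1 - a2) \<le> \<rho>0"
    and \<rho>: "\<rho> \<ge> 0" and t: "t \<in> {0..T}"
  shows "norm (y1 t - y2 t) \<le> 2 * (\<rho>0 + \<rho> * T) * exp (2 * L * T)"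
proof (rule Gronwall[OF _ L _ _ t])
  show dc: "continuous_on {0..T} (\<lambda>t. norm (y1 t - y2 t))" by (intro continuous_intros c)
  show "0 \<le> \<rho>0 + \<rho> * T" using a \<rho> t order_trans[OF norm_ge_zero a] by auto
  fix t assume t: "t \<in> {0..T}"
  define n where "n = (\<lambda>s. norm (y1 (clamp_to T s) - y2 (clamp_to T s)))"
  have n: "bdd_meas n" unfolding n_def using t by (intro bdd_meas_clamp[OF dc]) auto
  have "y1 t - y2 t = (a1 - a2) + IL 0 t (\<lambda>s. d1 s - d2 s)"
    using y1[OF t] y2[OF t] by (simp add: IL_diff d)
  then have "norm (y1 t - y2 t) \<le> \<rho>0 + norm (IL 0 t (\<lambda>s. d1 s - d2 s))"
    using a norm_triangle_mono[OF a order_refl] by metis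
  also have "norm (IL 0 t (\<lambda>s. d1 s - d2 s)) \<le> IL 0 t (\<lambda>s. L * n s + \<rho>)"
  proof (rule IL_norm_le)
    show "AE s in lebesgue_on {0..t}. norm (d1 s - d2 s) \<le> L * n s + \<rho>"
      using le t by (intro AE_I2) (auto simp: n_def)
  qed (intro bdd_meas_diff d bdd_meas_add bdd_meas_mult bdd_meas_const n)+
  also have "\<dots> = L * IL 0 t n + IL 0 t (\<lambda>s. \<rho>)"
    by (subst IL_add) (auto intro!: bdd_meas_mult bdd_meas_const n)
  also have "IL 0 t (\<lambda>s. \<rho>) = t * \<rho>" using t by (subst IL_const) auto
  also have "IL 0 t n = IL 0 t (\<lambda>s. norm (y1 s - y2 s))" using t by (intro IL_cong) (auto simp: n_def)
  also have "t * \<rho> \<le> \<rho> * T" using t \<rho> by (simp add: mult.commute[of t] mult_left_mono)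
  finally show "norm (y1 t - y2 t) \<le> \<rho>0 + \<rho> * T + L * IL 0 t (\<lambda>s. norm (y1 s - y2 s))" by simp
qed

section \<open>Second order perturbations of a controlled path\<close>

locale control_path =
  fixes T :: real and F0 F1 :: "'a::euclidean_space \<Rightarrow> 'a" and x z :: "real \<Rightarrow> 'a" and u v :: "real \<Rightarrow> real"
  assumes T: "0 < T"
    and C2F: "C2 F0" "C2 F1" and Lip: "\<exists>L. L-lipschitz_on UNIV F0" "\<exists>L. L-lipschitz_on UNIV F1"
    and xc: "continuous_on UNIV x" "bounded (range x)" and zc: "continuous_on UNIV z" "bounded (range z)"
    and um: "bdd_meas u" and vm: "bdd_meas v"
    and x_eq: "\<And>t. t \<in> {0..T} \<Longrightarrow> x t = x 0 + IL 0 t (\<lambda>s. F0 (x s) + u s *\<^sub>R F1 (x s))"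
    and z_eq: "\<And>t. t \<in> {0..T} \<Longrightarrow> z t = z 0 + IL 0 t (\<lambda>s. (frechet_derivative F0 (at (x s)) (z s) + u s *\<^sub>R frechet_derivative F1 (at (x s)) (z s)) + v s *\<^sub>R F1 (x s))"
begin

definition "A s h = frechet_derivative F0 (at (x s)) h + u s *\<^sub>R frechet_derivative F1 (at (x s)) h"

text \<open>The e^2 term of F0 + (u + e v) F1 at x + e z. Together with
  \<open>A s (\<zeta> s)\<close> and \<open>w s *\<^sub>R F1 (x s)\<close> it is the whole e^2
  coefficient of the perturbed right-hand side.\<close>

definition "Src s = (1/2) *\<^sub>R second_derivative F0 (x s) (z s) (z s) + (u s / 2) *\<^sub>R second_derivative F1 (x s) (z s) (z s)
   + v s *\<^sub>R frechet_derivative F1 (at (x s)) (z s)"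

lemma xm: "bdd_meas x" using xc by (rule bdd_meas_cont)
lemma zm: "bdd_meas z" using zc by (rule bdd_meas_cont)

lemma DF_meas:
  assumes "bdd_meas y"
  shows "bdd_meas (\<lambda>s. frechet_derivative F0 (at (x s)) (y s))" "bdd_meas (\<lambda>s. frechet_derivative F1 (at (x s)) (y s))"
  by (rule bdd_meas_compose2[OF xm assms C2_D_continuous[OF C2F(1)]])
     (rule bdd_meas_compose2[OF xm assms C2_D_continuous[OF C2F(2)]])

lemma F_meas: assumes "bdd_meas y" shows "bdd_meas (\<lambda>s. F0 (y s))" "bdd_meas (\<lambda>s. F1 (y s))"
  by (rule bdd_meas_compose[OF assms C2_continuous[OF C2F(1)]], rule bdd_meas_compose[OF assms C2_continuous[OF C2F(2)]])

lemma A_meas: "bdd_meas y \<Longrightarrow> bdd_meas (\<lambda>s. A s (y s))"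
  unfolding A_def by (intro bdd_meas_add bdd_meas_scaleR DF_meas um)

lemma Src_meas: "bdd_meas Src"
proof -
  have "bdd_meas (\<lambda>s. second_derivative F0 (x s) (z s) (z s))" "bdd_meas (\<lambda>s. second_derivative F1 (x s) (z s) (z s))"
    by (rule bdd_meas_compose2[OF xm zm C2_D2_continuous[OF C2F(1)]])
       (rule bdd_meas_compose2[OF xm zm C2_D2_continuous[OF C2F(2)]])
  then show ?thesis unfolding Src_def[abs_def]
    by (intro bdd_meas_add bdd_meas_scaleR bdd_meas_const DF_meas vm zm bdd_meas_compose[OF um]) (auto intro!: continuous_intros)
qed

lemma A_linear: "linear (A s)"
  unfolding A_def[abs_def] using C2_D_linear[OF C2F(1), of "x s"] C2_D_linear[OF C2F(2), of "x s"]
  by (intro bounded_linear.linear bounded_linear_add bounded_linear_scaleR_right[THEN bounded_linear_compose])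

lemma bdd_measE: assumes "bdd_meas f" obtains K where "K > 0" "\<And>t. norm (f t) \<le> K"
proof -
  obtain K where "\<And>t. norm (f t) \<le> K" using assms by (auto simp: bdd_meas_def)
  then have "\<And>t. norm (f t) \<le> \<bar>K\<bar> + 1" by (smt (verit))
  then show ?thesis using that[of "\<bar>K\<bar> + 1"] by auto
qed

text \<open>For each fixed basis vector b the function s |-> A s b is bounded, and there are
  finitely many of them; linearity does the rest, uniformly in s.\<close>

lemma A_bound: "\<exists>K. \<forall>s h. norm (A s h) \<le> K * norm h"
proof -
  define K where "K b = (SOME K. \<forall>s. norm (A s b) \<le> K)" for b :: 'a
  have K: "norm (A s b) \<le> K b" for s b
  proof -
    have "\<exists>K. \<forall>s. norm (A s b) \<le> K" using A_meas[OF bdd_meas_const[of b]] by (auto simp: bdd_meas_def)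
    from someI_ex[OF this] show ?thesis by (simp add: K_def)
  qed
  have "norm (A s h) \<le> (\<Sum>b\<in>Basis. K b) * norm h" for s h
  proof -
    have "A s h = A s (\<Sum>b\<in>Basis. (h \<bullet> b) *\<^sub>R b)" by (simp add: euclidean_representation)
    also have "\<dots> = (\<Sum>b\<in>Basis. (h \<bullet> b) *\<^sub>R A s b)" using A_linear[of s] by (simp add: linear_sum linear_cmul)
    also have "norm \<dots> \<le> (\<Sum>b\<in>Basis. norm h * K b)"
    proof (rule order_trans[OF norm_sum], rule sum_mono)
      fix b :: 'a assume "b \<in> Basis"
      then show "norm ((h \<bullet> b) *\<^sub>R A s b) \<le> norm h * K b"
        unfolding norm_scaleR using K[of s b] by (intro mult_mono) (auto simp: Basis_le_norm)
    qed
    finally show ?thesis by (simp add: sum_distrib_left mult.commute)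
  qed
  then show ?thesis by blast
qed

text \<open>\<zeta> is the e^2 coefficient of the trajectory with control u + e v + e^2 w and
  initial value x(0) + e z(0) + e^2 a. Only the free data a and w are bounded by \<open>R\<close>; a
  bound on \<zeta> is a consequence.\<close>

definition pert :: "real \<Rightarrow> 'a \<Rightarrow> (real \<Rightarrow> real) \<Rightarrow> (real \<Rightarrow> 'a) \<Rightarrow> bool" where
  "pert R a w \<zeta> \<longleftrightarrow> norm a \<le> R \<and> bdd_meas w \<and> (\<forall>t. \<bar>w t\<bar> \<le> R) \<and> bdd_meas \<zeta> \<and> continuous_on {0..T} \<zeta> \<and>
    (\<forall>t\<in>{0..T}. \<zeta> t = a + IL 0 t (\<lambda>s. A s (\<zeta> s) + (w s *\<^sub>R F1 (x s) + Src s)))"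

lemma pert_source_meas: "bdd_meas w \<Longrightarrow> bdd_meas (\<lambda>s. w s *\<^sub>R F1 (x s) + Src s)"
  by (intro bdd_meas_add bdd_meas_scaleR F_meas xm Src_meas)

lemma pert_exists:
  assumes w: "bdd_meas w" "\<And>t. \<bar>w t\<bar> \<le> R" and a: "norm a \<le> R"
  shows "\<exists>\<zeta>. pert R a w \<zeta>"
proof -
  obtain K where K: "\<And>s h. norm (A s h) \<le> K * norm h" using A_bound by blast
  have "\<exists>y. continuous_on UNIV y \<and> bounded (range y) \<and> (\<forall>t\<in>{0..T}. y t = a + IL 0 t (\<lambda>s. A s (y s) + (w s *\<^sub>R F1 (x s) + Src s)))"
  proof (rule ode_exists[where L=K])
    fix s and y y' :: 'a
    show "norm (A s y + (w s *\<^sub>R F1 (x s) + Src s) - (A s y' + (w s *\<^sub>R F1 (x s) + Src s))) \<le> K * norm (y - y')"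
      using K[of s "y - y'"] A_linear[of s] by (simp add: linear_diff)
  qed (use T in \<open>auto intro!: bdd_meas_add A_meas pert_source_meas w\<close>)
  then show ?thesis unfolding pert_def using w a by (meson bdd_meas_cont continuous_on_subset subset_UNIV)
qed

text \<open>The constant depends on \<open>R\<close> and on the fixed path, not on the individual
  perturbation. This uniformity becomes equicontinuity when the state constraint is treated as a
  continuum of inequalities.\<close>

lemma pert_bound:
  "\<exists>B>0. \<forall>a w \<zeta>. pert R a w \<zeta> \<longrightarrow> (\<forall>t\<in>{0..T}. norm (\<zeta> t) \<le> B) \<and> (\<forall>s\<in>{0..T}. \<forall>t\<in>{0..T}. norm (\<zeta> t - \<zeta> s) \<le> B * \<bar>t - s\<bar>)"
proof -
  obtain K where K: "\<And>s h. norm (A s h) \<le> K * norm h" using A_bound by blast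
  obtain KF where KF: "KF > 0" "\<And>s. norm (F1 (x s)) \<le> KF" using bdd_measE[OF F_meas(2)[OF xm]] by blast
  obtain KS where KS: "KS > 0" "\<And>s. norm (Src s) \<le> KS" using bdd_measE[OF Src_meas] by blast
  define \<rho> where "\<rho> = \<bar>R\<bar> * KF + KS"
  have \<rho>: "\<rho> > 0" using KF KS by (simp add: \<rho>_def add_nonneg_pos)
  define L where "L = \<bar>K\<bar> + 1"
  define B0 where "B0 = 2 * (\<bar>R\<bar> + \<rho> * T) * exp (2 * L * T)"
  define B where "B = B0 + (L * B0 + \<rho>)"
  have B0: "B0 \<ge> 0" using \<rho> T by (simp add: B0_def)
  have L: "L > 0" by (simp add: L_def)
  have "(\<forall>t\<in>{0..T}. norm (\<zeta> t) \<le> B) \<and> (\<forall>s\<in>{0..T}. \<forall>t\<in>{0..T}. norm (\<zeta> t - \<zeta> s) \<le> B * \<bar>t - s\<bar>)" if P: "pert R a w \<zeta>" for a w \<zeta>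
  proof -
    define d where "d s = A s (\<zeta> s) + (w s *\<^sub>R F1 (x s) + Src s)" for s
    have d: "bdd_meas d" unfolding d_def[abs_def] using P by (intro bdd_meas_add A_meas pert_source_meas) (auto simp: pert_def)
    have \<zeta>: "\<zeta> t = a + IL 0 t d" if "t \<in> {0..T}" for t using P that by (simp add: pert_def d_def[abs_def])
    have Pc: "continuous_on {0..T} \<zeta>" using P by (simp add: pert_def)
    have dn: "norm (d s) \<le> L * norm (\<zeta> s) + \<rho>" for s
    proof -
      have "norm (w s *\<^sub>R F1 (x s)) \<le> \<bar>R\<bar> * KF" unfolding norm_scaleR
        using P KF by (intro mult_mono) (auto simp: pert_def intro: order_trans)
      then have "norm (w s *\<^sub>R F1 (x s) + Src s) \<le> \<rho>" unfolding \<rho>_def using KS by (intro norm_triangle_mono) auto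
      moreover have "norm (A s (\<zeta> s)) \<le> L * norm (\<zeta> s)"
      proof -
        have "K * norm (\<zeta> s) \<le> L * norm (\<zeta> s)" by (intro mult_right_mono) (auto simp: L_def)
        then show ?thesis using K[of s "\<zeta> s"] by linarith
      qed
      ultimately show ?thesis unfolding d_def by (intro norm_triangle_mono)
    qed
    have b: "norm (\<zeta> t) \<le> B0" if t: "t \<in> {0..T}" for t
    proof -
      have "norm (\<zeta> t - 0) \<le> 2 * (\<bar>R\<bar> + \<rho> * T) * exp (2 * L * T)"
      proof (rule integral_equation_compare[OF L _ _ d bdd_meas_const[of 0] \<zeta> _ _ _ _ t, where ?a2.0=0])
        show "norm (a - 0) \<le> \<bar>R\<bar>" using P abs_ge_self[of R] by (simp only: pert_def diff_zero) linarith
      qed (use Pc dn \<rho> in auto)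
      then show ?thesis by (simp add: B0_def)
    qed
    have lip: "norm (\<zeta> t - \<zeta> s) \<le> B * \<bar>t - s\<bar>" if st: "s \<in> {0..T}" "t \<in> {0..T}" for s t
    proof -
      have *: "norm (\<zeta> t - \<zeta> s) \<le> (L * B0 + \<rho>) * \<bar>t - s\<bar>" if st: "0 \<le> s" "s \<le> t" "t \<le> T" for s t
      proof -
        have "\<zeta> t - \<zeta> s = IL s t d" using \<zeta>[of t] \<zeta>[of s] IL_increment[OF d st(1,2)] st by simp
        moreover have "norm (IL s t d) \<le> (L * B0 + \<rho>) * (t - s)"
        proof (rule IL_norm_bound[OF d _ st(2)], rule AE_I2)
          fix r assume "r \<in> space (lebesgue_on {s..t})"
          then have "norm (\<zeta> r) \<le> B0" using st by (intro b) auto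
          then have "L * norm (\<zeta> r) \<le> L * B0" using L by (intro mult_left_mono) auto
          then show "norm (d r) \<le> L * B0 + \<rho>" using dn[of r] by linarith
        qed
        ultimately show ?thesis using st by simp
      qed
      have "norm (\<zeta> t - \<zeta> s) \<le> (L * B0 + \<rho>) * \<bar>t - s\<bar>"
        using *[of s t] *[of t s] st by (cases "s \<le> t") (auto simp: norm_minus_commute abs_minus_commute)
      also have "\<dots> \<le> B * \<bar>t - s\<bar>" using B0 by (intro mult_right_mono) (auto simp: B_def)
      finally show ?thesis .
    qed
    have "B0 \<le> B" using L B0 \<rho> by (simp add: B_def)
    then show ?thesis using b lip by force
  qed
  moreover have "B > 0" using L B0 \<rho> by (simp add: B_def add_nonneg_pos)
  ultimately show ?thesis by blast
qed

text \<open>The equation for \<zeta> is affine in (a, w, \<zeta>). The weights must add up to 1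
  because the source \<open>Src\<close> is common to all perturbations.\<close>

lemma pert_sum:
  assumes I: "finite I" and P: "\<And>i. i \<in> I \<Longrightarrow> pert R (a i) (w i) (\<zeta> i)" and c: "\<And>i. i \<in> I \<Longrightarrow> 0 \<le> c i" "(\<Sum>i\<in>I. c i) = 1"
  shows "pert R (\<Sum>i\<in>I. c i *\<^sub>R a i) (\<lambda>t. \<Sum>i\<in>I. c i * w i t) (\<lambda>t. \<Sum>i\<in>I. c i *\<^sub>R \<zeta> i t)"
  unfolding pert_def
proof (intro conjI allI ballI)
  have "norm (\<Sum>i\<in>I. c i *\<^sub>R a i) \<le> (\<Sum>i\<in>I. c i * R)"
    using P c by (intro sum_norm_le) (auto simp: pert_def mult_left_mono)
  then show "norm (\<Sum>i\<in>I. c i *\<^sub>R a i) \<le> R" using c by (simp add: sum_distrib_right[symmetric])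
  show "bdd_meas (\<lambda>t. \<Sum>i\<in>I. c i * w i t)" using P by (intro bdd_meas_sum bdd_meas_mult bdd_meas_const) (auto simp: pert_def)
  show "bdd_meas (\<lambda>t. \<Sum>i\<in>I. c i *\<^sub>R \<zeta> i t)" using P by (intro bdd_meas_sum bdd_meas_scaleR bdd_meas_const) (auto simp: pert_def)
  show "continuous_on {0..T} (\<lambda>t. \<Sum>i\<in>I. c i *\<^sub>R \<zeta> i t)" using P by (intro continuous_intros) (auto simp: pert_def)
  fix t
  have "\<bar>\<Sum>i\<in>I. c i * w i t\<bar> \<le> (\<Sum>i\<in>I. \<bar>c i * w i t\<bar>)" by (rule sum_abs)
  also have "\<dots> \<le> (\<Sum>i\<in>I. c i * R)" using P c by (intro sum_mono) (auto simp: pert_def abs_mult mult_left_mono)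
  finally show "\<bar>\<Sum>i\<in>I. c i * w i t\<bar> \<le> R" using c by (simp add: sum_distrib_right[symmetric])
next
  fix t assume t: "t \<in> {0..T}"
  define d where "d i s = A s (\<zeta> i s) + (w i s *\<^sub>R F1 (x s) + Src s)" for i s
  have d: "bdd_meas (d i)" if "i \<in> I" for i unfolding d_def[abs_def] using P[OF that] by (intro bdd_meas_add A_meas pert_source_meas) (auto simp: pert_def)
  have "(\<Sum>i\<in>I. c i *\<^sub>R \<zeta> i t) = (\<Sum>i\<in>I. c i *\<^sub>R (a i + IL 0 t (d i)))"
    using P t by (intro sum.cong refl) (auto simp: pert_def d_def[abs_def])
  also have "\<dots> = (\<Sum>i\<in>I. c i *\<^sub>R a i) + (\<Sum>i\<in>I. IL 0 t (\<lambda>s. c i *\<^sub>R d i s))"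
    by (simp add: scaleR_add_right sum.distrib)
  also have "(\<Sum>i\<in>I. IL 0 t (\<lambda>s. c i *\<^sub>R d i s)) = IL 0 t (\<lambda>s. \<Sum>i\<in>I. c i *\<^sub>R d i s)"
    by (rule Bochner_Integration.integral_sum[symmetric]) (intro bdd_meas_integrable bdd_meas_scaleR bdd_meas_const d)
  also have "(\<lambda>s. \<Sum>i\<in>I. c i *\<^sub>R d i s) = (\<lambda>s. A s (\<Sum>i\<in>I. c i *\<^sub>R \<zeta> i s) + ((\<Sum>i\<in>I. c i * w i s) *\<^sub>R F1 (x s) + Src s))"
  proof
    fix s
    have "(\<Sum>i\<in>I. c i *\<^sub>R Src s) = Src s" using c(2) by (simp add: scaleR_sum_left[symmetric])
    then show "(\<Sum>i\<in>I. c i *\<^sub>R d i s) = A s (\<Sum>i\<in>I. c i *\<^sub>R \<zeta> i s) + ((\<Sum>i\<in>I. c i * w i s) *\<^sub>R F1 (x s) + Src s)"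
      using A_linear[of s] by (simp add: d_def linear_sum linear_cmul scaleR_add_right sum.distrib scaleR_sum_left)
  qed
  finally show "(\<Sum>i\<in>I. c i *\<^sub>R \<zeta> i t) = (\<Sum>i\<in>I. c i *\<^sub>R a i) + IL 0 t (\<lambda>s. A s (\<Sum>i\<in>I. c i *\<^sub>R \<zeta> i s) + ((\<Sum>i\<in>I. c i * w i s) *\<^sub>R F1 (x s) + Src s))" .
qed

end

section \<open>Nonlinear trajectories and their expansion in e\<close>

context control_path
begin

definition traj :: "real \<Rightarrow> 'a \<Rightarrow> (real \<Rightarrow> real) \<Rightarrow> (real \<Rightarrow> 'a) \<Rightarrow> bool" where
  "traj e a w y \<longleftrightarrow> bdd_meas y \<and> continuous_on {0..T} y \<and>
    (\<forall>t\<in>{0..T}. y t = (x 0 + e *\<^sub>R z 0 + e\<^sup>2 *\<^sub>R a) + IL 0 t (\<lambda>s. F0 (y s) + (u s + e * v s + e\<^sup>2 * w s) *\<^sub>R F1 (y s)))"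

lemma F_Lipschitz: "\<exists>L>0. \<forall>y y'. norm (F0 y - F0 y') \<le> L * norm (y - y') \<and> norm (F1 y - F1 y') \<le> L * norm (y - y')"
proof -
  obtain L0 L1 where L: "L0-lipschitz_on UNIV F0" "L1-lipschitz_on UNIV F1" using Lip by blast
  have "norm (F0 y - F0 y') \<le> (\<bar>L0\<bar> + \<bar>L1\<bar> + 1) * norm (y - y')" "norm (F1 y - F1 y') \<le> (\<bar>L0\<bar> + \<bar>L1\<bar> + 1) * norm (y - y')" for y y'
  proof -
    have "norm (F0 y - F0 y') \<le> L0 * norm (y - y')" using lipschitz_onD[OF L(1), of y y'] by (simp add: dist_norm)
    also have "\<dots> \<le> (\<bar>L0\<bar> + \<bar>L1\<bar> + 1) * norm (y - y')" by (intro mult_right_mono) auto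
    finally show "norm (F0 y - F0 y') \<le> (\<bar>L0\<bar> + \<bar>L1\<bar> + 1) * norm (y - y')" .
    have "norm (F1 y - F1 y') \<le> L1 * norm (y - y')" using lipschitz_onD[OF L(2), of y y'] by (simp add: dist_norm)
    also have "\<dots> \<le> (\<bar>L0\<bar> + \<bar>L1\<bar> + 1) * norm (y - y')" by (intro mult_right_mono) auto
    finally show "norm (F1 y - F1 y') \<le> (\<bar>L0\<bar> + \<bar>L1\<bar> + 1) * norm (y - y')" .
  qed
  then show ?thesis by (intro exI[of _ "\<bar>L0\<bar> + \<bar>L1\<bar> + 1"]) auto
qed

lemma control_meas: "bdd_meas w \<Longrightarrow> bdd_meas (\<lambda>s. u s + e * v s + e\<^sup>2 * w s)"
  by (intro bdd_meas_add bdd_meas_mult bdd_meas_const um vm)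

lemma rhs_meas: "bdd_meas w \<Longrightarrow> bdd_meas y \<Longrightarrow> bdd_meas (\<lambda>s. F0 (y s) + (u s + e * v s + e\<^sup>2 * w s) *\<^sub>R F1 (y s))"
  by (intro bdd_meas_add bdd_meas_scaleR F_meas control_meas)

lemma rhs_diff:
  assumes L: "\<And>y y'. norm (F0 y - F0 y') \<le> L * norm (y - y') \<and> norm (F1 y - F1 y') \<le> L * norm (y - y')" and U: "\<bar>U\<bar> \<le> KU"
  shows "norm ((F0 y + U *\<^sub>R F1 y) - (F0 y' + U *\<^sub>R F1 y')) \<le> (L + KU * L) * norm (y - y')"
proof -
  have "norm ((F0 y + U *\<^sub>R F1 y) - (F0 y' + U *\<^sub>R F1 y')) = norm ((F0 y - F0 y') + U *\<^sub>R (F1 y - F1 y'))"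
    by (simp add: algebra_simps)
  also have "\<dots> \<le> norm (F0 y - F0 y') + \<bar>U\<bar> * norm (F1 y - F1 y')"
    by (rule order_trans[OF norm_triangle_ineq]) simp
  also have "\<dots> \<le> L * norm (y - y') + KU * (L * norm (y - y'))"
    using L U by (intro add_mono mult_mono) (auto intro: order_trans[OF abs_ge_zero])
  finally show ?thesis by (simp add: algebra_simps)
qed

lemma traj_exists:
  assumes w: "bdd_meas w" shows "\<exists>y. traj e a w y"
proof -
  obtain L where L: "L > 0" "\<And>y y'. norm (F0 y - F0 y') \<le> L * norm (y - y') \<and> norm (F1 y - F1 y') \<le> L * norm (y - y')"
    using F_Lipschitz by blast
  obtain K where K: "K > 0" "\<And>s. norm (u s + e * v s + e\<^sup>2 * w s) \<le> K" using bdd_measE[OF control_meas[OF w]] by blast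
  have "\<exists>y. continuous_on UNIV y \<and> bounded (range y) \<and>
     (\<forall>t\<in>{0..T}. y t = (x 0 + e *\<^sub>R z 0 + e\<^sup>2 *\<^sub>R a) + IL 0 t (\<lambda>s. F0 (y s) + (u s + e * v s + e\<^sup>2 * w s) *\<^sub>R F1 (y s)))"
    by (rule ode_exists[where L="L + K * L"]) (use T K in \<open>auto intro!: rhs_diff L rhs_meas w\<close>)
  then show ?thesis unfolding traj_def by (meson bdd_meas_cont continuous_on_subset subset_UNIV)
qed

text \<open>For fixed e the trajectory depends continuously on (a, w). This supplies the continuity
  that the fixed point argument for the equality constraints requires.\<close>

lemma traj_diff:
  assumes t': "traj e a' w' y'" and w': "bdd_meas w'"
  shows "\<exists>C>0. \<forall>a w y \<delta>. traj e a w y \<longrightarrow> bdd_meas w \<longrightarrow> (\<forall>t. \<bar>w t - w' t\<bar> \<le> \<delta>) \<longrightarrow> norm (a - a') \<le> \<delta> \<longrightarrow> \<delta> \<le> 1 \<longrightarrow>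
     (\<forall>t\<in>{0..T}. norm (y t - y' t) \<le> C * \<delta>)"
proof -
  obtain L where L: "L > 0" "\<And>y y'. norm (F0 y - F0 y') \<le> L * norm (y - y') \<and> norm (F1 y - F1 y') \<le> L * norm (y - y')"
    using F_Lipschitz by blast
  obtain K where K: "K > 0" "\<And>s. norm (u s + e * v s + e\<^sup>2 * w' s) \<le> K" using bdd_measE[OF control_meas[OF w']] by blast
  have y': "bdd_meas y'" using t' by (simp add: traj_def)
  obtain KF where KF: "KF > 0" "\<And>s. norm (F1 (y' s)) \<le> KF" using bdd_measE[OF F_meas(2)[OF y']] by blast
  show ?thesis
  proof -
    have main: "norm (y t - y' t) \<le> 2 * (e\<^sup>2 * \<delta> + (e\<^sup>2 * \<delta> * KF) * T) * exp (2 * (L + (K + e\<^sup>2) * L) * T)"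
      if ty: "traj e a w y" and w: "bdd_meas w" and \<delta>: "\<And>t. \<bar>w t - w' t\<bar> \<le> \<delta>" "norm (a - a') \<le> \<delta>" "\<delta> \<le> 1" and t: "t \<in> {0..T}" for a w y \<delta> t
    proof (rule integral_equation_compare[OF _ _ _ rhs_meas[OF w] rhs_meas[OF w' y'] _ _ _ _ _ t])
      show "bdd_meas y" "continuous_on {0..T} y" "continuous_on {0..T} y'" using ty t' by (auto simp: traj_def)
      show "0 < L + (K + e\<^sup>2) * L" using L K by (simp add: add_pos_nonneg)
      have "\<delta> \<ge> 0" using order_trans[OF norm_ge_zero \<delta>(2)] .
      then show "0 \<le> e\<^sup>2 * \<delta> * KF" using KF by simp
      show "\<And>t. t \<in> {0..T} \<Longrightarrow> y t = (x 0 + e *\<^sub>R z 0 + e\<^sup>2 *\<^sub>R a) + IL 0 t (\<lambda>s. F0 (y s) + (u s + e * v s + e\<^sup>2 * w s) *\<^sub>R F1 (y s))"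
        using ty by (simp add: traj_def)
      show "\<And>t. t \<in> {0..T} \<Longrightarrow> y' t = (x 0 + e *\<^sub>R z 0 + e\<^sup>2 *\<^sub>R a') + IL 0 t (\<lambda>s. F0 (y' s) + (u s + e * v s + e\<^sup>2 * w' s) *\<^sub>R F1 (y' s))"
        using t' by (simp add: traj_def)
      have "norm (e\<^sup>2 *\<^sub>R (a - a')) \<le> e\<^sup>2 * \<delta>" using \<delta> by (simp add: mult_left_mono)
      then show "norm ((x 0 + e *\<^sub>R z 0 + e\<^sup>2 *\<^sub>R a) - (x 0 + e *\<^sub>R z 0 + e\<^sup>2 *\<^sub>R a')) \<le> e\<^sup>2 * \<delta>"
        by (simp add: scaleR_diff_right)
      fix s
      define U U' where "U = u s + e * v s + e\<^sup>2 * w s" and "U' = u s + e * v s + e\<^sup>2 * w' s"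
      have UU: "\<bar>U - U'\<bar> \<le> e\<^sup>2 * \<delta>" using \<delta>(1)[of s] by (simp add: U_def U'_def abs_mult mult_left_mono flip: right_diff_distrib)
      have "e\<^sup>2 * \<delta> \<le> e\<^sup>2" using \<delta>(3) by (simp add: mult_left_le)
      then have U: "\<bar>U\<bar> \<le> K + e\<^sup>2" using UU K(2)[of s] by (auto simp: U'_def[symmetric])
      have "(F0 (y s) + U *\<^sub>R F1 (y s)) - (F0 (y' s) + U' *\<^sub>R F1 (y' s)) =
         ((F0 (y s) + U *\<^sub>R F1 (y s)) - (F0 (y' s) + U *\<^sub>R F1 (y' s))) + (U - U') *\<^sub>R F1 (y' s)" by (simp add: algebra_simps)
      also have "norm \<dots> \<le> (L + (K + e\<^sup>2) * L) * norm (y s - y' s) + e\<^sup>2 * \<delta> * KF"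
      proof (rule norm_triangle_mono)
        show "norm ((F0 (y s) + U *\<^sub>R F1 (y s)) - (F0 (y' s) + U *\<^sub>R F1 (y' s))) \<le> (L + (K + e\<^sup>2) * L) * norm (y s - y' s)"
          by (rule rhs_diff[OF L(2) U])
        show "norm ((U - U') *\<^sub>R F1 (y' s)) \<le> e\<^sup>2 * \<delta> * KF" unfolding norm_scaleR
          using UU KF by (intro mult_mono) (auto intro: order_trans[OF abs_ge_zero UU])
      qed
      finally show "norm ((F0 (y s) + (u s + e * v s + e\<^sup>2 * w s) *\<^sub>R F1 (y s)) - (F0 (y' s) + (u s + e * v s + e\<^sup>2 * w' s) *\<^sub>R F1 (y' s)))
         \<le> (L + (K + e\<^sup>2) * L) * norm (y s - y' s) + e\<^sup>2 * \<delta> * KF" by (simp add: U_def U'_def)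
    qed
    define C where "C = 2 * (e\<^sup>2 + (e\<^sup>2 * KF) * T) * exp (2 * (L + (K + e\<^sup>2) * L) * T)"
    have C: "C \<ge> 0" using KF T by (simp add: C_def)
    have "norm (y t - y' t) \<le> (C + 1) * \<delta>"
      if ty: "traj e a w y" and w: "bdd_meas w" and \<delta>: "\<forall>t. \<bar>w t - w' t\<bar> \<le> \<delta>" "norm (a - a') \<le> \<delta>" "\<delta> \<le> 1" and t: "t \<in> {0..T}" for a w y \<delta> t
    proof -
      have "norm (y t - y' t) \<le> C * \<delta>" using main[OF ty w _ \<delta>(2,3) t] \<delta>(1) by (simp add: C_def algebra_simps)
      then show ?thesis using order_trans[OF norm_ge_zero \<delta>(2)] by (simp add: distrib_right)
    qed
    then show ?thesis using C by (intro exI[of _ "C + 1"]) auto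
  qed
qed

text \<open>The candidate x + e z + e^2 \<zeta> satisfies the nonlinear equation with a defect of at
  most \<open>\<rho> * e\<^sup>2\<close>, consisting of Taylor remainders and terms of order e^3;
  the stability estimate converts the defect into a distance. The threshold for e is the same for
  all perturbations of size \<open>R\<close>.\<close>

lemma traj_expansion:
  assumes R: "R > 0" and \<eta>: "\<eta> > 0"
  shows "\<exists>e0>0. \<forall>e a w \<zeta> y. 0 < e \<longrightarrow> e < e0 \<longrightarrow> pert R a w \<zeta> \<longrightarrow> traj e a w y \<longrightarrow>
    (\<forall>t\<in>{0..T}. norm (y t - x t - e *\<^sub>R z t - e\<^sup>2 *\<^sub>R \<zeta> t) \<le> \<eta> * e\<^sup>2)"
proof -
  obtain L where L: "L > 0" "\<And>y y'. norm (F0 y - F0 y') \<le> L * norm (y - y') \<and> norm (F1 y - F1 y') \<le> L * norm (y - y')"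
    using F_Lipschitz by blast
  obtain Kx where Kx: "Kx > 0" "\<And>s. norm (x s) \<le> Kx" using bdd_measE[OF xm] by blast
  obtain Kz where Kz: "Kz > 0" "\<And>s. norm (z s) \<le> Kz" using bdd_measE[OF zm] by blast
  obtain Ku where Ku: "Ku > 0" "\<And>s. norm (u s) \<le> Ku" using bdd_measE[OF um] by blast
  obtain Kv where Kv: "Kv > 0" "\<And>s. norm (v s) \<le> Kv" using bdd_measE[OF vm] by blast
  obtain B where B: "B > 0" "\<And>a w \<zeta> t. pert R a w \<zeta> \<Longrightarrow> t \<in> {0..T} \<Longrightarrow> norm (\<zeta> t) \<le> B"
    using pert_bound[of R] by blast
  define K where "K = cball (0::'a) Kx"
  have K: "compact K" "\<And>s. x s \<in> K" using Kx by (auto simp: K_def)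
  define R' where "R' = Kz + B"
  have R': "R' > 0" "Kz \<le> R'" "B \<le> R'" using Kz B by (auto simp: R'_def)
  have "bounded ((\<lambda>p. frechet_derivative F1 (at (fst p)) (snd p)) ` (K \<times> cball 0 R'))"
    by (intro compact_imp_bounded compact_continuous_image C2_D_continuous C2F compact_Times K compact_cball)
  then obtain M1 where M1: "M1 > 0" "\<And>y. y \<in> (\<lambda>p. frechet_derivative F1 (at (fst p)) (snd p)) ` (K \<times> cball 0 R') \<Longrightarrow> norm y \<le> M1"
    unfolding bounded_pos by blast
  have DM: "norm (frechet_derivative F1 (at (x s)) k) \<le> M1" if "norm k \<le> R'" for s k
    using that K(2) by (auto intro!: M1 image_eqI[of _ _ "(x s, k)"])
  have "bounded ((\<lambda>p. second_derivative F1 (fst p) (snd p) (snd p)) ` (K \<times> cball 0 R'))"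
    by (intro compact_imp_bounded compact_continuous_image C2_D2_continuous C2F compact_Times K compact_cball)
  then obtain M2 where M2: "M2 > 0" "\<And>y. y \<in> (\<lambda>p. second_derivative F1 (fst p) (snd p) (snd p)) ` (K \<times> cball 0 R') \<Longrightarrow> norm y \<le> M2"
    unfolding bounded_pos by blast
  have D2M: "norm (second_derivative F1 (x s) k k) \<le> M2" if "norm k \<le> R'" for s k
    using that K(2) by (auto intro!: M2 image_eqI[of _ _ "(x s, k)"])
  define KU where "KU = Ku + Kv + R"
  define Lt where "Lt = L + KU * L"
  have KU: "KU > 0" using Ku Kv R by (simp add: KU_def)
  have Lt: "Lt > 0" using L KU by (simp add: Lt_def add_pos_pos)
  \<comment> \<open>The admissible defect, chosen so that the factor from Gronwall's inequality
    turns it into exactly \<open>\<eta>\<close>.\<close>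
  define \<rho> where "\<rho> = \<eta> / (2 * T * exp (2 * Lt * T))"
  have \<rho>: "\<rho> > 0" "2 * (\<rho> * T) * exp (2 * Lt * T) = \<eta>" using \<eta> T by (auto simp: \<rho>_def)
  define C where "C = Kv * (M1 + M2) + R * M1 + R * (M1 + M2)"
  have C: "C > 0" using Kv M1 M2 R by (simp add: C_def add_pos_pos)
  define \<eta>1 where "\<eta>1 = \<rho> / (2 * (1 + KU))"
  have "\<rho> / (2 * c) * c = \<rho> / 2" if "c \<noteq> 0" for c using that by simp
  from this[of "1 + KU"] have \<eta>1: "\<eta>1 > 0" "\<eta>1 * (1 + KU) = \<rho> / 2" unfolding \<eta>1_def using \<rho> KU by auto
  obtain e1 where e1: "e1 > 0" "\<And>e x z \<zeta>. 0 < e \<Longrightarrow> e < e1 \<Longrightarrow> x \<in> K \<Longrightarrow> norm z \<le> R' \<Longrightarrow> norm \<zeta> \<le> R' \<Longrightarrow>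
    norm (F0 (x + e *\<^sub>R z + e\<^sup>2 *\<^sub>R \<zeta>) - F0 x - e *\<^sub>R frechet_derivative F0 (at x) z
      - e\<^sup>2 *\<^sub>R (frechet_derivative F0 (at x) \<zeta> + (1/2) *\<^sub>R second_derivative F0 x z z)) \<le> \<eta>1 * e\<^sup>2"
    using C2_expansion[OF C2F(1) K(1) \<eta>1(1) R'(1)] by blast
  obtain e2 where e2: "e2 > 0" "\<And>e x z \<zeta>. 0 < e \<Longrightarrow> e < e2 \<Longrightarrow> x \<in> K \<Longrightarrow> norm z \<le> R' \<Longrightarrow> norm \<zeta> \<le> R' \<Longrightarrow>
    norm (F1 (x + e *\<^sub>R z + e\<^sup>2 *\<^sub>R \<zeta>) - F1 x - e *\<^sub>R frechet_derivative F1 (at x) z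
      - e\<^sup>2 *\<^sub>R (frechet_derivative F1 (at x) \<zeta> + (1/2) *\<^sub>R second_derivative F1 x z z)) \<le> \<eta>1 * e\<^sup>2"
    using C2_expansion[OF C2F(2) K(1) \<eta>1(1) R'(1)] by blast
  define e0 where "e0 = Min {1, e1, e2, \<rho> / (2 * C)}"
  have e0: "e0 > 0" using e1 e2 \<rho> C by (simp add: e0_def)
  have "norm (y t - x t - e *\<^sub>R z t - e\<^sup>2 *\<^sub>R \<zeta> t) \<le> \<eta> * e\<^sup>2"
    if e: "0 < e" "e < e0" and P: "pert R a w \<zeta>" and ty: "traj e a w y" and t: "t \<in> {0..T}" for e a w \<zeta> y t
  proof -
    have ee: "e < e1" "e < e2" "e < 1" "e * C \<le> \<rho> / 2" using e C by (auto simp: e0_def field_simps)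
    define \<xi> where "\<xi> s = x s + e *\<^sub>R z s + e\<^sup>2 *\<^sub>R \<zeta> s" for s
    define d where "d s = (F0 (x s) + u s *\<^sub>R F1 (x s)) + (e *\<^sub>R (A s (z s) + v s *\<^sub>R F1 (x s))
        + e\<^sup>2 *\<^sub>R (A s (\<zeta> s) + (w s *\<^sub>R F1 (x s) + Src s)))" for s
    have w: "bdd_meas w" "\<And>s. \<bar>w s\<bar> \<le> R" and \<zeta>m: "bdd_meas \<zeta>" and \<zeta>c: "continuous_on {0..T} \<zeta>" using P by (auto simp: pert_def)
    have m: "bdd_meas (\<lambda>s. F0 (x s) + u s *\<^sub>R F1 (x s))" "bdd_meas (\<lambda>s. e *\<^sub>R (A s (z s) + v s *\<^sub>R F1 (x s)))"
      "bdd_meas (\<lambda>s. e\<^sup>2 *\<^sub>R (A s (\<zeta> s) + (w s *\<^sub>R F1 (x s) + Src s)))"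
      by (intro bdd_meas_add bdd_meas_scaleR F_meas um vm xm zm A_meas bdd_meas_const pert_source_meas w \<zeta>m)+
    have dm: "bdd_meas d" unfolding d_def[abs_def] by (intro bdd_meas_add m)
    have \<xi>_eq: "\<xi> t = (x 0 + e *\<^sub>R z 0 + e\<^sup>2 *\<^sub>R a) + IL 0 t d" if t: "t \<in> {0..T}" for t
    proof -
      have "IL 0 t d = IL 0 t (\<lambda>s. F0 (x s) + u s *\<^sub>R F1 (x s)) + (e *\<^sub>R IL 0 t (\<lambda>s. A s (z s) + v s *\<^sub>R F1 (x s)) +
          e\<^sup>2 *\<^sub>R IL 0 t (\<lambda>s. A s (\<zeta> s) + (w s *\<^sub>R F1 (x s) + Src s)))"
        unfolding d_def[abs_def] by (subst IL_add[OF m(1) bdd_meas_add[OF m(2,3)]], subst IL_add[OF m(2,3)]) simp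
      moreover have "\<zeta> t = a + IL 0 t (\<lambda>s. A s (\<zeta> s) + (w s *\<^sub>R F1 (x s) + Src s))" using P t by (simp add: pert_def)
      ultimately show ?thesis using x_eq[OF t] z_eq[OF t]
        by (simp add: \<xi>_def A_def scaleR_add_right algebra_simps)
    qed
    have res: "norm ((F0 (\<xi> s) + (u s + e * v s + e\<^sup>2 * w s) *\<^sub>R F1 (\<xi> s)) - d s) \<le> \<rho> * e\<^sup>2" if s: "s \<in> {0..T}" for s
    proof -
      have zs: "norm (z s) \<le> R'" "norm (\<zeta> s) \<le> R'" using Kz(2)[of s] B(2)[OF P s] R' by auto
      define U where "U = u s + e * v s + e\<^sup>2 * w s"
      define D1 where "D1 = frechet_derivative F1 (at (x s)) (z s)"
      define S1 where "S1 = frechet_derivative F1 (at (x s)) (\<zeta> s) + (1/2) *\<^sub>R second_derivative F1 (x s) (z s) (z s)"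
      define r0 where "r0 = F0 (\<xi> s) - F0 (x s) - e *\<^sub>R frechet_derivative F0 (at (x s)) (z s)
        - e\<^sup>2 *\<^sub>R (frechet_derivative F0 (at (x s)) (\<zeta> s) + (1/2) *\<^sub>R second_derivative F0 (x s) (z s) (z s))"
      define r1 where "r1 = F1 (\<xi> s) - F1 (x s) - e *\<^sub>R D1 - e\<^sup>2 *\<^sub>R S1"
      have r0: "norm r0 \<le> \<eta>1 * e\<^sup>2" unfolding r0_def \<xi>_def by (rule e1) (use e ee K zs in auto)
      have r1: "norm r1 \<le> \<eta>1 * e\<^sup>2" unfolding r1_def \<xi>_def D1_def S1_def by (rule e2) (use e ee K zs in auto)
      have D1: "norm D1 \<le> M1" unfolding D1_def by (rule DM[OF zs(1)])
      have S1: "norm S1 \<le> M1 + M2"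
      proof -
        have "norm ((1/2) *\<^sub>R second_derivative F1 (x s) (z s) (z s)) \<le> M2" using D2M[OF zs(1), of s] M2 by simp
        then show ?thesis unfolding S1_def using DM[OF zs(2), of s] by (intro norm_triangle_mono)
      qed
      have e21: "e\<^sup>2 \<le> 1" using e ee by (simp add: power_le_one)
      have U: "\<bar>U\<bar> \<le> KU"
      proof -
        have "\<bar>e * v s\<bar> \<le> 1 * Kv" unfolding abs_mult using e ee Kv(2)[of s] by (intro mult_mono) auto
        moreover have "\<bar>e\<^sup>2 * w s\<bar> \<le> 1 * R" unfolding abs_mult using e21 w(2)[of s] by (intro mult_mono) auto
        ultimately show ?thesis using Ku(2)[of s] by (auto simp: U_def KU_def)
      qed
      have F1: "F1 (\<xi> s) = F1 (x s) + e *\<^sub>R D1 + e\<^sup>2 *\<^sub>R S1 + r1" by (simp add: r1_def)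
      have F0: "F0 (\<xi> s) = F0 (x s) + e *\<^sub>R frechet_derivative F0 (at (x s)) (z s)
        + e\<^sup>2 *\<^sub>R (frechet_derivative F0 (at (x s)) (\<zeta> s) + (1/2) *\<^sub>R second_derivative F0 (x s) (z s) (z s)) + r0" by (simp add: r0_def)
      \<comment> \<open>Products of the control increments with the expansion of F1 that are of
        third or higher order; \<open>C\<close> bounds their coefficient because e < 1.\<close>
      define rr where "rr = e ^ 3 *\<^sub>R (v s *\<^sub>R S1 + w s *\<^sub>R D1 + (e * w s) *\<^sub>R S1)"
      have eq: "(F0 (\<xi> s) + U *\<^sub>R F1 (\<xi> s)) - d s = (r0 + U *\<^sub>R r1) + rr"
        unfolding F0 F1 d_def A_def Src_def U_def rr_def S1_def D1_def[symmetric]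
        by (simp add: scaleR_add_right scaleR_add_left power2_eq_square power3_eq_cube algebra_simps)
      have "norm (U *\<^sub>R r1) \<le> KU * (\<eta>1 * e\<^sup>2)" unfolding norm_scaleR using U r1 KU by (intro mult_mono) auto
      then have n1: "norm (r0 + U *\<^sub>R r1) \<le> \<eta>1 * e\<^sup>2 + KU * (\<eta>1 * e\<^sup>2)" using r0 by (intro norm_triangle_mono)
      have "norm (v s *\<^sub>R S1 + w s *\<^sub>R D1 + (e * w s) *\<^sub>R S1) \<le> Kv * (M1 + M2) + R * M1 + (1 * R) * (M1 + M2)"
      proof (intro norm_triangle_mono)
        show "norm (v s *\<^sub>R S1) \<le> Kv * (M1 + M2)" unfolding norm_scaleR using Kv(2)[of s] Kv(1) S1 by (intro mult_mono) auto
        show "norm (w s *\<^sub>R D1) \<le> R * M1" unfolding norm_scaleR using w(2)[of s] R D1 by (intro mult_mono) auto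
        show "norm ((e * w s) *\<^sub>R S1) \<le> (1 * R) * (M1 + M2)" unfolding norm_scaleR abs_mult
          using w(2)[of s] R S1 e ee by (intro mult_mono) auto
      qed
      then have "norm rr \<le> e ^ 3 * C" unfolding rr_def using e by (simp add: C_def mult_left_mono)
      also have "\<dots> = e\<^sup>2 * (e * C)" by (simp add: power2_eq_square power3_eq_cube)
      also have "\<dots> \<le> e\<^sup>2 * (\<rho> / 2)" using ee by (intro mult_left_mono) auto
      finally have rb: "norm rr \<le> e\<^sup>2 * (\<rho> / 2)" .
      have "norm ((r0 + U *\<^sub>R r1) + rr) \<le> (\<eta>1 * e\<^sup>2 + KU * (\<eta>1 * e\<^sup>2)) + e\<^sup>2 * (\<rho> / 2)" by (rule norm_triangle_mono[OF n1 rb])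
      also have "\<dots> = (\<eta>1 * (1 + KU)) * e\<^sup>2 + e\<^sup>2 * (\<rho> / 2)" by (simp add: algebra_simps)
      also have "\<dots> = \<rho> * e\<^sup>2" unfolding \<eta>1(2) by simp
      finally show ?thesis unfolding eq[symmetric] by (simp add: U_def)
    qed
    have "norm (y t - \<xi> t) \<le> 2 * (0 + (\<rho> * e\<^sup>2) * T) * exp (2 * Lt * T)"
    proof (rule integral_equation_compare[OF Lt _ _ rhs_meas[OF w(1)] dm _ \<xi>_eq _ _ _ t])
      show "bdd_meas y" "continuous_on {0..T} y" using ty by (auto simp: traj_def)
      show "continuous_on {0..T} \<xi>" unfolding \<xi>_def[abs_def]
        by (intro continuous_intros \<zeta>c continuous_on_subset[OF xc(1)] continuous_on_subset[OF zc(1)]) auto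
      show "\<And>t. t \<in> {0..T} \<Longrightarrow> y t = (x 0 + e *\<^sub>R z 0 + e\<^sup>2 *\<^sub>R a) + IL 0 t (\<lambda>s. F0 (y s) + (u s + e * v s + e\<^sup>2 * w s) *\<^sub>R F1 (y s))"
        using ty by (simp add: traj_def)
      fix s assume s: "s \<in> {0..T}"
      define U where "U = u s + e * v s + e\<^sup>2 * w s"
      have U: "\<bar>U\<bar> \<le> KU"
      proof -
        have e21: "e\<^sup>2 \<le> 1" using e ee by (simp add: power_le_one)
        have "\<bar>e * v s\<bar> \<le> 1 * Kv" unfolding abs_mult using e ee Kv(2)[of s] by (intro mult_mono) auto
        moreover have "\<bar>e\<^sup>2 * w s\<bar> \<le> 1 * R" unfolding abs_mult using e21 w(2)[of s] by (intro mult_mono) auto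
        ultimately show ?thesis using Ku(2)[of s] by (auto simp: U_def KU_def)
      qed
      have "(F0 (y s) + U *\<^sub>R F1 (y s)) - d s = ((F0 (y s) + U *\<^sub>R F1 (y s)) - (F0 (\<xi> s) + U *\<^sub>R F1 (\<xi> s))) + ((F0 (\<xi> s) + U *\<^sub>R F1 (\<xi> s)) - d s)" by simp
      also have "norm \<dots> \<le> Lt * norm (y s - \<xi> s) + \<rho> * e\<^sup>2"
        unfolding Lt_def using rhs_diff[OF L(2) U] res[OF s] by (intro norm_triangle_mono) (auto simp: U_def)
      finally show "norm ((F0 (y s) + (u s + e * v s + e\<^sup>2 * w s) *\<^sub>R F1 (y s)) - d s) \<le> Lt * norm (y s - \<xi> s) + \<rho> * e\<^sup>2"
        by (simp add: U_def)
    qed (use \<rho> in auto)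
    also have "\<dots> = (2 * (\<rho> * T) * exp (2 * Lt * T)) * e\<^sup>2" by simp
    finally show ?thesis unfolding \<rho>(2) by (simp add: \<xi>_def diff_diff_eq)
  qed
  then show ?thesis using e0 by blast
qed

end

section \<open>The reference trajectory and its arcs\<close>

text \<open>Setting an essentially bounded function to zero where its bound fails changes it on a
  null set of [0,T] only and produces a representative bounded everywhere.\<close>

definition trunc :: "real \<Rightarrow> real \<Rightarrow> (real \<Rightarrow> 'a::real_normed_vector) \<Rightarrow> real \<Rightarrow> 'a" where
  "trunc T K w t = (if t \<in> {0..T} \<and> norm (w t) \<le> K then w t else 0)"

lemma L_infty_trunc:
  fixes w :: "real \<Rightarrow> 'a::euclidean_space"
  assumes "L_infty T w"
  shows "\<exists>K. bdd_meas (trunc T K w) \<and> (AE t in lebesgue_on {0..T}. trunc T K w t = w t)"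
proof -
  obtain K where K: "AE t in lebesgue_on {0..T}. norm (w t) \<le> K" and w: "w \<in> borel_measurable (lebesgue_on {0..T})"
    using assms unfolding L_infty_def by blast
  have [measurable]: "(\<lambda>t. if t \<in> {0..T} then w t else 0) \<in> borel_measurable lebesgue"
    using w by (subst borel_measurable_if) auto
  have "trunc T K w = (\<lambda>t. if norm (if t \<in> {0..T} then w t else 0) \<le> K then (if t \<in> {0..T} then w t else 0) else 0)"
    by (auto simp: trunc_def fun_eq_iff)
  also have "\<dots> \<in> borel_measurable lebesgue" by measurable
  finally have "trunc T K w \<in> borel_measurable lebesgue" .
  moreover have "norm (trunc T K w t) \<le> \<bar>K\<bar>" for t by (auto simp: trunc_def)
  ultimately have "bdd_meas (trunc T K w)" unfolding bdd_meas_def by blast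
  moreover have "AE t in lebesgue_on {0..T}. trunc T K w t = w t"
  proof -
    have "AE t in lebesgue_on {0..T}. t \<in> {0..T}" by (rule AE_I2) simp
    with K show ?thesis by eventually_elim (simp add: trunc_def)
  qed
  ultimately show ?thesis by blast
qed

lemma W1_continuous:
  fixes x :: "real \<Rightarrow> 'a::euclidean_space"
  assumes W: "W1_infty_deriv T x x'"
  shows "continuous_on {0..T} x"
proof -
  obtain K where K: "bdd_meas (trunc T K x')" "AE t in lebesgue_on {0..T}. trunc T K x' t = x' t"
    using L_infty_trunc W unfolding W1_infty_deriv_def by blast
  have "continuous_on {0..T} (\<lambda>t. x 0 + IL 0 t (trunc T K x'))" by (intro continuous_intros IL_continuous K)
  then show ?thesis
  proof (rule continuous_on_eq)
    fix t assume t: "t \<in> {0..T}"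
    have "x' \<in> borel_measurable (lebesgue_on {0..t})"
      by (rule measurable_restrict_mono[of x' lebesgue "{0..T}"])
        (use W t in \<open>auto simp: W1_infty_deriv_def L_infty_def\<close>)
    then have "IL 0 t (trunc T K x') = IL 0 t x'"
      using t by (intro IL_cong_AE[OF K(2) bdd_meas_on[OF K(1)]]) auto
    moreover have "x t = x 0 + IL 0 t x'" using W t unfolding W1_infty_deriv_def by blast
    ultimately show "x 0 + IL 0 t (trunc T K x') = x t" by (simp only:)
  qed
qed

lemma W1_integral:
  fixes x :: "real \<Rightarrow> 'a::euclidean_space"
  assumes W: "W1_infty_deriv T x x'" and d: "bdd_meas d" "AE t in lebesgue_on {0..T}. x' t = d t" and t: "t \<in> {0..T}"
  shows "x t = x 0 + IL 0 t d"
proof -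
  have "x' \<in> borel_measurable (lebesgue_on {0..t})"
    by (rule measurable_restrict_mono[of x' lebesgue "{0..T}"])
      (use W t in \<open>auto simp: W1_infty_deriv_def L_infty_def\<close>)
  then have "IL 0 t x' = IL 0 t d"
    using t by (intro IL_cong_AE[OF d(2) _ bdd_meas_on[OF d(1)]]) auto
  moreover have "x t = x 0 + IL 0 t x'" using W t unfolding W1_infty_deriv_def by blast
  ultimately show ?thesis by (simp only:)
qed

lemma bdd_meas_L_infty: "bdd_meas w \<Longrightarrow> L_infty T w"
proof -
  assume w: "bdd_meas w"
  then obtain K where "\<And>t. norm (w t) \<le> K" by (auto simp: bdd_meas_def)
  then show "L_infty T w" unfolding L_infty_def using bdd_meas_on[OF w] by (intro conjI exI[of _ K] AE_I2) auto
qed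

section \<open>The reference trajectory and difference quotients of the state constraint\<close>

locale ocp_reference =
  fixes P :: "('n::finite) ocp" and u :: "real \<Rightarrow> real" and x :: "real \<Rightarrow> real ^ 'n"
  assumes data: "ocp_data P" and feas: "feasible P u x"
begin

abbreviation "T \<equiv> horizon P"
abbreviation "G t \<equiv> state_con P (x t)"

lemma T: "0 < T" using data by (simp add: ocp_data_def)
lemma C2s: "C2 (f0 P)" "C2 (f1 P)" "C2 (cost P)" "C2 (state_con P)" "i \<in> {1..n1 P + n2 P} \<Longrightarrow> C2 (endpoint_con P i)"
  using data by (auto simp: ocp_data_def)

definition "ub = trunc T (SOME K. bdd_meas (trunc T K u) \<and> (AE t in lebesgue_on {0..T}. trunc T K u t = u t)) u"

lemma ub: "bdd_meas ub" "AE t in lebesgue_on {0..T}. ub t = u t"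
proof -
  have "L_infty T u" using feas by (simp add: feasible_def)
  from someI_ex[OF L_infty_trunc[OF this]] show "bdd_meas ub" "AE t in lebesgue_on {0..T}. ub t = u t"
    by (auto simp: ub_def)
qed

definition "xb t = x (clamp_to T t)"

lemma x_cont: "continuous_on {0..T} x"
  using feas W1_continuous unfolding feasible_def by blast

lemma xb: "continuous_on UNIV xb" "bounded (range xb)" "t \<in> {0..T} \<Longrightarrow> xb t = x t"
  unfolding xb_def using clamp_compose[OF x_cont] T by auto

lemma xb_meas: "bdd_meas xb" by (intro bdd_meas_cont xb)

lemma F_xb_meas: "bdd_meas (\<lambda>s. f0 P (xb s))" "bdd_meas (\<lambda>s. f1 P (xb s))"
  by (rule bdd_meas_compose[OF xb_meas C2_continuous[OF C2s(1)]], rule bdd_meas_compose[OF xb_meas C2_continuous[OF C2s(2)]])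

lemma rhs_xb_meas: "bdd_meas (\<lambda>s. f0 P (xb s) + ub s *\<^sub>R f1 P (xb s))"
  by (intro bdd_meas_add bdd_meas_scaleR F_xb_meas ub)

lemma xb_eq: "t \<in> {0..T} \<Longrightarrow> xb t = xb 0 + IL 0 t (\<lambda>s. f0 P (xb s) + ub s *\<^sub>R f1 P (xb s))"
proof -
  assume t: "t \<in> {0..T}"
  obtain x' where x': "W1_infty_deriv T x x'" "AE t in lebesgue_on {0..T}. x' t = dynamics P (u t) (x t)"
    using feas unfolding feasible_def by blast
  have "AE t in lebesgue_on {0..T}. t \<in> {0..T}" by (rule AE_I2) simp
  with x'(2) ub(2) have "AE s in lebesgue_on {0..T}. x' s = f0 P (xb s) + ub s *\<^sub>R f1 P (xb s)"
    by eventually_elim (simp add: dynamics_def xb)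
  from W1_integral[OF x'(1) rhs_xb_meas this t] show ?thesis using xb t T by simp
qed

lemma G_cont: "continuous_on {0..T} G"
  using continuous_on_compose2[OF C2_continuous[OF C2s(4)] x_cont] by auto

lemma G_le: "t \<in> {0..T} \<Longrightarrow> G t \<le> 0" using feas by (simp add: feasible_def)

text \<open>Formally g(x_t) has the derivative g0 + u g1, so the control that keeps g constant along
  the trajectory is - g0 / g1 wherever g1 does not vanish.\<close>

definition "g0 t = frechet_derivative (state_con P) (at (x t)) (f0 P (x t))"
definition "g1 t = frechet_derivative (state_con P) (at (x t)) (f1 P (x t))"
definition "Mean \<tau> t = (IL 0 t ub - IL 0 \<tau> ub) / (t - \<tau>)"

text \<open>Only the mean value of the control between \<open>\<tau>\<close> and \<open>t\<close> enters the difference quotient of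
  \<open>g(x\<^sub>t)\<close>; this avoids differentiating \<open>g(x\<^sub>t)\<close> almost everywhere.\<close>

lemma G_quotient:
  assumes \<tau>: "\<tau> \<in> {0..T}"
  shows "((\<lambda>t. (G t - G \<tau>) / (t - \<tau>) - (g0 \<tau> + Mean \<tau> t * g1 \<tau>)) \<longlongrightarrow> 0) (at \<tau> within {0..T})"
proof -
  define r where "r s = f0 P (xb s) + ub s *\<^sub>R f1 P (xb s)" for s
  have rm: "bdd_meas r" unfolding r_def[abs_def] by (rule rhs_xb_meas)
  obtain Kr where Kr: "\<And>s. norm (r s) \<le> Kr" using rm by (auto simp: bdd_meas_def)
  obtain Ku where Ku: "\<And>s. norm (ub s) \<le> Ku" using ub(1) by (auto simp: bdd_meas_def)
  define D where "D = frechet_derivative (state_con P) (at (x \<tau>))"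
  have D: "(state_con P has_derivative D) (at (x \<tau>))" unfolding D_def by (rule C2_has_derivative[OF C2s(4)])
  have Dl: "bounded_linear D" by (rule has_derivative_bounded_linear[OF D])
  have q: "(x t - x \<tau>) = IL 0 t r - IL 0 \<tau> r" if "t \<in> {0..T}" for t
    using xb_eq[OF that] xb_eq[OF \<tau>] xb(3)[OF that] xb(3)[OF \<tau>] by (simp add: r_def[abs_def])
  define q1 where "q1 t = (1 / (t - \<tau>)) *\<^sub>R (x t - x \<tau>)" for t
  have q1b: "norm (q1 t) \<le> Kr" if "t \<in> {0..T}" "t \<noteq> \<tau>" for t
    unfolding q1_def q[OF that(1)] using IL_Lipschitz[OF rm Kr, of \<tau> t] that \<tau> by (simp add: divide_simps)
  have x1: "((\<lambda>t. q1 t - (f0 P (x \<tau>) + Mean \<tau> t *\<^sub>R f1 P (x \<tau>))) \<longlongrightarrow> 0) (at \<tau> within {0..T})"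
  proof (rule tendstoI)
    fix e :: real assume e: "e > 0"
    \<comment> \<open>The velocity minus the velocity with the state frozen at
      \<open>\<tau>\<close>. The control is not frozen, so continuity of the state alone makes
      \<open>k\<close> small near \<open>\<tau>\<close>.\<close>
    define k where "k s = (f0 P (xb s) - f0 P (xb \<tau>)) + ub s *\<^sub>R (f1 P (xb s) - f1 P (xb \<tau>))" for s
    have km: "bdd_meas k" unfolding k_def[abs_def] by (intro bdd_meas_add bdd_meas_scaleR bdd_meas_diff F_xb_meas ub bdd_meas_const)
    have Ku0: "Ku \<ge> 0" using order_trans[OF norm_ge_zero Ku] .
    have "\<exists>d>0. \<forall>s. dist s \<tau> < d \<longrightarrow> dist (f0 P (xb s)) (f0 P (xb \<tau>)) < e / (4 * (1 + Ku)) \<and> dist (f1 P (xb s)) (f1 P (xb \<tau>)) < e / (4 * (1 + Ku))"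
    proof -
      have c: "continuous_on UNIV (\<lambda>s. f0 P (xb s))" "continuous_on UNIV (\<lambda>s. f1 P (xb s))"
        using continuous_on_compose2[OF C2_continuous[OF C2s(1)] xb(1)] continuous_on_compose2[OF C2_continuous[OF C2s(2)] xb(1)] by auto
      have p: "e / (4 * (1 + Ku)) > 0" using e Ku0 by simp
      obtain d1 where d1: "d1 > 0" "\<And>s. dist s \<tau> < d1 \<Longrightarrow> dist (f0 P (xb s)) (f0 P (xb \<tau>)) < e / (4 * (1 + Ku))"
        using c(1) p unfolding continuous_on_iff by blast
      obtain d2 where d2: "d2 > 0" "\<And>s. dist s \<tau> < d2 \<Longrightarrow> dist (f1 P (xb s)) (f1 P (xb \<tau>)) < e / (4 * (1 + Ku))"
        using c(2) p unfolding continuous_on_iff by blast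
      show ?thesis using d1 d2 by (intro exI[of _ "min d1 d2"]) auto
    qed
    then obtain d where d: "d > 0" "\<And>s. dist s \<tau> < d \<Longrightarrow> dist (f0 P (xb s)) (f0 P (xb \<tau>)) < e / (4 * (1 + Ku))"
      "\<And>s. dist s \<tau> < d \<Longrightarrow> dist (f1 P (xb s)) (f1 P (xb \<tau>)) < e / (4 * (1 + Ku))" by blast
    have kb: "norm (k s) \<le> e / 2" if "dist s \<tau> < d" for s
    proof -
      have "norm (ub s *\<^sub>R (f1 P (xb s) - f1 P (xb \<tau>))) \<le> Ku * (e / (4 * (1 + Ku)))"
        unfolding norm_scaleR using Ku[of s] d(3)[OF that] e Ku0 by (intro mult_mono) (auto simp: dist_norm)
      then have "norm (k s) \<le> e / (4 * (1 + Ku)) + Ku * (e / (4 * (1 + Ku)))"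
        unfolding k_def using d(2)[OF that] by (intro norm_triangle_mono) (auto simp: dist_norm)
      also have "\<dots> = (1 + Ku) * (e / (4 * (1 + Ku)))" by (simp only: distrib_right mult_1)
      also have "\<dots> = e / 4" using Ku0 by (simp add: nonzero_divide_eq_eq add_nonneg_eq_0_iff)
      finally show ?thesis using e by simp
    qed
    have "dist (q1 t - (f0 P (x \<tau>) + Mean \<tau> t *\<^sub>R f1 P (x \<tau>))) 0 < e" if t: "t \<in> {0..T}" "t \<noteq> \<tau>" "dist t \<tau> < d" for t
    proof -
      have sc: "IL 0 s (\<lambda>r. ub r *\<^sub>R f1 P (xb \<tau>)) = IL 0 s ub *\<^sub>R f1 P (xb \<tau>)" for s
        by (rule integral_scaleR_left) (intro bdd_meas_integrable ub)
      have kk: "IL 0 s k = IL 0 s r - s *\<^sub>R f0 P (xb \<tau>) - IL 0 s ub *\<^sub>R f1 P (xb \<tau>)" if "0 \<le> s" for s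
      proof -
        have "k = (\<lambda>s. r s - (f0 P (xb \<tau>) + ub s *\<^sub>R f1 P (xb \<tau>)))" by (auto simp: k_def r_def algebra_simps)
        then have "IL 0 s k = IL 0 s r - IL 0 s (\<lambda>s. f0 P (xb \<tau>) + ub s *\<^sub>R f1 P (xb \<tau>))"
          by (simp add: IL_diff rm bdd_meas_add bdd_meas_const bdd_meas_scaleR ub)
        also have "IL 0 s (\<lambda>s. f0 P (xb \<tau>) + ub s *\<^sub>R f1 P (xb \<tau>)) = IL 0 s (\<lambda>s. f0 P (xb \<tau>)) + IL 0 s ub *\<^sub>R f1 P (xb \<tau>)"
          by (simp add: IL_add bdd_meas_const bdd_meas_scaleR ub sc del: integral_const)
        also have "IL 0 s (\<lambda>s. f0 P (xb \<tau>)) = s *\<^sub>R f0 P (xb \<tau>)" using IL_const[OF that] by simp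
        finally show ?thesis by simp
      qed
      have "norm (IL 0 t k - IL 0 \<tau> k) \<le> e / 2 * \<bar>t - \<tau>\<bar>"
      proof (cases "\<tau> \<le> t")
        case True
        then have "norm (IL \<tau> t k) \<le> e / 2 * (t - \<tau>)"
          using t by (intro IL_norm_bound[OF km] AE_I2 kb) (auto simp: dist_real_def)
        then show ?thesis using IL_increment[OF km, of \<tau> t] True \<tau> by auto
      next
        case False
        then have "norm (IL t \<tau> k) \<le> e / 2 * (\<tau> - t)"
          using t by (intro IL_norm_bound[OF km] AE_I2 kb) (auto simp: dist_real_def)
        then show ?thesis using IL_increment[OF km, of t \<tau>] False t by (auto simp: norm_minus_commute)
      qed
      moreover have "IL 0 t k - IL 0 \<tau> k = (t - \<tau>) *\<^sub>R (q1 t - (f0 P (x \<tau>) + Mean \<tau> t *\<^sub>R f1 P (x \<tau>)))"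
      proof -
        have 1: "(t - \<tau>) *\<^sub>R q1 t = IL 0 t r - IL 0 \<tau> r" using t q[OF t(1)] by (simp add: q1_def)
        have 2: "(t - \<tau>) * Mean \<tau> t = IL 0 t ub - IL 0 \<tau> ub" using t by (simp add: Mean_def)
        have 3: "(t - \<tau>) *\<^sub>R (q1 t - (f0 P (x \<tau>) + Mean \<tau> t *\<^sub>R f1 P (x \<tau>)))
          = (IL 0 t r - IL 0 \<tau> r) - ((t - \<tau>) *\<^sub>R f0 P (x \<tau>) + (IL 0 t ub - IL 0 \<tau> ub) *\<^sub>R f1 P (x \<tau>))"
          by (simp only: scaleR_diff_right scaleR_add_right scaleR_scaleR 1 2)
        have 4: "IL 0 s r = IL 0 s k + s *\<^sub>R f0 P (x \<tau>) + IL 0 s ub *\<^sub>R f1 P (x \<tau>)" if "0 \<le> s" for s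
          using kk[OF that] xb(3)[OF \<tau>] by simp
        have t0: "0 \<le> t" "0 \<le> \<tau>" using t \<tau> by auto
        show ?thesis unfolding 3 4[OF t0(1)] 4[OF t0(2)] by (simp add: algebra_simps)
      qed
      ultimately have "\<bar>t - \<tau>\<bar> * norm (q1 t - (f0 P (x \<tau>) + Mean \<tau> t *\<^sub>R f1 P (x \<tau>))) \<le> \<bar>t - \<tau>\<bar> * (e / 2)" by (simp add: mult.commute)
      then have "norm (q1 t - (f0 P (x \<tau>) + Mean \<tau> t *\<^sub>R f1 P (x \<tau>))) \<le> e / 2" using t by simp
      then show ?thesis using e by (simp add: dist_norm)
    qed
    then show "\<forall>\<^sub>F t in at \<tau> within {0..T}. dist (q1 t - (f0 P (x \<tau>) + Mean \<tau> t *\<^sub>R f1 P (x \<tau>))) 0 < e"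
      unfolding eventually_at using d(1) by blast
  qed
  have D1: "((\<lambda>t. D (q1 t - (f0 P (x \<tau>) + Mean \<tau> t *\<^sub>R f1 P (x \<tau>)))) \<longlongrightarrow> 0) (at \<tau> within {0..T})"
    using bounded_linear.tendsto[OF Dl x1] bounded_linear.linear[OF Dl] by (simp add: linear_0)
  \<comment> \<open>Differentiability of g at x(\<tau>); the Lipschitz bound \<open>Kr\<close> for
    the trajectory turns an error small relative to the increment of x into one small relative to
    the increment of t.\<close>
  have D2: "((\<lambda>t. (G t - G \<tau>) / (t - \<tau>) - D (q1 t)) \<longlongrightarrow> 0) (at \<tau> within {0..T})"
  proof (rule tendstoI)
    fix e :: real assume e: "e > 0"
    have Kr0: "Kr \<ge> 0" using order_trans[OF norm_ge_zero Kr] .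
    have "e / (2 * (Kr + 1)) > 0" using e Kr0 by simp
    then obtain d where d: "d > 0" "\<And>y. norm (y - x \<tau>) < d \<Longrightarrow> norm (state_con P y - state_con P (x \<tau>) - D (y - x \<tau>)) \<le> e / (2 * (Kr + 1)) * norm (y - x \<tau>)"
      using D unfolding has_derivative_at_alt by blast
    have "dist ((G t - G \<tau>) / (t - \<tau>) - D (q1 t)) 0 < e" if t: "t \<in> {0..T}" "t \<noteq> \<tau>" "dist t \<tau> < d / (Kr + 1)" for t
    proof -
      have xt: "x t - x \<tau> = (t - \<tau>) *\<^sub>R q1 t" using t by (simp add: q1_def)
      have n: "norm (x t - x \<tau>) \<le> \<bar>t - \<tau>\<bar> * (Kr + 1)" unfolding xt norm_scaleR using q1b[OF t(1,2)] by (intro mult_mono) auto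
      also have "\<dots> < d" using t(3) Kr0 by (simp add: dist_real_def field_simps)
      finally have "norm (G t - G \<tau> - D (x t - x \<tau>)) \<le> e / (2 * (Kr + 1)) * norm (x t - x \<tau>)" by (rule d)
      also have "\<dots> \<le> e / (2 * (Kr + 1)) * (\<bar>t - \<tau>\<bar> * (Kr + 1))" using n e Kr0 by (intro mult_left_mono) auto
      also have "\<dots> = e / 2 * \<bar>t - \<tau>\<bar>"
      proof -
        have "e / (2 * c) * (m * c) = e / 2 * m" if "c \<noteq> 0" for c m :: real using that by simp
        from this[of "Kr + 1" "\<bar>t - \<tau>\<bar>"] show ?thesis using Kr0 by linarith
      qed
      finally have "norm (G t - G \<tau> - D (x t - x \<tau>)) \<le> e / 2 * \<bar>t - \<tau>\<bar>" .
      moreover have "G t - G \<tau> - D (x t - x \<tau>) = (t - \<tau>) * ((G t - G \<tau>) / (t - \<tau>) - D (q1 t))"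
      proof -
        have "D (x t - x \<tau>) = (t - \<tau>) * D (q1 t)" unfolding xt using bounded_linear.linear[OF Dl] by (simp add: linear_cmul)
        moreover have "G t - G \<tau> = (t - \<tau>) * ((G t - G \<tau>) / (t - \<tau>))" using t by simp
        ultimately show ?thesis by (simp only: right_diff_distrib)
      qed
      ultimately have "\<bar>t - \<tau>\<bar> * \<bar>(G t - G \<tau>) / (t - \<tau>) - D (q1 t)\<bar> \<le> \<bar>t - \<tau>\<bar> * (e / 2)" by (simp add: abs_mult mult.commute)
      then have "\<bar>(G t - G \<tau>) / (t - \<tau>) - D (q1 t)\<bar> \<le> e / 2" using t by (auto simp: mult_le_cancel_left_pos)
      then show ?thesis using e by (simp add: dist_real_def)
    qed
    then show "\<forall>\<^sub>F t in at \<tau> within {0..T}. dist ((G t - G \<tau>) / (t - \<tau>) - D (q1 t)) 0 < e"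
      unfolding eventually_at using d(1) Kr0 by (intro exI[of _ "d / (Kr + 1)"]) auto
  qed
  have "D (q1 t - (f0 P (x \<tau>) + Mean \<tau> t *\<^sub>R f1 P (x \<tau>))) = D (q1 t) - (g0 \<tau> + Mean \<tau> t * g1 \<tau>)" for t
    using bounded_linear.linear[OF Dl] by (simp add: linear_diff linear_add linear_cmul g0_def g1_def D_def)
  then have "D (q1 t - (f0 P (x \<tau>) + Mean \<tau> t *\<^sub>R f1 P (x \<tau>))) + ((G t - G \<tau>) / (t - \<tau>) - D (q1 t))
      = (G t - G \<tau>) / (t - \<tau>) - (g0 \<tau> + Mean \<tau> t * g1 \<tau>)" for t by simp
  with tendsto_add[OF D1 D2] show ?thesis by (simp only: add_0_left)
qed

end

section \<open>Mean values of the control near a junction\<close>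

context ocp_reference
begin

lemma Mean_bound_right:
  assumes st: "0 \<le> \<tau>" "\<tau> < t" "t \<le> T" and AE: "AE s in lebesgue. s \<in> {\<tau><..<t} \<longrightarrow> \<bar>u s - r\<bar> \<le> e"
  shows "\<bar>Mean \<tau> t - r\<bar> \<le> e"
proof -
  have d: "bdd_meas (\<lambda>s. ub s - r)" by (intro bdd_meas_diff ub bdd_meas_const)
  have a: "AE s in lebesgue. s \<in> {0..T} \<longrightarrow> ub s = u s" using ub(2) by (simp add: AE_restrict_space_iff)
  have n: "AE s in lebesgue. s \<notin> {\<tau>, t}" by (rule AE_I'[of "{\<tau>, t}"]) auto
  have "AE s in lebesgue. s \<in> {\<tau>..t} \<longrightarrow> norm (ub s - r) \<le> e"
    using AE a n by eventually_elim (use st in force)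
  then have "norm (IL \<tau> t (\<lambda>s. ub s - r)) \<le> e * (t - \<tau>)"
    using st by (intro IL_norm_bound[OF d]) (auto simp: AE_restrict_space_iff)
  also have "IL \<tau> t (\<lambda>s. ub s - r) = IL 0 t ub - IL 0 \<tau> ub - (t - \<tau>) * r"
    using st IL_const[of \<tau> t r] by (simp add: IL_diff ub bdd_meas_const IL_increment[OF ub(1)] del: integral_const)
  also have "IL 0 t ub - IL 0 \<tau> ub = (t - \<tau>) * Mean \<tau> t" using st by (simp add: Mean_def)
  also have "(t - \<tau>) * Mean \<tau> t - (t - \<tau>) * r = (t - \<tau>) * (Mean \<tau> t - r)" by (simp only: right_diff_distrib)
  finally show ?thesis using st by (simp add: abs_mult mult.commute)
qed

lemma Mean_sym: "Mean \<tau> t = Mean t \<tau>"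
  unfolding Mean_def by (metis minus_diff_eq minus_divide_divide)

lemma Mean_bound_left:
  assumes st: "0 \<le> t" "t < \<tau>" "\<tau> \<le> T" and AE: "AE s in lebesgue. s \<in> {t<..<\<tau>} \<longrightarrow> \<bar>u s - r\<bar> \<le> e"
  shows "\<bar>Mean \<tau> t - r\<bar> \<le> e"
proof -
  show ?thesis using Mean_bound_right[of t \<tau> r e] assms by (simp add: Mean_sym)
qed

text \<open>Null sets drop out of the integral, so an essential limit of the control becomes an
  ordinary limit of its mean values.\<close>

lemma Mean_limit_right:
  assumes \<tau>: "0 \<le> \<tau>" "\<tau> < T" and lim: "(u \<longlongrightarrow> r) (inf (ae_filter lebesgue) (at_right \<tau>))"
  shows "(Mean \<tau> \<longlongrightarrow> r) (at_right \<tau>)"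
proof (rule tendstoI)
  fix e :: real assume e: "e > 0"
  have "\<forall>\<^sub>F s in inf (ae_filter lebesgue) (at_right \<tau>). dist (u s) r < e / 2" using e by (intro tendstoD[OF lim]) auto
  then obtain A B where AB: "AE s in lebesgue. A s" "eventually B (at_right \<tau>)" "\<And>s. A s \<Longrightarrow> B s \<Longrightarrow> dist (u s) r < e/2"
    unfolding eventually_inf by blast
  obtain b where b: "b > \<tau>" "\<And>s. \<tau> < s \<Longrightarrow> s < b \<Longrightarrow> B s" using AB(2) \<tau> unfolding eventually_at_right[OF \<tau>(2)] by blast
  have "dist (Mean \<tau> t) r < e" if t: "\<tau> < t" "t < min b T" for t
  proof -
    have "AE s in lebesgue. s \<in> {\<tau><..<t} \<longrightarrow> \<bar>u s - r\<bar> \<le> e / 2"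
      using AB(1) by eventually_elim (use AB(3) b(2) t in \<open>auto simp: dist_real_def less_imp_le\<close>)
    then have "\<bar>Mean \<tau> t - r\<bar> \<le> e / 2" using t \<tau> by (intro Mean_bound_right) auto
    then show ?thesis using e by (simp add: dist_real_def)
  qed
  then show "\<forall>\<^sub>F t in at_right \<tau>. dist (Mean \<tau> t) r < e"
    unfolding eventually_at_right[OF \<tau>(2)] using b(1) \<tau> by (intro exI[of _ "min b T"]) auto
qed

lemma Mean_limit_left:
  assumes \<tau>: "0 < \<tau>" "\<tau> \<le> T" and lim: "(u \<longlongrightarrow> r) (inf (ae_filter lebesgue) (at_left \<tau>))"
  shows "(Mean \<tau> \<longlongrightarrow> r) (at_left \<tau>)"
proof (rule tendstoI)
  fix e :: real assume e: "e > 0"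
  have "\<forall>\<^sub>F s in inf (ae_filter lebesgue) (at_left \<tau>). dist (u s) r < e / 2" using e by (intro tendstoD[OF lim]) auto
  then obtain A B where AB: "AE s in lebesgue. A s" "eventually B (at_left \<tau>)" "\<And>s. A s \<Longrightarrow> B s \<Longrightarrow> dist (u s) r < e/2"
    unfolding eventually_inf by blast
  obtain b where b: "b < \<tau>" "\<And>s. b < s \<Longrightarrow> s < \<tau> \<Longrightarrow> B s" using AB(2) unfolding eventually_at_left[OF \<tau>(1)] by blast
  have "dist (Mean \<tau> t) r < e" if t: "max b 0 < t" "t < \<tau>" for t
  proof -
    have "AE s in lebesgue. s \<in> {t<..<\<tau>} \<longrightarrow> \<bar>u s - r\<bar> \<le> e / 2"
      using AB(1) by eventually_elim (use AB(3) b(2) t in \<open>auto simp: dist_real_def less_imp_le\<close>)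
    then have "\<bar>Mean \<tau> t - r\<bar> \<le> e / 2" using t \<tau> by (intro Mean_bound_left) auto
    then show ?thesis using e by (simp add: dist_real_def)
  qed
  then show "\<forall>\<^sub>F t in at_left \<tau>. dist (Mean \<tau> t) r < e"
    unfolding eventually_at_left[OF \<tau>(1)] using b(1) \<tau> by (intro exI[of _ "max b 0"]) auto
qed

lemma Mean_ge_right:
  assumes st: "0 \<le> \<tau>" "\<tau> < t" "t \<le> T" and AE: "AE s in lebesgue. s \<in> {\<tau><..<t} \<longrightarrow> m \<le> u s"
  shows "m \<le> Mean \<tau> t"
proof -
  obtain Ku where Ku: "\<And>s. norm (ub s) \<le> Ku" using ub(1) by (auto simp: bdd_meas_def)
  have a: "AE s in lebesgue. s \<in> {0..T} \<longrightarrow> ub s = u s" using ub(2) by (simp add: AE_restrict_space_iff)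
  \<comment> \<open>The one-sided bound becomes a two-sided one around a shifted centre: the
    interval of radius \<open>Ku + \<bar>m\<bar>\<close> about this centre has lower end
    \<open>m\<close> and contains the essential values of the control.\<close>
  have "AE s in lebesgue. s \<in> {\<tau><..<t} \<longrightarrow> \<bar>u s - (m + (Ku + \<bar>m\<bar>))\<bar> \<le> Ku + \<bar>m\<bar>"
    using AE a
  proof eventually_elim
    case (elim s)
    show ?case
    proof
      assume s: "s \<in> {\<tau><..<t}"
      then have "\<bar>u s\<bar> \<le> Ku" "m \<le> u s" using elim Ku[of s] st by auto
      then show "\<bar>u s - (m + (Ku + \<bar>m\<bar>))\<bar> \<le> Ku + \<bar>m\<bar>" by linarith
    qed
  qed
  from Mean_bound_right[OF st this] show ?thesis by linarith
qed

lemma Mean_le_right: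
  assumes st: "0 \<le> \<tau>" "\<tau> < t" "t \<le> T" and AE: "AE s in lebesgue. s \<in> {\<tau><..<t} \<longrightarrow> u s \<le> m"
  shows "Mean \<tau> t \<le> m"
proof -
  obtain Ku where Ku: "\<And>s. norm (ub s) \<le> Ku" using ub(1) by (auto simp: bdd_meas_def)
  have a: "AE s in lebesgue. s \<in> {0..T} \<longrightarrow> ub s = u s" using ub(2) by (simp add: AE_restrict_space_iff)
  have "AE s in lebesgue. s \<in> {\<tau><..<t} \<longrightarrow> \<bar>u s - (m - (Ku + \<bar>m\<bar>))\<bar> \<le> Ku + \<bar>m\<bar>"
    using AE a
  proof eventually_elim
    case (elim s)
    show ?case
    proof
      assume s: "s \<in> {\<tau><..<t}"
      then have "\<bar>u s\<bar> \<le> Ku" "u s \<le> m" using elim Ku[of s] st by auto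
      then show "\<bar>u s - (m - (Ku + \<bar>m\<bar>))\<bar> \<le> Ku + \<bar>m\<bar>" by linarith
    qed
  qed
  from Mean_bound_right[OF st this] show ?thesis by linarith
qed

text \<open>In the next two lemmas \<open>F\<close> is the one-sided neighbourhood filter of an end point \<open>\<tau>\<close> of a
  \<open>C\<close> arc, on the side of the arc and on the opposite side, respectively.\<close>

lemma Mean_limit_contact:
  assumes \<tau>: "\<tau> \<in> {0..T}" and F: "F \<le> at \<tau> within {0..T}" and G0: "G \<tau> = 0" "\<forall>\<^sub>F t in F. G t = 0" and g1: "g1 \<tau> \<noteq> 0"
  shows "(Mean \<tau> \<longlongrightarrow> - g0 \<tau> / g1 \<tau>) F"
proof -
  have "((\<lambda>t. (G t - G \<tau>) / (t - \<tau>) - (g0 \<tau> + Mean \<tau> t * g1 \<tau>)) \<longlongrightarrow> 0) F"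
    using tendsto_mono[OF F G_quotient[OF \<tau>]] .
  \<comment> \<open>Along the arc the difference quotient of g vanishes, which forces the mean
    values towards the control - g0 / g1 that keeps the constraint active.\<close>
  then have "((\<lambda>t. - (g0 \<tau> + Mean \<tau> t * g1 \<tau>)) \<longlongrightarrow> 0) F"
    by (rule Lim_transform_eventually) (use G0(2) in eventually_elim, simp add: G0)
  then have "((\<lambda>t. (- (- (g0 \<tau> + Mean \<tau> t * g1 \<tau>)) - g0 \<tau>) / g1 \<tau>) \<longlongrightarrow> (- 0 - g0 \<tau>) / g1 \<tau>) F"
    by (intro tendsto_intros g1)
  then show ?thesis using g1 by simp
qed

lemma slope_outside:
  assumes \<tau>: "\<tau> \<in> {0..T}" and F: "F \<le> at \<tau> within {0..T}" and G0: "G \<tau> = 0" and g1: "g1 \<tau> \<noteq> 0"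
    and lim: "(Mean \<tau> \<longlongrightarrow> r) F" and r: "r \<noteq> - g0 \<tau> / g1 \<tau>"
  shows "\<exists>c>0. \<forall>\<^sub>F t in F. G t \<le> - c * \<bar>t - \<tau>\<bar>"
proof -
  \<comment> \<open>The one-sided derivative of g(x_t) at \<open>\<tau>\<close>. It is nonzero
    because the control mean has another limit than the one keeping g constant; its sign is
    irrelevant, since g(x_t) <= 0 makes the modulus of g equal to -g.\<close>
  define k where "k = g0 \<tau> + r * g1 \<tau>"
  have k: "k \<noteq> 0" using r g1 by (auto simp: k_def field_simps)
  have "((\<lambda>t. (G t - G \<tau>) / (t - \<tau>) - (g0 \<tau> + Mean \<tau> t * g1 \<tau>)) \<longlongrightarrow> 0) F"
    using tendsto_mono[OF F G_quotient[OF \<tau>]] .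
  moreover have "((\<lambda>t. g0 \<tau> + Mean \<tau> t * g1 \<tau>) \<longlongrightarrow> k) F" unfolding k_def by (intro tendsto_intros lim)
  ultimately have "((\<lambda>t. ((G t - G \<tau>) / (t - \<tau>) - (g0 \<tau> + Mean \<tau> t * g1 \<tau>)) + (g0 \<tau> + Mean \<tau> t * g1 \<tau>)) \<longlongrightarrow> 0 + k) F"
    by (rule tendsto_add)
  then have "((\<lambda>t. G t / (t - \<tau>)) \<longlongrightarrow> k) F" by (simp add: G0)
  then have "((\<lambda>t. \<bar>G t / (t - \<tau>)\<bar>) \<longlongrightarrow> \<bar>k\<bar>) F" by (rule tendsto_rabs)
  then have "\<forall>\<^sub>F t in F. \<bar>G t / (t - \<tau>)\<bar> > \<bar>k\<bar> / 2" using k by (intro order_tendstoD) auto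
  moreover have "\<forall>\<^sub>F t in F. t \<in> {0..T} \<and> t \<noteq> \<tau>"
    using F by (rule filter_leD) (auto simp: eventually_at intro!: exI[of _ 1])
  ultimately have "\<forall>\<^sub>F t in F. G t \<le> - (\<bar>k\<bar> / 2) * \<bar>t - \<tau>\<bar>"
  proof eventually_elim
    case (elim t)
    then have "\<bar>k\<bar> / 2 * \<bar>t - \<tau>\<bar> \<le> \<bar>G t\<bar>" by (simp add: abs_divide divide_simps split: if_splits)
    then show ?case using G_le[of t] elim by simp
  qed
  then show ?thesis using k by (intro exI[of _ "\<bar>k\<bar> / 2"]) auto
qed

end

section \<open>Arc structure and margins of the constraints\<close>

text \<open>Otherwise all intervals of the family end at or before b or begin after b. The stretch
  from b to the nearest such beginning, or to T, would then be an uncovered set of positive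
  measure.\<close>

lemma finite_open_cover_right:
  fixes b T :: real
  assumes fin: "finite \<A>" and I: "\<And>I. I \<in> \<A> \<Longrightarrow> \<exists>p q. I = {p<..<q} \<and> p < q" and neg: "negligible ({0..T} - \<Union>\<A>)" and b: "0 \<le> b" "b < T"
  shows "\<exists>p q. {p<..<q} \<in> \<A> \<and> p \<le> b \<and> b < q"
proof (rule ccontr)
  assume no: "\<not> ?thesis"
  define E where "E = insert T {Inf I | I. I \<in> \<A> \<and> Inf I > b}"
  have E: "finite E" "E \<noteq> {}" "\<And>y. y \<in> E \<Longrightarrow> y > b" using fin b by (auto simp: E_def)
  define d where "d = Min E"
  have d: "d > b" using E by (simp add: d_def)
  have dT: "d \<le> T" unfolding d_def using E(1) by (intro Min_le) (auto simp: E_def)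
  have "{b<..<d} \<inter> I = {}" if II: "I \<in> \<A>" for I
  proof -
    obtain p q where pq: "I = {p<..<q}" "p < q" using I[OF II] by blast
    then have inf: "Inf I = p" by simp
    have "p > b \<or> q \<le> b" using no II pq(1) by (metis not_le)
    then consider "p > b" | "q \<le> b" by blast
    then show ?thesis
    proof cases
      case 1
      then have "p \<in> E" using II inf by (auto simp: E_def)
      then have "d \<le> p" unfolding d_def using E(1) by (intro Min_le) auto
      then show ?thesis using pq by auto
    next
      case 2
      then show ?thesis using pq by auto
    qed
  qed
  then have "{b<..<d} \<subseteq> {0..T} - \<Union>\<A>" using b dT by auto
  then have "negligible {b<..<d}" using neg negligible_subset by blast
  then have "{b<..<d} = {}" using negligible_interval(2)[of b d] by (simp add: box_real)
  then show False using d by simp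
qed

lemma finite_open_cover_left:
  fixes b T :: real
  assumes fin: "finite \<A>" and I: "\<And>I. I \<in> \<A> \<Longrightarrow> \<exists>p q. I = {p<..<q} \<and> p < q" and neg: "negligible ({0..T} - \<Union>\<A>)" and b: "0 < b" "b \<le> T"
  shows "\<exists>p q. {p<..<q} \<in> \<A> \<and> p < b \<and> b \<le> q"
proof (rule ccontr)
  assume no: "\<not> ?thesis"
  define E where "E = insert 0 {Sup I | I. I \<in> \<A> \<and> Sup I < b}"
  have E: "finite E" "E \<noteq> {}" "\<And>y. y \<in> E \<Longrightarrow> y < b" using fin b by (auto simp: E_def)
  define d where "d = Max E"
  have d: "d < b" using E by (simp add: d_def)
  have dT: "0 \<le> d" unfolding d_def using E(1) by (intro Max_ge) (auto simp: E_def)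
  have "{d<..<b} \<inter> I = {}" if II: "I \<in> \<A>" for I
  proof -
    obtain p q where pq: "I = {p<..<q}" "p < q" using I[OF II] by blast
    then have sup: "Sup I = q" by simp
    have "q < b \<or> p \<ge> b" using no II pq(1) by (metis not_le)
    then consider "q < b" | "p \<ge> b" by blast
    then show ?thesis
    proof cases
      case 1
      then have "q \<in> E" using II sup by (auto simp: E_def)
      then have "q \<le> d" unfolding d_def using E(1) by (intro Max_ge) auto
      then show ?thesis using pq by auto
    next
      case 2
      then show ?thesis using pq by auto
    qed
  qed
  then have "{d<..<b} \<subseteq> {0..T} - \<Union>\<A>" using b dT by auto
  then have "negligible {d<..<b}" using neg negligible_subset by blast
  then have "{d<..<b} = {}" using negligible_interval(2)[of d b] by (simp add: box_real)
  then show False using d by simp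
qed

lemma at_left_le_within: "(0::real) < b \<Longrightarrow> b \<le> T \<Longrightarrow> at_left b \<le> at b within {0..T}"
proof -
  assume b: "0 < b" "b \<le> T"
  have "at_left b = at b within {0..<b}"
    by (rule at_within_nhd[of b "{0<..}"]) (use b in auto)
  also have "\<dots> \<le> at b within {0..T}" using b by (intro at_le) auto
  finally show ?thesis .
qed

lemma at_right_le_within: "(0::real) \<le> b \<Longrightarrow> b < T \<Longrightarrow> at_right b \<le> at b within {0..T}"
proof -
  assume b: "0 \<le> b" "b < T"
  have "at_right b = at b within {b<..T}"
    by (rule at_within_nhd[of b "{..<T}"]) (use b in auto)
  also have "\<dots> \<le> at b within {0..T}" using b by (intro at_le) auto
  finally show ?thesis .
qed

locale ocp_arcs = ocp_reference P u x for P :: "('n::finite) ocp" and u :: "real \<Rightarrow> real" and x :: "real \<Rightarrow> real ^ 'n" +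
  assumes fin: "finite_arc_structure P u x" and away: "control_away_from_bounds P u x"
    and disc: "discontinuous_at_CS_SC_junctions P u x" and first: "first_order_state_constraint P x"
begin

abbreviation "C \<equiv> contact_set P x"

lemma C_iff: "t \<in> C \<longleftrightarrow> t \<in> {0..T} \<and> G t = 0" by (simp add: contact_set_def)

lemma g1_nonzero: "t \<in> C \<Longrightarrow> g1 t \<noteq> 0"
  using first unfolding first_order_state_constraint_def g1_def by blast

lemma C_arcD: "C_arc P x a b \<Longrightarrow> 0 \<le> a \<and> a < b \<and> b \<le> T \<and> {a<..<b} \<subseteq> C"
  by (auto simp: C_arc_def maximal_interval_def)

lemma C_arc_closed: "C_arc P x a b \<Longrightarrow> {a..b} \<subseteq> C"
proof -
  assume ab: "C_arc P x a b"
  have "C = \<Union>{{a..b} | a b. C_arc P x a b}" using fin by (simp add: finite_arc_structure_def)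
  then show "{a..b} \<subseteq> C" using ab by blast
qed

lemma C_arc_obtain: "t \<in> C \<Longrightarrow> \<exists>a b. C_arc P x a b \<and> t \<in> {a..b}"
proof -
  assume t: "t \<in> C"
  have "C = \<Union>{{a..b} | a b. C_arc P x a b}" using fin by (simp add: finite_arc_structure_def)
  then show ?thesis using t by blast
qed

lemma BS_arc_negative: "B_arc P u a b \<or> S_arc P u x a b \<Longrightarrow> t \<in> {a<..<b} \<Longrightarrow> G t < 0"
  using fin unfolding finite_arc_structure_def by blast

lemma BS_arc_bounds: "B_arc P u a b \<or> S_arc P u x a b \<Longrightarrow> 0 \<le> a \<and> a < b \<and> b \<le> T"
  by (auto simp: B_arc_def S_arc_def maximal_interval_def)

lemma arcs_obtain:
  obtains \<A> where "finite \<A>" "\<And>I. I \<in> \<A> \<Longrightarrow> \<exists>a b. I = {a<..<b} \<and> a < b \<and> (B_arc P u a b \<or> C_arc P x a b \<or> S_arc P u x a b)"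
    "negligible ({0..T} - \<Union>\<A>)"
proof -
  obtain \<A> where A: "finite \<A>" "\<forall>I\<in>\<A>. \<exists>a b. I = {a<..<b} \<and> (B_arc P u a b \<or> C_arc P x a b \<or> S_arc P u x a b)"
    "negligible ({0..T} - \<Union>\<A>)"
    using fin unfolding finite_arc_structure_def by blast
  show ?thesis
  proof (rule that[OF A(1) _ A(3)])
    fix I assume "I \<in> \<A>"
    then obtain a b where "I = {a<..<b}" "B_arc P u a b \<or> C_arc P x a b \<or> S_arc P u x a b" using A(2) by blast
    then show "\<exists>a b. I = {a<..<b} \<and> a < b \<and> (B_arc P u a b \<or> C_arc P x a b \<or> S_arc P u x a b)"
      using BS_arc_bounds[of a b] C_arcD[of a b] by blast
  qed
qed

text \<open>Some arc of the finite family covers a right neighbourhood of b. A C arc there would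
  extend (a, b) against maximality, and a B or S arc cannot start before b, because g vanishes on
  the C arc and is negative on the others.\<close>

lemma junction_right:
  assumes ab: "C_arc P x a b" and bT: "b < T"
  shows "\<exists>q>b. B_arc P u b q \<or> S_arc P u x b q"
proof -
  obtain \<A> where A: "finite \<A>" "\<And>I. I \<in> \<A> \<Longrightarrow> \<exists>a b. I = {a<..<b} \<and> a < b \<and> (B_arc P u a b \<or> C_arc P x a b \<or> S_arc P u x a b)"
    "negligible ({0..T} - \<Union>\<A>)" by (rule arcs_obtain) (rule that)
  have a: "0 \<le> a" "a < b" "{a<..<b} \<subseteq> C" "{a..b} \<subseteq> C" using C_arcD[OF ab] C_arc_closed[OF ab] by auto
  have A2: "\<exists>p q. I = {p<..<q} \<and> p < q" if "I \<in> \<A>" for I using A(2)[OF that] by blast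
  obtain p q where pq: "{p<..<q} \<in> \<A>" "p \<le> b" "b < q"
    using finite_open_cover_right[OF A(1) A2 A(3), of b] a bT by auto
  obtain p' q' where pq': "{p<..<q} = {p'<..<q'}" "B_arc P u p' q' \<or> C_arc P x p' q' \<or> S_arc P u x p' q'" using A(2)[OF pq(1)] by blast
  have "p < q" using pq by simp
  then have "p' = p \<and> q' = q" using pq'(1) by (metis greaterThanLessThan_eq_iff less_eq_real_def not_less order_less_le_trans)
  then have t: "B_arc P u p q \<or> C_arc P x p q \<or> S_arc P u x p q" using pq' by simp
  have "\<not> C_arc P x p q"
  proof
    assume c: "C_arc P x p q"
    have "{a<..<q} \<subseteq> {a..b} \<union> {p<..<q}" using pq by auto
    then have "{a<..<q} \<subseteq> C" using a(4) C_arcD[OF c] by blast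
    then have "q = b" using ab C_arcD[OF c] pq a unfolding C_arc_def maximal_interval_def by (meson less_imp_le order_refl)
    then show False using pq by simp
  qed
  then have t: "B_arc P u p q \<or> S_arc P u x p q" using t by blast
  have "p = b"
  proof (rule ccontr)
    assume "p \<noteq> b"
    then have "max a p < b" using pq a by simp
    then obtain t where "max a p < t" "t < b" using dense by blast
    then have "t \<in> C" "G t < 0" using BS_arc_negative[OF t, of t] a pq by auto
    then show False by (simp add: C_iff)
  qed
  then show ?thesis using t pq by blast
qed

lemma junction_left:
  assumes ab: "C_arc P x a b" and a0: "0 < a"
  shows "\<exists>p<a. B_arc P u p a \<or> S_arc P u x p a"
proof -
  obtain \<A> where A: "finite \<A>" "\<And>I. I \<in> \<A> \<Longrightarrow> \<exists>a b. I = {a<..<b} \<and> a < b \<and> (B_arc P u a b \<or> C_arc P x a b \<or> S_arc P u x a b)"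
    "negligible ({0..T} - \<Union>\<A>)" by (rule arcs_obtain) (rule that)
  have a: "b \<le> T" "a < b" "{a<..<b} \<subseteq> C" "{a..b} \<subseteq> C" using C_arcD[OF ab] C_arc_closed[OF ab] by auto
  have A2: "\<exists>p q. I = {p<..<q} \<and> p < q" if "I \<in> \<A>" for I using A(2)[OF that] by blast
  obtain p q where pq: "{p<..<q} \<in> \<A>" "p < a" "a \<le> q"
    using finite_open_cover_left[OF A(1) A2 A(3), of a] a a0 by auto
  obtain p' q' where pq': "{p<..<q} = {p'<..<q'}" "B_arc P u p' q' \<or> C_arc P x p' q' \<or> S_arc P u x p' q'" using A(2)[OF pq(1)] by blast
  have "p < q" using pq by simp
  then have "p' = p \<and> q' = q" using pq'(1) by (metis greaterThanLessThan_eq_iff less_eq_real_def not_less order_less_le_trans)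
  then have t: "B_arc P u p q \<or> C_arc P x p q \<or> S_arc P u x p q" using pq' by simp
  have "\<not> C_arc P x p q"
  proof
    assume c: "C_arc P x p q"
    have "{p<..<b} \<subseteq> {a..b} \<union> {p<..<q}" using pq by auto
    then have "{p<..<b} \<subseteq> C" using a(4) C_arcD[OF c] by blast
    then have "p = a" using ab C_arcD[OF c] pq a unfolding C_arc_def maximal_interval_def by (meson less_imp_le order_refl)
    then show False using pq by simp
  qed
  then have t: "B_arc P u p q \<or> S_arc P u x p q" using t by blast
  have "q = a"
  proof (rule ccontr)
    assume "q \<noteq> a"
    then have "a < min b q" using pq a by simp
    then obtain t where "a < t" "t < min b q" using dense by blast
    then have "t \<in> C" "G t < 0" using BS_arc_negative[OF t, of t] a pq by auto
    then show False by (simp add: C_iff)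
  qed
  then show ?thesis using t pq by blast
qed

lemma away_obtain:
  obtains \<rho> where "\<rho> > 0" "\<And>a b. C_arc P x a b \<or> S_arc P u x a b \<Longrightarrow>
     AE t in lebesgue. t \<in> {a<..<b} \<longrightarrow> u_min P + ereal \<rho> \<le> ereal (u t) \<and> ereal (u t) \<le> u_max P - ereal \<rho>"
proof -
  obtain \<rho> where \<rho>: "\<rho> > 0" "\<And>a b. C_arc P x a b \<or> S_arc P u x a b \<Longrightarrow>
     AE t in lebesgue_on {a<..<b}. u_min P + ereal \<rho> \<le> ereal (u t) \<and> ereal (u t) \<le> u_max P - ereal \<rho>"
    using away unfolding control_away_from_bounds_def by blast
  show ?thesis
  proof (rule that[OF \<rho>(1)])
    fix a b assume "C_arc P x a b \<or> S_arc P u x a b"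
    from \<rho>(2)[OF this] show "AE t in lebesgue. t \<in> {a<..<b} \<longrightarrow> u_min P + ereal \<rho> \<le> ereal (u t) \<and> ereal (u t) \<le> u_max P - ereal \<rho>"
      by (subst (asm) AE_restrict_space_iff) auto
  qed
qed

text \<open>The arc has positive length, so the bound is attained by some real control value and is
  therefore finite.\<close>

lemma B_arc_value:
  assumes "B_arc P u p q"
  shows "\<exists>r. (AE t in lebesgue. t \<in> {p<..<q} \<longrightarrow> u t = r) \<and> (u_min P = ereal r \<or> u_max P = ereal r)"
proof -
  have pq: "p < q" using BS_arc_bounds assms by blast
  have *: "\<exists>r. (AE t in lebesgue. t \<in> {p<..<q} \<longrightarrow> u t = r) \<and> m = ereal r"
    if n: "negligible ({p<..<q} - {t\<in>{0..T}. ereal (u t) = m})" for m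
  proof -
    have "{p<..<q} \<inter> {t\<in>{0..T}. ereal (u t) = m} \<noteq> {}"
    proof
      assume "{p<..<q} \<inter> {t\<in>{0..T}. ereal (u t) = m} = {}"
      then have "{p<..<q} - {t\<in>{0..T}. ereal (u t) = m} = {p<..<q}" by blast
      then have "{p<..<q} = {}" using n negligible_interval(2)[of p q] by (simp add: box_real)
      then show False using pq by simp
    qed
    then obtain s where s: "ereal (u s) = m" by blast
    have "AE t in lebesgue. t \<notin> {p<..<q} - {t\<in>{0..T}. ereal (u t) = m}"
      using n by (intro AE_not_in) (simp add: negligible_iff_null_sets)
    then have "AE t in lebesgue. t \<in> {p<..<q} \<longrightarrow> u t = u s"
      by eventually_elim (use s in auto)
    then show ?thesis using s by blast
  qed
  show ?thesis
    using assms *[of "u_min P"] *[of "u_max P"]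
    unfolding B_arc_def maximal_interval_def B_minus_def B_plus_def by blast
qed

text \<open>On a C arc the control keeps the distance \<open>\<rho>\<close> from its bounds, hence
  so does the limit of its means. The jump at a junction of a C arc with a B arc is thus automatic,
  whereas at CS and SC junctions it is an assumption.\<close>

lemma outside_value:
  assumes l: "(Mean \<tau> \<longlongrightarrow> l) F" "F \<noteq> bot" and \<rho>: "\<rho> > 0" and r: "u_min P = ereal r \<or> u_max P = ereal r"
    and lo: "\<And>m. u_min P = ereal m \<Longrightarrow> \<forall>\<^sub>F t in F. m + \<rho> \<le> Mean \<tau> t"
    and hi: "\<And>m. u_max P = ereal m \<Longrightarrow> \<forall>\<^sub>F t in F. Mean \<tau> t \<le> m - \<rho>"
  shows "r \<noteq> l"
  using r
proof
  assume "u_min P = ereal r"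
  from tendsto_lowerbound[OF l(1) lo[OF this] l(2)] show ?thesis using \<rho> by simp
next
  assume "u_max P = ereal r"
  from tendsto_upperbound[OF l(1) hi[OF this] l(2)] show ?thesis using \<rho> by simp
qed

text \<open>The control means have different limits on the two sides of b: on the arc the limit is
  the value keeping g at zero, and outside it differs either by the assumed jump or because the
  control sits at a bound. So g leaves zero with nonzero slope.\<close>

lemma slope_right:
  assumes ab: "C_arc P x a b" and bT: "b < T"
  shows "\<exists>c>0. \<forall>\<^sub>F t in at_right b. G t \<le> - c * \<bar>t - b\<bar>"
proof -
  have a: "0 \<le> a" "a < b" "{a<..<b} \<subseteq> C" "{a..b} \<subseteq> C" using C_arcD[OF ab] C_arc_closed[OF ab] by auto
  have bC: "b \<in> C" and b0: "b \<in> {0..T}" using a bT by auto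
  then have Gb: "G b = 0" and g1b: "g1 b \<noteq> 0" using g1_nonzero by (auto simp: C_iff)
  have FL: "at_left b \<le> at b within {0..T}" and FR: "at_right b \<le> at b within {0..T}"
    using a bT by (auto intro: at_left_le_within at_right_le_within)
  define l where "l = - g0 b / g1 b"
  have evL: "eventually (\<lambda>t. t \<in> {a<..<b}) (at_left b)"
    using a unfolding eventually_at_left[OF a(2)] by auto
  have limL: "(Mean b \<longlongrightarrow> l) (at_left b)"
    unfolding l_def by (rule Mean_limit_contact[OF b0 FL Gb _ g1b], rule eventually_mono[OF evL]) (use a in \<open>auto simp: C_iff\<close>)
  obtain q where q: "b < q" "B_arc P u b q \<or> S_arc P u x b q" using junction_right[OF ab bT] by blast
  have "\<exists>r. (Mean b \<longlongrightarrow> r) (at_right b) \<and> r \<noteq> l"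
    using q(2)
  proof
    assume S: "S_arc P u x b q"
    then have "has_nonzero_jump u b" using disc ab unfolding discontinuous_at_CS_SC_junctions_def CS_junction_def by blast
    then obtain l' r where lr: "l' \<noteq> r" "(u \<longlongrightarrow> l') (inf (ae_filter lebesgue) (at_left b))" "(u \<longlongrightarrow> r) (inf (ae_filter lebesgue) (at_right b))"
      unfolding has_nonzero_jump_def by blast
    have "(Mean b \<longlongrightarrow> l') (at_left b)" using a bT by (intro Mean_limit_left lr) auto
    then have "l' = l" using limL by (intro tendsto_unique[OF _ _ limL]) auto
    moreover have "(Mean b \<longlongrightarrow> r) (at_right b)" using a bT by (intro Mean_limit_right lr) auto
    ultimately show ?thesis using lr(1) by blast
  next
    assume B: "B_arc P u b q"
    obtain r where r: "AE t in lebesgue. t \<in> {b<..<q} \<longrightarrow> u t = r" "u_min P = ereal r \<or> u_max P = ereal r"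
      using B_arc_value[OF B] by blast
    have "\<forall>\<^sub>F t in at_right b. r = Mean b t"
      unfolding eventually_at_right[OF q(1)]
    proof (intro exI[of _ q] conjI allI impI q)
      fix t assume t: "b < t" "t < q"
      have "\<bar>Mean b t - r\<bar> \<le> 0"
        using t a BS_arc_bounds[of b q] B by (intro Mean_bound_right eventually_mono[OF r(1)]) auto
      then show "r = Mean b t" by simp
    qed
    then have lim: "(Mean b \<longlongrightarrow> r) (at_right b)" by (rule Lim_transform_eventually[OF tendsto_const])
    obtain \<rho> where \<rho>: "\<rho> > 0" "\<And>a b. C_arc P x a b \<or> S_arc P u x a b \<Longrightarrow>
       AE t in lebesgue. t \<in> {a<..<b} \<longrightarrow> u_min P + ereal \<rho> \<le> ereal (u t) \<and> ereal (u t) \<le> u_max P - ereal \<rho>"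
      by (rule away_obtain) blast
    have aw: "AE t in lebesgue. t \<in> {a<..<b} \<longrightarrow> u_min P + ereal \<rho> \<le> ereal (u t) \<and> ereal (u t) \<le> u_max P - ereal \<rho>"
      using \<rho>(2) ab by blast
    have "r \<noteq> l"
    proof (rule outside_value[OF limL _ \<rho>(1) r(2)])
      fix m assume m: "u_min P = ereal m"
      show "\<forall>\<^sub>F t in at_left b. m + \<rho> \<le> Mean b t"
      proof (rule eventually_mono[OF evL])
        fix t assume t: "t \<in> {a<..<b}"
        have "AE s in lebesgue. s \<in> {t<..<b} \<longrightarrow> m + \<rho> \<le> u s" using aw by eventually_elim (use t m in auto)
        then have "m + \<rho> \<le> Mean t b" using t a bT by (intro Mean_ge_right) auto
        then show "m + \<rho> \<le> Mean b t" by (simp add: Mean_sym[of b])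
      qed
    next
      fix m assume m: "u_max P = ereal m"
      show "\<forall>\<^sub>F t in at_left b. Mean b t \<le> m - \<rho>"
      proof (rule eventually_mono[OF evL])
        fix t assume t: "t \<in> {a<..<b}"
        have "AE s in lebesgue. s \<in> {t<..<b} \<longrightarrow> u s \<le> m - \<rho>" using aw by eventually_elim (use t m in auto)
        then have "Mean t b \<le> m - \<rho>" using t a bT by (intro Mean_le_right) auto
        then show "Mean b t \<le> m - \<rho>" by (simp add: Mean_sym[of b])
      qed
    qed simp
    then show ?thesis using lim by blast
  qed
  then obtain r where r: "(Mean b \<longlongrightarrow> r) (at_right b)" "r \<noteq> l" by blast
  show ?thesis using slope_outside[OF b0 FR Gb g1b r(1)] r(2) by (simp add: l_def)
qed

lemma slope_left:
  assumes ab: "C_arc P x a b" and a0: "0 < a"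
  shows "\<exists>c>0. \<forall>\<^sub>F t in at_left a. G t \<le> - c * \<bar>t - a\<bar>"
proof -
  have a: "b \<le> T" "a < b" "{a<..<b} \<subseteq> C" "{a..b} \<subseteq> C" using C_arcD[OF ab] C_arc_closed[OF ab] by auto
  have bC: "a \<in> C" and b0: "a \<in> {0..T}" using a a0 by auto
  then have Gb: "G a = 0" and g1b: "g1 a \<noteq> 0" using g1_nonzero by (auto simp: C_iff)
  have FL: "at_left a \<le> at a within {0..T}" and FR: "at_right a \<le> at a within {0..T}"
    using a a0 by (auto intro: at_left_le_within at_right_le_within)
  define l where "l = - g0 a / g1 a"
  have evR: "eventually (\<lambda>t. t \<in> {a<..<b}) (at_right a)"
    using a unfolding eventually_at_right[OF a(2)] by auto
  have limR: "(Mean a \<longlongrightarrow> l) (at_right a)"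
    unfolding l_def by (rule Mean_limit_contact[OF b0 FR Gb _ g1b], rule eventually_mono[OF evR]) (use a in \<open>auto simp: C_iff\<close>)
  obtain p where p: "p < a" "B_arc P u p a \<or> S_arc P u x p a" using junction_left[OF ab a0] by blast
  have "\<exists>r. (Mean a \<longlongrightarrow> r) (at_left a) \<and> r \<noteq> l"
    using p(2)
  proof
    assume S: "S_arc P u x p a"
    then have "has_nonzero_jump u a" using disc ab unfolding discontinuous_at_CS_SC_junctions_def SC_junction_def by blast
    then obtain r l' where lr: "r \<noteq> l'" "(u \<longlongrightarrow> r) (inf (ae_filter lebesgue) (at_left a))" "(u \<longlongrightarrow> l') (inf (ae_filter lebesgue) (at_right a))"
      unfolding has_nonzero_jump_def by blast
    have "(Mean a \<longlongrightarrow> l') (at_right a)" using a a0 by (intro Mean_limit_right lr) auto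
    then have "l' = l" using limR by (intro tendsto_unique[OF _ _ limR]) auto
    moreover have "(Mean a \<longlongrightarrow> r) (at_left a)" using a a0 by (intro Mean_limit_left lr) auto
    ultimately show ?thesis using lr(1) by blast
  next
    assume B: "B_arc P u p a"
    obtain r where r: "AE t in lebesgue. t \<in> {p<..<a} \<longrightarrow> u t = r" "u_min P = ereal r \<or> u_max P = ereal r"
      using B_arc_value[OF B] by blast
    have "\<forall>\<^sub>F t in at_left a. r = Mean a t"
      unfolding eventually_at_left[OF p(1)]
    proof (intro exI[of _ p] conjI allI impI p)
      fix t assume t: "p < t" "t < a"
      have "\<bar>Mean a t - r\<bar> \<le> 0"
        using t a BS_arc_bounds[of p a] B by (intro Mean_bound_left eventually_mono[OF r(1)]) auto
      then show "r = Mean a t" by simp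
    qed
    then have lim: "(Mean a \<longlongrightarrow> r) (at_left a)" by (rule Lim_transform_eventually[OF tendsto_const])
    obtain \<rho> where \<rho>: "\<rho> > 0" "\<And>a b. C_arc P x a b \<or> S_arc P u x a b \<Longrightarrow>
       AE t in lebesgue. t \<in> {a<..<b} \<longrightarrow> u_min P + ereal \<rho> \<le> ereal (u t) \<and> ereal (u t) \<le> u_max P - ereal \<rho>"
      by (rule away_obtain) blast
    have aw: "AE t in lebesgue. t \<in> {a<..<b} \<longrightarrow> u_min P + ereal \<rho> \<le> ereal (u t) \<and> ereal (u t) \<le> u_max P - ereal \<rho>"
      using \<rho>(2) ab by blast
    have "r \<noteq> l"
    proof (rule outside_value[OF limR _ \<rho>(1) r(2)])
      fix m assume m: "u_min P = ereal m"
      show "\<forall>\<^sub>F t in at_right a. m + \<rho> \<le> Mean a t"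
      proof (rule eventually_mono[OF evR])
        fix t assume t: "t \<in> {a<..<b}"
        have "AE s in lebesgue. s \<in> {a<..<t} \<longrightarrow> m + \<rho> \<le> u s" using aw by eventually_elim (use t m in auto)
        then show "m + \<rho> \<le> Mean a t" using t a a0 by (intro Mean_ge_right) auto
      qed
    next
      fix m assume m: "u_max P = ereal m"
      show "\<forall>\<^sub>F t in at_right a. Mean a t \<le> m - \<rho>"
      proof (rule eventually_mono[OF evR])
        fix t assume t: "t \<in> {a<..<b}"
        have "AE s in lebesgue. s \<in> {a<..<t} \<longrightarrow> u s \<le> m - \<rho>" using aw by eventually_elim (use t m in auto)
        then show "Mean a t \<le> m - \<rho>" using t a a0 by (intro Mean_le_right) auto
      qed
    qed simp
    then show ?thesis using lim by blast
  qed
  then obtain r where r: "(Mean a \<longlongrightarrow> r) (at_left a)" "r \<noteq> l" by blast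
  show ?thesis using slope_outside[OF b0 FL Gb g1b r(1)] r(2) by (simp add: l_def)
qed

text \<open>This is the only place where the arc structure enters: it makes every critical direction
  radial for the state constraint, so that no curvature term appears in the second order condition.\<close>

lemma state_constraint_margin:
  "\<exists>c>0. \<forall>t\<in>{0..T}. G t \<le> - c \<or> (\<exists>s\<in>C. G t \<le> - c * \<bar>t - s\<bar>)"
proof -
  define ok where "ok c t \<longleftrightarrow> G t \<le> - c \<or> (\<exists>s\<in>C. G t \<le> - c * \<bar>t - s\<bar>)" for c t
  have ok_mono: "ok c' t" if "ok c t" "0 < c'" "c' \<le> c" for c c' t
  proof -
    have "- c * \<bar>t - s\<bar> \<le> - c' * \<bar>t - s\<bar>" for s using that by (intro mult_right_mono) auto
    then show ?thesis using that unfolding ok_def by (meson neg_le_iff_le order_trans)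
  qed
  have okC: "ok c t" if "t \<in> C" for c t using that by (auto simp: ok_def C_iff intro!: bexI[of _ t])
  have loc: "\<exists>c>0. \<forall>\<^sub>F t in at \<tau> within {0..T}. ok c t" if \<tau>: "\<tau> \<in> {0..T}" for \<tau>
  proof (cases "\<tau> \<in> C")
    case False
    then have n: "G \<tau> < 0" using \<tau> G_le[OF \<tau>] by (auto simp: C_iff)
    have "(G \<longlongrightarrow> G \<tau>) (at \<tau> within {0..T})" using G_cont \<tau> by (auto simp: continuous_on_def)
    then have "\<forall>\<^sub>F t in at \<tau> within {0..T}. G t < G \<tau> / 2" using n by (intro order_tendstoD) auto
    then have "\<forall>\<^sub>F t in at \<tau> within {0..T}. ok (- G \<tau> / 2) t" by eventually_elim (simp add: ok_def)
    then show ?thesis using n by (intro exI[of _ "- G \<tau> / 2"]) auto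
  next
    case True
    then obtain a b where ab: "C_arc P x a b" "\<tau> \<in> {a..b}" using C_arc_obtain by blast
    have a: "0 \<le> a" "a < b" "b \<le> T" "{a..b} \<subseteq> C" using C_arcD[OF ab(1)] C_arc_closed[OF ab(1)] by auto
    have R: "\<exists>c>0. \<exists>d>\<tau>. \<forall>t. \<tau> < t \<and> t < d \<and> t \<le> T \<longrightarrow> ok c t"
    proof -
      consider "\<tau> < b" | "\<tau> = b" "b < T" | "\<tau> = T" using ab a by fastforce
      then show ?thesis
      proof cases
        case 1
        have "\<forall>t. \<tau> < t \<and> t < b \<and> t \<le> T \<longrightarrow> ok 1 t" using ab a(4) by (auto intro!: okC)
        then show ?thesis using 1 zero_less_one[where 'a=real] by blast
      next
        case 2
        obtain c where c: "c > 0" "\<forall>\<^sub>F t in at_right b. G t \<le> - c * \<bar>t - b\<bar>" using slope_right[OF ab(1) 2(2)] by blast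
        then obtain d where "d > b" "\<And>t. b < t \<Longrightarrow> t < d \<Longrightarrow> G t \<le> - c * \<bar>t - b\<bar>"
          unfolding eventually_at_right[OF 2(2)] by blast
        then have "\<forall>t. \<tau> < t \<and> t < d \<and> t \<le> T \<longrightarrow> ok c t" unfolding ok_def using 2 True by blast
        then show ?thesis using c(1) 2 \<open>d > b\<close> by blast
      next
        case 3
        then have "\<forall>t. \<tau> < t \<and> t < T + 1 \<and> t \<le> T \<longrightarrow> ok 1 t" "T + 1 > \<tau>" by auto
        then show ?thesis using zero_less_one[where 'a=real] by blast
      qed
    qed
    have L: "\<exists>c>0. \<exists>d<\<tau>. \<forall>t. t < \<tau> \<and> d < t \<and> 0 \<le> t \<longrightarrow> ok c t"
    proof -
      consider "a < \<tau>" | "\<tau> = a" "0 < a" | "\<tau> = 0" using ab a by fastforce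
      then show ?thesis
      proof cases
        case 1
        have "\<forall>t. t < \<tau> \<and> a < t \<and> 0 \<le> t \<longrightarrow> ok 1 t" using ab a(4) by (auto intro!: okC)
        then show ?thesis using 1 zero_less_one[where 'a=real] by blast
      next
        case 2
        obtain c where c: "c > 0" "\<forall>\<^sub>F t in at_left a. G t \<le> - c * \<bar>t - a\<bar>" using slope_left[OF ab(1) 2(2)] by blast
        then obtain d where "d < a" "\<And>t. d < t \<Longrightarrow> t < a \<Longrightarrow> G t \<le> - c * \<bar>t - a\<bar>"
          unfolding eventually_at_left[OF 2(2)] by blast
        then have "\<forall>t. t < \<tau> \<and> d < t \<and> 0 \<le> t \<longrightarrow> ok c t" unfolding ok_def using 2 True by blast
        then show ?thesis using c(1) 2 \<open>d < a\<close> by blast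
      next
        case 3
        then have "\<forall>t. t < \<tau> \<and> - 1 < t \<and> 0 \<le> t \<longrightarrow> ok 1 t" "- 1 < \<tau>" by auto
        then show ?thesis using zero_less_one[where 'a=real] by blast
      qed
    qed
    obtain c1 d1 where 1: "c1 > 0" "d1 > \<tau>" "\<And>t. \<tau> < t \<Longrightarrow> t < d1 \<Longrightarrow> t \<le> T \<Longrightarrow> ok c1 t" using R by blast
    obtain c2 d2 where 2: "c2 > 0" "d2 < \<tau>" "\<And>t. t < \<tau> \<Longrightarrow> d2 < t \<Longrightarrow> 0 \<le> t \<Longrightarrow> ok c2 t" using L by blast
    have "\<forall>\<^sub>F t in at \<tau> within {0..T}. ok (min c1 c2) t"
      unfolding eventually_at
    proof (intro exI[of _ "min (d1 - \<tau>) (\<tau> - d2)"] conjI ballI impI)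
      fix t assume t: "t \<in> {0..T}" "t \<noteq> \<tau> \<and> dist t \<tau> < min (d1 - \<tau>) (\<tau> - d2)"
      then have "ok c1 t \<or> ok c2 t" using 1(3)[of t] 2(3)[of t] by (cases "t < \<tau>") (auto simp: dist_real_def)
      then show "ok (min c1 c2) t" using ok_mono 1(1) 2(1) by (meson min.cobounded1 min.cobounded2 min_less_iff_conj)
    qed (use 1 2 in auto)
    then show ?thesis using 1 2 by (intro exI[of _ "min c1 c2"]) auto
  qed
  \<comment> \<open>The point \<open>\<tau>\<close> itself is added to its punctured neighbourhood,
    after which compactness of [0,T] yields a common constant.\<close>
  have loc': "\<exists>c>0. \<exists>d>0. \<forall>t\<in>{0..T}. dist \<tau> t < d \<longrightarrow> ok c t" if \<tau>: "\<tau> \<in> {0..T}" for \<tau>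
  proof -
    obtain c d where c: "c > 0" "d > 0" "\<And>t. t \<in> {0..T} \<Longrightarrow> t \<noteq> \<tau> \<Longrightarrow> dist t \<tau> < d \<Longrightarrow> ok c t"
      using loc[OF \<tau>] unfolding eventually_at by blast
    have "\<exists>c'>0. ok c' \<tau>"
    proof (cases "\<tau> \<in> C")
      case True then show ?thesis using okC[of \<tau> 1] by (intro exI[of _ 1]) auto
    next
      case False
      then have "G \<tau> < 0" using \<tau> G_le[OF \<tau>] by (auto simp: C_iff)
      then show ?thesis by (intro exI[of _ "- G \<tau>"]) (auto simp: ok_def)
    qed
    then obtain c' where c': "c' > 0" "ok c' \<tau>" by blast
    have "ok (min c c') t" if "t \<in> {0..T}" "dist \<tau> t < d" for t
      using c(3)[of t] c' c(1) that ok_mono by (cases "t = \<tau>") (auto simp: dist_commute intro: ok_mono)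
    then show ?thesis using c(1,2) c'(1) by (intro exI[of _ "min c c'"]) auto
  qed
  then obtain cc dd where cd: "\<And>\<tau>. \<tau> \<in> {0..T} \<Longrightarrow> cc \<tau> > 0 \<and> dd \<tau> > 0 \<and> (\<forall>t\<in>{0..T}. dist \<tau> t < dd \<tau> \<longrightarrow> ok (cc \<tau>) t)"
    by metis
  obtain N where N: "N \<subseteq> {0..T}" "finite N" "{0..T} \<subseteq> (\<Union>\<tau>\<in>N. ball \<tau> (dd \<tau>))"
  proof (rule compactE_image[of "{0..T}" "{0..T}" "\<lambda>\<tau>. ball \<tau> (dd \<tau>)"])
    show "{0..T} \<subseteq> (\<Union>\<tau>\<in>{0..T}. ball \<tau> (dd \<tau>))" using cd by (auto intro!: bexI)
  qed auto
  have Ne: "N \<noteq> {}" using N(3) T by (metis UN_empty atLeastatMost_empty_iff2 empty_subsetI less_imp_le order_antisym_conv)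
  define c where "c = Min (cc ` N)"
  have c: "c > 0" unfolding c_def using N Ne cd by (subst Min_gr_iff) auto
  have "ok c t" if t: "t \<in> {0..T}" for t
  proof -
    obtain \<tau> where \<tau>: "\<tau> \<in> N" "dist \<tau> t < dd \<tau>" using N(3) t by auto
    then have "ok (cc \<tau>) t" using cd N(1) t by blast
    moreover have "c \<le> cc \<tau>" unfolding c_def using N \<tau> by (intro Min_le) auto
    ultimately show ?thesis using ok_mono c by blast
  qed
  then show ?thesis using c unfolding ok_def by blast
qed

text \<open>The arcs are replaced by a pointwise alternative valid almost everywhere: the control is
  at a bound or at distance \<open>\<rho>\<close> from both. In this form the control constraint is
  checked for perturbed controls.\<close>

lemma bounds_margin:
  "\<exists>\<rho>>0. AE t in lebesgue. t \<in> {0..T} \<longrightarrow> t \<in> B_minus P u \<or> t \<in> B_plus P u \<or>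
     (u_min P + ereal \<rho> \<le> ereal (u t) \<and> ereal (u t) \<le> u_max P - ereal \<rho>)"
proof -
  obtain \<rho> where \<rho>: "\<rho> > 0" "\<And>a b. C_arc P x a b \<or> S_arc P u x a b \<Longrightarrow>
     AE t in lebesgue. t \<in> {a<..<b} \<longrightarrow> u_min P + ereal \<rho> \<le> ereal (u t) \<and> ereal (u t) \<le> u_max P - ereal \<rho>"
    by (rule away_obtain) blast
  obtain \<A> where A: "finite \<A>" "\<And>I. I \<in> \<A> \<Longrightarrow> \<exists>a b. I = {a<..<b} \<and> a < b \<and> (B_arc P u a b \<or> C_arc P x a b \<or> S_arc P u x a b)"
    "negligible ({0..T} - \<Union>\<A>)" by (rule arcs_obtain) (rule that)
  define good where "good t \<longleftrightarrow> t \<in> B_minus P u \<or> t \<in> B_plus P u \<or>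
     (u_min P + ereal \<rho> \<le> ereal (u t) \<and> ereal (u t) \<le> u_max P - ereal \<rho>)" for t
  have neg: "AE t in lebesgue. t \<notin> N" if "negligible N" for N :: "real set"
    using that by (intro AE_not_in) (simp add: negligible_iff_null_sets)
  have "AE t in lebesgue. t \<in> I \<longrightarrow> good t" if II: "I \<in> \<A>" for I
  proof -
    obtain a b where ab: "I = {a<..<b}" "B_arc P u a b \<or> C_arc P x a b \<or> S_arc P u x a b" using A(2)[OF II] by blast
    from ab(2) consider "B_arc P u a b" | "C_arc P x a b \<or> S_arc P u x a b" by blast
    then show ?thesis
    proof cases
      case 1
      then have "negligible (I - B_minus P u) \<or> negligible (I - B_plus P u)"
        by (auto simp: B_arc_def maximal_interval_def ab)
      then show ?thesis
      proof
        assume "negligible (I - B_minus P u)"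
        from neg[OF this] show ?thesis by eventually_elim (auto simp: good_def)
      next
        assume "negligible (I - B_plus P u)"
        from neg[OF this] show ?thesis by eventually_elim (auto simp: good_def)
      qed
    next
      case 2
      from \<rho>(2)[OF this] show ?thesis by eventually_elim (auto simp: good_def ab)
    qed
  qed
  then have "AE t in lebesgue. \<forall>I\<in>\<A>. t \<in> I \<longrightarrow> good t" using A(1) by (intro AE_finite_allI) auto
  with neg[OF A(3)] have "AE t in lebesgue. t \<in> {0..T} \<longrightarrow> good t" by eventually_elim auto
  then show ?thesis using \<rho>(1) unfolding good_def by blast
qed

end

section \<open>Feasible second order perturbations\<close>

lemma C2_D_Lipschitz:
  fixes h :: "'a::euclidean_space \<Rightarrow> 'b::euclidean_space"
  assumes "C2 h" "R > 0"
  shows "\<exists>K>0. \<forall>x x' k k'. norm x \<le> R \<longrightarrow> norm x' \<le> R \<longrightarrow> norm k \<le> R \<longrightarrow> norm k' \<le> R \<longrightarrow>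
    norm (frechet_derivative h (at x) k - frechet_derivative h (at x') k') \<le> K * (norm (x - x') + norm (k - k'))"
proof -
  obtain h' h'' where h: "\<And>x. (h' has_derivative blinfun_apply (h'' x)) (at x)" "continuous_on UNIV h''"
    "\<And>x k. frechet_derivative h (at x) k = blinfun_apply (h' x) k"
    using C2E[OF assms(1)] by metis
  have hc: "continuous_on UNIV h'" using h(1) by (meson has_derivative_continuous continuous_at_imp_continuous_on)
  have "bounded (h'' ` cball 0 R)" "bounded (h' ` cball 0 R)"
    by (intro compact_imp_bounded compact_continuous_image continuous_on_subset[OF h(2)] continuous_on_subset[OF hc] compact_cball, simp)+
  then obtain M1 M2 where M: "M1 > 0" "M2 > 0" "\<And>y. y \<in> h'' ` cball 0 R \<Longrightarrow> norm y \<le> M2" "\<And>y. y \<in> h' ` cball 0 R \<Longrightarrow> norm y \<le> M1"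
    unfolding bounded_pos by metis
  define K where "K = M1 + M2 * R"
  have "norm (frechet_derivative h (at x) k - frechet_derivative h (at x') k') \<le> K * (norm (x - x') + norm (k - k'))"
    if n: "norm x \<le> R" "norm x' \<le> R" "norm k \<le> R" "norm k' \<le> R" for x x' k k'
  proof -
    have "norm (h' x - h' x') \<le> M2 * norm (x - x')"
    proof (rule differentiable_bound[of "cball 0 R"])
      fix y :: 'a assume "y \<in> cball 0 R"
      then show "onorm (blinfun_apply (h'' y)) \<le> M2" using M(3)[of "h'' y"] by (simp add: norm_blinfun.rep_eq[symmetric])
    qed (use n in \<open>auto intro: has_derivative_at_withinI h\<close>)
    moreover have "norm (blinfun_apply (h' x - h' x') k) \<le> norm (h' x - h' x') * R"
      using n by (intro order_trans[OF norm_blinfun] mult_left_mono) auto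
    moreover have "norm (h' x - h' x') * R \<le> (M2 * norm (x - x')) * R" using calculation(1) assms(2) by (intro mult_right_mono) auto
    ultimately have 1: "norm (blinfun_apply (h' x - h' x') k) \<le> (M2 * R) * norm (x - x')" by (simp add: mult_ac)
    have 2: "norm (blinfun_apply (h' x') (k - k')) \<le> M1 * norm (k - k')"
      using M(4)[of "h' x'"] n by (intro order_trans[OF norm_blinfun] mult_right_mono) auto
    have "h' x k - h' x' k' = blinfun_apply (h' x - h' x') k + blinfun_apply (h' x') (k - k')"
      by (simp add: blinfun.diff_left blinfun.diff_right)
    then have "norm (frechet_derivative h (at x) k - frechet_derivative h (at x') k') \<le> (M2 * R) * norm (x - x') + M1 * norm (k - k')"
      unfolding h(3) using norm_triangle_mono[OF 1 2] by simp
    also have "\<dots> \<le> K * norm (x - x') + K * norm (k - k')"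
      unfolding K_def using M assms(2) by (intro add_mono mult_right_mono) auto
    finally show ?thesis by (simp add: distrib_left)
  qed
  moreover have "K > 0" using M assms(2) by (simp add: K_def add_pos_pos)
  ultimately show ?thesis by blast
qed

lemma frechet_derivative_dynamics:
  assumes "C2 (f0 P)" "C2 (f1 P)"
  shows "frechet_derivative (\<lambda>y. dynamics P c y) (at a) k = frechet_derivative (f0 P) (at a) k + c *\<^sub>R frechet_derivative (f1 P) (at a) k"
proof -
  have "((\<lambda>y. dynamics P c y) has_derivative (\<lambda>k. frechet_derivative (f0 P) (at a) k + c *\<^sub>R frechet_derivative (f1 P) (at a) k)) (at a)"
    unfolding dynamics_def by (intro has_derivative_add has_derivative_scaleR_right C2_has_derivative assms)
  from frechet_derivative_at[OF this] show ?thesis by metis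
qed

section \<open>Second order expansions along a critical direction\<close>

locale ocp_direction = ocp_arcs P u x for P :: "('n::finite) ocp" and u :: "real \<Rightarrow> real" and x :: "real \<Rightarrow> real ^ 'n" +
  fixes v :: "real \<Rightarrow> real" and z :: "real \<Rightarrow> real ^ 'n"
  assumes crit: "(v, z) \<in> critical_cone P u x"
begin

definition "vb = trunc T (SOME K. bdd_meas (trunc T K v) \<and> (AE t in lebesgue_on {0..T}. trunc T K v t = v t)) v"

lemma vb: "bdd_meas vb" "AE t in lebesgue_on {0..T}. vb t = v t"
proof -
  have "L_infty T v" using crit by (simp add: critical_cone_def)
  from someI_ex[OF L_infty_trunc[OF this]] show "bdd_meas vb" "AE t in lebesgue_on {0..T}. vb t = v t"
    by (auto simp: vb_def)
qed

definition "zb t = z (clamp_to T t)"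

lemma z_cont: "continuous_on {0..T} z"
  using crit W1_continuous unfolding critical_cone_def by blast

lemma zb: "continuous_on UNIV zb" "bounded (range zb)" "t \<in> {0..T} \<Longrightarrow> zb t = z t"
  unfolding zb_def using clamp_compose[OF z_cont] T by auto

lemma zb_meas: "bdd_meas zb" by (intro bdd_meas_cont zb)

lemma zb_eq: "t \<in> {0..T} \<Longrightarrow> zb t = zb 0 + IL 0 t (\<lambda>s. (frechet_derivative (f0 P) (at (xb s)) (zb s)
    + ub s *\<^sub>R frechet_derivative (f1 P) (at (xb s)) (zb s)) + vb s *\<^sub>R f1 P (xb s))"
proof -
  assume t: "t \<in> {0..T}"
  obtain z' where z': "W1_infty_deriv T z z'" "AE t in lebesgue_on {0..T}. z' t = lin_dynamics P u x t (z t) + v t *\<^sub>R f1 P (x t)"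
    using crit unfolding critical_cone_def by blast
  have "AE t in lebesgue_on {0..T}. t \<in> {0..T}" by (rule AE_I2) simp
  with z'(2) ub(2) vb(2) have *: "AE s in lebesgue_on {0..T}. z' s = (frechet_derivative (f0 P) (at (xb s)) (zb s)
    + ub s *\<^sub>R frechet_derivative (f1 P) (at (xb s)) (zb s)) + vb s *\<^sub>R f1 P (xb s)"
    by eventually_elim (simp add: lin_dynamics_def frechet_derivative_dynamics C2s xb zb)
  have "bdd_meas (\<lambda>s. (frechet_derivative (f0 P) (at (xb s)) (zb s)
    + ub s *\<^sub>R frechet_derivative (f1 P) (at (xb s)) (zb s)) + vb s *\<^sub>R f1 P (xb s))"
    by (intro bdd_meas_add bdd_meas_scaleR ub vb F_xb_meas bdd_meas_compose2[OF xb_meas zb_meas C2_D_continuous] C2s)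
  from W1_integral[OF z'(1) this * t] show ?thesis using zb t T by simp
qed

sublocale cp: control_path T "f0 P" "f1 P" xb zb ub vb
proof
  show "\<exists>L. L-lipschitz_on UNIV (f0 P)" "\<exists>L. L-lipschitz_on UNIV (f1 P)" using data by (auto simp: ocp_data_def)
qed (rule T C2s xb zb ub vb | erule xb_eq zb_eq)+

abbreviation "X0 \<equiv> (x 0, x T)"
abbreviation "Z0 \<equiv> (z 0, z T)"

text \<open>\<open>ev h\<close> and \<open>kap\<close> are the e^2 coefficients of an endpoint
  function h and of g along x + e z + e^2 \<zeta>. Both are affine in \<zeta>, which is the source
  of convexity in the minimax argument.\<close>

definition ev :: "((real ^ 'n) \<times> (real ^ 'n) \<Rightarrow> real) \<Rightarrow> (real \<Rightarrow> real ^ 'n) \<Rightarrow> real" where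
  "ev h \<zeta> = frechet_derivative h (at X0) (\<zeta> 0, \<zeta> T) + (1/2) * second_derivative h X0 Z0 Z0"

definition kap :: "(real \<Rightarrow> real ^ 'n) \<Rightarrow> real \<Rightarrow> real" where
  "kap \<zeta> t = frechet_derivative (state_con P) (at (xb t)) (\<zeta> t) + (1/2) * second_derivative (state_con P) (xb t) (zb t) (zb t)"

lemma T0: "0 \<in> {0..T}" "T \<in> {0..T}" using T by auto

lemma endpoint_expansion:
  assumes h: "C2 h" and R: "R > 0" and \<eta>: "\<eta> > 0"
  shows "\<exists>e0>0. \<forall>e a w \<zeta> y. 0 < e \<longrightarrow> e < e0 \<longrightarrow> cp.pert R a w \<zeta> \<longrightarrow> cp.traj e a w y \<longrightarrow>
    \<bar>h (y 0, y T) - h X0 - e * frechet_derivative h (at X0) Z0 - e\<^sup>2 * ev h \<zeta>\<bar> \<le> \<eta> * e\<^sup>2"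
proof -
  obtain B where B: "B > 0" "\<And>a w \<zeta> t. cp.pert R a w \<zeta> \<Longrightarrow> t \<in> {0..T} \<Longrightarrow> norm (\<zeta> t) \<le> B"
    using cp.pert_bound[of R] by blast
  define R' where "R' = norm Z0 + 2 * B"
  have R': "R' > 0" using B by (simp add: R'_def add_nonneg_pos)
  obtain e1 \<delta> where e1: "e1 > 0" "\<delta> > 0" and E: "\<And>e z \<zeta> y. 0 < e \<Longrightarrow> e < e1 \<Longrightarrow> norm z \<le> R' \<Longrightarrow> norm \<zeta> \<le> R' \<Longrightarrow>
    norm (y - X0 - e *\<^sub>R z - e\<^sup>2 *\<^sub>R \<zeta>) \<le> \<delta> * e\<^sup>2 \<Longrightarrow>
    norm (h y - h X0 - e *\<^sub>R frechet_derivative h (at X0) z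
      - e\<^sup>2 *\<^sub>R (frechet_derivative h (at X0) \<zeta> + (1/2) *\<^sub>R second_derivative h X0 z z)) \<le> \<eta> * e\<^sup>2"
    using C2_expansion_perturbed[OF h compact_sing[of X0] \<eta> R'] by (auto simp del: split_paired_All)
  \<comment> \<open>Each of the two end points contributes half of the permitted error of the
    pair.\<close>
  have "\<delta> / 2 > 0" using e1 by simp
  from cp.traj_expansion[OF R this] obtain e2 where e2: "e2 > 0" "\<And>e a w \<zeta> y t. 0 < e \<Longrightarrow> e < e2 \<Longrightarrow> cp.pert R a w \<zeta> \<Longrightarrow> cp.traj e a w y \<Longrightarrow>
     t \<in> {0..T} \<Longrightarrow> norm (y t - xb t - e *\<^sub>R zb t - e\<^sup>2 *\<^sub>R \<zeta> t) \<le> \<delta> / 2 * e\<^sup>2" by blast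
  have "\<bar>h (y 0, y T) - h X0 - e * frechet_derivative h (at X0) Z0 - e\<^sup>2 * ev h \<zeta>\<bar> \<le> \<eta> * e\<^sup>2"
    if e: "0 < e" "e < min e1 e2" and P: "cp.pert R a w \<zeta>" and ty: "cp.traj e a w y" for e a w \<zeta> y
  proof -
    have n: "norm (y t - x t - e *\<^sub>R z t - e\<^sup>2 *\<^sub>R \<zeta> t) \<le> \<delta> / 2 * e\<^sup>2" if "t \<in> {0..T}" for t
      using e2(2)[OF e(1) _ P ty that] e xb(3)[OF that] zb(3)[OF that] by simp
    have "(y 0, y T) - X0 - e *\<^sub>R Z0 - e\<^sup>2 *\<^sub>R (\<zeta> 0, \<zeta> T) = (y 0 - x 0 - e *\<^sub>R z 0 - e\<^sup>2 *\<^sub>R \<zeta> 0, y T - x T - e *\<^sub>R z T - e\<^sup>2 *\<^sub>R \<zeta> T)"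
      by simp
    then have 1: "norm ((y 0, y T) - X0 - e *\<^sub>R Z0 - e\<^sup>2 *\<^sub>R (\<zeta> 0, \<zeta> T)) \<le> \<delta> * e\<^sup>2"
      using norm_Pair_le[of "y 0 - x 0 - e *\<^sub>R z 0 - e\<^sup>2 *\<^sub>R \<zeta> 0" "y T - x T - e *\<^sub>R z T - e\<^sup>2 *\<^sub>R \<zeta> T"] n[OF T0(1)] n[OF T0(2)] by simp
    have 2: "norm (\<zeta> 0, \<zeta> T) \<le> R'"
      using norm_Pair_le[of "\<zeta> 0" "\<zeta> T"] B(2)[OF P T0(1)] B(2)[OF P T0(2)] norm_ge_zero[of Z0] unfolding R'_def by linarith
    have "norm Z0 \<le> R'" using B by (simp add: R'_def)
    from E[OF e(1) _ this 2 1] show ?thesis using e by (simp add: ev_def)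
  qed
  then show ?thesis using e1 e2 by (intro exI[of _ "min e1 e2"]) auto
qed

lemma state_expansion:
  assumes R: "R > 0" and \<eta>: "\<eta> > 0"
  shows "\<exists>e0>0. \<forall>e a w \<zeta> y. 0 < e \<longrightarrow> e < e0 \<longrightarrow> cp.pert R a w \<zeta> \<longrightarrow> cp.traj e a w y \<longrightarrow> (\<forall>t\<in>{0..T}.
    \<bar>state_con P (y t) - G t - e * frechet_derivative (state_con P) (at (x t)) (z t) - e\<^sup>2 * kap \<zeta> t\<bar> \<le> \<eta> * e\<^sup>2)"
proof -
  obtain B where B: "B > 0" "\<And>a w \<zeta> t. cp.pert R a w \<zeta> \<Longrightarrow> t \<in> {0..T} \<Longrightarrow> norm (\<zeta> t) \<le> B"
    using cp.pert_bound[of R] by blast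
  obtain Kx where Kx: "Kx > 0" "\<And>s. norm (xb s) \<le> Kx" using cp.bdd_measE[OF xb_meas] by blast
  obtain Kz where Kz: "Kz > 0" "\<And>s. norm (zb s) \<le> Kz" using cp.bdd_measE[OF zb_meas] by blast
  define R' where "R' = Kz + B"
  have R': "R' > 0" using B Kz by (simp add: R'_def)
  obtain e1 \<delta> where e1: "e1 > 0" "\<delta> > 0" and E: "\<And>e x z \<zeta> y. 0 < e \<Longrightarrow> e < e1 \<Longrightarrow> x \<in> cball 0 Kx \<Longrightarrow> norm z \<le> R' \<Longrightarrow> norm \<zeta> \<le> R' \<Longrightarrow>
    norm (y - x - e *\<^sub>R z - e\<^sup>2 *\<^sub>R \<zeta>) \<le> \<delta> * e\<^sup>2 \<Longrightarrow>
    norm (state_con P y - state_con P x - e *\<^sub>R frechet_derivative (state_con P) (at x) z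
      - e\<^sup>2 *\<^sub>R (frechet_derivative (state_con P) (at x) \<zeta> + (1/2) *\<^sub>R second_derivative (state_con P) x z z)) \<le> \<eta> * e\<^sup>2"
    using C2_expansion_perturbed[OF C2s(4) compact_cball[of 0 Kx] \<eta> R'] by blast
  from cp.traj_expansion[OF R e1(2)] obtain e2 where e2: "e2 > 0" "\<And>e a w \<zeta> y t. 0 < e \<Longrightarrow> e < e2 \<Longrightarrow> cp.pert R a w \<zeta> \<Longrightarrow> cp.traj e a w y \<Longrightarrow>
     t \<in> {0..T} \<Longrightarrow> norm (y t - xb t - e *\<^sub>R zb t - e\<^sup>2 *\<^sub>R \<zeta> t) \<le> \<delta> * e\<^sup>2" by blast
  have "\<bar>state_con P (y t) - G t - e * frechet_derivative (state_con P) (at (x t)) (z t) - e\<^sup>2 * kap \<zeta> t\<bar> \<le> \<eta> * e\<^sup>2"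
    if e: "0 < e" "e < min e1 e2" and P: "cp.pert R a w \<zeta>" and ty: "cp.traj e a w y" and t: "t \<in> {0..T}" for e a w \<zeta> y t
  proof -
    have "norm (\<zeta> t) \<le> R'" "norm (zb t) \<le> R'" "xb t \<in> cball 0 Kx" using B(2)[OF P t] B(1) Kz(1) Kz(2)[of t] Kx(2)[of t] by (auto simp: R'_def)
    with E[OF e(1) _ _ _ _ e2(2)[OF e(1) _ P ty t]] show ?thesis using e xb(3)[OF t] zb(3)[OF t] by (simp add: kap_def)
  qed
  then show ?thesis using e1 e2 by (intro exI[of _ "min e1 e2"]) auto
qed

lemma state_Lipschitz: "\<exists>K>0. \<forall>s\<in>{0..T}. \<forall>t\<in>{0..T}. norm (xb t - xb s) \<le> K * \<bar>t - s\<bar> \<and> norm (zb t - zb s) \<le> K * \<bar>t - s\<bar>"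
proof -
  define dx where "dx s = f0 P (xb s) + ub s *\<^sub>R f1 P (xb s)" for s
  define dz where "dz s = (frechet_derivative (f0 P) (at (xb s)) (zb s)
    + ub s *\<^sub>R frechet_derivative (f1 P) (at (xb s)) (zb s)) + vb s *\<^sub>R f1 P (xb s)" for s
  have dx: "bdd_meas dx" unfolding dx_def[abs_def] by (rule rhs_xb_meas)
  have dz: "bdd_meas dz" unfolding dz_def[abs_def]
    by (intro bdd_meas_add bdd_meas_scaleR ub vb F_xb_meas bdd_meas_compose2[OF xb_meas zb_meas C2_D_continuous] C2s)
  obtain K1 where K1: "K1 > 0" "\<And>s. norm (dx s) \<le> K1" using cp.bdd_measE[OF dx] by blast
  obtain K2 where K2: "K2 > 0" "\<And>s. norm (dz s) \<le> K2" using cp.bdd_measE[OF dz] by blast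
  have "norm (xb t - xb s) \<le> (K1 + K2) * \<bar>t - s\<bar> \<and> norm (zb t - zb s) \<le> (K1 + K2) * \<bar>t - s\<bar>" if st: "s \<in> {0..T}" "t \<in> {0..T}" for s t
  proof -
    have "norm (xb t - xb s) \<le> K1 * \<bar>t - s\<bar>"
      using IL_Lipschitz[OF dx K1(2), of s t] st xb_eq[OF st(1)] xb_eq[OF st(2)] by (simp add: dx_def[abs_def])
    moreover have "norm (zb t - zb s) \<le> K2 * \<bar>t - s\<bar>"
      using IL_Lipschitz[OF dz K2(2), of s t] st zb_eq[OF st(1)] zb_eq[OF st(2)] by (simp add: dz_def[abs_def])
    moreover have "K1 * \<bar>t - s\<bar> \<le> (K1 + K2) * \<bar>t - s\<bar>" "K2 * \<bar>t - s\<bar> \<le> (K1 + K2) * \<bar>t - s\<bar>"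
      using K1 K2 by (auto intro!: mult_right_mono)
    ultimately show ?thesis by linarith
  qed
  then show ?thesis using K1 K2 by (intro exI[of _ "K1 + K2"]) auto
qed

text \<open>The Lipschitz bound for g'(x)z is what competes with the linear margin of g away from C;
  the one for g'(x)\<zeta> yields equicontinuity of \<open>kap\<close>.\<close>

lemma Dg_Lipschitz:
  "\<exists>K>0. \<forall>a w \<zeta>. cp.pert R a w \<zeta> \<longrightarrow> (\<forall>s\<in>{0..T}. \<forall>t\<in>{0..T}.
    \<bar>frechet_derivative (state_con P) (at (xb t)) (\<zeta> t) - frechet_derivative (state_con P) (at (xb s)) (\<zeta> s)\<bar> \<le> K * \<bar>t - s\<bar> \<and>
    \<bar>frechet_derivative (state_con P) (at (xb t)) (zb t) - frechet_derivative (state_con P) (at (xb s)) (zb s)\<bar> \<le> K * \<bar>t - s\<bar> \<and>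
    \<bar>frechet_derivative (state_con P) (at (xb t)) (\<zeta> t)\<bar> \<le> K \<and> \<bar>frechet_derivative (state_con P) (at (xb t)) (zb t)\<bar> \<le> K)"
proof -
  obtain B where B: "B > 0" "\<And>a w \<zeta> t. cp.pert R a w \<zeta> \<Longrightarrow> t \<in> {0..T} \<Longrightarrow> norm (\<zeta> t) \<le> B"
    "\<And>a w \<zeta> s t. cp.pert R a w \<zeta> \<Longrightarrow> s \<in> {0..T} \<Longrightarrow> t \<in> {0..T} \<Longrightarrow> norm (\<zeta> t - \<zeta> s) \<le> B * \<bar>t - s\<bar>"
    using cp.pert_bound[of R] by blast
  obtain Kx where Kx: "Kx > 0" "\<And>s. norm (xb s) \<le> Kx" using cp.bdd_measE[OF xb_meas] by blast
  obtain Kz where Kz: "Kz > 0" "\<And>s. norm (zb s) \<le> Kz" using cp.bdd_measE[OF zb_meas] by blast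
  define R' where "R' = Kx + Kz + B"
  have R': "R' > 0" "\<And>s. norm (xb s) \<le> R'" "\<And>s. norm (zb s) \<le> R'" "B \<le> R'" 
  proof -
    show "norm (xb s) \<le> R'" "norm (zb s) \<le> R'" for s using Kx(1) Kx(2)[of s] Kz(1) Kz(2)[of s] B(1) unfolding R'_def by linarith+
  qed (use Kx(1) Kz(1) B(1) in \<open>auto simp: R'_def\<close>)
  obtain L where L: "L > 0" "\<And>x x' k k'. norm x \<le> R' \<Longrightarrow> norm x' \<le> R' \<Longrightarrow> norm k \<le> R' \<Longrightarrow> norm k' \<le> R' \<Longrightarrow>
    norm (frechet_derivative (state_con P) (at x) k - frechet_derivative (state_con P) (at x') k') \<le> L * (norm (x - x') + norm (k - k'))"
    using C2_D_Lipschitz[OF C2s(4) R'(1)] by blast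
  obtain M where M: "M > 0" "\<And>s t. s \<in> {0..T} \<Longrightarrow> t \<in> {0..T} \<Longrightarrow> norm (xb t - xb s) \<le> M * \<bar>t - s\<bar> \<and> norm (zb t - zb s) \<le> M * \<bar>t - s\<bar>"
    using state_Lipschitz by blast
  define K where "K = L * (M + B) + L * (M + M) + L * R'"
  have KL: "L * (M + B) \<le> K" "L * (M + M) \<le> K" "L * R' \<le> K" "K > 0" using L M B R' by (auto simp: K_def add_pos_pos)
  have bnd: "\<bar>frechet_derivative (state_con P) (at (xb t)) k\<bar> \<le> K" if "norm k \<le> R'" for t k
  proof -
    have "norm (frechet_derivative (state_con P) (at (xb t)) k - frechet_derivative (state_con P) (at (xb t)) 0) \<le> L * (norm (xb t - xb t) + norm (k - 0))"
      using that R' by (intro L) auto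
    moreover have "frechet_derivative (state_con P) (at (xb t)) 0 = 0"
      using bounded_linear.linear[OF C2_D_linear[OF C2s(4)]] by (simp add: linear_0)
    moreover have "L * norm k \<le> L * R'" using that L by (intro mult_left_mono) auto
    ultimately show ?thesis using KL by simp
  qed
  have "\<bar>frechet_derivative (state_con P) (at (xb t)) (\<zeta> t) - frechet_derivative (state_con P) (at (xb s)) (\<zeta> s)\<bar> \<le> K * \<bar>t - s\<bar> \<and>
    \<bar>frechet_derivative (state_con P) (at (xb t)) (zb t) - frechet_derivative (state_con P) (at (xb s)) (zb s)\<bar> \<le> K * \<bar>t - s\<bar> \<and>
    \<bar>frechet_derivative (state_con P) (at (xb t)) (\<zeta> t)\<bar> \<le> K \<and> \<bar>frechet_derivative (state_con P) (at (xb t)) (zb t)\<bar> \<le> K"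
    if P: "cp.pert R a w \<zeta>" and st: "s \<in> {0..T}" "t \<in> {0..T}" for a w \<zeta> s t
  proof -
    have n: "norm (\<zeta> t) \<le> R'" "norm (\<zeta> s) \<le> R'" using B(2)[OF P] st R'(4) by (meson order_trans)+
    have "\<bar>frechet_derivative (state_con P) (at (xb t)) (\<zeta> t) - frechet_derivative (state_con P) (at (xb s)) (\<zeta> s)\<bar> \<le> L * (norm (xb t - xb s) + norm (\<zeta> t - \<zeta> s))"
      using L(2)[OF R'(2) R'(2) n, of t s] by simp
    also have "\<dots> \<le> L * (M * \<bar>t - s\<bar> + B * \<bar>t - s\<bar>)" using M(2)[OF st] B(3)[OF P st] L(1) by (intro mult_left_mono add_mono) auto
    also have "\<dots> = L * (M + B) * \<bar>t - s\<bar>" by (simp add: distrib_left distrib_right)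
    also have "\<dots> \<le> K * \<bar>t - s\<bar>" using KL by (intro mult_right_mono) auto
    finally have 1: "\<bar>frechet_derivative (state_con P) (at (xb t)) (\<zeta> t) - frechet_derivative (state_con P) (at (xb s)) (\<zeta> s)\<bar> \<le> K * \<bar>t - s\<bar>" .
    have "\<bar>frechet_derivative (state_con P) (at (xb t)) (zb t) - frechet_derivative (state_con P) (at (xb s)) (zb s)\<bar> \<le> L * (norm (xb t - xb s) + norm (zb t - zb s))"
      using L(2)[OF R'(2)[of t] R'(2)[of s] R'(3)[of t] R'(3)[of s]] by simp
    also have "\<dots> \<le> L * (M * \<bar>t - s\<bar> + M * \<bar>t - s\<bar>)" using M(2)[OF st] L(1) by (intro mult_left_mono add_mono) auto
    also have "\<dots> = L * (M + M) * \<bar>t - s\<bar>" by (simp add: distrib_left distrib_right)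
    also have "\<dots> \<le> K * \<bar>t - s\<bar>" using KL by (intro mult_right_mono) auto
    finally show ?thesis using 1 bnd[OF n(1)] bnd[OF R'(3)] by blast
  qed
  then show ?thesis using KL(4) by blast
qed

definition "k2 t = (1/2) * second_derivative (state_con P) (xb t) (zb t) (zb t)"

lemma k2_cont: "continuous_on UNIV k2"
proof -
  have "continuous_on UNIV (\<lambda>t. (\<lambda>p. second_derivative (state_con P) (fst p) (snd p) (snd p)) (xb t, zb t))"
    by (rule continuous_on_compose2[OF C2_D2_continuous[OF C2s(4)]]) (auto intro!: continuous_intros xb zb)
  then show ?thesis unfolding k2_def[abs_def] by (intro continuous_intros) simp
qed

lemma kap_bound: "\<exists>M>0. \<forall>a w \<zeta>. cp.pert R a w \<zeta> \<longrightarrow> (\<forall>t\<in>{0..T}. \<bar>kap \<zeta> t\<bar> \<le> M)"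
proof -
  obtain K where K: "K > 0" "\<And>a w \<zeta> t. cp.pert R a w \<zeta> \<Longrightarrow> t \<in> {0..T} \<Longrightarrow> \<bar>frechet_derivative (state_con P) (at (xb t)) (\<zeta> t)\<bar> \<le> K"
    using Dg_Lipschitz[of R] by blast
  have "compact (k2 ` {0..T})" by (intro compact_continuous_image continuous_on_subset[OF k2_cont]) auto
  then obtain M where M: "M > 0" "\<And>y. y \<in> k2 ` {0..T} \<Longrightarrow> norm y \<le> M" using compact_imp_bounded bounded_pos by metis
  have "\<bar>kap \<zeta> t\<bar> \<le> K + M" if "cp.pert R a w \<zeta>" "t \<in> {0..T}" for a w \<zeta> t
    using K(2)[OF that] M(2)[of "k2 t"] that by (auto simp: kap_def k2_def intro: order_trans[OF abs_triangle_ineq])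
  then show ?thesis using K(1) M(1) by (intro exI[of _ "K + M"]) auto
qed

lemma kap_equicontinuous:
  assumes \<eta>: "\<eta> > 0"
  shows "\<exists>d>0. \<forall>a w \<zeta>. cp.pert R a w \<zeta> \<longrightarrow> (\<forall>s\<in>{0..T}. \<forall>t\<in>{0..T}. \<bar>t - s\<bar> < d \<longrightarrow> \<bar>kap \<zeta> t - kap \<zeta> s\<bar> < \<eta>)"
proof -
  obtain K where K: "K > 0" "\<And>a w \<zeta> s t. cp.pert R a w \<zeta> \<Longrightarrow> s \<in> {0..T} \<Longrightarrow> t \<in> {0..T} \<Longrightarrow>
     \<bar>frechet_derivative (state_con P) (at (xb t)) (\<zeta> t) - frechet_derivative (state_con P) (at (xb s)) (\<zeta> s)\<bar> \<le> K * \<bar>t - s\<bar>"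
    using Dg_Lipschitz[of R] by blast
  have "uniformly_continuous_on {0..T} k2" by (intro compact_uniformly_continuous continuous_on_subset[OF k2_cont]) auto
  then obtain d where d: "d > 0" "\<And>s t. s \<in> {0..T} \<Longrightarrow> t \<in> {0..T} \<Longrightarrow> \<bar>t - s\<bar> < d \<Longrightarrow> \<bar>k2 t - k2 s\<bar> < \<eta> / 2"
    unfolding uniformly_continuous_on_def dist_real_def using \<eta> by (metis half_gt_zero)
  have "\<bar>kap \<zeta> t - kap \<zeta> s\<bar> < \<eta>" if P: "cp.pert R a w \<zeta>" and st: "s \<in> {0..T}" "t \<in> {0..T}" "\<bar>t - s\<bar> < min d (\<eta> / (2 * K))" for a w \<zeta> s t
  proof -
    have "K * \<bar>t - s\<bar> < \<eta> / 2" using st(3) K(1) by (simp add: field_simps)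
    then show ?thesis using K(2)[OF P st(1,2)] d(2)[OF st(1,2)] st(3) unfolding kap_def k2_def[symmetric] by linarith
  qed
  then show ?thesis using d(1) K(1) \<eta> by (intro exI[of _ "min d (\<eta> / (2 * K))"]) auto
qed

lemma ev_bound: assumes "C2 h" shows "\<exists>M>0. \<forall>a w \<zeta>. cp.pert R a w \<zeta> \<longrightarrow> \<bar>ev h \<zeta>\<bar> \<le> M"
proof -
  obtain B where B: "B > 0" "\<And>a w \<zeta> t. cp.pert R a w \<zeta> \<Longrightarrow> t \<in> {0..T} \<Longrightarrow> norm (\<zeta> t) \<le> B"
    using cp.pert_bound[of R] by blast
  obtain K where K: "\<And>k. norm (frechet_derivative h (at X0) k) \<le> norm k * K" "K > 0"
    using bounded_linear.pos_bounded[OF C2_D_linear[OF assms]] by metis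
  have "\<bar>ev h \<zeta>\<bar> \<le> (2 * B) * K + \<bar>(1/2) * second_derivative h X0 Z0 Z0\<bar>" if P: "cp.pert R a w \<zeta>" for a w \<zeta>
  proof -
    have "norm (\<zeta> 0, \<zeta> T) \<le> 2 * B" using norm_Pair_le[of "\<zeta> 0" "\<zeta> T"] B(2)[OF P T0(1)] B(2)[OF P T0(2)] by linarith
    then have "norm (\<zeta> 0, \<zeta> T) * K \<le> (2 * B) * K" using K(2) by (intro mult_right_mono) auto
    then show ?thesis unfolding ev_def using K(1)[of "(\<zeta> 0, \<zeta> T)"] by (intro order_trans[OF abs_triangle_ineq] add_right_mono) auto
  qed
  then show ?thesis using B(1) K(2) by (intro exI[of _ "(2 * B) * K + \<bar>(1/2) * second_derivative h X0 Z0 Z0\<bar>"]) (auto intro!: add_pos_nonneg)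
qed

end

section \<open>Perturbed trajectories near a weak minimum\<close>

context ocp_direction
begin

text \<open>At a bound v may vanish, so the e^2 correction needs the right sign by itself. Off the
  bounds the distance \<open>\<rho>\<close> absorbs it, and no restriction is imposed.\<close>

definition adm :: "(real \<Rightarrow> real) \<Rightarrow> bool" where
  "adm w \<longleftrightarrow> (AE t in lebesgue. t \<in> {0..T} \<longrightarrow> (t \<in> B_minus P u \<longrightarrow> w t \<ge> 0) \<and> (t \<in> B_plus P u \<longrightarrow> w t \<le> 0))"

lemma adm_sum: "finite I \<Longrightarrow> (\<And>i. i \<in> I \<Longrightarrow> adm (w i)) \<Longrightarrow> (\<And>i. i \<in> I \<Longrightarrow> c i \<ge> 0) \<Longrightarrow> adm (\<lambda>t. \<Sum>i\<in>I. c i * w i t)"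
proof -
  assume I: "finite I" "\<And>i. i \<in> I \<Longrightarrow> adm (w i)" "\<And>i. i \<in> I \<Longrightarrow> c i \<ge> 0"
  have "AE t in lebesgue. \<forall>i\<in>I. t \<in> {0..T} \<longrightarrow> (t \<in> B_minus P u \<longrightarrow> w i t \<ge> 0) \<and> (t \<in> B_plus P u \<longrightarrow> w i t \<le> 0)"
    using I by (intro AE_finite_allI) (auto simp: adm_def)
  then show ?thesis unfolding adm_def
    by eventually_elim (auto intro!: sum_nonneg sum_nonpos mult_nonneg_nonneg mult_nonneg_nonpos I)
qed

text \<open>A step away from one bound must not overshoot the other. The gap is the width of the
  control interval if it is finite and positive; coinciding bounds are treated separately.\<close>

lemma bounds_gap: "\<exists>d>0. u_min P < u_max P \<longrightarrow> (\<forall>m. (u_min P = ereal m \<longrightarrow> ereal (m + d) \<le> u_max P) \<and> (u_max P = ereal m \<longrightarrow> u_min P \<le> ereal (m - d)))"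
proof (cases "u_min P")
  case (real a)
  show ?thesis
  proof (cases "u_max P")
    case (real b)
    then show ?thesis using \<open>u_min P = ereal a\<close> by (intro exI[of _ "if a < b then b - a else 1"]) auto
  qed (use real data in \<open>auto simp: ocp_data_def intro!: exI[of _ "1::real"]\<close>)
qed (use data in \<open>auto simp: ocp_data_def intro!: exI[of _ "1::real"]\<close>)

lemma control_in_bounds:
  assumes R: "R > 0"
  shows "\<exists>e0>0. \<forall>e w. 0 < e \<longrightarrow> e < e0 \<longrightarrow> (\<forall>t. \<bar>w t\<bar> \<le> R) \<longrightarrow> adm w \<longrightarrow>
     (AE t in lebesgue. t \<in> {0..T} \<longrightarrow> u_min P \<le> ereal (ub t + e * vb t + e\<^sup>2 * w t) \<and> ereal (ub t + e * vb t + e\<^sup>2 * w t) \<le> u_max P)"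
proof -
  obtain \<rho> where \<rho>: "\<rho> > 0" "AE t in lebesgue. t \<in> {0..T} \<longrightarrow> t \<in> B_minus P u \<or> t \<in> B_plus P u \<or>
     (u_min P + ereal \<rho> \<le> ereal (u t) \<and> ereal (u t) \<le> u_max P - ereal \<rho>)" using bounds_margin by blast
  obtain d where d: "d > 0" "u_min P < u_max P \<Longrightarrow> u_min P = ereal m \<Longrightarrow> ereal (m + d) \<le> u_max P"
     "u_min P < u_max P \<Longrightarrow> u_max P = ereal m \<Longrightarrow> u_min P \<le> ereal (m - d)" for m using bounds_gap by metis
  obtain Kv where Kv: "Kv > 0" "\<And>s. norm (vb s) \<le> Kv" using cp.bdd_measE[OF vb(1)] by blast
  \<comment> \<open>As e < 1, the increment of the control is at most e (Kv + R), hence below both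
    \<open>\<rho>\<close> and \<open>d\<close>.\<close>
  define e0 where "e0 = min 1 (min \<rho> d / (Kv + R))"
  have e0: "e0 > 0" using \<rho> d(1) Kv R by (simp add: e0_def add_pos_pos)
  have aeu: "AE t in lebesgue. t \<in> {0..T} \<longrightarrow> ub t = u t" using ub(2) by (simp add: AE_restrict_space_iff)
  have aev: "AE t in lebesgue. t \<in> {0..T} \<longrightarrow> vb t = v t" using vb(2) by (simp add: AE_restrict_space_iff)
  have bnd: "AE t in lebesgue. t \<in> {0..T} \<longrightarrow> u_min P \<le> ereal (u t) \<and> ereal (u t) \<le> u_max P"
  proof -
    have "AE t in lebesgue_on {0..T}. u_min P \<le> ereal (u t) \<and> ereal (u t) \<le> u_max P"
      using feas unfolding feasible_def by blast
    then show ?thesis by (subst (asm) AE_restrict_space_iff) auto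
  qed
  have vm: "AE t in lebesgue. t \<in> {0..T} \<longrightarrow> t \<in> B_minus P u \<longrightarrow> v t \<ge> 0" and vp: "AE t in lebesgue. t \<in> {0..T} \<longrightarrow> t \<in> B_plus P u \<longrightarrow> v t \<le> 0"
    using crit unfolding critical_cone_def by (auto simp: AE_restrict_space_iff)
  have "AE t in lebesgue. t \<in> {0..T} \<longrightarrow> u_min P \<le> ereal (ub t + e * vb t + e\<^sup>2 * w t) \<and> ereal (ub t + e * vb t + e\<^sup>2 * w t) \<le> u_max P"
    if e: "0 < e" "e < e0" and w: "\<And>t. \<bar>w t\<bar> \<le> R" "adm w" for e w
    using \<rho>(2) aeu aev bnd vm vp w(2)[unfolded adm_def]
  proof eventually_elim
    case (elim t)
    show ?case
    proof
      assume t: "t \<in> {0..T}"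
      define q where "q = e * v t + e\<^sup>2 * w t"
      have eq: "ub t + e * vb t + e\<^sup>2 * w t = u t + q" using elim t by (simp add: q_def)
      have "\<bar>q\<bar> \<le> e * \<bar>v t\<bar> + e\<^sup>2 * \<bar>w t\<bar>" unfolding q_def using e by (intro order_trans[OF abs_triangle_ineq]) (simp add: abs_mult)
      also have "\<dots> \<le> e * Kv + e * R"
      proof (rule add_mono)
        show "e * \<bar>v t\<bar> \<le> e * Kv" using e Kv(2)[of t] elim t by (intro mult_left_mono) auto
        have "e\<^sup>2 \<le> e" using e by (simp add: power2_eq_square mult_left_le_one_le e0_def)
        then show "e\<^sup>2 * \<bar>w t\<bar> \<le> e * R" using w(1)[of t] e by (intro mult_mono) auto
      qed
      also have "\<dots> = e * (Kv + R)" by (simp add: distrib_left)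
      also have "\<dots> < min \<rho> d" using e Kv R by (simp add: e0_def pos_less_divide_eq add_pos_pos)
      finally have q: "\<bar>q\<bar> < \<rho>" "\<bar>q\<bar> < d" by auto
      have umm: "u_min P \<le> u_max P" using elim t by (meson order_trans)
      have "u_min P \<le> ereal (u t + q) \<and> ereal (u t + q) \<le> u_max P"
      proof (cases "t \<in> B_minus P u \<or> t \<in> B_plus P u")
        case False
        then have h: "u_min P + ereal \<rho> \<le> ereal (u t)" "ereal (u t) \<le> u_max P - ereal \<rho>" using elim t by auto
        have "u_min P \<le> ereal (u t + q)" using h(1) q(1) by (cases "u_min P") auto
        moreover have "ereal (u t + q) \<le> u_max P" using h(2) q(1) by (cases "u_max P") auto
        ultimately show ?thesis by blast
      next
        case B: True
        show ?thesis
        proof (cases "u_min P = u_max P")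
          case True
          \<comment> \<open>If the bounds coincide, both sign conditions apply at t, so v and w
            vanish there and the control is unchanged.\<close>
          then have "t \<in> B_minus P u \<and> t \<in> B_plus P u" using B by (auto simp: B_minus_def B_plus_def)
          then have "v t = 0" "w t = 0" using elim t by auto
          then show ?thesis using elim t by (simp add: q_def)
        next
          case False
          then have lt: "u_min P < u_max P" using umm by simp
          from B show ?thesis
          proof
            assume m: "t \<in> B_minus P u"
            then have um: "u_min P = ereal (u t)" by (simp add: B_minus_def)
            have "q \<ge> 0" unfolding q_def using elim t m e by auto
            moreover have "ereal (u t + q) \<le> ereal (u t + d)" using q by simp
            from order_trans[OF this d(2)[OF lt um]] have "ereal (u t + q) \<le> u_max P" .
            ultimately show ?thesis by (simp add: um)
          next
            assume m: "t \<in> B_plus P u"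
            then have um: "u_max P = ereal (u t)" by (simp add: B_plus_def)
            have "q \<le> 0" unfolding q_def using elim t m e by (auto intro!: add_nonpos_nonpos mult_nonneg_nonpos)
            moreover have "ereal (u t - d) \<le> ereal (u t + q)" using q by simp
            from order_trans[OF d(3)[OF lt um] this] have "u_min P \<le> ereal (u t + q)" .
            ultimately show ?thesis by (simp add: um)
          qed
        qed
      qed
      then show "u_min P \<le> ereal (ub t + e * vb t + e\<^sup>2 * w t) \<and> ereal (ub t + e * vb t + e\<^sup>2 * w t) \<le> u_max P" by (simp add: eq)
    qed
  qed
  then show ?thesis using e0 by blast
qed

text \<open>Three regimes, matched by the last three entries of \<open>e0\<close>. Where g(x_t) <=
  -c, all perturbation terms are small. Otherwise g(x_t) <= -c |t - s| with s in C, and half of this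
  margin beats the first order term because g'(x)z <= 0 at s. If |t - s| < d, the second order term
  is still negative by equicontinuity of \<open>kap\<close>; if not, the other half, at least c d /
  2, absorbs it.\<close>

lemma state_feasible:
  assumes R: "R > 0" and r: "r > 0"
  shows "\<exists>e0>0. \<forall>e a w \<zeta> y. 0 < e \<longrightarrow> e < e0 \<longrightarrow> cp.pert R a w \<zeta> \<longrightarrow> cp.traj e a w y \<longrightarrow> (\<forall>t\<in>C. kap \<zeta> t \<le> - r) \<longrightarrow>
     (\<forall>t\<in>{0..T}. state_con P (y t) \<le> 0)"
proof -
  define Dz where "Dz t = frechet_derivative (state_con P) (at (xb t)) (zb t)" for t
  obtain c where c: "c > 0" "\<And>t. t \<in> {0..T} \<Longrightarrow> G t \<le> - c \<or> (\<exists>s\<in>C. G t \<le> - c * \<bar>t - s\<bar>)" using state_constraint_margin by blast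
  obtain K where K: "K > 0" "\<And>a w \<zeta> s t. cp.pert R a w \<zeta> \<Longrightarrow> s \<in> {0..T} \<Longrightarrow> t \<in> {0..T} \<Longrightarrow> \<bar>Dz t - Dz s\<bar> \<le> K * \<bar>t - s\<bar> \<and> \<bar>Dz t\<bar> \<le> K"
    using Dg_Lipschitz[of R] unfolding Dz_def by blast
  obtain M where M: "M > 0" "\<And>a w \<zeta> t. cp.pert R a w \<zeta> \<Longrightarrow> t \<in> {0..T} \<Longrightarrow> \<bar>kap \<zeta> t\<bar> \<le> M" using kap_bound[of R] by blast
  obtain d where d: "d > 0" "\<And>a w \<zeta> s t. cp.pert R a w \<zeta> \<Longrightarrow> s \<in> {0..T} \<Longrightarrow> t \<in> {0..T} \<Longrightarrow> \<bar>t - s\<bar> < d \<Longrightarrow> \<bar>kap \<zeta> t - kap \<zeta> s\<bar> < r / 2"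
    using kap_equicontinuous[of "r/2" R] r by auto
  have r2: "r / 2 > 0" using r by simp
  obtain e1 where e1: "e1 > 0" "\<And>e a w \<zeta> y t. 0 < e \<Longrightarrow> e < e1 \<Longrightarrow> cp.pert R a w \<zeta> \<Longrightarrow> cp.traj e a w y \<Longrightarrow> t \<in> {0..T} \<Longrightarrow>
    \<bar>state_con P (y t) - G t - e * frechet_derivative (state_con P) (at (x t)) (z t) - e\<^sup>2 * kap \<zeta> t\<bar> \<le> r / 2 * e\<^sup>2"
    using state_expansion[OF R r2] by blast
  define e0 where "e0 = Min {1, e1, c / (K + M + r), c / (2 * K), c * d / (2 * (M + r))}"
  have e0: "e0 > 0" using e1 c K M r d by (simp add: e0_def add_pos_pos)
  have "state_con P (y t) \<le> 0"
    if e: "0 < e" "e < e0" and P: "cp.pert R a w \<zeta>" and ty: "cp.traj e a w y" and k: "\<And>t. t \<in> C \<Longrightarrow> kap \<zeta> t \<le> - r" and t: "t \<in> {0..T}" for e a w \<zeta> y t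
  proof -
    have KM: "K + M + r > 0" "2 * (M + r) > 0" using K M r by auto
    have ee: "e < 1" "e < e1" "e * (K + M + r) < c" "e * (2 * K) < c" "e * (2 * (M + r)) < c * d"
      using e K M r KM by (auto simp: e0_def pos_less_divide_eq)
    have e2: "e\<^sup>2 \<le> e" "e\<^sup>2 > 0" using e ee by (auto simp: power2_eq_square mult_left_le_one_le)
    have ex: "state_con P (y t) \<le> G t + e * Dz t + e\<^sup>2 * kap \<zeta> t + r / 2 * e\<^sup>2"
      using e1(2)[OF e(1) ee(2) P ty t] unfolding Dz_def xb(3)[OF t] zb(3)[OF t] by (simp only: abs_le_iff) linarith
    have re: "r / 2 * e\<^sup>2 \<le> e * r"
    proof -
      have "r / 2 * e\<^sup>2 \<le> r * e" using r e2 by (intro mult_mono) auto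
      then show ?thesis by (simp only: mult.commute)
    qed
    have kM: "e\<^sup>2 * kap \<zeta> t \<le> e\<^sup>2 * M" using M(2)[OF P t] e2 by (intro mult_left_mono) auto
    from c(2)[OF t] show ?thesis
    proof
      assume G: "G t \<le> - c"
      have "e * Dz t \<le> e * K" using K(2)[OF P t t] e by (intro mult_left_mono) auto
      moreover have "e\<^sup>2 * M \<le> e * M" using e2 M by (intro mult_right_mono) auto
      moreover have "r / 2 * e\<^sup>2 \<le> e * r" by (rule re)
      moreover have "e * K + e * M + e * r < c" using ee(3) by (simp add: distrib_left)
      ultimately show ?thesis using ex G kM by linarith
    next
      assume "\<exists>s\<in>C. G t \<le> - c * \<bar>t - s\<bar>"
      then obtain s where s: "s \<in> C" "G t \<le> - c * \<bar>t - s\<bar>" by blast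
      then have s0: "s \<in> {0..T}" by (simp add: C_iff)
      have "Dz s \<le> 0" using crit s(1) s0 xb(3)[OF s0] zb(3)[OF s0] by (simp add: Dz_def critical_cone_def)
      moreover have "\<bar>Dz t - Dz s\<bar> \<le> K * \<bar>t - s\<bar>" using K(2)[OF P s0 t] by blast
      ultimately have "Dz t \<le> K * \<bar>t - s\<bar>" by linarith
      then have Dt: "e * Dz t \<le> e * (K * \<bar>t - s\<bar>)" using e by (intro mult_left_mono) auto
      have "e * (2 * K) * \<bar>t - s\<bar> \<le> c * \<bar>t - s\<bar>" using ee(4) by (intro mult_right_mono) auto
      then have eK: "e * (K * \<bar>t - s\<bar>) \<le> c * \<bar>t - s\<bar> / 2" by simp
      have cn: "c * \<bar>t - s\<bar> \<ge> 0" using c(1) by simp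
      show ?thesis
      proof (cases "\<bar>t - s\<bar> < d")
        case True
        have "kap \<zeta> t \<le> - r / 2" using d(2)[OF P s0 t True] k[OF s(1)] by linarith
        then have "e\<^sup>2 * kap \<zeta> t \<le> e\<^sup>2 * (- r / 2)" using e2 by (intro mult_left_mono) auto
        then have "e\<^sup>2 * kap \<zeta> t + r / 2 * e\<^sup>2 \<le> 0" by (simp add: mult.commute)
        then show ?thesis using ex s(2) Dt eK cn by linarith
      next
        case False
        then have "c * d \<le> c * \<bar>t - s\<bar>" using c(1) by (intro mult_left_mono) auto
        moreover have "e\<^sup>2 * M \<le> e * M" using e2 M by (intro mult_right_mono) auto
        moreover have "r / 2 * e\<^sup>2 \<le> e * r" by (rule re)
        moreover have "2 * (e * M) + 2 * (e * r) < c * d" using ee(5) by (simp add: algebra_simps)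
        ultimately show ?thesis using ex s(2) Dt eK kM by linarith
      qed
    qed
  qed
  then show ?thesis using e0 by blast
qed

definition "IA = {i\<in>{n1 P + 1..n1 P + n2 P}. endpoint_con P i X0 = 0}"

text \<open>Under the strict second order inequalities the perturbed trajectory is close to the
  reference, cheaper, and meets all constraints except possibly the equalities, so minimality forces
  some equality to fail. Without equality constraints the conclusion is contradictory, which is the
  intended reading in that case.\<close>

lemma feasible_step:
  assumes wm: "weak_minimum P u x" and R: "R > 0" and r: "r > 0" and \<eta>: "\<eta> > 0"
  shows "\<exists>e0>0. \<forall>e a w \<zeta> y. 0 < e \<longrightarrow> e < e0 \<longrightarrow> cp.pert R a w \<zeta> \<longrightarrow> adm w \<longrightarrow> cp.traj e a w y \<longrightarrow>
     ev (cost P) \<zeta> \<le> - r \<longrightarrow> (\<forall>i\<in>IA. ev (endpoint_con P i) \<zeta> \<le> - r) \<longrightarrow> (\<forall>t\<in>C. kap \<zeta> t \<le> - r) \<longrightarrow>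
     (\<forall>i\<in>{1..n1 P}. \<bar>endpoint_con P i (y 0, y T) - e\<^sup>2 * ev (endpoint_con P i) \<zeta>\<bar> \<le> \<eta> * e\<^sup>2) \<and>
     (\<exists>i\<in>{1..n1 P}. endpoint_con P i (y 0, y T) \<noteq> 0)"
proof -
  obtain \<epsilon> where \<epsilon>: "\<epsilon> > 0" "\<And>v y. feasible P v y \<Longrightarrow> AE t in lebesgue_on {0..T}. \<bar>v t - u t\<bar> \<le> \<epsilon> \<Longrightarrow>
      \<forall>t\<in>{0..T}. norm (y t - x t) \<le> \<epsilon> \<Longrightarrow> cost P X0 \<le> cost P (y 0, y T)"
    using wm unfolding weak_minimum_def by blast
  \<comment> \<open>The expansion error may use up at most half of the decrease
    \<open>r * e\<^sup>2\<close>.\<close>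
  define \<eta>' where "\<eta>' = min \<eta> (r / 2)"
  have \<eta>': "\<eta>' > 0" "\<eta>' \<le> \<eta>" "\<eta>' \<le> r / 2" using \<eta> r by (auto simp: \<eta>'_def)
  define N where "N = n1 P + n2 P"
  obtain e1 where e1: "e1 > 0" "\<And>e w. 0 < e \<Longrightarrow> e < e1 \<Longrightarrow> (\<forall>t. \<bar>w t\<bar> \<le> R) \<Longrightarrow> adm w \<Longrightarrow>
     (AE t in lebesgue. t \<in> {0..T} \<longrightarrow> u_min P \<le> ereal (ub t + e * vb t + e\<^sup>2 * w t) \<and> ereal (ub t + e * vb t + e\<^sup>2 * w t) \<le> u_max P)"
    using control_in_bounds[OF R] by blast
  obtain e2 where e2: "e2 > 0" "\<And>e a w \<zeta> y. 0 < e \<Longrightarrow> e < e2 \<Longrightarrow> cp.pert R a w \<zeta> \<Longrightarrow> cp.traj e a w y \<Longrightarrow> (\<forall>t\<in>C. kap \<zeta> t \<le> - r) \<Longrightarrow>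
     (\<forall>t\<in>{0..T}. state_con P (y t) \<le> 0)" using state_feasible[OF R r] by blast
  obtain e3 where e3: "e3 > 0" "\<And>e a w \<zeta> y. 0 < e \<Longrightarrow> e < e3 \<Longrightarrow> cp.pert R a w \<zeta> \<Longrightarrow> cp.traj e a w y \<Longrightarrow>
    \<bar>cost P (y 0, y T) - cost P X0 - e * frechet_derivative (cost P) (at X0) Z0 - e\<^sup>2 * ev (cost P) \<zeta>\<bar> \<le> \<eta>' * e\<^sup>2"
    using endpoint_expansion[OF C2s(3) R \<eta>'(1)] by blast
  have "\<forall>i\<in>{1..N}. \<exists>e0>0. \<forall>e a w \<zeta> y. 0 < e \<longrightarrow> e < e0 \<longrightarrow> cp.pert R a w \<zeta> \<longrightarrow> cp.traj e a w y \<longrightarrow>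
    \<bar>endpoint_con P i (y 0, y T) - endpoint_con P i X0 - e * frechet_derivative (endpoint_con P i) (at X0) Z0 - e\<^sup>2 * ev (endpoint_con P i) \<zeta>\<bar> \<le> \<eta>' * e\<^sup>2"
    unfolding N_def by (intro ballI endpoint_expansion C2s R \<eta>')
  then obtain ee where ee: "\<And>i. i \<in> {1..N} \<Longrightarrow> ee i > 0" "\<And>i e a w \<zeta> y. i \<in> {1..N} \<Longrightarrow> 0 < e \<Longrightarrow> e < ee i \<Longrightarrow> cp.pert R a w \<zeta> \<Longrightarrow> cp.traj e a w y \<Longrightarrow>
    \<bar>endpoint_con P i (y 0, y T) - endpoint_con P i X0 - e * frechet_derivative (endpoint_con P i) (at X0) Z0 - e\<^sup>2 * ev (endpoint_con P i) \<zeta>\<bar> \<le> \<eta>' * e\<^sup>2"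
    by metis
  have "\<forall>i\<in>{1..N}. \<exists>M>0. \<forall>a w \<zeta>. cp.pert R a w \<zeta> \<longrightarrow> \<bar>ev (endpoint_con P i) \<zeta>\<bar> \<le> M"
    unfolding N_def by (intro ballI ev_bound C2s)
  then obtain Me where Me: "\<And>i. i \<in> {1..N} \<Longrightarrow> Me i > 0" "\<And>i a w \<zeta>. i \<in> {1..N} \<Longrightarrow> cp.pert R a w \<zeta> \<Longrightarrow> \<bar>ev (endpoint_con P i) \<zeta>\<bar> \<le> Me i" by metis
  define De where "De i = \<bar>frechet_derivative (endpoint_con P i) (at X0) Z0\<bar>" for i
  \<comment> \<open>For an inactive inequality and e < 1, the value changes by at most e times the
    denominator; below \<open>gap i\<close> the constraint stays negative.\<close>
  define gap where "gap i = (if endpoint_con P i X0 < 0 then - endpoint_con P i X0 / (De i + Me i + \<eta>') else 1)" for i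
  have gap: "gap i > 0" if "i \<in> {1..N}" for i
  proof -
    have "De i + Me i + \<eta>' > 0" using Me(1)[OF that] \<eta>'(1) by (simp add: De_def)
    then show ?thesis unfolding gap_def by (auto intro!: divide_neg_pos)
  qed
  obtain Kv where Kv: "Kv > 0" "\<And>s. norm (vb s) \<le> Kv" using cp.bdd_measE[OF vb(1)] by blast
  obtain Kz where Kz: "Kz > 0" "\<And>s. norm (zb s) \<le> Kz" using cp.bdd_measE[OF zb_meas] by blast
  obtain B where B: "B > 0" "\<And>a w \<zeta> t. cp.pert R a w \<zeta> \<Longrightarrow> t \<in> {0..T} \<Longrightarrow> norm (\<zeta> t) \<le> B"
    using cp.pert_bound[of R] by blast
  obtain e4 where e4: "e4 > 0" "\<And>e a w \<zeta> y t. 0 < e \<Longrightarrow> e < e4 \<Longrightarrow> cp.pert R a w \<zeta> \<Longrightarrow> cp.traj e a w y \<Longrightarrow>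
     t \<in> {0..T} \<Longrightarrow> norm (y t - xb t - e *\<^sub>R zb t - e\<^sup>2 *\<^sub>R \<zeta> t) \<le> 1 * e\<^sup>2"
    using cp.traj_expansion[OF R zero_less_one] by blast
  define E where "E = {1, e1, e2, e3, e4, \<epsilon> / (Kv + R), \<epsilon> / (Kz + B + 1)} \<union> ee ` {1..N} \<union> gap ` {1..N}"
  define e0 where "e0 = Min E"
  have E: "finite E" "E \<noteq> {}" "\<And>y. y \<in> E \<Longrightarrow> y > 0"
    using e1 e2 e3 e4 \<epsilon>(1) Kv R Kz B ee(1) gap by (auto simp: E_def intro!: divide_pos_pos add_pos_pos)
  have e0: "e0 > 0" using E by (simp add: e0_def)
  have main: "(\<forall>i\<in>{1..n1 P}. \<bar>endpoint_con P i (y 0, y T) - e\<^sup>2 * ev (endpoint_con P i) \<zeta>\<bar> \<le> \<eta> * e\<^sup>2) \<and>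
     (\<exists>i\<in>{1..n1 P}. endpoint_con P i (y 0, y T) \<noteq> 0)"
    if e: "0 < e" "e < e0" and Pt: "cp.pert R a w \<zeta>" and w: "adm w" and ty: "cp.traj e a w y"
      and c0: "ev (cost P) \<zeta> \<le> - r" and cI: "\<And>i. i \<in> IA \<Longrightarrow> ev (endpoint_con P i) \<zeta> \<le> - r" and cC: "\<forall>t\<in>C. kap \<zeta> t \<le> - r" for e a w \<zeta> y
  proof -
    have lt: "e < q" if "q \<in> E" for q using e(2) E that by (simp add: e0_def)
    have el: "e < 1" "e < e1" "e < e2" "e < e3" "e < e4" "e < \<epsilon> / (Kv + R)" "e < \<epsilon> / (Kz + B + 1)"
      "\<And>i. i \<in> {1..N} \<Longrightarrow> e < ee i" "\<And>i. i \<in> {1..N} \<Longrightarrow> e < gap i"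
      by (rule lt, simp add: E_def)+
    have e21: "e\<^sup>2 \<le> e" "e\<^sup>2 > 0" using e el by (auto simp: power2_eq_square mult_left_le_one_le)
    have wR: "\<forall>t. \<bar>w t\<bar> \<le> R" and wm': "bdd_meas w" using Pt by (auto simp: cp.pert_def)
    define U where "U t = ub t + e * vb t + e\<^sup>2 * w t" for t
    have Um: "bdd_meas U" unfolding U_def[abs_def] by (rule cp.control_meas[OF wm'])
    have ym: "bdd_meas y" using ty by (simp add: cp.traj_def)
    have eqs: "\<bar>endpoint_con P i (y 0, y T) - e\<^sup>2 * ev (endpoint_con P i) \<zeta>\<bar> \<le> \<eta> * e\<^sup>2" if i: "i \<in> {1..n1 P}" for i
    proof -
      have iN: "i \<in> {1..N}" using i by (auto simp: N_def)
      have "endpoint_con P i X0 = 0" "frechet_derivative (endpoint_con P i) (at X0) Z0 = 0"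
        using feas crit i by (auto simp: feasible_def critical_cone_def)
      then have "\<bar>endpoint_con P i (y 0, y T) - e\<^sup>2 * ev (endpoint_con P i) \<zeta>\<bar> \<le> \<eta>' * e\<^sup>2"
        using ee(2)[OF iN e(1) el(8)[OF iN] Pt ty] by simp
      also have "\<dots> \<le> \<eta> * e\<^sup>2" using \<eta>' by (intro mult_right_mono) auto
      finally show ?thesis .
    qed
    have ineqs: "endpoint_con P i (y 0, y T) \<le> 0" if i: "i \<in> {n1 P + 1..n1 P + n2 P}" for i
    proof -
      have iN: "i \<in> {1..N}" using i by (auto simp: N_def)
      have ex: "\<bar>endpoint_con P i (y 0, y T) - endpoint_con P i X0 - e * frechet_derivative (endpoint_con P i) (at X0) Z0 - e\<^sup>2 * ev (endpoint_con P i) \<zeta>\<bar> \<le> \<eta>' * e\<^sup>2"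
        by (rule ee(2)[OF iN e(1) el(8)[OF iN] Pt ty])
      show ?thesis
      proof (cases "endpoint_con P i X0 = 0")
        case True
        then have iA: "i \<in> IA" using i by (simp add: IA_def)
        have "frechet_derivative (endpoint_con P i) (at X0) Z0 \<le> 0" using crit i True by (simp add: critical_cone_def)
        then have "e * frechet_derivative (endpoint_con P i) (at X0) Z0 \<le> 0" using e by (simp add: mult_nonneg_nonpos)
        moreover have "e\<^sup>2 * ev (endpoint_con P i) \<zeta> \<le> e\<^sup>2 * (- r)" using cI[OF iA] by (intro mult_left_mono) auto
        moreover have "\<eta>' * e\<^sup>2 \<le> r / 2 * e\<^sup>2" using \<eta>' by (intro mult_right_mono) auto
        moreover have "r * e\<^sup>2 \<ge> 0" using r by simp
        ultimately show ?thesis using ex True by (simp add: abs_le_iff mult.commute)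
      next
        case False
        then have neg: "endpoint_con P i X0 < 0" using feas i by (force simp: feasible_def)
        have s: "De i + Me i + \<eta>' > 0" using Me(1)[OF iN] \<eta>' by (simp add: De_def add_nonneg_pos)
        have "e * (De i + Me i + \<eta>') < - endpoint_con P i X0"
          using el(9)[OF iN] s unfolding gap_def if_P[OF neg] by (simp only: pos_less_divide_eq)
        then have "e * De i + e * Me i + e * \<eta>' < - endpoint_con P i X0" by (simp add: distrib_left)
        moreover have "e * frechet_derivative (endpoint_con P i) (at X0) Z0 \<le> e * De i" using e by (simp add: De_def)
        moreover have "e\<^sup>2 * ev (endpoint_con P i) \<zeta> \<le> e * Me i"
        proof -
          have "e\<^sup>2 * ev (endpoint_con P i) \<zeta> \<le> e\<^sup>2 * Me i" using Me(2)[OF iN Pt] by (intro mult_left_mono) auto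
          also have "\<dots> \<le> e * Me i" using e21 Me(1)[OF iN] by (intro mult_right_mono) auto
          finally show ?thesis .
        qed
        moreover have "\<eta>' * e\<^sup>2 \<le> e * \<eta>'" using e21 \<eta>' by (simp add: mult.commute)
        ultimately show ?thesis using ex by (simp only: abs_le_iff) linarith
      qed
    qed
    have costlt: "cost P (y 0, y T) < cost P X0"
    proof -
      have "frechet_derivative (cost P) (at X0) Z0 \<le> 0" using crit by (simp add: critical_cone_def)
      then have "e * frechet_derivative (cost P) (at X0) Z0 \<le> 0" using e by (simp add: mult_nonneg_nonpos)
      moreover have "e\<^sup>2 * ev (cost P) \<zeta> \<le> e\<^sup>2 * (- r)" using c0 by (intro mult_left_mono) auto
      moreover have "\<eta>' * e\<^sup>2 \<le> r / 2 * e\<^sup>2" using \<eta>' by (intro mult_right_mono) auto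
      moreover have "r * e\<^sup>2 > 0" using r e by simp
      ultimately show ?thesis using e3(2)[OF e(1) el(4) Pt ty] by (simp add: abs_le_iff mult.commute)
    qed
    have "\<exists>i\<in>{1..n1 P}. endpoint_con P i (y 0, y T) \<noteq> 0"
    proof (rule ccontr)
      assume "\<not> (\<exists>i\<in>{1..n1 P}. endpoint_con P i (y 0, y T) \<noteq> 0)"
      then have eq0: "\<forall>i\<in>{1..n1 P}. endpoint_con P i (y 0, y T) = 0" by blast
      have rhs: "bdd_meas (\<lambda>s. f0 P (y s) + U s *\<^sub>R f1 P (y s))" unfolding U_def by (rule cp.rhs_meas[OF wm' ym])
      have ytr: "y t = (xb 0 + e *\<^sub>R zb 0 + e\<^sup>2 *\<^sub>R a) + IL 0 t (\<lambda>s. f0 P (y s) + U s *\<^sub>R f1 P (y s))" if "t \<in> {0..T}" for t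
        using ty that unfolding cp.traj_def U_def by blast
      have "IL 0 0 (\<lambda>s. f0 P (y s) + U s *\<^sub>R f1 P (y s)) = 0" using IL_combine[OF rhs, of 0 0 0] by simp
      then have y0: "y 0 = xb 0 + e *\<^sub>R zb 0 + e\<^sup>2 *\<^sub>R a" using ytr[OF T0(1)] by simp
      have "feasible P U y"
        unfolding feasible_def
      proof (intro conjI)
        show "L_infty T U" by (rule bdd_meas_L_infty[OF Um])
        show "\<exists>x'. W1_infty_deriv T y x' \<and> (AE t in lebesgue_on {0..T}. x' t = dynamics P (U t) (y t))"
          unfolding W1_infty_deriv_def
          by (rule exI[of _ "\<lambda>s. f0 P (y s) + U s *\<^sub>R f1 P (y s)"]) (use rhs ytr y0 bdd_meas_L_infty in \<open>auto simp: dynamics_def\<close>)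
        show "AE t in lebesgue_on {0..T}. u_min P \<le> ereal (U t) \<and> ereal (U t) \<le> u_max P"
          using e1(2)[OF e(1) el(2) wR w] unfolding U_def by (subst AE_restrict_space_iff) auto
        show "\<forall>t\<in>{0..T}. state_con P (y t) \<le> 0" by (rule e2(2)[OF e(1) el(3) Pt ty cC])
      qed (use eq0 ineqs in auto)
      moreover have "AE t in lebesgue_on {0..T}. \<bar>U t - u t\<bar> \<le> \<epsilon>"
        using ub(2)
      proof eventually_elim
        case (elim t)
        have "\<bar>U t - u t\<bar> = \<bar>e * vb t + e\<^sup>2 * w t\<bar>" using elim by (simp add: U_def)
        also have "\<dots> \<le> \<bar>e * vb t\<bar> + \<bar>e\<^sup>2 * w t\<bar>" by (rule abs_triangle_ineq)
        also have "\<dots> \<le> e * Kv + e * R" unfolding abs_mult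
          using less_imp_le[OF e(1)] e21(1) Kv(2)[of t] wR[rule_format, of t] by (intro add_mono mult_mono) auto
        also have "\<dots> = e * (Kv + R)" by (simp add: distrib_left)
        also have "\<dots> < \<epsilon>" using el(6) Kv R by (simp add: pos_less_divide_eq)
        finally show ?case by simp
      qed
      moreover have "\<forall>t\<in>{0..T}. norm (y t - x t) \<le> \<epsilon>"
      proof
        fix t assume t: "t \<in> {0..T}"
        have "y t - x t = (y t - xb t - e *\<^sub>R zb t - e\<^sup>2 *\<^sub>R \<zeta> t) + (e *\<^sub>R zb t + e\<^sup>2 *\<^sub>R \<zeta> t)" using xb(3)[OF t] by simp
        also have "norm \<dots> \<le> 1 * e\<^sup>2 + (e * Kz + e\<^sup>2 * B)"
        proof (rule norm_triangle_mono[OF e4(2)[OF e(1) el(5) Pt ty t]], rule norm_triangle_mono)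
          show "norm (e *\<^sub>R zb t) \<le> e * Kz" using e Kz(2)[of t] by (simp add: mult_left_mono)
          show "norm (e\<^sup>2 *\<^sub>R \<zeta> t) \<le> e\<^sup>2 * B" using B(2)[OF Pt t] by (simp add: mult_left_mono)
        qed
        also have "\<dots> \<le> e * 1 + (e * Kz + e * B)" using e21(1) mult_right_mono[OF e21(1), of B] B(1) by linarith
        also have "\<dots> = e * (Kz + B + 1)" by (simp add: algebra_simps)
        also have "\<dots> < \<epsilon>" using el(7) Kz B(1) by (simp add: pos_less_divide_eq)
        finally show "norm (y t - x t) \<le> \<epsilon>" by simp
      qed
      ultimately show False using \<epsilon>(2) costlt by fastforce
    qed
    then show ?thesis using eqs by blast
  qed
  show ?thesis by (intro exI[of _ e0] conjI e0 allI impI main) (assumption | blast)+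
qed

end

section \<open>Solving the equality constraints\<close>

context ocp_direction
begin

lemma ev_sum:
  assumes "C2 h" "finite I" "(\<Sum>i\<in>I. c i) = 1"
  shows "ev h (\<lambda>t. \<Sum>i\<in>I. c i *\<^sub>R \<zeta> i t) = (\<Sum>i\<in>I. c i * ev h (\<zeta> i))"
proof -
  have l: "linear (frechet_derivative h (at X0))" using C2_D_linear[OF assms(1)] by (rule bounded_linear.linear)
  have "((\<Sum>i\<in>I. c i *\<^sub>R \<zeta> i 0), (\<Sum>i\<in>I. c i *\<^sub>R \<zeta> i T)) = (\<Sum>i\<in>I. c i *\<^sub>R (\<zeta> i 0, \<zeta> i T))"
    by (simp add: prod_eq_iff fst_sum snd_sum)
  moreover have "frechet_derivative h (at X0) (\<Sum>i\<in>I. c i *\<^sub>R (\<zeta> i 0, \<zeta> i T)) = (\<Sum>i\<in>I. c i * frechet_derivative h (at X0) (\<zeta> i 0, \<zeta> i T))"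
    using l by (simp add: linear_sum linear_cmul del: scaleR_Pair)
  ultimately have "ev h (\<lambda>t. \<Sum>i\<in>I. c i *\<^sub>R \<zeta> i t) = (\<Sum>i\<in>I. c i * frechet_derivative h (at X0) (\<zeta> i 0, \<zeta> i T)) + (\<Sum>i\<in>I. c i) * ((1/2) * second_derivative h X0 Z0 Z0)"
    using assms(3) by (simp add: ev_def)
  also have "\<dots> = (\<Sum>i\<in>I. c i * ev h (\<zeta> i))" by (simp only: ev_def distrib_left sum.distrib sum_distrib_right)
  finally show ?thesis .
qed

lemma kap_sum:
  assumes "finite I" "(\<Sum>i\<in>I. c i) = 1"
  shows "kap (\<lambda>t. \<Sum>i\<in>I. c i *\<^sub>R \<zeta> i t) t = (\<Sum>i\<in>I. c i * kap (\<zeta> i) t)"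
proof -
  have l: "linear (frechet_derivative (state_con P) (at (xb t)))" using C2_D_linear[OF C2s(4)] by (rule bounded_linear.linear)
  have "kap (\<lambda>t. \<Sum>i\<in>I. c i *\<^sub>R \<zeta> i t) t = (\<Sum>i\<in>I. c i * frechet_derivative (state_con P) (at (xb t)) (\<zeta> i t)) + (\<Sum>i\<in>I. c i) * k2 t"
    using l assms(2) by (simp add: kap_def k2_def linear_sum linear_cmul)
  also have "\<dots> = (\<Sum>i\<in>I. c i * kap (\<zeta> i) t)" by (simp only: kap_def k2_def distrib_left sum.distrib sum_distrib_right)
  finally show ?thesis .
qed

lemma sum_le_convex: "finite I \<Longrightarrow> (\<And>i. i \<in> I \<Longrightarrow> c i \<ge> 0) \<Longrightarrow> (\<Sum>i\<in>I. c i) = 1 \<Longrightarrow> (\<And>i. i \<in> I \<Longrightarrow> f i \<le> b) \<Longrightarrow> (\<Sum>i\<in>I. c i * f i) \<le> (b::real)"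
proof -
  assume a: "finite I" "\<And>i. i \<in> I \<Longrightarrow> c i \<ge> 0" "(\<Sum>i\<in>I. c i) = 1" "\<And>i. i \<in> I \<Longrightarrow> f i \<le> b"
  have "(\<Sum>i\<in>I. c i * f i) \<le> (\<Sum>i\<in>I. c i * b)" using a by (intro sum_mono mult_left_mono) auto
  then show ?thesis using a(3) by (simp add: sum_distrib_right[symmetric])
qed

text \<open>The perturbations \<open>\<zeta>\<^sub>k\<close> belonging to \<open>y = 0\<close> and \<open>y = \<plusminus> r e\<^sub>j\<close> are combined with
  weights depending on \<open>\<theta> \<in> [-1,1]\<^sup>K\<close>; the nonlinear equality constraints are then a small
  perturbation of the identity in \<open>\<theta>\<close> and have a zero by Brouwer's theorem.\<close>

lemma strict_perturbation_contradiction: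
  assumes wm: "weak_minimum P u x" and R: "R > 0" and r: "r > 0"
    and H: "\<And>y. (\<And>i. i \<in> {1..n1 P} \<Longrightarrow> \<bar>y i\<bar> \<le> r) \<Longrightarrow> \<exists>a w \<zeta>. cp.pert R a w \<zeta> \<and> adm w \<and> ev (cost P) \<zeta> \<le> - r \<and>
       (\<forall>i\<in>IA. ev (endpoint_con P i) \<zeta> \<le> - r) \<and> (\<forall>t\<in>C. kap \<zeta> t \<le> - r) \<and>
       (\<forall>i\<in>{1..n1 P}. \<bar>ev (endpoint_con P i) \<zeta> - y i\<bar> \<le> r / (8 * (real (n1 P) + 1)))"
  shows False
proof -
  define K where "K = n1 P"
  \<comment> \<open>\<open>None\<close> stands for the target y = 0, and \<open>Some (j, b)\<close>
    for r or -r in coordinate j according to \<open>b\<close>.\<close>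
  define I where "I = insert None (Some ` ({..<K} \<times> (UNIV :: bool set)))"
  have I: "finite I" by (simp add: I_def)
  have sumI: "(\<Sum>k\<in>I. g k) = g None + (\<Sum>j<K. g (Some (j, True)) + g (Some (j, False)))" for g :: "(nat \<times> bool) option \<Rightarrow> real"
  proof -
    have "(\<Sum>k\<in>I. g k) = g None + (\<Sum>k\<in>Some ` ({..<K} \<times> (UNIV :: bool set)). g k)"
      unfolding I_def by (subst sum.insert) auto
    also have "(\<Sum>k\<in>Some ` ({..<K} \<times> (UNIV :: bool set)). g k) = (\<Sum>j<K. \<Sum>b\<in>UNIV. g (Some (j, b)))"
      by (subst sum.reindex) (auto simp: sum.cartesian_product)
    finally show ?thesis by (simp add: UNIV_bool add.commute)
  qed
  define Y :: "(nat \<times> bool) option \<Rightarrow> nat \<Rightarrow> real" where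
    "Y k i = (case k of None \<Rightarrow> 0 | Some (j, b) \<Rightarrow> if i = Suc j then (if b then r else - r) else 0)" for k i
  have "\<forall>k. \<exists>a w \<zeta>. cp.pert R a w \<zeta> \<and> adm w \<and> ev (cost P) \<zeta> \<le> - r \<and>
       (\<forall>i\<in>IA. ev (endpoint_con P i) \<zeta> \<le> - r) \<and> (\<forall>t\<in>C. kap \<zeta> t \<le> - r) \<and>
       (\<forall>i\<in>{1..n1 P}. \<bar>ev (endpoint_con P i) \<zeta> - Y k i\<bar> \<le> r / (8 * (real (n1 P) + 1)))"
    by (intro allI H) (use r in \<open>auto simp: Y_def split: option.splits\<close>)
  then obtain a w \<zeta> where P: "\<And>k. cp.pert R (a k) (w k) (\<zeta> k)" and W: "\<And>k. adm (w k)"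
    and c0: "\<And>k. ev (cost P) (\<zeta> k) \<le> - r" and cI: "\<And>k i. i \<in> IA \<Longrightarrow> ev (endpoint_con P i) (\<zeta> k) \<le> - r"
    and cC: "\<And>k t. t \<in> C \<Longrightarrow> kap (\<zeta> k) t \<le> - r"
    and cE: "\<And>k i. i \<in> {1..n1 P} \<Longrightarrow> \<bar>ev (endpoint_con P i) (\<zeta> k) - Y k i\<bar> \<le> r / (8 * (real (n1 P) + 1))"
    by metis
  \<comment> \<open>The sign of \<open>\<theta> j\<close> decides which of the two perturbations of
    coordinate j receives the weight |\<theta>_j| / K; the rest goes to \<open>None\<close>. The
    weights add up to 1 and the weighted targets to r \<theta> / K.\<close>
  define c :: "(nat \<Rightarrow> real) \<Rightarrow> (nat \<times> bool) option \<Rightarrow> real" where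
    "c \<theta> k = (case k of None \<Rightarrow> 1 - (\<Sum>j<K. \<bar>\<theta> j\<bar>) / real K | Some (j, b) \<Rightarrow> max 0 (if b then \<theta> j else - \<theta> j) / real K)" for \<theta> k
  have c1: "(\<Sum>k\<in>I. c \<theta> k) = 1" for \<theta>
  proof -
    have "(\<Sum>j<K. c \<theta> (Some (j, True)) + c \<theta> (Some (j, False))) = (\<Sum>j<K. \<bar>\<theta> j\<bar> / real K)"
      by (intro sum.cong refl) (auto simp: c_def max_def abs_if add_divide_distrib[symmetric])
    then show ?thesis unfolding sumI by (simp add: c_def sum_divide_distrib)
  qed
  have cpos: "c \<theta> k \<ge> 0" if \<theta>: "\<And>j. j < K \<Longrightarrow> \<theta> j \<in> {-1..1}" for \<theta> k
  proof (cases k)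
    case None
    have "(\<Sum>j<K. \<bar>\<theta> j\<bar>) \<le> (\<Sum>j<K. 1)" using \<theta> by (intro sum_mono) (auto simp: abs_le_iff minus_le_iff)
    then have "(\<Sum>j<K. \<bar>\<theta> j\<bar>) / real K \<le> 1" by (cases "K = 0") (auto simp: divide_simps)
    then show ?thesis by (simp add: c_def None)
  next
    case (Some jb)
    then show ?thesis by (cases jb) (auto simp: c_def)
  qed
  define aa where "aa \<theta> = (\<Sum>k\<in>I. c \<theta> k *\<^sub>R a k)" for \<theta>
  define ww where "ww \<theta> = (\<lambda>t. \<Sum>k\<in>I. c \<theta> k * w k t)" for \<theta>
  define zz where "zz \<theta> = (\<lambda>t. \<Sum>k\<in>I. c \<theta> k *\<^sub>R \<zeta> k t)" for \<theta>
  have wwm: "bdd_meas (ww \<theta>)" for \<theta>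
    unfolding ww_def using P by (intro bdd_meas_sum bdd_meas_mult bdd_meas_const) (auto simp: cp.pert_def)
  \<comment> \<open>This equals the tolerance in \<open>H\<close>. The two errors together, after
    scaling by K / (r e^2), stay below 1, as \<open>near_identity_zero\<close> requires.\<close>
  define \<eta> where "\<eta> = r / (8 * (real K + 1))"
  have \<eta>: "\<eta> > 0" using r by (simp add: \<eta>_def)
  obtain e0 where e0: "e0 > 0" "\<And>e a w \<zeta> y. 0 < e \<Longrightarrow> e < e0 \<Longrightarrow> cp.pert R a w \<zeta> \<Longrightarrow> adm w \<Longrightarrow> cp.traj e a w y \<Longrightarrow>
     ev (cost P) \<zeta> \<le> - r \<Longrightarrow> (\<forall>i\<in>IA. ev (endpoint_con P i) \<zeta> \<le> - r) \<Longrightarrow> (\<forall>t\<in>C. kap \<zeta> t \<le> - r) \<Longrightarrow>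
     (\<forall>i\<in>{1..n1 P}. \<bar>endpoint_con P i (y 0, y T) - e\<^sup>2 * ev (endpoint_con P i) \<zeta>\<bar> \<le> \<eta> * e\<^sup>2) \<and>
     (\<exists>i\<in>{1..n1 P}. endpoint_con P i (y 0, y T) \<noteq> 0)"
    using feasible_step[OF wm R r \<eta>] by blast
  define e where "e = e0 / 2"
  have e: "0 < e" "e < e0" using e0(1) by (auto simp: e_def)
  \<comment> \<open>Any choice of trajectory will do: \<open>cp.traj_diff\<close> compares arbitrary
    trajectories, so the choice depends continuously on \<theta> at the end points.\<close>
  define yy where "yy \<theta> = (SOME y. cp.traj e (aa \<theta>) (ww \<theta>) y)" for \<theta>
  have yy: "cp.traj e (aa \<theta>) (ww \<theta>) (yy \<theta>)" for \<theta>
    unfolding yy_def by (rule someI_ex[OF cp.traj_exists[OF wwm]])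
  \<comment> \<open>Rescaled so that the component is \<theta>_j plus a small error. Constraints are
    numbered from 1 and coordinates from 0, hence \<open>Suc j\<close>.\<close>
  define f where "f \<theta> j = real K / (r * e\<^sup>2) * endpoint_con P (Suc j) (yy \<theta> 0, yy \<theta> T)" for \<theta> j
  have Pz: "cp.pert R (aa \<theta>) (ww \<theta>) (zz \<theta>)" and Wz: "adm (ww \<theta>)" and c0z: "ev (cost P) (zz \<theta>) \<le> - r"
    and cIz: "\<forall>i\<in>IA. ev (endpoint_con P i) (zz \<theta>) \<le> - r" and cCz: "\<forall>t\<in>C. kap (zz \<theta>) t \<le> - r"
    if \<theta>: "\<And>j. j < K \<Longrightarrow> \<theta> j \<in> {-1..1}" for \<theta>
  proof -
    note cp' = cpos[of \<theta>, OF \<theta>]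
    show "cp.pert R (aa \<theta>) (ww \<theta>) (zz \<theta>)" unfolding aa_def ww_def zz_def by (rule cp.pert_sum[OF I P cp' c1])
    show "adm (ww \<theta>)" unfolding ww_def by (rule adm_sum[OF I W cp'])
    show "ev (cost P) (zz \<theta>) \<le> - r" unfolding zz_def ev_sum[OF C2s(3) I c1] by (rule sum_le_convex[OF I cp' c1 c0])
    show "\<forall>i\<in>IA. ev (endpoint_con P i) (zz \<theta>) \<le> - r"
    proof
      fix i assume i: "i \<in> IA"
      then have "C2 (endpoint_con P i)" by (intro C2s) (auto simp: IA_def)
      from ev_sum[OF this I c1] show "ev (endpoint_con P i) (zz \<theta>) \<le> - r"
        unfolding zz_def using sum_le_convex[OF I cp' c1 cI[OF i]] by simp
    qed
    show "\<forall>t\<in>C. kap (zz \<theta>) t \<le> - r"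
      unfolding zz_def kap_sum[OF I c1] by (intro ballI sum_le_convex[OF I cp' c1 cC])
  qed
  have step: "\<bar>endpoint_con P i (yy \<theta> 0, yy \<theta> T) - e\<^sup>2 * ev (endpoint_con P i) (zz \<theta>)\<bar> \<le> \<eta> * e\<^sup>2"
    "\<exists>i\<in>{1..n1 P}. endpoint_con P i (yy \<theta> 0, yy \<theta> T) \<noteq> 0"
    if \<theta>: "\<And>j. j < K \<Longrightarrow> \<theta> j \<in> {-1..1}" and i: "i \<in> {1..n1 P}" for \<theta> i
    using e0(2)[OF e Pz[of \<theta>, OF \<theta>] Wz[of \<theta>, OF \<theta>] yy c0z[of \<theta>, OF \<theta>] cIz[of \<theta>, OF \<theta>] cCz[of \<theta>, OF \<theta>]] i by blast+
  have "\<exists>\<theta>. (\<forall>j<K. \<theta> j \<in> {-1..1}) \<and> (\<forall>j<K. f \<theta> j = 0)"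
  proof (rule near_identity_zero)
    fix \<theta> j assume \<theta>: "\<And>j. j < K \<Longrightarrow> \<theta> j \<in> {-1..1::real}" and j: "j < K"
    have i: "Suc j \<in> {1..n1 P}" using j by (auto simp: K_def)
    have "C2 (endpoint_con P (Suc j))" using i by (intro C2s) auto
    then have evz: "ev (endpoint_con P (Suc j)) (zz \<theta>) = (\<Sum>k\<in>I. c \<theta> k * ev (endpoint_con P (Suc j)) (\<zeta> k))"
      unfolding zz_def by (rule ev_sum[OF _ I c1])
    have "(\<Sum>k\<in>I. c \<theta> k * Y k (Suc j)) = (\<Sum>m<K. (if m = j then r * \<theta> j / real K else 0))"
    proof -
      have "c \<theta> (Some (m, True)) * Y (Some (m, True)) (Suc j) + c \<theta> (Some (m, False)) * Y (Some (m, False)) (Suc j)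
        = (if m = j then r * \<theta> j / real K else 0)" for m
        by (auto simp: Y_def c_def max_def)
      moreover have "Y None (Suc j) = 0" by (simp add: Y_def)
      ultimately show ?thesis unfolding sumI by simp
    qed
    also have "\<dots> = r * \<theta> j / real K" using j by simp
    finally have Ys: "(\<Sum>k\<in>I. c \<theta> k * Y k (Suc j)) = r * \<theta> j / real K" .
    have "\<bar>ev (endpoint_con P (Suc j)) (zz \<theta>) - r * \<theta> j / real K\<bar> = \<bar>\<Sum>k\<in>I. c \<theta> k * (ev (endpoint_con P (Suc j)) (\<zeta> k) - Y k (Suc j))\<bar>"
      unfolding evz Ys[symmetric] by (simp add: right_diff_distrib sum_subtractf)
    also have "\<dots> \<le> (\<Sum>k\<in>I. \<bar>c \<theta> k * (ev (endpoint_con P (Suc j)) (\<zeta> k) - Y k (Suc j))\<bar>)" by (rule sum_abs)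
    also have "\<dots> = (\<Sum>k\<in>I. c \<theta> k * \<bar>ev (endpoint_con P (Suc j)) (\<zeta> k) - Y k (Suc j)\<bar>)"
      using cpos[of \<theta>, OF \<theta>] by (simp add: abs_mult)
    also have "\<dots> \<le> \<eta>" unfolding \<eta>_def K_def using cE[OF i] by (intro sum_le_convex[OF I cpos[of \<theta>, OF \<theta>] c1])
    finally have evb: "\<bar>ev (endpoint_con P (Suc j)) (zz \<theta>) - r * \<theta> j / real K\<bar> \<le> \<eta>" .
    define E where "E = endpoint_con P (Suc j) (yy \<theta> 0, yy \<theta> T)"
    have K0: "real K > 0" using j by simp
    have "\<bar>E - e\<^sup>2 * ev (endpoint_con P (Suc j)) (zz \<theta>)\<bar> \<le> \<eta> * e\<^sup>2" unfolding E_def by (rule step(1)[of \<theta>, OF \<theta> i])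
    moreover have "\<bar>e\<^sup>2 * ev (endpoint_con P (Suc j)) (zz \<theta>) - e\<^sup>2 * (r * \<theta> j / real K)\<bar> \<le> \<eta> * e\<^sup>2"
      unfolding right_diff_distrib[symmetric] abs_mult using mult_left_mono[OF evb, of "e\<^sup>2"] by (simp add: mult.commute)
    moreover have "\<bar>p - q'\<bar> \<le> 2 * m" if "\<bar>p - q\<bar> \<le> m" "\<bar>q - q'\<bar> \<le> m" for p q q' m :: real using that by linarith
    ultimately have "\<bar>E - e\<^sup>2 * (r * \<theta> j / real K)\<bar> \<le> 2 * (\<eta> * e\<^sup>2)" by blast
    then have "\<bar>E - e\<^sup>2 * (r * \<theta> j / real K)\<bar> \<le> 2 * \<eta> * e\<^sup>2" by (simp only: mult.assoc)
    then have "real K / (r * e\<^sup>2) * \<bar>E - e\<^sup>2 * (r * \<theta> j / real K)\<bar> \<le> real K / (r * e\<^sup>2) * (2 * \<eta> * e\<^sup>2)"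
      using r by (intro mult_left_mono) auto
    moreover have "f \<theta> j - \<theta> j = real K / (r * e\<^sup>2) * (E - e\<^sup>2 * (r * \<theta> j / real K))"
      using K0 r e(1) by (simp add: f_def E_def field_simps)
    then have "\<bar>f \<theta> j - \<theta> j\<bar> = real K / (r * e\<^sup>2) * \<bar>E - e\<^sup>2 * (r * \<theta> j / real K)\<bar>" using r by (simp add: abs_mult)
    moreover have "real K / (r * e\<^sup>2) * (2 * \<eta> * e\<^sup>2) \<le> 1" using r e(1) by (simp add: \<eta>_def divide_simps)
    ultimately show "\<bar>f \<theta> j - \<theta> j\<bar> \<le> 1" by linarith
  next
    fix X :: "nat \<Rightarrow> nat \<Rightarrow> real" and l j
    assume X: "\<And>n i. i < K \<Longrightarrow> X n i \<in> {-1..1}" and Xl: "\<And>i. i < K \<Longrightarrow> (\<lambda>n. X n i) \<longlonglongrightarrow> l i" and j: "j < K"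
    obtain C where C: "C > 0" "\<And>a w y \<delta> t. cp.traj e a w y \<Longrightarrow> bdd_meas w \<Longrightarrow> (\<forall>t. \<bar>w t - ww l t\<bar> \<le> \<delta>) \<Longrightarrow> norm (a - aa l) \<le> \<delta> \<Longrightarrow> \<delta> \<le> 1 \<Longrightarrow>
       t \<in> {0..T} \<Longrightarrow> norm (y t - yy l t) \<le> C * \<delta>"
      using cp.traj_diff[OF yy[of l] wwm[of l]] by blast
    define \<delta> where "\<delta> n = R * (\<Sum>k\<in>I. \<bar>c (X n) k - c l k\<bar>)" for n
    have cl: "(\<lambda>n. c (X n) k) \<longlonglongrightarrow> c l k" if kI: "k \<in> I" for k
    proof (cases k)
      case None
      then show ?thesis unfolding c_def by (cases "K = 0") (auto intro!: tendsto_intros Xl)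
    next
      case (Some jb)
      then obtain m b where jb: "jb = (m, b)" "m < K" using kI by (auto simp: I_def)
      then have "(\<lambda>n. if b then X n m else - X n m) \<longlonglongrightarrow> (if b then l m else - l m)" using Xl[OF jb(2)] by (auto intro: tendsto_minus)
      then have "(\<lambda>n. max 0 (if b then X n m else - X n m) / real K) \<longlonglongrightarrow> max 0 (if b then l m else - l m) / real K"
        using jb(2) by (intro tendsto_divide tendsto_max tendsto_const) auto
      then show ?thesis unfolding c_def by (simp add: Some jb)
    qed
    have "\<delta> \<longlonglongrightarrow> R * (\<Sum>k\<in>I. \<bar>c l k - c l k\<bar>)" unfolding \<delta>_def by (intro tendsto_intros cl)
    then have \<delta>0: "\<delta> \<longlonglongrightarrow> 0" by simp
    have bw: "\<bar>ww (X n) t - ww l t\<bar> \<le> \<delta> n" for n t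
    proof -
      have "\<bar>ww (X n) t - ww l t\<bar> = \<bar>\<Sum>k\<in>I. (c (X n) k - c l k) * w k t\<bar>" by (simp add: ww_def left_diff_distrib sum_subtractf)
      also have "\<dots> \<le> (\<Sum>k\<in>I. \<bar>(c (X n) k - c l k) * w k t\<bar>)" by (rule sum_abs)
      also have "\<dots> \<le> (\<Sum>k\<in>I. \<bar>c (X n) k - c l k\<bar> * R)" unfolding abs_mult using P by (intro sum_mono mult_left_mono) (auto simp: cp.pert_def)
      finally show ?thesis by (simp add: \<delta>_def sum_distrib_left mult.commute)
    qed
    have ba: "norm (aa (X n) - aa l) \<le> \<delta> n" for n
    proof -
      have "norm (aa (X n) - aa l) = norm (\<Sum>k\<in>I. (c (X n) k - c l k) *\<^sub>R a k)" by (simp add: aa_def scaleR_diff_left sum_subtractf)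
      also have "\<dots> \<le> (\<Sum>k\<in>I. \<bar>c (X n) k - c l k\<bar> * R)" using P by (intro sum_norm_le) (auto simp: cp.pert_def intro!: mult_left_mono)
      finally show ?thesis by (simp add: \<delta>_def sum_distrib_left mult.commute)
    qed
    have yl: "(\<lambda>n. yy (X n) t) \<longlonglongrightarrow> yy l t" if t: "t \<in> {0..T}" for t
    proof -
      have "\<forall>\<^sub>F n in sequentially. \<delta> n < 1" using \<delta>0 by (intro order_tendstoD) auto
      then have "\<forall>\<^sub>F n in sequentially. norm (yy (X n) t - yy l t) \<le> C * \<delta> n"
        by eventually_elim (use C(2)[OF yy wwm _ ba _ t] bw in auto)
      moreover have "(\<lambda>n. C * \<delta> n) \<longlonglongrightarrow> 0" using tendsto_mult_right_zero[OF \<delta>0] by simp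
      ultimately have "(\<lambda>n. yy (X n) t - yy l t) \<longlonglongrightarrow> 0" by (rule Lim_null_comparison)
      then show ?thesis by (simp add: LIM_zero_iff)
    qed
    have "isCont (endpoint_con P (Suc j)) (yy l 0, yy l T)"
      using C2_continuous[OF C2s(5)[of "Suc j"], of UNIV] j by (simp add: continuous_on_eq_continuous_at K_def)
    moreover have "(\<lambda>n. (yy (X n) 0, yy (X n) T)) \<longlonglongrightarrow> (yy l 0, yy l T)" by (intro tendsto_Pair yl T0)
    ultimately have "(\<lambda>n. endpoint_con P (Suc j) (yy (X n) 0, yy (X n) T)) \<longlonglongrightarrow> endpoint_con P (Suc j) (yy l 0, yy l T)"
      by (rule isCont_tendsto_compose)
    then show "(\<lambda>n. f (X n) j) \<longlonglongrightarrow> f l j" unfolding f_def by (intro tendsto_intros)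
  qed
  then obtain \<theta> where \<theta>: "\<And>j. j < K \<Longrightarrow> \<theta> j \<in> {-1..1}" "\<And>j. j < K \<Longrightarrow> f \<theta> j = 0" by blast
  have ex: "\<exists>i\<in>{1..n1 P}. endpoint_con P i (yy \<theta> 0, yy \<theta> T) \<noteq> 0"
    using e0(2)[OF e Pz[of \<theta>, OF \<theta>(1)] Wz[of \<theta>, OF \<theta>(1)] yy c0z[of \<theta>, OF \<theta>(1)] cIz[of \<theta>, OF \<theta>(1)] cCz[of \<theta>, OF \<theta>(1)]] by blast
  then obtain i where i: "i \<in> {1..n1 P}" "endpoint_con P i (yy \<theta> 0, yy \<theta> T) \<noteq> 0" by blast
  then obtain j where j: "i = Suc j" "j < K" by (cases i) (auto simp: K_def)
  then show False using \<theta>(2)[OF j(2)] i r e(1) by (simp add: f_def K_def)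
qed

end

section \<open>Multipliers\<close>

context ocp_direction
begin

lemma kap_continuous: "continuous_on {0..T} \<zeta> \<Longrightarrow> continuous_on {0..T} (kap \<zeta>)"
proof -
  assume \<zeta>: "continuous_on {0..T} \<zeta>"
  have "continuous_on {0..T} (\<lambda>t. (\<lambda>p. frechet_derivative (state_con P) (at (fst p)) (snd p)) (xb t, \<zeta> t))"
    by (rule continuous_on_compose2[OF C2_D_continuous[OF C2s(4), of UNIV]])
       (auto intro!: continuous_intros \<zeta> continuous_on_subset[OF xb(1)])
  then show ?thesis unfolding kap_def[abs_def] k2_def[symmetric]
    by (intro continuous_intros continuous_on_subset[OF k2_cont]) auto
qed

lemma pert_mono: "cp.pert R a w \<zeta> \<Longrightarrow> R \<le> R' \<Longrightarrow> cp.pert R' a w \<zeta>"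
  unfolding cp.pert_def by (blast intro: order_trans)

definition "N = n1 P + n2 P"

text \<open>The finitely many endpoint conditions are placed at the points \<open>T + 1 + j\<close>, so that a single
  probability measure on the compact set \<open>D\<close> carries all multipliers: \<open>j = 0\<close> is the cost,
  \<open>1 \<le> j \<le> N\<close> are the endpoint constraints, and \<open>j = N + i\<close> is equality constraint \<open>i\<close>
  with the opposite sign.\<close>

definition "J = {0} \<union> {1..n1 P} \<union> IA \<union> (\<lambda>i. N + i) ` {1..n1 P}"
definition "D = C \<union> (\<lambda>j. T + 1 + real j) ` J"

definition "sc \<zeta> j = (if j = 0 then ev (cost P) \<zeta> else if j \<le> N then ev (endpoint_con P j) \<zeta> else - ev (endpoint_con P (j - N)) \<zeta>)"
definition "out \<zeta> d = (if d \<le> T then kap \<zeta> d else sc \<zeta> (nat \<lfloor>d - T - 1\<rfloor>))"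

lemma J_finite: "finite J" by (simp add: J_def IA_def)

lemma C_compact: "compact C"
proof -
  have "C = {t \<in> {0..T}. G t = 0}" by (auto simp: C_iff)
  moreover have "closed {t \<in> {0..T}. G t = 0}" using continuous_closed_preimage_constant[OF G_cont] by simp
  ultimately show ?thesis by (metis (no_types, lifting) bounded_closed_interval bounded_subset compact_eq_bounded_closed mem_Collect_eq subsetI)
qed

lemma D_compact: "compact D"
  unfolding D_def by (intro compact_Un C_compact finite_imp_compact finite_imageI J_finite)

lemma out_simps: "d \<in> C \<Longrightarrow> out \<zeta> d = kap \<zeta> d" "out \<zeta> (T + 1 + real j) = sc \<zeta> j"
  by (auto simp: out_def C_iff)

lemma D_separated: "d \<in> D \<Longrightarrow> d' \<in> D \<Longrightarrow> \<bar>d - d'\<bar> < 1 \<Longrightarrow> d = d' \<or> (d \<in> C \<and> d' \<in> C)"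
  unfolding D_def by (auto simp: C_iff)

lemma sc_bound: assumes j: "j \<in> J" shows "\<exists>M>0. \<forall>a w \<zeta>. cp.pert R a w \<zeta> \<longrightarrow> \<bar>sc \<zeta> j\<bar> \<le> M"
proof -
  consider "j = 0" | "j \<noteq> 0" "j \<le> N" | "j \<noteq> 0" "\<not> j \<le> N" by blast
  then show ?thesis
  proof cases
    case 1
    then show ?thesis using ev_bound[OF C2s(3)] by (simp add: sc_def)
  next
    case 2
    then have "C2 (endpoint_con P j)" by (intro C2s) (auto simp: N_def)
    from ev_bound[OF this] show ?thesis using 2 by (simp add: sc_def)
  next
    case 3
    then have "j - N \<in> {1..n1 P + n2 P}" using j by (auto simp: J_def IA_def N_def)
    then have "C2 (endpoint_con P (j - N))" by (intro C2s)
    from ev_bound[OF this] show ?thesis using 3 by (simp add: sc_def)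
  qed
qed

lemma sc_sum:
  assumes "finite I" "(\<Sum>i\<in>I. c i) = 1" and j: "j \<in> J"
  shows "sc (\<lambda>t. \<Sum>i\<in>I. c i *\<^sub>R \<zeta> i t) j = (\<Sum>i\<in>I. c i * sc (\<zeta> i) j)"
proof -
  consider "j = 0" | "j \<noteq> 0" "j \<le> N" | "j \<noteq> 0" "\<not> j \<le> N" by blast
  then show ?thesis
  proof cases
    case 1
    then show ?thesis using ev_sum[OF C2s(3) assms(1,2)] by (simp add: sc_def)
  next
    case 2
    then have "C2 (endpoint_con P j)" by (intro C2s) (auto simp: N_def)
    from ev_sum[OF this assms(1,2)] show ?thesis using 2 by (simp add: sc_def)
  next
    case 3
    then have "j - N \<in> {1..n1 P + n2 P}" using j by (auto simp: J_def IA_def N_def)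
    then have "C2 (endpoint_con P (j - N))" by (intro C2s)
    from ev_sum[OF this assms(1,2)] show ?thesis using 3 by (simp add: sc_def sum_negf)
  qed
qed

text \<open>Values off \<open>D\<close> are left free, as the estimates and the convexity are needed
  on \<open>D\<close> only. The bound on the data grows with n, so every admissible perturbation
  enters some \<open>X n\<close>.\<close>

definition "X n = {h. \<exists>a w \<zeta>. cp.pert (real n + 1) a w \<zeta> \<and> adm w \<and> (\<forall>d\<in>D. h d = out \<zeta> d)}"

lemma X_convex:
  assumes h: "h \<in> X n" and k: "k \<in> X n" and s: "0 \<le> s" "s \<le> 1"
  shows "(\<lambda>d. (1 - s) * h d + s * k d) \<in> X n"
proof -
  obtain a w \<zeta> where 1: "cp.pert (real n + 1) a w \<zeta>" "adm w" "\<forall>d\<in>D. h d = out \<zeta> d" using h by (auto simp: X_def)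
  obtain a' w' \<zeta>' where 2: "cp.pert (real n + 1) a' w' \<zeta>'" "adm w'" "\<forall>d\<in>D. k d = out \<zeta>' d" using k by (auto simp: X_def)
  define c where "c b = (if b then s else 1 - s)" for b
  define Z where "Z b = (if b then \<zeta>' else \<zeta>)" for b
  have c: "(\<Sum>b\<in>UNIV. c b) = 1" "\<And>b. c b \<ge> 0" using s by (auto simp: UNIV_bool c_def)
  define Zs where "Zs = (\<lambda>t. \<Sum>b\<in>UNIV. c b *\<^sub>R Z b t)"
  have p: "cp.pert (real n + 1) (\<Sum>b\<in>UNIV. c b *\<^sub>R (if b then a' else a)) (\<lambda>t. \<Sum>b\<in>UNIV. c b * (if b then w' else w) t) Zs"
    unfolding Zs_def by (rule cp.pert_sum) (use 1 2 c in \<open>auto simp: Z_def\<close>)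
  have q: "adm (\<lambda>t. \<Sum>b\<in>UNIV. c b * (if b then w' else w) t)" by (rule adm_sum) (use 1 2 c in auto)
  have "(1 - s) * h d + s * k d = out Zs d" if d: "d \<in> D" for d
  proof -
    have "(1 - s) * h d + s * k d = (\<Sum>b\<in>UNIV. c b * out (Z b) d)" using 1(3) 2(3) d by (simp add: UNIV_bool c_def Z_def)
    also have "\<dots> = out Zs d"
    proof (cases "d \<in> C")
      case True
      show ?thesis unfolding out_simps(1)[OF True] Zs_def by (rule kap_sum[symmetric]) (use c in auto)
    next
      case False
      then obtain j where j: "j \<in> J" "d = T + 1 + real j" using d by (auto simp: D_def)
      show ?thesis unfolding j(2) out_simps(2) Zs_def by (rule sc_sum[symmetric]) (use c j in auto)
    qed
    finally show ?thesis .
  qed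
  then show ?thesis unfolding X_def using p q by blast
qed

lemma X_bounded: "\<exists>M. \<forall>h\<in>X n. \<forall>d\<in>D. \<bar>h d\<bar> \<le> M"
proof -
  obtain M0 where M0: "M0 > 0" "\<And>a w \<zeta> t. cp.pert (real n + 1) a w \<zeta> \<Longrightarrow> t \<in> {0..T} \<Longrightarrow> \<bar>kap \<zeta> t\<bar> \<le> M0" using kap_bound by blast
  have "\<forall>j\<in>J. \<exists>M>0. \<forall>a w \<zeta>. cp.pert (real n + 1) a w \<zeta> \<longrightarrow> \<bar>sc \<zeta> j\<bar> \<le> M" using sc_bound by blast
  then obtain M where M: "\<And>j. j \<in> J \<Longrightarrow> M j > 0" "\<And>j a w \<zeta>. j \<in> J \<Longrightarrow> cp.pert (real n + 1) a w \<zeta> \<Longrightarrow> \<bar>sc \<zeta> j\<bar> \<le> M j" by metis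
  have "\<bar>h d\<bar> \<le> M0 + (\<Sum>j\<in>J. M j)" if h: "h \<in> X n" and d: "d \<in> D" for h d
  proof -
    obtain a w \<zeta> where 1: "cp.pert (real n + 1) a w \<zeta>" "\<forall>d\<in>D. h d = out \<zeta> d" using h by (auto simp: X_def)
    have sJ: "(\<Sum>j\<in>J. M j) \<ge> 0" using M(1) by (intro sum_nonneg) (auto intro: less_imp_le)
    show ?thesis
    proof (cases "d \<in> C")
      case True
      then have "\<bar>h d\<bar> \<le> M0" using 1(2) d M0(2)[OF 1(1), of d] by (simp add: out_simps C_iff)
      then show ?thesis using sJ by simp
    next
      case False
      then obtain j where j: "j \<in> J" "d = T + 1 + real j" using d by (auto simp: D_def)
      have "\<bar>h d\<bar> \<le> M j" using 1(2) d M(2)[OF j(1) 1(1)] j(2) by (simp add: out_simps)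
      moreover have "M j \<le> (\<Sum>j\<in>J. M j)" using j J_finite M(1) by (intro member_le_sum) (auto intro: less_imp_le)
      ultimately show ?thesis using M0(1) by simp
    qed
  qed
  then show ?thesis by blast
qed

lemma X_equicontinuous:
  assumes e: "e > 0" shows "\<exists>\<delta>>0. \<forall>h\<in>X n. \<forall>d\<in>D. \<forall>d'\<in>D. \<bar>d - d'\<bar> < \<delta> \<longrightarrow> \<bar>h d - h d'\<bar> < e"
proof -
  obtain \<delta> where \<delta>: "\<delta> > 0" "\<And>a w \<zeta> s t. cp.pert (real n + 1) a w \<zeta> \<Longrightarrow> s \<in> {0..T} \<Longrightarrow> t \<in> {0..T} \<Longrightarrow> \<bar>t - s\<bar> < \<delta> \<Longrightarrow> \<bar>kap \<zeta> t - kap \<zeta> s\<bar> < e"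
    using kap_equicontinuous[OF e] by blast
  have "\<bar>h d - h d'\<bar> < e" if h: "h \<in> X n" and d: "d \<in> D" "d' \<in> D" "\<bar>d - d'\<bar> < min \<delta> 1" for h d d'
  proof -
    obtain a w \<zeta> where 1: "cp.pert (real n + 1) a w \<zeta>" "\<forall>d\<in>D. h d = out \<zeta> d" using h by (auto simp: X_def)
    have "d = d' \<or> (d \<in> C \<and> d' \<in> C)" using D_separated[OF d(1,2)] d(3) by simp
    then show ?thesis
    proof
      assume c: "d \<in> C \<and> d' \<in> C"
      then show ?thesis using \<delta>(2)[OF 1(1), of d' d] 1(2) d by (simp add: out_simps C_iff)
    qed (use e in simp)
  qed
  then show ?thesis using \<delta>(1) by (intro exI[of _ "min \<delta> 1"]) auto
qed

text \<open>With data bounded by n + 1 and slack r n = 1 / (n + 1), the strict system must fail for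
  some target \<open>y n\<close>. Failure means that one of the shifted constraint values is
  positive for each member of \<open>X n\<close>, which is what \<open>minimax_limit\<close>
  consumes. The point masses of the resulting distribution give \<beta> and \<Psi>, its restriction
  to [0,T] gives \<mu>.\<close>

lemma multiplier_measure:
  assumes wm: "weak_minimum P u x"
  shows "\<exists>\<beta> \<Psi> \<mu>. \<beta> \<ge> 0 \<and> (\<forall>i\<in>{n1 P + 1..n1 P + n2 P}. \<Psi> i \<ge> 0 \<and> \<Psi> i * endpoint_con P i X0 = 0) \<and>
    sets \<mu> = sets (restrict_space borel {0..T}) \<and> finite_measure \<mu> \<and> (AE t in \<mu>. t \<in> C) \<and>
    (\<beta> \<noteq> 0 \<or> (\<exists>i\<in>{1..n1 P + n2 P}. \<Psi> i \<noteq> 0) \<or> emeasure \<mu> (space \<mu>) \<noteq> 0) \<and>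
    (\<forall>R a w \<zeta>. cp.pert R a w \<zeta> \<longrightarrow> adm w \<longrightarrow>
       \<beta> * ev (cost P) \<zeta> + (\<Sum>i=1..n1 P + n2 P. \<Psi> i * ev (endpoint_con P i) \<zeta>) + (\<integral>t. kap \<zeta> t \<partial>\<mu>) \<ge> 0)"
proof -
  define r where "r n = 1 / (real n + 1)" for n
  \<comment> \<open>The tolerance under which \<open>strict_perturbation_contradiction\<close>
    operates; here it also serves as the slack of the minimax argument.\<close>
  define \<eta> where "\<eta> n = r n / (8 * (real (n1 P) + 1))" for n
  have r: "r n > 0" for n by (simp add: r_def)
  have \<eta>: "\<eta> n > 0" "\<eta> n \<le> r n" for n
  proof -
    show "\<eta> n > 0" using r by (simp add: \<eta>_def)
    have "r n * 1 \<le> r n * (8 * (real (n1 P) + 1))" using r[of n] by (intro mult_left_mono) auto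
    then show "\<eta> n \<le> r n" by (simp add: \<eta>_def divide_le_eq)
  qed
  define good where "good n y a w \<zeta> \<longleftrightarrow> cp.pert (real n + 1) a w \<zeta> \<and> adm w \<and> ev (cost P) \<zeta> \<le> - r n \<and>
     (\<forall>i\<in>IA. ev (endpoint_con P i) \<zeta> \<le> - r n) \<and> (\<forall>t\<in>C. kap \<zeta> t \<le> - r n) \<and>
     (\<forall>i\<in>{1..n1 P}. \<bar>ev (endpoint_con P i) \<zeta> - y i\<bar> \<le> \<eta> n)" for n and y :: "nat \<Rightarrow> real" and a w \<zeta>
  have "\<exists>y. (\<forall>i\<in>{1..n1 P}. \<bar>y i\<bar> \<le> r n) \<and> (\<forall>a w \<zeta>. \<not> good n y a w \<zeta>)" for n
  proof (rule ccontr)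
    assume "\<not> ?thesis"
    then have g: "\<exists>a w \<zeta>. good n y a w \<zeta>" if "\<And>i. i \<in> {1..n1 P} \<Longrightarrow> \<bar>y i\<bar> \<le> r n" for y using that by blast
    have R: "real n + 1 > 0" by simp
    show False
      by (rule strict_perturbation_contradiction[OF wm R r[of n]]) (rule g[unfolded good_def \<eta>_def])
  qed
  then obtain y where y: "\<And>n i. i \<in> {1..n1 P} \<Longrightarrow> \<bar>y n i\<bar> \<le> r n" and ngood: "\<And>n a w \<zeta>. \<not> good n (y n) a w \<zeta>" by metis
  have no: "\<not> (ev (cost P) \<zeta> \<le> - r n \<and> (\<forall>i\<in>IA. ev (endpoint_con P i) \<zeta> \<le> - r n) \<and> (\<forall>t\<in>C. kap \<zeta> t \<le> - r n) \<and>
       (\<forall>i\<in>{1..n1 P}. \<bar>ev (endpoint_con P i) \<zeta> - y n i\<bar> \<le> \<eta> n))"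
    if "cp.pert (real n + 1) a w \<zeta>" "adm w" for n a w \<zeta>
    using ngood[of n a w \<zeta>] that unfolding good_def by blast
  \<comment> \<open>The shifts are chosen so that positivity of \<open>sc \<zeta> j + bj n j\<close>
    is violation of the strict condition: at \<open>j\<close> and \<open>N + j\<close> it says that
    the equality value leaves the \<open>\<eta> n\<close>-neighbourhood of \<open>y n j\<close>
    above or below.\<close>
  define bj where "bj n j = (if j \<in> {1..n1 P} then - y n j - \<eta> n else if N < j then y n (j - N) - \<eta> n else r n)" for n j
  define b where "b n d = (if d \<le> T then r n else bj n (nat \<lfloor>d - T - 1\<rfloor>))" for n d
  have b_simps: "b n d = r n" "b n (T + 1 + real j) = bj n j" if "d \<in> C" for n d j using that by (auto simp: b_def C_iff)
  have b_simps2: "b n (T + 1 + real j) = bj n j" for n j by (auto simp: b_def)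
  have n1N: "n1 P \<le> N" by (simp add: N_def)
  have p0: "0 \<in> J" by (simp add: J_def)
  have D_pt: "T + 1 + real j \<in> D" if "j \<in> J" for j using that by (auto simp: D_def)
  have D_cases: "d \<in> C \<or> (\<exists>j\<in>J. d = T + 1 + real j)" if "d \<in> D" for d using that by (auto simp: D_def)
  have pt_notC: "T + 1 + real j \<notin> C" for j by (simp add: C_iff)
  have pt_iso: "\<forall>d\<in>D. \<bar>d - (T + 1 + real j)\<bar> < 1 \<longrightarrow> d = T + 1 + real j" if "j \<in> J" for j
    using D_separated[OF _ D_pt[OF that]] pt_notC by blast
  have "\<exists>\<nu>. real_distribution \<nu> \<and> measure \<nu> D = 1 \<and>
     (\<forall>n. \<forall>h\<in>X n. \<forall>k\<in>borel_measurable borel. (\<forall>d\<in>D. k d = h d) \<longrightarrow> integral\<^sup>L \<nu> k \<ge> 0) \<and>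
     (\<forall>d1\<in>D. \<forall>d2\<in>D. \<forall>\<delta>>0. (\<forall>d\<in>D. \<bar>d - d1\<bar> < \<delta> \<longrightarrow> d = d1) \<and> (\<forall>d\<in>D. \<bar>d - d2\<bar> < \<delta> \<longrightarrow> d = d2) \<and>
        (\<forall>n. \<forall>h\<in>X n. h d1 + b n d1 + \<eta> n \<le> 0 \<or> h d2 + b n d2 + \<eta> n \<le> 0) \<longrightarrow>
        measure \<nu> {d1} = 0 \<or> measure \<nu> {d2} = 0)"
  proof (rule minimax_limit[OF D_compact, where \<beta>="\<lambda>n. 2 * r n"])
    show "X n \<noteq> {}" for n
    proof -
      obtain \<zeta> where "cp.pert (real n + 1) 0 (\<lambda>_. 0) \<zeta>" using cp.pert_exists[of "\<lambda>_. 0" "real n + 1" 0] bdd_meas_const by auto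
      moreover have "adm (\<lambda>_. 0)" by (simp add: adm_def)
      ultimately show ?thesis unfolding X_def by blast
    qed
    show "X m \<subseteq> X n" if "m \<le> n" for m n
    proof -
      have "cp.pert (real n + 1) a w \<zeta>" if "cp.pert (real m + 1) a w \<zeta>" for a w \<zeta>
        using pert_mono[OF that] \<open>m \<le> n\<close> by simp
      then show ?thesis unfolding X_def by blast
    qed
    show "\<bar>b n d\<bar> \<le> 2 * r n" if "d \<in> D" for n d
      using D_cases[OF that]
    proof
      assume "d \<in> C" then show ?thesis using r[of n] by (simp add: b_simps)
    next
      assume "\<exists>j\<in>J. d = T + 1 + real j"
      then obtain j where j: "j \<in> J" "d = T + 1 + real j" by blast
      have "N < j \<Longrightarrow> j - N \<in> {1..n1 P}" using j(1) by (auto simp: J_def IA_def N_def)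
      then show ?thesis using y[of j n] y[of "j - N" n] r[of n] \<eta>[of n] unfolding j(2) b_simps2 bj_def by auto
    qed
    show "(\<lambda>n. 2 * r n) \<longlonglongrightarrow> 0"
    proof -
      have "(\<lambda>n. 2 * inverse (real (Suc n))) \<longlonglongrightarrow> 2 * 0" by (intro tendsto_intros LIMSEQ_inverse_real_of_nat)
      then show ?thesis by (simp add: r_def inverse_eq_divide add.commute)
    qed
    show "\<eta> \<longlonglongrightarrow> 0"
    proof -
      have "(\<lambda>n. inverse (real (Suc n)) / (8 * (real (n1 P) + 1))) \<longlonglongrightarrow> 0 / (8 * (real (n1 P) + 1))"
        by (intro tendsto_intros LIMSEQ_inverse_real_of_nat) (simp add: add_nonneg_eq_0_iff)
      then show ?thesis by (simp add: \<eta>_def[abs_def] r_def inverse_eq_divide add.commute)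
    qed
    show "continuous_on D (b n)" for n
      unfolding continuous_on_iff
    proof (intro ballI allI impI)
      fix d e :: real assume d: "d \<in> D" and e: "e > 0"
      have "dist (b n d') (b n d) < e" if d': "d' \<in> D" "dist d' d < 1" for d'
      proof -
        have "d' = d \<or> (d' \<in> C \<and> d \<in> C)" using D_separated[OF d'(1) d] d'(2) by (simp add: dist_real_def)
        then show ?thesis using e b_simps(1) by auto
      qed
      then show "\<exists>\<delta>>0. \<forall>d'\<in>D. dist d' d < \<delta> \<longrightarrow> dist (b n d') (b n d) < e" by (intro exI[of _ 1]) auto
    qed
    show "\<exists>d\<in>D. h d + b n d > 0" if h: "h \<in> X n" for n h
    proof -
      obtain a w \<zeta> where 1: "cp.pert (real n + 1) a w \<zeta>" "adm w" and ho: "\<And>d. d \<in> D \<Longrightarrow> h d = out \<zeta> d" using h by (auto simp: X_def)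
      have hp: "h (T + 1 + real j) + b n (T + 1 + real j) = sc \<zeta> j + bj n j" if "j \<in> J" for j
        using ho[OF D_pt[OF that]] by (simp add: out_simps b_simps2)
      from no[OF 1] consider "ev (cost P) \<zeta> > - r n" | i where "i \<in> IA" "ev (endpoint_con P i) \<zeta> > - r n"
        | t where "t \<in> C" "kap \<zeta> t > - r n" | i where "i \<in> {1..n1 P}" "\<bar>ev (endpoint_con P i) \<zeta> - y n i\<bar> > \<eta> n"
        by (meson not_le)
      then show ?thesis
      proof cases
        case 1
        then have "sc \<zeta> 0 + bj n 0 > 0" by (simp add: sc_def bj_def)
        then show ?thesis using hp[OF p0] D_pt[OF p0] by (metis)
      next
        case (2 i)
        then have i: "i \<in> J" "i \<noteq> 0" "i \<le> N" "i \<notin> {1..n1 P}" by (auto simp: J_def IA_def N_def)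
        then have "sc \<zeta> i + bj n i > 0" using 2 by (simp add: sc_def bj_def)
        then show ?thesis using hp[OF i(1)] D_pt[OF i(1)] by metis
      next
        case (3 t)
        then have "t \<in> D" by (simp add: D_def)
        then show ?thesis using 3 ho[of t] by (intro bexI[of _ t]) (auto simp: out_simps b_simps)
      next
        case (4 i)
        then have i: "i \<in> J" "N + i \<in> J" "i \<noteq> 0" "i \<le> N" using n1N by (auto simp: J_def)
        have i2: "N + i \<notin> {1..n1 P}" "N < N + i" using 4(1) n1N by auto
        have "sc \<zeta> i + bj n i > 0 \<or> sc \<zeta> (N + i) + bj n (N + i) > 0"
          using 4 i i2 by (auto simp: sc_def bj_def abs_if split: if_splits)
        then show ?thesis using hp[OF i(1)] hp[OF i(2)] D_pt[OF i(1)] D_pt[OF i(2)] by metis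
      qed
    qed
  qed (use \<eta> X_convex X_bounded X_equicontinuous in auto)
  then obtain \<nu> where \<nu>: "real_distribution \<nu>" "measure \<nu> D = 1"
    and \<nu>I: "\<And>n h k. h \<in> X n \<Longrightarrow> k \<in> borel_measurable borel \<Longrightarrow> (\<forall>d\<in>D. k d = h d) \<Longrightarrow> integral\<^sup>L \<nu> k \<ge> 0"
    and \<nu>E: "\<And>d1 d2 \<delta>. d1 \<in> D \<Longrightarrow> d2 \<in> D \<Longrightarrow> \<delta> > 0 \<Longrightarrow> (\<forall>d\<in>D. \<bar>d - d1\<bar> < \<delta> \<longrightarrow> d = d1) \<Longrightarrow> (\<forall>d\<in>D. \<bar>d - d2\<bar> < \<delta> \<longrightarrow> d = d2) \<Longrightarrow>
        (\<forall>n. \<forall>h\<in>X n. h d1 + b n d1 + \<eta> n \<le> 0 \<or> h d2 + b n d2 + \<eta> n \<le> 0) \<Longrightarrow> measure \<nu> {d1} = 0 \<or> measure \<nu> {d2} = 0"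
    by blast
  interpret \<nu>: real_distribution \<nu> by (rule \<nu>)
  define m where "m j = measure \<nu> {T + 1 + real j}" for j
  have m0: "m j \<ge> 0" for j by (simp add: m_def)
  \<comment> \<open>Adding the slack cancels \<open>- \<eta> n\<close> in both shifts and leaves a
    number and its negative, which are not both positive. At most one sign of each equation carries
    mass, so \<Psi> i = 0 forces both masses to vanish and total mass 1 gives nontriviality.\<close>
  have excl: "m i = 0 \<or> m (N + i) = 0" if i: "i \<in> {1..n1 P}" for i
    unfolding m_def
  proof (rule \<nu>E[of _ _ 1])
    have iJ: "i \<in> J" "N + i \<in> J" using i by (auto simp: J_def)
    show "T + 1 + real i \<in> D" "T + 1 + real (N + i) \<in> D" by (rule D_pt[OF iJ(1)], rule D_pt[OF iJ(2)])
    show "\<forall>d\<in>D. \<bar>d - (T + 1 + real i)\<bar> < 1 \<longrightarrow> d = T + 1 + real i" by (rule pt_iso[OF iJ(1)])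
    show "\<forall>d\<in>D. \<bar>d - (T + 1 + real (N + i))\<bar> < 1 \<longrightarrow> d = T + 1 + real (N + i)" by (rule pt_iso[OF iJ(2)])
    show "\<forall>n. \<forall>h\<in>X n. h (T + 1 + real i) + b n (T + 1 + real i) + \<eta> n \<le> 0 \<or> h (T + 1 + real (N + i)) + b n (T + 1 + real (N + i)) + \<eta> n \<le> 0"
    proof (intro allI ballI)
      fix n h assume "h \<in> X n"
      then obtain \<zeta> where ho: "\<And>d. d \<in> D \<Longrightarrow> h d = out \<zeta> d" by (auto simp: X_def)
      have "h (T + 1 + real i) = sc \<zeta> i" "h (T + 1 + real (N + i)) = sc \<zeta> (N + i)"
        using ho[OF D_pt[OF iJ(1)]] ho[OF D_pt[OF iJ(2)]] by (simp_all only: out_simps)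
      moreover have "i \<noteq> 0" "i \<le> N" "N + i \<notin> {1..n1 P}" "N < N + i" using i n1N by auto
      ultimately show "h (T + 1 + real i) + b n (T + 1 + real i) + \<eta> n \<le> 0 \<or> h (T + 1 + real (N + i)) + b n (T + 1 + real (N + i)) + \<eta> n \<le> 0"
        using i by (simp only: b_simps2) (auto simp: bj_def sc_def)
    qed
  qed simp
  define \<Psi> where "\<Psi> i = (if i \<in> {1..n1 P} then m i - m (N + i) else if i \<in> IA then m i else 0)" for i
  define \<mu> where "\<mu> = restrict_space \<nu> {0..T}"
  have sets\<mu>: "sets \<mu> = sets (restrict_space borel {0..T})" by (simp add: \<mu>_def sets_restrict_space)
  have fin\<mu>: "finite_measure \<mu>" unfolding \<mu>_def by (intro finite_measure_restrict_space \<nu>.finite_measure_axioms) auto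
  have Db: "D \<in> sets borel" using D_compact by (simp add: compact_imp_closed)
  have AED: "AE t in \<nu>. t \<in> D" using \<nu>.prob_eq_1[of D] \<nu>(2) Db by simp
  have AEC: "AE t in \<mu>. t \<in> C"
  proof -
    have "AE t in \<nu>. t \<in> {0..T} \<longrightarrow> t \<in> C" using AED by eventually_elim (auto simp: D_def)
    then show ?thesis unfolding \<mu>_def by (subst AE_restrict_space_iff) auto
  qed
  have em: "emeasure \<mu> (space \<mu>) = emeasure \<nu> {0..T}"
    unfolding \<mu>_def by (simp add: space_restrict_space emeasure_restrict_space)
  have nontriv: "m 0 \<noteq> 0 \<or> (\<exists>i\<in>{1..n1 P + n2 P}. \<Psi> i \<noteq> 0) \<or> emeasure \<mu> (space \<mu>) \<noteq> 0"
  proof (rule ccontr)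
    assume "\<not> ?thesis"
    then have z: "m 0 = 0" "\<And>i. i \<in> {1..n1 P + n2 P} \<Longrightarrow> \<Psi> i = 0" "emeasure \<nu> {0..T} = 0" by (auto simp: em)
    have zE: "m i = 0 \<and> m (N + i) = 0" if "i \<in> {1..n1 P}" for i
      using z(2)[of i] that excl[OF that] by (auto simp: \<Psi>_def)
    have zI: "m i = 0" if "i \<in> IA" for i using z(2)[of i] that by (auto simp: \<Psi>_def IA_def)
    have mJ: "m j = 0" if "j \<in> J" for j using that z(1) zE zI unfolding J_def by (elim UnE imageE) auto
    have "measure \<nu> D \<le> measure \<nu> ({0..T} \<union> (\<Union>j\<in>J. {T + 1 + real j}))"
    proof (rule \<nu>.finite_measure_mono)
      show "{0..T} \<union> (\<Union>j\<in>J. {T + 1 + real j}) \<in> \<nu>.events" using J_finite by auto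
    qed (auto simp: D_def C_iff)
    also have "\<dots> \<le> measure \<nu> {0..T} + measure \<nu> (\<Union>j\<in>J. {T + 1 + real j})"
      using J_finite by (intro measure_Un_le) auto
    also have "measure \<nu> (\<Union>j\<in>J. {T + 1 + real j}) \<le> (\<Sum>j\<in>J. m j)"
      unfolding m_def using J_finite by (intro \<nu>.finite_measure_subadditive_finite) auto
    also have "(\<Sum>j\<in>J. m j) = 0" using mJ by simp
    also have "measure \<nu> {0..T} = 0" using z(3) by (simp add: measure_def)
    finally show False using \<nu>(2) by simp
  qed
  have main: "m 0 * ev (cost P) \<zeta> + (\<Sum>i=1..n1 P + n2 P. \<Psi> i * ev (endpoint_con P i) \<zeta>) + (\<integral>t. kap \<zeta> t \<partial>\<mu>) \<ge> 0"
    if P: "cp.pert R a w \<zeta>" and w: "adm w" for R a w \<zeta>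
  proof -
    obtain n :: nat where n: "R \<le> real n" using real_arch_simple by blast
    have "cp.pert (real n + 1) a w \<zeta>" using pert_mono[OF P] n by simp
    then have oX: "out \<zeta> \<in> X n" using w by (auto simp: X_def)
    have kc: "continuous_on {0..T} (kap \<zeta>)" using P by (intro kap_continuous) (simp add: cp.pert_def)
    define kc where "kc d = kap \<zeta> (clamp_to T d)" for d
    have kcc: "continuous_on UNIV kc" "bounded (range kc)" unfolding kc_def[abs_def] using clamp_compose[OF kc] T by auto
    have [measurable]: "kc \<in> borel_measurable borel" using kcc(1) by (rule borel_measurable_continuous_onI)
    obtain B where B: "\<And>d. \<bar>kc d\<bar> \<le> B" using kcc(2) by (auto simp: bounded_iff)
    \<comment> \<open>A Borel function on the whole line that agrees with \<open>out \<zeta>\<close>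
      on \<open>D\<close>: the clamped state part plus point values at the added points.\<close>
    define k where "k d = indicat_real {0..T} d * kc d + (\<Sum>j\<in>J. sc \<zeta> j * indicat_real {T + 1 + real j} d)" for d
    have km: "k \<in> borel_measurable borel" unfolding k_def[abs_def]
      by (intro borel_measurable_add borel_measurable_times borel_measurable_sum borel_measurable_indicator \<open>kc \<in> borel_measurable borel\<close>) auto
    have "k d = out \<zeta> d" if d: "d \<in> D" for d
      using D_cases[OF d]
    proof
      assume c: "d \<in> C"
      then have "d \<in> {0..T}" by (simp add: C_iff)
      then show ?thesis using c by (simp add: k_def kc_def out_simps indicator_def)
    next
      assume "\<exists>j\<in>J. d = T + 1 + real j"
      then obtain j where j: "j \<in> J" "d = T + 1 + real j" by blast
      have "(\<Sum>i\<in>J. sc \<zeta> i * indicat_real {T + 1 + real i} d) = (\<Sum>i\<in>J. if i = j then sc \<zeta> j else 0)"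
        by (intro sum.cong refl) (auto simp: j(2))
      then show ?thesis using j J_finite T by (simp add: k_def out_simps)
    qed
    then have "0 \<le> integral\<^sup>L \<nu> k" using \<nu>I[OF oX km] by blast
    also have "integral\<^sup>L \<nu> k = (\<integral>d. indicat_real {0..T} d * kc d \<partial>\<nu>) + (\<Sum>j\<in>J. sc \<zeta> j * m j)"
    proof -
      have 1: "integrable \<nu> (\<lambda>d. indicat_real {0..T} d * kc d)"
      proof (rule \<nu>.integrable_const_bound[where B="\<bar>B\<bar>"])
        show "AE d in \<nu>. norm (indicat_real {0..T} d * kc d) \<le> \<bar>B\<bar>"
          using B by (intro AE_I2) (auto simp: indicator_def intro: order_trans[OF _ abs_ge_self])
      qed simp
      have 2: "integrable \<nu> (\<lambda>d. sc \<zeta> j * indicat_real {T + 1 + real j} d)" for j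
        by (intro integrable_mult_right integrable_real_indicator) (auto simp: \<nu>.emeasure_finite less_top[symmetric])
      have "integral\<^sup>L \<nu> k = (\<integral>d. indicat_real {0..T} d * kc d \<partial>\<nu>) + (\<Sum>j\<in>J. \<integral>d. sc \<zeta> j * indicat_real {T + 1 + real j} d \<partial>\<nu>)"
        unfolding k_def[abs_def] using 1 2 by simp
      then show ?thesis by (simp add: m_def)
    qed
    also have "(\<integral>d. indicat_real {0..T} d * kc d \<partial>\<nu>) = (\<integral>t. kap \<zeta> t \<partial>\<mu>)"
    proof -
      have "(\<integral>t. kap \<zeta> t \<partial>\<mu>) = (\<integral>t. kc t \<partial>\<mu>)"
        by (intro Bochner_Integration.integral_cong) (auto simp: \<mu>_def space_restrict_space kc_def)
      also have "\<dots> = (\<integral>d. indicat_real {0..T} d * kc d \<partial>\<nu>)"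
        unfolding \<mu>_def by (subst integral_restrict_space) auto
      finally show ?thesis by simp
    qed
    also have "(\<Sum>j\<in>J. sc \<zeta> j * m j) = m 0 * ev (cost P) \<zeta> + (\<Sum>i=1..n1 P + n2 P. \<Psi> i * ev (endpoint_con P i) \<zeta>)"
    proof -
      have fIA: "finite IA" by (simp add: IA_def)
      have "(\<Sum>j\<in>J. sc \<zeta> j * m j) = (\<Sum>j\<in>{0} \<union> {1..n1 P} \<union> IA. sc \<zeta> j * m j) + (\<Sum>j\<in>(\<lambda>i. N + i) ` {1..n1 P}. sc \<zeta> j * m j)"
        unfolding J_def by (rule sum.union_disjoint) (auto simp: IA_def N_def)
      also have "(\<Sum>j\<in>(\<lambda>i. N + i) ` {1..n1 P}. sc \<zeta> j * m j) = (\<Sum>i\<in>{1..n1 P}. - ev (endpoint_con P i) \<zeta> * m (N + i))"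
        by (subst sum.reindex) (auto simp: sc_def inj_on_def intro!: sum.cong)
      also have "(\<Sum>j\<in>{0} \<union> {1..n1 P} \<union> IA. sc \<zeta> j * m j) = (\<Sum>j\<in>{0} \<union> {1..n1 P}. sc \<zeta> j * m j) + (\<Sum>j\<in>IA. sc \<zeta> j * m j)"
        by (rule sum.union_disjoint) (auto simp: IA_def)
      also have "(\<Sum>j\<in>{0} \<union> {1..n1 P}. sc \<zeta> j * m j) = sc \<zeta> 0 * m 0 + (\<Sum>j\<in>{1..n1 P}. sc \<zeta> j * m j)"
        by (subst sum.union_disjoint) auto
      also have "(\<Sum>j\<in>{1..n1 P}. sc \<zeta> j * m j) = (\<Sum>i\<in>{1..n1 P}. ev (endpoint_con P i) \<zeta> * m i)"
        using n1N by (intro sum.cong refl) (auto simp: sc_def)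
      also have "(\<Sum>j\<in>IA. sc \<zeta> j * m j) = (\<Sum>i\<in>{n1 P + 1..n1 P + n2 P}. \<Psi> i * ev (endpoint_con P i) \<zeta>)"
      proof (rule sum.mono_neutral_cong_left)
        show "IA \<subseteq> {n1 P + 1..n1 P + n2 P}" by (auto simp: IA_def)
        show "\<forall>i\<in>{n1 P + 1..n1 P + n2 P} - IA. \<Psi> i * ev (endpoint_con P i) \<zeta> = 0" by (auto simp: \<Psi>_def)
        show "\<And>i. i \<in> IA \<Longrightarrow> sc \<zeta> i * m i = \<Psi> i * ev (endpoint_con P i) \<zeta>" by (auto simp: \<Psi>_def sc_def IA_def N_def)
      qed simp
      finally have 1: "(\<Sum>j\<in>J. sc \<zeta> j * m j) = sc \<zeta> 0 * m 0 + (\<Sum>i\<in>{1..n1 P}. ev (endpoint_con P i) \<zeta> * m i) +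
        (\<Sum>i\<in>{n1 P + 1..n1 P + n2 P}. \<Psi> i * ev (endpoint_con P i) \<zeta>) + (\<Sum>i\<in>{1..n1 P}. - ev (endpoint_con P i) \<zeta> * m (N + i))" .
      have "{1..n1 P + n2 P} = {1..n1 P} \<union> {n1 P + 1..n1 P + n2 P}" by auto
      then have "(\<Sum>i=1..n1 P + n2 P. \<Psi> i * ev (endpoint_con P i) \<zeta>) = (\<Sum>i\<in>{1..n1 P}. \<Psi> i * ev (endpoint_con P i) \<zeta>) +
        (\<Sum>i\<in>{n1 P + 1..n1 P + n2 P}. \<Psi> i * ev (endpoint_con P i) \<zeta>)" by (simp add: sum.union_disjoint)
      also have "(\<Sum>i\<in>{1..n1 P}. \<Psi> i * ev (endpoint_con P i) \<zeta>) = (\<Sum>i\<in>{1..n1 P}. ev (endpoint_con P i) \<zeta> * m i) + (\<Sum>i\<in>{1..n1 P}. - ev (endpoint_con P i) \<zeta> * m (N + i))"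
        unfolding sum.distrib[symmetric] by (intro sum.cong refl) (auto simp: \<Psi>_def algebra_simps)
      finally show ?thesis using 1 by (simp add: sc_def mult.commute)
    qed
    finally show ?thesis by (simp add: add.commute)
  qed
  have \<Psi>I: "\<forall>i\<in>{n1 P + 1..n1 P + n2 P}. \<Psi> i \<ge> 0 \<and> \<Psi> i * endpoint_con P i X0 = 0"
    using m0 by (auto simp: \<Psi>_def IA_def)
  show ?thesis
    by (intro exI[of _ "m 0"] exI[of _ \<Psi>] exI[of _ \<mu>] conjI m0 \<Psi>I sets\<mu> fin\<mu> AEC nontriv allI impI main)
qed

end

section \<open>Derivatives of the Hamiltonian and of the endpoint Lagrangian\<close>

lemma second_derivative_eqI:
  assumes "\<And>y. (h has_derivative D y) (at y)" "((\<lambda>y. D y k) has_derivative E) (at x)"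
  shows "second_derivative h x k l = E l"
proof -
  have 1: "frechet_derivative h (at y) = D y" for y using frechet_derivative_at[OF assms(1)] by metis
  show ?thesis unfolding second_derivative_def 1 using frechet_derivative_at[OF assms(2)] by metis
qed

lemma frechet_derivative_eqI: "(h has_derivative D) (at x) \<Longrightarrow> frechet_derivative h (at x) = D"
  using frechet_derivative_at by metis

lemma hamiltonian_has_derivative:
  assumes "C2 (f0 P)" "C2 (f1 P)"
  shows "((\<lambda>y. hamiltonian P c y p) has_derivative
    (\<lambda>k. p \<bullet> (frechet_derivative (f0 P) (at y) k + c *\<^sub>R frechet_derivative (f1 P) (at y) k))) (at y)"
  unfolding hamiltonian_def dynamics_def
  by (intro has_derivative_inner_right has_derivative_add has_derivative_scaleR_right C2_has_derivative assms)

lemma H_xx_eq: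
  assumes "C2 (f0 P)" "C2 (f1 P)"
  shows "H_xx P c y p k l = p \<bullet> (second_derivative (f0 P) y k l + c *\<^sub>R second_derivative (f1 P) y k l)"
  unfolding H_xx_def
proof (rule second_derivative_eqI[OF hamiltonian_has_derivative[OF assms]])
  show "((\<lambda>y. p \<bullet> (frechet_derivative (f0 P) (at y) k + c *\<^sub>R frechet_derivative (f1 P) (at y) k)) has_derivative
     (\<lambda>l. p \<bullet> (second_derivative (f0 P) y k l + c *\<^sub>R second_derivative (f1 P) y k l))) (at y)"
    by (intro has_derivative_inner_right has_derivative_add has_derivative_scaleR_right C2_D_has_derivative assms)
qed

lemma H_ux_eq:
  assumes "C2 (f0 P)" "C2 (f1 P)"
  shows "H_ux P c y p k = p \<bullet> frechet_derivative (f1 P) (at y) k"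
proof -
  have 1: "frechet_derivative (\<lambda>y. hamiltonian P w y p) (at y) k = p \<bullet> frechet_derivative (f0 P) (at y) k + w * (p \<bullet> frechet_derivative (f1 P) (at y) k)" for w
    unfolding frechet_derivative_eqI[OF hamiltonian_has_derivative[OF assms]] by (simp add: inner_add_right)
  show ?thesis unfolding H_ux_def 1 by (rule DERIV_imp_deriv) (auto intro!: derivative_eq_intros)
qed

lemma ell_has_derivative:
  assumes "C2 (cost P)" "\<And>i. i \<in> {1..n1 P + n2 P} \<Longrightarrow> C2 (endpoint_con P i)"
  shows "(ell P \<beta> \<Psi> has_derivative (\<lambda>k. \<beta> * frechet_derivative (cost P) (at y) k +
     (\<Sum>i=1..n1 P + n2 P. \<Psi> i * frechet_derivative (endpoint_con P i) (at y) k))) (at y)"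
  unfolding ell_def[abs_def]
  by (intro has_derivative_add has_derivative_mult_right has_derivative_sum C2_has_derivative assms)

lemma second_derivative_ell:
  assumes "C2 (cost P)" "\<And>i. i \<in> {1..n1 P + n2 P} \<Longrightarrow> C2 (endpoint_con P i)"
  shows "second_derivative (ell P \<beta> \<Psi>) y k l = \<beta> * second_derivative (cost P) y k l +
     (\<Sum>i=1..n1 P + n2 P. \<Psi> i * second_derivative (endpoint_con P i) y k l)"
proof (rule second_derivative_eqI[OF ell_has_derivative[OF assms]])
  show "((\<lambda>y. \<beta> * frechet_derivative (cost P) (at y) k + (\<Sum>i=1..n1 P + n2 P. \<Psi> i * frechet_derivative (endpoint_con P i) (at y) k))
     has_derivative (\<lambda>l. \<beta> * second_derivative (cost P) y k l + (\<Sum>i=1..n1 P + n2 P. \<Psi> i * second_derivative (endpoint_con P i) y k l))) (at y)"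
    by (intro has_derivative_add has_derivative_mult_right has_derivative_sum C2_D_has_derivative assms)
qed auto

lemma linear_eq_inner:
  fixes L :: "'a::euclidean_space \<Rightarrow> real"
  assumes "linear L" shows "(\<Sum>b\<in>Basis. L b *\<^sub>R b) \<bullet> h = L h"
proof -
  have "L h = L (\<Sum>b\<in>Basis. (h \<bullet> b) *\<^sub>R b)" by (simp add: euclidean_representation)
  also have "\<dots> = (\<Sum>b\<in>Basis. (h \<bullet> b) *\<^sub>R L b)" using assms by (simp add: linear_sum linear_cmul)
  finally have "L h = (\<Sum>b\<in>Basis. (h \<bullet> b) *\<^sub>R L b)" .
  then show ?thesis by (simp only: inner_sum_left inner_scaleR_left real_scaleR_def mult.commute inner_commute[of h])
qed

text \<open>Scaling argument for perturbations that form a cone: a bound from below along the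
  half-line leaves no room for a negative slope.\<close>

lemma nonneg_of_affine_bound:
  assumes "\<And>s. s \<ge> 0 \<Longrightarrow> s * m + c \<ge> (0::real)" shows "m \<ge> 0"
proof (rule ccontr)
  assume "\<not> m \<ge> 0"
  then have m: "m < 0" by simp
  define s where "s = (\<bar>c\<bar> + 1) / - m"
  have "s \<ge> 0" using m unfolding s_def by (intro divide_nonneg_pos) auto
  from assms[OF this] have "s * m + c \<ge> 0" .
  moreover have "s * m = - (\<bar>c\<bar> + 1)" using m by (simp add: s_def)
  ultimately show False by linarith
qed

section \<open>Elimination of the perturbation by duality\<close>

context ocp_direction
begin

text \<open>After duality the multiplier inequality is affine in the free data: a linear term in a,
  the integral of w times p f_1, and a constant \<open>c0\<close>. Zero data give
  \<open>c0 \<ge> 0\<close>, arbitrary a gives the condition at 0, the cone of admissible w gives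
  the signs of p f_1, and \<open>2 * c0\<close> is the quadratic form.\<close>

lemma second_order_multiplier:
  assumes wm: "weak_minimum P u x"
  shows "\<exists>lam\<in>multipliers P u x. quad_form P u x v z lam \<ge> 0"
proof -
  obtain \<beta> \<Psi> \<mu> where \<beta>: "\<beta> \<ge> 0" and \<Psi>: "\<forall>i\<in>{n1 P + 1..n1 P + n2 P}. \<Psi> i \<ge> 0 \<and> \<Psi> i * endpoint_con P i X0 = 0"
    and \<mu>: "sets \<mu> = sets (restrict_space borel {0..T})" "finite_measure \<mu>" "AE t in \<mu>. t \<in> C"
    and nontriv: "\<beta> \<noteq> 0 \<or> (\<exists>i\<in>{1..n1 P + n2 P}. \<Psi> i \<noteq> 0) \<or> emeasure \<mu> (space \<mu>) \<noteq> 0"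
    and main: "\<And>R a w \<zeta>. cp.pert R a w \<zeta> \<Longrightarrow> adm w \<Longrightarrow>
       \<beta> * ev (cost P) \<zeta> + (\<Sum>i=1..n1 P + n2 P. \<Psi> i * ev (endpoint_con P i) \<zeta>) + (\<integral>t. kap \<zeta> t \<partial>\<mu>) \<ge> 0"
    using multiplier_measure[OF wm] by blast
  define Dg where "Dg t = frechet_derivative (state_con P) (at (xb t))" for t
  have Dgl: "linear (Dg t)" for t unfolding Dg_def using C2_D_linear[OF C2s(4)] by (rule bounded_linear.linear)
  define \<gamma> where "\<gamma> t = (\<Sum>b\<in>Basis. Dg t b *\<^sub>R b)" for t
  have \<gamma>: "\<gamma> t \<bullet> h = Dg t h" for t h unfolding \<gamma>_def by (rule linear_eq_inner[OF Dgl])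
  have \<gamma>c: "continuous_on UNIV \<gamma>"
  proof -
    have "continuous_on UNIV (\<lambda>t. (\<lambda>p. frechet_derivative (state_con P) (at (fst p)) (snd p)) (xb t, b))" for b
      by (rule continuous_on_compose2[OF C2_D_continuous[OF C2s(4), of UNIV]]) (auto intro!: continuous_intros xb(1))
    then have "continuous_on UNIV (\<lambda>t. Dg t b)" for b by (simp add: Dg_def)
    then show ?thesis unfolding \<gamma>_def[abs_def] by (intro continuous_intros)
  qed
  have \<gamma>m: "\<gamma> \<in> borel_measurable borel" using \<gamma>c by (rule borel_measurable_continuous_onI)
  have \<gamma>b: "\<exists>K. \<forall>t. norm (\<gamma> t) \<le> K"
  proof -
    have "compact (\<gamma> ` {0..T})" by (intro compact_continuous_image continuous_on_subset[OF \<gamma>c]) auto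
    then obtain K where K: "\<And>y. y \<in> \<gamma> ` {0..T} \<Longrightarrow> norm y \<le> K" using compact_imp_bounded bounded_iff by metis
    \<comment> \<open>The extended trajectory is constant outside [0,T], so the bound on the compact
      interval is global.\<close>
    have "\<gamma> t = \<gamma> (clamp_to T t)" for t
    proof -
      have "clamp_to T (clamp_to T t) = clamp_to T t" using T by (simp add: clamp_to_def)
      then have "xb (clamp_to T t) = xb t" by (simp add: xb_def)
      then show ?thesis by (simp add: \<gamma>_def Dg_def)
    qed
    then have "norm (\<gamma> t) \<le> K" for t using K clamp_to_in[of T t] T by (metis imageI less_imp_le)
    then show ?thesis by blast
  qed
  define L where "L hk = frechet_derivative (ell P \<beta> \<Psi>) (at X0) hk" for hk
  have L_eq: "L hk = \<beta> * frechet_derivative (cost P) (at X0) hk + (\<Sum>i=1..n1 P + n2 P. \<Psi> i * frechet_derivative (endpoint_con P i) (at X0) hk)" for hk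
    unfolding L_def by (subst frechet_derivative_eqI[OF ell_has_derivative]) (auto intro: C2s)
  have Ll: "linear L"
    unfolding L_eq[abs_def] by (rule has_derivative_linear[OF ell_has_derivative]) (auto intro: C2s)
  have ell2: "second_derivative (ell P \<beta> \<Psi>) X0 Z0 Z0 = \<beta> * second_derivative (cost P) X0 Z0 Z0 +
     (\<Sum>i=1..n1 P + n2 P. \<Psi> i * second_derivative (endpoint_con P i) X0 Z0 Z0)"
    by (rule second_derivative_ell) (auto intro: C2s)
  \<comment> \<open>The gradients of the endpoint Lagrangian in the final and in the initial state;
    \<open>l1\<close> is the terminal value prescribed for the costate.\<close>
  define l1 where "l1 = (\<Sum>b\<in>Basis. L (0, b) *\<^sub>R b)"
  define l0 where "l0 = (\<Sum>b\<in>Basis. L (b, 0) *\<^sub>R b)"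
  have lin1: "linear (\<lambda>k. L (0, k))" "linear (\<lambda>h. L (h, 0))"
    using linear_compose[OF _ Ll, of "\<lambda>k. (0, k)"] linear_compose[OF _ Ll, of "\<lambda>h. (h, 0)"]
    by (auto simp: o_def linear_iff)
  have l: "L (h, k) = l0 \<bullet> h + l1 \<bullet> k" for h k
  proof -
    have "L (h, k) = L ((h, 0) + (0, k))" by simp
    also have "\<dots> = L (h, 0) + L (0, k)" using Ll by (rule linear_add)
    finally show ?thesis using linear_eq_inner[OF lin1(1), of k] linear_eq_inner[OF lin1(2), of h] by (simp add: l0_def l1_def)
  qed
  interpret ls: linear_system T cp.A \<gamma> \<mu> l1
    by (rule linear_system.intro; fact T cp.A_linear cp.A_meas cp.A_bound \<gamma>m \<gamma>b \<mu>)
  define pf where "pf s = ls.ph s \<bullet> f1 P (xb s)" for s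
  have pfm: "bdd_meas pf" unfolding pf_def[abs_def] by (intro bdd_meas_inner ls.ph_bdd_meas F_xb_meas)
  have pSm: "bdd_meas (\<lambda>s. ls.ph s \<bullet> cp.Src s)" by (intro bdd_meas_inner ls.ph_bdd_meas cp.Src_meas)
  \<comment> \<open>Everything that does not contain a or w. The factors 1/2 in \<open>Src\<close>,
    \<open>ev\<close> and \<open>k2\<close> make it one half of the quadratic form.\<close>
  define c0 where "c0 = IL 0 T (\<lambda>s. ls.ph s \<bullet> cp.Src s) + (1/2) * second_derivative (ell P \<beta> \<Psi>) X0 Z0 Z0 + (\<integral>t. k2 t \<partial>\<mu>)"
  have k2int: "integrable \<mu> k2"
  proof -
    have "compact (k2 ` {0..T})" by (intro compact_continuous_image continuous_on_subset[OF k2_cont]) auto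
    then obtain K where K: "\<And>y. y \<in> k2 ` {0..T} \<Longrightarrow> norm y \<le> K" using compact_imp_bounded bounded_iff by metis
    show ?thesis
    proof (rule ls.\<mu>.integrable_const_bound[where B=K])
      show "AE t in \<mu>. norm (k2 t) \<le> K" using K by (intro AE_I2) (auto simp: ls.\<mu>_space)
      show "k2 \<in> borel_measurable \<mu>" by (intro ls.\<mu>_borel borel_measurable_continuous_onI k2_cont)
    qed
  qed
  have ineq: "(l0 + ls.ph 0) \<bullet> a + IL 0 T (\<lambda>s. w s * pf s) + c0 \<ge> 0" if w: "bdd_meas w" "adm w" for a w
  proof -
    obtain Kw where Kw: "Kw > 0" "\<And>t. norm (w t) \<le> Kw" using cp.bdd_measE[OF w(1)] by blast
    \<comment> \<open>The multiplier was found independently of the size bound, so the bound may be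
      adapted to the given a and w.\<close>
    obtain \<zeta> where \<zeta>: "cp.pert (Kw + norm a) a w \<zeta>"
      using cp.pert_exists[OF w(1), of "Kw + norm a" a] Kw by (auto simp: add_increasing2)
    have \<zeta>m: "bdd_meas \<zeta>" and \<zeta>c: "continuous_on {0..T} \<zeta>" and \<zeta>e: "\<And>t. t \<in> {0..T} \<Longrightarrow> \<zeta> t = a + IL 0 t (\<lambda>s. cp.A s (\<zeta> s) + (w s *\<^sub>R f1 P (xb s) + cp.Src s))"
      using \<zeta> by (auto simp: cp.pert_def)
    have "IL 0 0 (\<lambda>s. cp.A s (\<zeta> s) + (w s *\<^sub>R f1 P (xb s) + cp.Src s)) = 0"
      using IL_combine[of "\<lambda>s. cp.A s (\<zeta> s) + (w s *\<^sub>R f1 P (xb s) + cp.Src s)" 0 0 0] by (simp add: bdd_meas_add cp.A_meas \<zeta>m cp.pert_source_meas w)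
    then have \<zeta>0: "\<zeta> 0 = a" using \<zeta>e[OF T0(1)] by simp
    have dual: "l1 \<bullet> \<zeta> T + (\<integral>\<tau>. \<gamma> \<tau> \<bullet> \<zeta> \<tau> \<partial>\<mu>) = ls.ph 0 \<bullet> a + IL 0 T (\<lambda>s. ls.ph s \<bullet> (w s *\<^sub>R f1 P (xb s) + cp.Src s))"
      by (rule ls.duality[OF \<zeta>m \<zeta>e cp.pert_source_meas[OF w(1)]])
    have "IL 0 T (\<lambda>s. ls.ph s \<bullet> (w s *\<^sub>R f1 P (xb s) + cp.Src s)) = IL 0 T (\<lambda>s. w s * pf s + ls.ph s \<bullet> cp.Src s)"
      by (simp add: pf_def inner_add_right)
    also have "\<dots> = IL 0 T (\<lambda>s. w s * pf s) + IL 0 T (\<lambda>s. ls.ph s \<bullet> cp.Src s)"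
      by (intro IL_add bdd_meas_mult w pfm pSm)
    finally have dual': "l1 \<bullet> \<zeta> T + (\<integral>\<tau>. \<gamma> \<tau> \<bullet> \<zeta> \<tau> \<partial>\<mu>) = ls.ph 0 \<bullet> a + IL 0 T (\<lambda>s. w s * pf s) + IL 0 T (\<lambda>s. ls.ph s \<bullet> cp.Src s)"
      using dual by simp
    have kap_eq: "kap \<zeta> t = \<gamma> t \<bullet> \<zeta> t + k2 t" for t by (simp add: kap_def k2_def \<gamma> Dg_def)
    have gint: "integrable \<mu> (\<lambda>t. \<gamma> t \<bullet> \<zeta> t)"
    proof -
      obtain K1 where K1: "\<And>t. norm (\<gamma> t) \<le> K1" using \<gamma>b by blast
      obtain K2 where K2: "K2 > 0" "\<And>t. norm (\<zeta> t) \<le> K2" using cp.bdd_measE[OF \<zeta>m] by blast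
      show ?thesis
      proof (rule ls.\<mu>.integrable_const_bound[where B="K1 * K2"])
        show "AE t in \<mu>. norm (\<gamma> t \<bullet> \<zeta> t) \<le> K1 * K2"
        proof (rule AE_I2)
          fix t
          have "norm (\<gamma> t \<bullet> \<zeta> t) \<le> norm (\<gamma> t) * norm (\<zeta> t)" by (simp add: Cauchy_Schwarz_ineq2)
          also have "\<dots> \<le> K1 * K2" using K1[of t] K2(2)[of t] by (intro mult_mono) (auto intro: order_trans[OF norm_ge_zero])
          finally show "norm (\<gamma> t \<bullet> \<zeta> t) \<le> K1 * K2" .
        qed
        have "(\<lambda>t. \<zeta> (clamp_to T t)) \<in> borel_measurable borel"
          using clamp_compose(1)[OF \<zeta>c] T by (intro borel_measurable_continuous_onI) auto
        then have "(\<lambda>t. \<gamma> t \<bullet> \<zeta> (clamp_to T t)) \<in> borel_measurable \<mu>"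
          using \<gamma>m by (intro ls.\<mu>_borel) measurable
        then show "(\<lambda>t. \<gamma> t \<bullet> \<zeta> t) \<in> borel_measurable \<mu>"
          by (rule measurable_cong[THEN iffD1, rotated]) (simp add: ls.\<mu>_space)
      qed
    qed
    have "(\<integral>t. kap \<zeta> t \<partial>\<mu>) = (\<integral>\<tau>. \<gamma> \<tau> \<bullet> \<zeta> \<tau> \<partial>\<mu>) + (\<integral>t. k2 t \<partial>\<mu>)" unfolding kap_eq using gint k2int by simp
    moreover have "\<beta> * ev (cost P) \<zeta> + (\<Sum>i=1..n1 P + n2 P. \<Psi> i * ev (endpoint_con P i) \<zeta>) = L (\<zeta> 0, \<zeta> T) + (1/2) * second_derivative (ell P \<beta> \<Psi>) X0 Z0 Z0"
    proof -
      have "(\<Sum>i=1..n1 P + n2 P. \<Psi> i * ev (endpoint_con P i) \<zeta>) = (\<Sum>i=1..n1 P + n2 P. \<Psi> i * frechet_derivative (endpoint_con P i) (at X0) (\<zeta> 0, \<zeta> T))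
        + (1/2) * (\<Sum>i=1..n1 P + n2 P. \<Psi> i * second_derivative (endpoint_con P i) X0 Z0 Z0)"
        unfolding sum_distrib_left sum.distrib[symmetric] by (intro sum.cong refl) (simp add: ev_def algebra_simps)
      then show ?thesis unfolding L_eq ell2 by (simp add: ev_def algebra_simps)
    qed
    ultimately show ?thesis using main[OF \<zeta> w(2)] dual' unfolding l \<zeta>0 c0_def by (simp add: inner_add_left)
  qed
  have c0: "c0 \<ge> 0" using ineq[of "\<lambda>_. 0" 0] by (simp add: bdd_meas_const adm_def)
  have l0: "ls.ph 0 = - l0"
  proof -
    \<comment> \<open>The initial perturbation a is a multiple of the negative of its own
      coefficient, so a nonzero coefficient would make the left side unbounded below.\<close>
    have "s * (- ((l0 + ls.ph 0) \<bullet> (l0 + ls.ph 0))) + c0 \<ge> 0" for s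
      using ineq[of "\<lambda>_. 0" "- s *\<^sub>R (l0 + ls.ph 0)"] by (simp add: bdd_meas_const adm_def)
    from nonneg_of_affine_bound[OF this] have "(l0 + ls.ph 0) \<bullet> (l0 + ls.ph 0) \<le> 0" by simp
    then have "l0 + ls.ph 0 = 0" using inner_ge_zero[of "l0 + ls.ph 0"] by (metis antisym inner_eq_zero_iff)
    then show ?thesis by (simp add: add_eq_0_iff)
  qed
  have wcone: "IL 0 T (\<lambda>s. w s * pf s) \<ge> 0" if w: "bdd_meas w" "adm w" for w
  proof (rule nonneg_of_affine_bound)
    fix s :: real assume s: "s \<ge> 0"
    have "adm (\<lambda>t. s * w t)" using w(2) unfolding adm_def by (elim eventually_mono) (auto simp: s mult_nonneg_nonpos)
    then have "(l0 + ls.ph 0) \<bullet> 0 + IL 0 T (\<lambda>t. (s * w t) * pf t) + c0 \<ge> 0"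
      by (intro ineq bdd_meas_mult bdd_meas_const w)
    then show "s * IL 0 T (\<lambda>s. w s * pf s) + c0 \<ge> 0" by (simp add: mult.assoc)
  qed
  have aeu: "AE t in lebesgue. t \<in> {0..T} \<longrightarrow> ub t = u t" using ub(2) by (simp add: AE_restrict_space_iff)
  have [measurable]: "ub \<in> borel_measurable lebesgue" "pf \<in> borel_measurable lebesgue" by (rule bdd_measD[OF ub(1)], rule bdd_measD[OF pfm])
  \<comment> \<open>If w times p f_1 is nowhere positive while its integral is nonnegative, the
    product vanishes almost everywhere.\<close>
  have sign: "AE t in lebesgue_on {0..T}. \<not> (w t * pf t < 0)"
    if w: "bdd_meas w" "adm w" and neg: "\<And>t. w t * pf t \<le> 0" for w
  proof -
    have m: "bdd_meas (\<lambda>s. w s * pf s)" by (intro bdd_meas_mult w pfm)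
    have "integral\<^sup>L (lebesgue_on {0..T}) (\<lambda>s. - (w s * pf s)) = 0"
    proof (rule antisym)
      show "integral\<^sup>L (lebesgue_on {0..T}) (\<lambda>s. - (w s * pf s)) \<le> 0" using wcone[OF w] by simp
      show "0 \<le> integral\<^sup>L (lebesgue_on {0..T}) (\<lambda>s. - (w s * pf s))" using neg by (intro integral_nonneg_AE AE_I2) simp
    qed
    then have "AE s in lebesgue_on {0..T}. - (w s * pf s) = 0"
      by (subst (asm) integral_nonneg_eq_0_iff_AE) (use neg bdd_meas_integrable[OF m] in auto)
    then show ?thesis by eventually_elim auto
  qed
  have sgn1: "AE t in lebesgue_on {0..T}. pf t > 0 \<longrightarrow> ereal (u t) = u_min P"
  proof -
    \<comment> \<open>Lowers the control where p f_1 > 0 and the lower bound is not attained; this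
      is admissible, as only points of \<open>B_minus\<close> forbid negative values. If the lower
      bound is infinite, the test excludes p f_1 > 0 altogether.\<close>
    define w where "w t = (if pf t > 0 \<and> ereal (ub t) \<noteq> u_min P then - 1 else 0 :: real)" for t
    have "w \<in> borel_measurable lebesgue" unfolding w_def by measurable
    then have wm: "bdd_meas w" unfolding bdd_meas_def by (auto simp: w_def intro!: exI[of _ 1])
    have wa: "adm w" unfolding adm_def using aeu by eventually_elim (auto simp: w_def B_minus_def)
    have "AE t in lebesgue_on {0..T}. \<not> (w t * pf t < 0)" by (rule sign[OF wm wa]) (simp add: w_def)
    with ub(2) show ?thesis by eventually_elim (auto simp: w_def split: if_splits)
  qed
  have sgn2: "AE t in lebesgue_on {0..T}. pf t < 0 \<longrightarrow> ereal (u t) = u_max P"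
  proof -
    define w where "w t = (if pf t < 0 \<and> ereal (ub t) \<noteq> u_max P then 1 else 0 :: real)" for t
    have "w \<in> borel_measurable lebesgue" unfolding w_def by measurable
    then have wm: "bdd_meas w" unfolding bdd_meas_def by (auto simp: w_def intro!: exI[of _ 1])
    have wa: "adm w" unfolding adm_def using aeu by eventually_elim (auto simp: w_def B_plus_def)
    have "AE t in lebesgue_on {0..T}. \<not> (w t * pf t < 0)" by (rule sign[OF wm wa]) (simp add: w_def)
    with ub(2) show ?thesis by eventually_elim (auto simp: w_def split: if_splits)
  qed
  define p where "p = ls.costate"
  have aeT: "AE t in lebesgue_on {0..T}. t \<in> {0..T} \<and> t \<noteq> T"
  proof -
    have "AE t in lebesgue. t \<noteq> T" by (rule AE_I'[of "{T}"]) auto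
    then show ?thesis by (auto simp: AE_restrict_space_iff elim!: eventually_mono)
  qed
  \<comment> \<open>The definitions integrate the given u and v, so besides the bounded
    representatives the measurability of the original functions on [0,T] is recorded.\<close>
  have um: "u \<in> borel_measurable (lebesgue_on {0..T})" and vm: "v \<in> borel_measurable (lebesgue_on {0..T})"
    using feas crit by (auto simp: feasible_def critical_cone_def L_infty_def)
  have pm: "p \<in> borel_measurable (lebesgue_on {0..T})"
  proof -
    have [measurable]: "ls.ph \<in> borel_measurable lebesgue" by (rule bdd_measD[OF ls.ph_bdd_meas])
    have [measurable]: "(\<lambda>t::real. t) \<in> borel_measurable lebesgue" by (rule measurable_completion) simp
    have "p \<in> borel_measurable lebesgue" unfolding p_def ls.costate_def[abs_def] by measurable
    then show ?thesis by (rule measurable_restrict_space1)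
  qed
  have "(\<beta>, \<Psi>, p, \<mu>) \<in> multipliers P u x"
    unfolding multipliers_def
  proof (simp only: mem_Collect_eq case_prod_conv, intro conjI)
    show "bounded_variation_on 0 T p" unfolding p_def by (rule ls.costate_bounded_variation)
    show "(\<integral>t. G t \<partial>\<mu>) = 0"
    proof (rule integral_eq_zero_AE)
      show "AE t in \<mu>. G t = 0" using \<mu>(3) by eventually_elim (simp add: C_iff)
    qed
    show "\<forall>h k. frechet_derivative (ell P \<beta> \<Psi>) (at X0) (h, k) = - p 0 \<bullet> h + p T \<bullet> k"
      using l l0 by (simp add: L_def p_def ls.costate_0 ls.costate_end)
    show "AE t in lebesgue_on {0..T}. (- \<infinity> < u_min P \<and> 0 < p t \<bullet> f1 P (x t) \<longrightarrow> ereal (u t) = u_min P) \<and>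
        (u_max P < \<infinity> \<and> p t \<bullet> f1 P (x t) < 0 \<longrightarrow> ereal (u t) = u_max P) \<and>
        (u_min P < ereal (u t) \<and> ereal (u t) < u_max P \<longrightarrow> p t \<bullet> f1 P (x t) = 0)"
      using sgn1 sgn2 aeT
    proof eventually_elim
      case (elim t)
      then have "pf t = p t \<bullet> f1 P (x t)" by (simp add: pf_def p_def ls.costate_ph xb)
      then show ?case using elim by (metis less_irrefl linorder_neqE_linordered_idom)
    qed
    show "costate_equation P u x p \<mu>"
      unfolding costate_equation_def
    proof (intro allI impI)
      fix s t h assume st: "0 \<le> s \<and> s \<le> t \<and> t \<le> T"
      have "- ((right_value T p t - left_value p s) \<bullet> h) = IL s t (\<lambda>\<tau>. p \<tau> \<bullet> cp.A \<tau> h) + (LINT \<tau>:{s..t}|\<mu>. \<gamma> \<tau> \<bullet> h)"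
        unfolding p_def using st by (intro ls.costate_equation_A) auto
      also have "IL s t (\<lambda>\<tau>. p \<tau> \<bullet> cp.A \<tau> h) = (LINT \<tau>:{s..t}|lebesgue. p \<tau> \<bullet> lin_dynamics P u x \<tau> h)"
      proof -
        have sub: "{s..t} \<subseteq> {0..T}" using st by auto
        have mr: "f \<in> borel_measurable (lebesgue_on {s..t})" if "f \<in> borel_measurable (lebesgue_on {0..T})" for f :: "real \<Rightarrow> 'c::euclidean_space"
          by (rule measurable_restrict_mono[OF that sub])
        have le: "lin_dynamics P u x \<tau> h = frechet_derivative (f0 P) (at (xb \<tau>)) h + u \<tau> *\<^sub>R frechet_derivative (f1 P) (at (xb \<tau>)) h" if "\<tau> \<in> {0..T}" for \<tau>
          using that by (simp add: lin_dynamics_def frechet_derivative_dynamics C2s xb)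
        have lm: "(\<lambda>\<tau>. p \<tau> \<bullet> lin_dynamics P u x \<tau> h) \<in> borel_measurable (lebesgue_on {s..t})"
        proof -
          have "(\<lambda>\<tau>. p \<tau> \<bullet> (frechet_derivative (f0 P) (at (xb \<tau>)) h + u \<tau> *\<^sub>R frechet_derivative (f1 P) (at (xb \<tau>)) h)) \<in> borel_measurable (lebesgue_on {0..T})"
            by (intro borel_measurable_inner borel_measurable_add borel_measurable_scaleR pm um bdd_meas_on cp.DF_meas bdd_meas_const)
          then show ?thesis
            by (intro mr) (rule measurable_cong[THEN iffD1, rotated], auto simp: le)
        qed
        have am: "(\<lambda>\<tau>. p \<tau> \<bullet> cp.A \<tau> h) \<in> borel_measurable (lebesgue_on {s..t})"
          by (intro mr borel_measurable_inner pm bdd_meas_on cp.A_meas bdd_meas_const)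
        have "AE \<tau> in lebesgue_on {0..T}. p \<tau> \<bullet> cp.A \<tau> h = p \<tau> \<bullet> lin_dynamics P u x \<tau> h"
          using ub(2) aeT by eventually_elim (simp add: le cp.A_def)
        from IL_cong_AE[OF this am lm sub] show ?thesis
          unfolding set_lebesgue_integral_def by (subst (asm) (2) integral_restrict_space) auto
      qed
      also have "(LINT \<tau>:{s..t}|\<mu>. \<gamma> \<tau> \<bullet> h) = (LINT \<tau>:{s..t}|\<mu>. frechet_derivative (state_con P) (at (x \<tau>)) h)"
        unfolding set_lebesgue_integral_def
        by (intro Bochner_Integration.integral_cong) (auto simp: \<gamma> Dg_def ls.\<mu>_space xb)
      finally show "- ((right_value T p t - left_value p s) \<bullet> h) = (LINT \<tau>:{s..t}|lebesgue. p \<tau> \<bullet> lin_dynamics P u x \<tau> h) +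
         (LINT \<tau>:{s..t}|\<mu>. frechet_derivative (state_con P) (at (x \<tau>)) h)" .
    qed
  qed (use \<beta> \<mu> nontriv \<Psi> in auto)
  moreover have "quad_form P u x v z (\<beta>, \<Psi>, p, \<mu>) = 2 * c0"
  proof -
    have "(LINT t|lebesgue_on {0..T}. H_xx P (u t) (x t) (p t) (z t) (z t) + 2 * v t * H_ux P (u t) (x t) (p t) (z t))
      = IL 0 T (\<lambda>s. 2 * (ls.ph s \<bullet> cp.Src s))"
    proof (rule integral_cong_AE)
      have D2m: "bdd_meas (\<lambda>s. second_derivative (f0 P) (xb s) (zb s) (zb s))" "bdd_meas (\<lambda>s. second_derivative (f1 P) (xb s) (zb s) (zb s))"
        by (rule bdd_meas_compose2[OF xb_meas zb_meas C2_D2_continuous[OF C2s(1)]])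
           (rule bdd_meas_compose2[OF xb_meas zb_meas C2_D2_continuous[OF C2s(2)]])
      have "(\<lambda>t. p t \<bullet> (second_derivative (f0 P) (xb t) (zb t) (zb t) + u t *\<^sub>R second_derivative (f1 P) (xb t) (zb t) (zb t))
          + 2 * v t * (p t \<bullet> frechet_derivative (f1 P) (at (xb t)) (zb t))) \<in> borel_measurable (lebesgue_on {0..T})"
        by (intro borel_measurable_add borel_measurable_times borel_measurable_inner borel_measurable_scaleR borel_measurable_const pm um vm bdd_meas_on cp.DF_meas D2m zb_meas)
      then show "(\<lambda>t. H_xx P (u t) (x t) (p t) (z t) (z t) + 2 * v t * H_ux P (u t) (x t) (p t) (z t)) \<in> borel_measurable (lebesgue_on {0..T})"
        by (rule measurable_cong[THEN iffD1, rotated]) (simp add: H_xx_eq H_ux_eq C2s xb zb)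
      show "(\<lambda>s. 2 * (ls.ph s \<bullet> cp.Src s)) \<in> borel_measurable (lebesgue_on {0..T})"
        by (intro bdd_meas_on bdd_meas_mult bdd_meas_const pSm)
      show "AE t in lebesgue_on {0..T}. H_xx P (u t) (x t) (p t) (z t) (z t) + 2 * v t * H_ux P (u t) (x t) (p t) (z t) = 2 * (ls.ph t \<bullet> cp.Src t)"
        using ub(2) vb(2) aeT
      proof eventually_elim
        case (elim t)
        then have "p t = ls.ph t" by (simp add: p_def ls.costate_ph)
        then show ?case using elim by (simp add: H_xx_eq H_ux_eq C2s xb zb cp.Src_def inner_add_right algebra_simps)
      qed
    qed
    moreover have "(\<integral>t. second_derivative (state_con P) (x t) (z t) (z t) \<partial>\<mu>) = (\<integral>t. 2 * k2 t \<partial>\<mu>)"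
      by (intro Bochner_Integration.integral_cong) (auto simp: k2_def ls.\<mu>_space xb zb)
    ultimately show ?thesis by (simp add: quad_form_def c0_def)
  qed
  ultimately show ?thesis using c0 by (intro bexI[of _ "(\<beta>, \<Psi>, p, \<mu>)"]) auto
qed

end

theorem theorem3p5:
  fixes P :: "('n::finite) ocp"
    and u :: "real \<Rightarrow> real"
    and x :: "real \<Rightarrow> real ^ 'n"
  assumes "ocp_data P"
    and "weak_minimum P u x"
    and "finite_arc_structure P u x"
    and "control_away_from_bounds P u x"
    and "discontinuous_at_CS_SC_junctions P u x"
    and "first_order_state_constraint P x"
  shows "\<forall>(v, z)\<in>critical_cone P u x. \<exists>lam\<in>multipliers P u x. quad_form P u x v z lam \<ge> 0"
proof clarify
  fix v z assume "(v, z) \<in> critical_cone P u x"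
  moreover have "feasible P u x" using assms(2) by (simp add: weak_minimum_def)
  ultimately interpret ocp_direction P u x v z using assms by unfold_locales auto
  show "\<exists>lam\<in>multipliers P u x. quad_form P u x v z lam \<ge> 0" by (rule second_order_multiplier[OF assms(2)])
qed

end
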